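(* Let $p\ge3$ and $0<b<\beta_p$. For every integer $k\ge1$ there exists a constant $K>0$ such that for all $\beta\in[0,b]$ and all $N\ge1$, $$\mathbb E\big\langle R_{1,2}^{2k}\big\rangle_\beta\le\frac{K}{N^k}.$$
   Context: $\Sigma_N=\{-1,1\}^N$, $(g_{i_1,\dots,i_p})$ i.i.d. standard Gaussians, $H_N(\sigma)=N^{-(p-1)/2}\sum_{1\le i_1,\dots,i_p\le N}g_{i_1,\dots,i_p}\sigma_{i_1}\cdots\sigma_{i_p}$, $F_N(\beta)=\frac1N\log\sum_{\sigma}2^{-N}\exp(\tfrac{\beta}{\sqrt2}H_N(\sigma))$, which converges a.s. to a nonrandom $F(\beta)\le\beta^2/4$. $\mathcal R=\{\beta>0:F(\beta)=\beta^2/4\}$, $\beta_p=\max\mathcal R$. The Gibbs measure is $G_{N,\beta}(\sigma)\propto\exp(\tfrac{\beta}{\sqrt2}H_N(\sigma))$; $\langle\cdot\rangle_\beta$ is the average with respect to $G_{N,\beta}^{\otimes2}$ over independent samples $\sigma^1,\sigma^2$; $R_{1,2}=\frac1N\sum_i\sigma^1_i\sigma^2_i$. $\mathbb E$ is expectation over the disorder. *)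

theory Defs
  imports "HOL-Probability.Probability"
begin

text \<open>Disorder: an i.i.d. standard Gaussian array g indexed by all finite index
tuples (lists of naturals); index tuples for system size N are lists of length p
with entries in {0..<N} (0-based version of 1..N). All N share one disorder array.\<close>

definition disorder :: "(nat list \<Rightarrow> real) measure" where
  "disorder = PiM UNIV (\<lambda>_. density lborel (\<lambda>x. ennreal (std_normal_density x)))"

definition idx :: "nat \<Rightarrow> nat \<Rightarrow> nat list set" where
  "idx p N = {is. length is = p \<and> set is \<subseteq> {..<N}}"

definition spins :: "nat \<Rightarrow> (nat \<Rightarrow> real) set" where
  "spins N = PiE {..<N} (\<lambda>_. {-1, 1})"

definition hamil :: "nat \<Rightarrow> nat \<Rightarrow> (nat list \<Rightarrow> real) \<Rightarrow> (nat \<Rightarrow> real) \<Rightarrow> real" where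
  "hamil p N g \<sigma> = real N powr (- (real p - 1) / 2) *
     (\<Sum>is\<in>idx p N. g is * (\<Prod>j<p. \<sigma> (is ! j)))"

definition gibbs_weight :: "nat \<Rightarrow> nat \<Rightarrow> real \<Rightarrow> (nat list \<Rightarrow> real) \<Rightarrow> (nat \<Rightarrow> real) \<Rightarrow> real" where
  "gibbs_weight p N \<beta> g \<sigma> = exp (\<beta> / sqrt 2 * hamil p N g \<sigma>)"

definition free_energy_N :: "nat \<Rightarrow> nat \<Rightarrow> real \<Rightarrow> (nat list \<Rightarrow> real) \<Rightarrow> real" where
  "free_energy_N p N \<beta> g = ln (\<Sum>\<sigma>\<in>spins N. 2 powr (- real N) * gibbs_weight p N \<beta> g \<sigma>) / real N"

definition free_energy :: "nat \<Rightarrow> real \<Rightarrow> real" where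
  "free_energy p \<beta> = (THE c. AE g in disorder. (\<lambda>N. free_energy_N p N \<beta> g) \<longlonglongrightarrow> c)"

definition replica_symmetric_set :: "nat \<Rightarrow> real set" where
  "replica_symmetric_set p = {\<beta>. \<beta> > 0 \<and> free_energy p \<beta> = \<beta>\<^sup>2 / 4}"

definition beta_crit :: "nat \<Rightarrow> real" where
  "beta_crit p = (GREATEST \<beta>. \<beta> \<in> replica_symmetric_set p)"

definition overlap :: "nat \<Rightarrow> (nat \<Rightarrow> real) \<Rightarrow> (nat \<Rightarrow> real) \<Rightarrow> real" where
  "overlap N \<sigma>1 \<sigma>2 = (\<Sum>i<N. \<sigma>1 i * \<sigma>2 i) / real N"

definition gibbs_avg2 :: "nat \<Rightarrow> nat \<Rightarrow> real \<Rightarrow> (nat list \<Rightarrow> real)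
     \<Rightarrow> ((nat \<Rightarrow> real) \<Rightarrow> (nat \<Rightarrow> real) \<Rightarrow> real) \<Rightarrow> real" where
  "gibbs_avg2 p N \<beta> g f =
     (\<Sum>\<sigma>1\<in>spins N. \<Sum>\<sigma>2\<in>spins N.
        gibbs_weight p N \<beta> g \<sigma>1 * gibbs_weight p N \<beta> g \<sigma>2 * f \<sigma>1 \<sigma>2)
     / (\<Sum>\<sigma>\<in>spins N. gibbs_weight p N \<beta> g \<sigma>)\<^sup>2"

end

(*
  Write s = beta / sqrt 2 and let f_N(s) be the mean free energy, normalised to vanish at s = 0.

  Below the critical point f_N(s) tends to s^2/2. Planting a configuration at the critical point
  tilts the disorder by Z / E Z, so the planted free energy is also asymptotically minimal there, and
  this forces the planted overlap R to satisfy P(R^p >= a) <= exp(-cN) for every level a > 0: the bound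
  for level a gives the bound for level 2a/3. What remains are small overlaps, where E exp(s^2 N R^p)
  is dominated by E exp(N R^2 / 4) because p >= 3; Cauchy-Schwarz yields the moments N^-k under the planted
  law, and comparing the planted with the null Gibbs measure transfers them to the original model.

  Since free_energy is a THE and beta_crit a GREATEST, both are meaningful only once f_N(s) is known to
  converge for every s. Interpolating between one system of size N and blocks of size M gives approximate
  superadditivity. For odd p this needs the block overlaps to be nearly nonnegative (Talagrand), which
  holds after a small perturbation by all q-spin fields: the Ghirlanda-Guerra identities would otherwise
  produce arbitrarily many replicas with pairwise overlaps below a negative constant, contradicting
  positive semidefiniteness of the Gram matrix.
*)

theory Submission
  imports Defs
begin

text \<open>The growth step rests on a factor 2. Restricted to configurations with R^p >= 2a/3, the
  planted free energy has s-derivative s (2 <R^p> - <R_12^p>): the plant counts twice, the overlap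
  R_12 of two samples once. Sample-sample overlaps have the law of sample-plant overlaps, so R_12^p
  >= a has probability at most exp(-cN), and it stays rare after restricting to a set of Gibbs
  weight exp(-cN/4). Hence the derivative is at least s a/6, and a restricted free energy close to
  the full one would soon overtake it.

  Convergence of f_N is organised so that no rates are needed. Every block carries its own
  perturbing fields of macroscopic strength c, at a cost of order c^2 D per spin; this can be made
  small because the number D of fields is fixed before c. Positivity holds only on average over a
  grid of field strengths, but uniformly in the base weights. So the interpolation is averaged over
  one grid point per block, and each block is treated with all other disorder frozen into the base
  weights.\<close>

definition N1 :: "real measure" where
  "N1 = density lborel (\<lambda>x. ennreal (std_normal_density x))"

lemma disorder_N1: "disorder = PiM UNIV (\<lambda>_. N1)"
  by (simp add: disorder_def N1_def)

lemma sets_N1[measurable_cong, simp]: "sets N1 = sets borel"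
  by (simp add: N1_def)

lemma borel_measurable_N1[simp]: "borel_measurable N1 = borel_measurable borel"
  by (rule measurable_cong_sets) auto

lemma space_N1[simp]: "space N1 = UNIV"
  by (simp add: N1_def)

lemma space_disorder[simp]: "space disorder = UNIV"
  by (simp add: disorder_N1 space_PiM)

lemma prob_N1: "prob_space N1"
  unfolding N1_def by (rule prob_space_normal_density) simp

lemma prob_disorder: "prob_space disorder"
  unfolding disorder_N1 by (rule prob_space_PiM) (rule prob_N1)

interpretation N1: prob_space N1 by (rule prob_N1)
interpretation D: prob_space disorder by (rule prob_disorder)
interpretation ND: pair_sigma_finite N1 disorder by unfold_locales

lemma sets_disorder[measurable_cong]: "sets disorder = sets (PiM UNIV (\<lambda>_. borel))"
  unfolding disorder_N1 by (intro sets_PiM_cong) auto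

lemma measurable_coord:
  "f \<in> measurable M disorder \<Longrightarrow> (\<lambda>x. f x i) \<in> borel_measurable M"
  by (rule measurable_compose[of f M disorder "\<lambda>w. w i"])
    (simp_all add: measurable_component_singleton cong: measurable_cong_sets sets_disorder)

lemma measurable_eval[measurable (raw)]: "(\<lambda>w. w i) \<in> borel_measurable disorder"
  by (rule measurable_coord) simp

lemma measurable_to_disorder:
  assumes "\<And>i. (\<lambda>x. f x i) \<in> borel_measurable M"
  shows "f \<in> measurable M disorder"
  by (subst measurable_cong_sets[OF refl sets_disorder])
    (rule measurable_PiM_single', use assms in auto)

lemma measurable_upd_coord[measurable (raw)]:
  "f \<in> measurable M disorder \<Longrightarrow> g \<in> borel_measurable M \<Longrightarrow> (\<lambda>x. ((f x)(i := g x)) k) \<in> borel_measurable M"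
  by (cases "k = i") (simp_all add: measurable_coord)

lemma measurable_upd[measurable (raw)]:
  "f \<in> measurable M disorder \<Longrightarrow> g \<in> borel_measurable M \<Longrightarrow> (\<lambda>x. (f x)(i := g x)) \<in> measurable M disorder"
  by (rule measurable_to_disorder) (rule measurable_upd_coord)

subsection \<open>The one-dimensional Gaussian\<close>

lemma N1_nn: "f \<in> borel_measurable borel \<Longrightarrow>
    (\<integral>\<^sup>+x. f x \<partial>N1) = (\<integral>\<^sup>+x. ennreal (std_normal_density x) * f x \<partial>lborel)"
  unfolding N1_def by (subst nn_integral_density) auto

text \<open>Completing the square in the density: the one-dimensional Cameron-Martin formula. The
  exponential tilt has total mass one and translates the Gaussian by \<open>a\<close>.\<close>

lemma N1_shift:
  fixes a :: real
  assumes [measurable]: "f \<in> borel_measurable borel"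
  shows "(\<integral>\<^sup>+x. f x * ennreal (exp (a * x - a\<^sup>2/2)) \<partial>N1) = (\<integral>\<^sup>+x. f (x + a) \<partial>N1)"
proof -
  have e: "std_normal_density (a + x) * exp (a * (a + x) - a\<^sup>2/2) = std_normal_density x" for x
    by (simp add: std_normal_density_def mult_exp_exp power2_eq_square field_simps)
  have "(\<integral>\<^sup>+x. f x * ennreal (exp (a * x - a\<^sup>2/2)) \<partial>N1)
      = (\<integral>\<^sup>+x. ennreal (std_normal_density x * exp (a * x - a\<^sup>2/2)) * f x \<partial>lborel)"
    by (subst N1_nn) (auto simp: ennreal_mult' ac_simps intro!: nn_integral_cong)
  also have "\<dots> = (\<integral>\<^sup>+x. ennreal (std_normal_density x) * f (a + x) \<partial>lborel)"
    by (subst nn_integral_real_affine[where c=1 and t=a]) (auto simp: e)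
  also have "\<dots> = (\<integral>\<^sup>+x. f (x + a) \<partial>N1)"
    by (subst N1_nn) (auto simp: ac_simps)
  finally show ?thesis .
qed

lemma N1_mgf: "(\<integral>\<^sup>+x. ennreal (exp (a * x)) \<partial>N1) = ennreal (exp (a\<^sup>2/2))"
proof -
  have "(\<integral>\<^sup>+x. ennreal (exp (a * x)) \<partial>N1)
      = (\<integral>\<^sup>+x. ennreal (exp (a\<^sup>2/2)) * (1 * ennreal (exp (a * x - a\<^sup>2/2))) \<partial>N1)"
    by (intro nn_integral_cong) (simp add: ennreal_mult'[symmetric] mult_exp_exp)
  also have "\<dots> = ennreal (exp (a\<^sup>2/2)) * (\<integral>\<^sup>+x. 1 * ennreal (exp (a * x - a\<^sup>2/2)) \<partial>N1)"
    by (subst nn_integral_cmult) auto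
  also have "(\<integral>\<^sup>+x. 1 * ennreal (exp (a * x - a\<^sup>2/2)) \<partial>N1) = 1"
    by (subst N1_shift) (auto simp: N1.emeasure_space_1[simplified])
  finally show ?thesis by simp
qed

lemma N1_reflect:
  assumes [measurable]: "f \<in> borel_measurable borel"
  shows "(\<integral>\<^sup>+x. f (- x) \<partial>N1) = (\<integral>\<^sup>+x. f x \<partial>N1)"
proof -
  have "(\<integral>\<^sup>+x. f x \<partial>N1) = (\<integral>\<^sup>+x. ennreal (std_normal_density x) * f (-x) \<partial>lborel)"
    by (subst N1_nn, simp, subst nn_integral_real_affine[where c="-1" and t=0])
       (auto simp: std_normal_density_def)
  then show ?thesis by (subst N1_nn) auto
qed

lemma N1_exp_abs: "(\<integral>\<^sup>+x. ennreal (exp (a * \<bar>x\<bar>)) \<partial>N1) < \<infinity>"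
proof -
  have "(\<integral>\<^sup>+x. ennreal (exp (a * \<bar>x\<bar>)) \<partial>N1) \<le> (\<integral>\<^sup>+x. ennreal (exp (a * x)) + ennreal (exp ((-a) * x)) \<partial>N1)"
    by (intro nn_integral_mono) (auto simp: abs_if ennreal_plus[symmetric] simp del: ennreal_plus intro!: ennreal_leI)
  also have "\<dots> = ennreal (exp (a\<^sup>2/2)) + ennreal (exp (a\<^sup>2/2))"
    by (subst nn_integral_add) (auto simp: N1_mgf[of a] N1_mgf[of "-a", simplified])
  also have "\<dots> < \<infinity>" by simp
  finally show ?thesis .
qed

lemma N1_integrable_exp_abs: "integrable N1 (\<lambda>x. exp (a * \<bar>x\<bar>))"
  by (rule integrableI_bounded) (use N1_exp_abs[of a] in auto)

lemma N1_integrable_abs: "integrable N1 (\<lambda>x. \<bar>x\<bar>)"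
proof (rule Bochner_Integration.integrable_bound[OF N1_integrable_exp_abs[of 1]])
  have "\<bar>x\<bar> \<le> exp \<bar>x\<bar>" for x :: real using exp_ge_add_one_self[of "\<bar>x\<bar>"] by linarith
  then show "AE x in N1. norm \<bar>x\<bar> \<le> norm (exp (1 * \<bar>x\<bar>))" by simp
qed auto

text \<open>Since \<open>- x * \<phi> x\<close> is the derivative of the density, the two sides
  differ by the integral over the line of the derivative of \<open>\<phi> x * G x\<close>, which
  vanishes because \<open>G\<close> is bounded and the density decays. Bounded \<open>G\<close> and
  \<open>g\<close> are the case that arises for Gibbs averages of disorder-free functions.\<close>

lemma N1_ibp:
  fixes G g :: "real \<Rightarrow> real"
  assumes G: "\<And>x. (G has_real_derivative g x) (at x)" and g: "\<And>x. isCont g x"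
    and GB: "\<And>x. \<bar>G x\<bar> \<le> B" and gB: "\<And>x. \<bar>g x\<bar> \<le> B"
  shows "(\<integral>x. x * G x \<partial>N1) = (\<integral>x. g x \<partial>N1)"
proof -
  have Gc: "continuous_on UNIV G"
    by (meson G DERIV_isCont continuous_at_imp_continuous_on)
  have [measurable]: "G \<in> borel_measurable borel" "g \<in> borel_measurable borel"
    using Gc g by (auto intro!: borel_measurable_continuous_onI simp: continuous_on_eq_continuous_at)
  define \<phi> where "\<phi> = std_normal_density"
  have \<phi>': "(\<phi> has_real_derivative - x * \<phi> x) (at x)" for x
    unfolding \<phi>_def std_normal_density_def
    by (auto intro!: derivative_eq_intros simp: field_simps)
  have i1: "integrable lborel (\<lambda>x. \<phi> x * (x * G x))"
  proof (rule Bochner_Integration.integrable_bound)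
    show "integrable lborel (\<lambda>x. B * (std_normal_density x * \<bar>x\<bar>^1))"
      by (intro integrable_mult_right integrable_std_normal_moment_abs)
    have "\<bar>\<phi> x * (x * G x)\<bar> \<le> \<bar>B * (std_normal_density x * \<bar>x\<bar>^1)\<bar>" for x
      using mult_mono[OF GB[of x] order_refl, of "\<phi> x * \<bar>x\<bar>"] GB[of x]
      by (auto simp: abs_mult \<phi>_def ac_simps)
    then show "AE x in lborel. norm (\<phi> x * (x * G x)) \<le> norm (B * (std_normal_density x * \<bar>x\<bar>^1))"
      by simp
  qed (auto simp: \<phi>_def)
  have i2: "integrable lborel (\<lambda>x. \<phi> x * g x)"
  proof (rule Bochner_Integration.integrable_bound)
    show "integrable lborel (\<lambda>x. B * std_normal_density x)"
      by (intro integrable_mult_right) simp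
    have "\<bar>\<phi> x * g x\<bar> \<le> \<bar>B * std_normal_density x\<bar>" for x
      using mult_mono[OF gB[of x] order_refl, of "\<phi> x"] gB[of x]
      by (auto simp: abs_mult \<phi>_def ac_simps)
    then show "AE x in lborel. norm (\<phi> x * g x) \<le> norm (B * std_normal_density x)"
      by simp
  qed (auto simp: \<phi>_def)
  define f where "f x = \<phi> x * g x - \<phi> x * (x * G x)" for x
  have lim: "((\<lambda>x. \<phi> x * G x) \<longlongrightarrow> 0) F" if "(\<phi> \<longlongrightarrow> 0) F" for F
  proof (rule Lim_null_comparison[where g="\<lambda>x. B * \<phi> x"])
    show "\<forall>\<^sub>F x in F. norm (\<phi> x * G x) \<le> B * \<phi> x"
      using GB mult_right_mono[OF GB, of "\<phi> x" for x] by (auto simp: abs_mult \<phi>_def ac_simps intro!: always_eventually)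
    show "((\<lambda>x. B * \<phi> x) \<longlongrightarrow> 0) F" using tendsto_mult_left[OF that, of B] by simp
  qed
  have exp_lim: "((\<lambda>x::real. exp (- x\<^sup>2 / 2)) \<longlongrightarrow> 0) F" if "filterlim (\<lambda>x. x\<^sup>2) at_top F" for F
  proof -
    have "filterlim (\<lambda>x::real. x\<^sup>2 * (1/2)) at_top F"
      by (rule filterlim_at_top_mult_tendsto_pos[OF tendsto_const _ that]) simp
    then have "filterlim (\<lambda>x::real. - (x\<^sup>2 * (1/2))) at_bot F"
      by (simp add: filterlim_uminus_at_top)
    from filterlim_compose[OF exp_at_bot this] show ?thesis by simp
  qed
  have \<phi>lim: "(\<phi> \<longlongrightarrow> 0) F" if "filterlim (\<lambda>x. x\<^sup>2) at_top F" for F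
    using tendsto_mult_left[OF exp_lim[OF that], of "1 / sqrt (2 * pi)"]
    unfolding \<phi>_def std_normal_density_def[abs_def] by simp
  have top: "(\<phi> \<longlongrightarrow> 0) at_top"
    by (rule \<phi>lim) (rule filterlim_pow_at_top, simp_all add: filterlim_ident)
  have bot: "(\<phi> \<longlongrightarrow> 0) at_bot"
    by (rule \<phi>lim) (rule filterlim_pow_at_bot_even, simp_all add: filterlim_ident)
  have "(LBINT x=-\<infinity>..\<infinity>. f x) = 0 - 0"
  proof (rule interval_integral_FTC_integrable[where F="\<lambda>x. \<phi> x * G x"])
    show "((\<lambda>x. \<phi> x * G x) has_vector_derivative f x) (at x)" for x
      unfolding has_real_derivative_iff_has_vector_derivative[symmetric]
      by (rule DERIV_cong[OF DERIV_mult[OF \<phi>' G]]) (simp add: f_def algebra_simps)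
    show "isCont f x" for x
      unfolding f_def using DERIV_isCont[OF \<phi>'] DERIV_isCont[OF G] g
      by (intro continuous_intros) auto
    show "set_integrable lborel (einterval (-\<infinity>) \<infinity>) f"
      using i1 i2 by (simp add: set_integrable_def einterval_def f_def)
    show "(((\<lambda>x. \<phi> x * G x) \<circ> real_of_ereal) \<longlongrightarrow> 0) (at_right (-\<infinity>))"
      unfolding ereal_tendsto_simps by (rule lim[OF bot])
    show "(((\<lambda>x. \<phi> x * G x) \<circ> real_of_ereal) \<longlongrightarrow> 0) (at_left \<infinity>)"
      unfolding ereal_tendsto_simps by (rule lim[OF top])
  qed auto
  then have "(\<integral>x. f x \<partial>lborel) = 0"
    by (simp add: interval_lebesgue_integral_def set_lebesgue_integral_def einterval_def)
  then have "(\<integral>x. \<phi> x * (x * G x) \<partial>lborel) = (\<integral>x. \<phi> x * g x \<partial>lborel)"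
    unfolding f_def using i1 i2 by (simp add: Bochner_Integration.integral_diff)
  moreover have "(\<integral>x. h x \<partial>N1) = (\<integral>x. \<phi> x * h x \<partial>lborel)"
    if "h \<in> borel_measurable borel" for h :: "real \<Rightarrow> real"
    unfolding N1_def \<phi>_def using that by (subst integral_density) auto
  ultimately show ?thesis by simp
qed

subsection \<open>Resampling coordinates\<close>

text \<open>Redrawing one coordinate preserves the product law. Statements about finitely many
  coordinates are reduced to one dimension through this fact, by induction on the set of
  coordinates, so that the infinite product never has to be split.\<close>

lemma resample_distr: "distr (N1 \<Otimes>\<^sub>M disorder) disorder (\<lambda>(x, w). w(i := x)) = disorder"
  using distr_pair_PiM_eq_PiM[of UNIV "\<lambda>_. N1" i] prob_N1 by (simp add: disorder_N1)

lemma resample_nn: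
  assumes [measurable]: "F \<in> borel_measurable disorder"
  shows "(\<integral>\<^sup>+w. F w \<partial>disorder) = (\<integral>\<^sup>+w. \<integral>\<^sup>+x. F (w(i := x)) \<partial>N1 \<partial>disorder)"
proof -
  have "(\<integral>\<^sup>+w. F w \<partial>disorder) = (\<integral>\<^sup>+z. F ((\<lambda>(x, w). w(i := x)) z) \<partial>(N1 \<Otimes>\<^sub>M disorder))"
    using nn_integral_distr[of "\<lambda>(x, w). w(i := x)" "N1 \<Otimes>\<^sub>M disorder" disorder F]
    by (simp only: resample_distr) simp
  also have "\<dots> = (\<integral>\<^sup>+w. \<integral>\<^sup>+x. F (w(i := x)) \<partial>N1 \<partial>disorder)"
    by (subst ND.nn_integral_snd[symmetric]) auto
  finally show ?thesis .
qed

lemma resample_int: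
  fixes F :: "(nat list \<Rightarrow> real) \<Rightarrow> real"
  assumes F: "integrable disorder F"
  shows "(\<integral>w. F w \<partial>disorder) = (\<integral>w. (\<integral>x. F (w(i := x)) \<partial>N1) \<partial>disorder)"
    and "integrable disorder (\<lambda>w. \<integral>x. F (w(i := x)) \<partial>N1)"
    and "AE w in disorder. integrable N1 (\<lambda>x. F (w(i := x)))"
proof -
  have [measurable]: "F \<in> borel_measurable disorder" using F by auto
  have m: "(\<lambda>(x, w). w(i := x)) \<in> measurable (N1 \<Otimes>\<^sub>M disorder) disorder"
    by measurable
  have "integrable (distr (N1 \<Otimes>\<^sub>M disorder) disorder (\<lambda>(x, w). w(i := x))) F"
    by (simp only: resample_distr F)
  then have i: "integrable (N1 \<Otimes>\<^sub>M disorder) (\<lambda>z. F ((\<lambda>(x, w). w(i := x)) z))"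
    by (rule integrable_distr[OF m])
  then have i': "integrable (N1 \<Otimes>\<^sub>M disorder) (case_prod (\<lambda>x w. F (w(i := x))))"
    by (simp add: case_prod_beta')
  have "(\<integral>w. F w \<partial>disorder) = (\<integral>z. F ((\<lambda>(x, w). w(i := x)) z) \<partial>(N1 \<Otimes>\<^sub>M disorder))"
    using integral_distr[OF m, of F] by (simp only: resample_distr) simp
  also have "\<dots> = (\<integral>w. (\<integral>x. F (w(i := x)) \<partial>N1) \<partial>disorder)"
    using ND.integral_snd[OF i'] by (simp add: case_prod_beta')
  finally show "(\<integral>w. F w \<partial>disorder) = (\<integral>w. (\<integral>x. F (w(i := x)) \<partial>N1) \<partial>disorder)" .
  show "integrable disorder (\<lambda>w. \<integral>x. F (w(i := x)) \<partial>N1)"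
    using ND.integrable_snd[OF i'] .
  show "AE w in disorder. integrable N1 (\<lambda>x. F (w(i := x)))"
    using ND.AE_integrable_snd[OF i'] .
qed

lemma exp_abs_sum_finite:
  assumes "finite J"
  shows "(\<integral>\<^sup>+w. ennreal (exp (C * (\<Sum>i\<in>J. \<bar>w i\<bar>))) \<partial>disorder) < \<infinity>"
  using assms
proof (induction J)
  case empty
  then show ?case by (simp add: D.emeasure_space_1[simplified])
next
  case (insert i J)
  have "(\<integral>\<^sup>+w. ennreal (exp (C * (\<Sum>i\<in>insert i J. \<bar>w i\<bar>))) \<partial>disorder)
    = (\<integral>\<^sup>+w. \<integral>\<^sup>+x. ennreal (exp (C * (\<Sum>k\<in>insert i J. \<bar>(w(i:=x)) k\<bar>))) \<partial>N1 \<partial>disorder)"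
    by (subst resample_nn[where i=i]) auto
  also have "\<dots> = (\<integral>\<^sup>+w. \<integral>\<^sup>+x. ennreal (exp (C * (\<Sum>i\<in>J. \<bar>w i\<bar>))) * ennreal (exp (C * \<bar>x\<bar>)) \<partial>N1 \<partial>disorder)"
  proof (intro nn_integral_cong)
    fix w :: "nat list \<Rightarrow> real" and x :: real
    have "(\<Sum>k\<in>J. \<bar>(w(i:=x)) k\<bar>) = (\<Sum>k\<in>J. \<bar>w k\<bar>)"
      by (intro sum.cong) (use insert in auto)
    then show "ennreal (exp (C * (\<Sum>k\<in>insert i J. \<bar>(w(i:=x)) k\<bar>)))
        = ennreal (exp (C * (\<Sum>i\<in>J. \<bar>w i\<bar>))) * ennreal (exp (C * \<bar>x\<bar>))"
      using insert by (simp add: ennreal_mult'[symmetric] exp_add[symmetric] distrib_left add.commute)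
  qed
  also have "\<dots> = (\<integral>\<^sup>+w. ennreal (exp (C * (\<Sum>i\<in>J. \<bar>w i\<bar>))) \<partial>disorder) * (\<integral>\<^sup>+x. ennreal (exp (C * \<bar>x\<bar>)) \<partial>N1)"
    by (subst nn_integral_cmult, simp) (subst nn_integral_multc, auto)
  also have "\<dots> < \<infinity>"
    using insert.IH N1_exp_abs[of C] by (simp add: ennreal_mult_less_top)
  finally show ?case .
qed

section \<open>Functionals of exponential growth in finitely many coordinates\<close>

text \<open>A class of integrable functionals closed under sums, products and Gibbs averaging and
  containing coordinates, fields and exponentials of fields. Integrability side conditions thereby
  become structural. The summand 1 in the exponent lets \<open>C\<close> absorb constants as
  well.\<close>

definition tame :: "((nat list \<Rightarrow> real) \<Rightarrow> real) \<Rightarrow> bool" where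
  "tame F \<longleftrightarrow> F \<in> borel_measurable disorder \<and>
     (\<exists>J C. finite J \<and> C \<ge> 0 \<and> (\<forall>w. \<bar>F w\<bar> \<le> exp (C * (1 + (\<Sum>i\<in>J. \<bar>w i\<bar>)))))"

lemma tame_meas[measurable_dest]: "tame F \<Longrightarrow> F \<in> borel_measurable disorder"
  by (simp add: tame_def)

lemma tameI:
  "F \<in> borel_measurable disorder \<Longrightarrow> finite J \<Longrightarrow> C \<ge> 0 \<Longrightarrow>
    (\<And>w. \<bar>F w\<bar> \<le> exp (C * (1 + (\<Sum>i\<in>J. \<bar>w i\<bar>)))) \<Longrightarrow> tame F"
  unfolding tame_def by blast

lemma tame_integrable: assumes "tame F" shows "integrable disorder F"
proof -
  from assms obtain J C where J: "finite J" "C \<ge> 0" "\<And>w. \<bar>F w\<bar> \<le> exp (C * (1 + (\<Sum>i\<in>J. \<bar>w i\<bar>)))"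
    and [measurable]: "F \<in> borel_measurable disorder"
    unfolding tame_def by blast
  have "integrable disorder (\<lambda>w. exp C * exp (C * (\<Sum>i\<in>J. \<bar>w i\<bar>)))"
    by (intro integrable_mult_right integrableI_bounded) (use exp_abs_sum_finite[OF J(1), of C] in auto)
  then show ?thesis
    by (rule Bochner_Integration.integrable_bound) (use J in \<open>auto simp: mult_exp_exp algebra_simps\<close>)
qed

lemma tame_bound:
  assumes [measurable]: "F \<in> borel_measurable disorder" and "\<And>w. \<bar>F w\<bar> \<le> B"
  shows "tame F"
proof (rule tameI[of _ "{}" "\<bar>B\<bar>"])
  fix w
  have "\<bar>F w\<bar> \<le> \<bar>B\<bar>" using assms(2)[of w] by linarith
  also have "\<dots> \<le> exp \<bar>B\<bar>" using exp_ge_add_one_self[of "\<bar>B\<bar>"] by linarith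
  finally show "\<bar>F w\<bar> \<le> exp (\<bar>B\<bar> * (1 + (\<Sum>i\<in>{}. \<bar>w i\<bar>)))" by simp
qed auto

lemma tame_const[simp]: "tame (\<lambda>_. c)"
  by (rule tame_bound[of _ "\<bar>c\<bar>"]) auto

lemma tame_exp_lin:
  assumes [measurable]: "F \<in> borel_measurable disorder" and "finite J" "C \<ge> 0"
    and le: "\<And>w. \<bar>F w\<bar> \<le> C * (1 + (\<Sum>i\<in>J. \<bar>w i\<bar>))"
  shows "tame (\<lambda>w. exp (F w))" "tame F"
proof -
  show "tame (\<lambda>w. exp (F w))"
    by (rule tameI[OF _ assms(2,3)]) (use le in \<open>auto simp: abs_le_iff\<close>)
  show "tame F"
  proof (rule tameI[OF _ assms(2,3)])
    fix w show "\<bar>F w\<bar> \<le> exp (C * (1 + (\<Sum>i\<in>J. \<bar>w i\<bar>)))"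
      using le[of w] exp_ge_add_one_self[of "C * (1 + (\<Sum>i\<in>J. \<bar>w i\<bar>))"] by linarith
  qed simp
qed

lemma tame_coord[simp]: "tame (\<lambda>w. w i)"
  by (rule tame_exp_lin(2)[of _ "{i}" 1]) auto

lemma tame_add_mult:
  assumes "tame F" "tame G" shows "tame (\<lambda>w. F w + G w)" "tame (\<lambda>w. F w * G w)"
proof -
  from assms have [measurable]: "F \<in> borel_measurable disorder" "G \<in> borel_measurable disorder"
    by (auto simp: tame_def)
  from assms obtain J C K E where J: "finite J" "C \<ge> 0" "\<And>w. \<bar>F w\<bar> \<le> exp (C * (1 + (\<Sum>i\<in>J. \<bar>w i\<bar>)))"
     and K: "finite K" "E \<ge> 0" "\<And>w. \<bar>G w\<bar> \<le> exp (E * (1 + (\<Sum>i\<in>K. \<bar>w i\<bar>)))"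
    unfolding tame_def by blast
  let ?S = "\<lambda>J w. (\<Sum>i\<in>J. \<bar>w i :: real\<bar>)"
  have 1: "?S J w \<le> ?S (J \<union> K) w" "?S K w \<le> ?S (J \<union> K) w" for w
    by (auto intro!: sum_mono2 simp: J K)
  have 2: "C * (1 + ?S J w) + E * (1 + ?S K w) \<le> (C + E) * (1 + ?S (J \<union> K) w)" for w
    using mult_left_mono[OF 1(1)[of w] J(2)] mult_left_mono[OF 1(2)[of w] K(2)]
    by (simp add: algebra_simps)
  have nn: "0 \<le> ?S J w" for J and w :: "nat list \<Rightarrow> real" by (simp add: sum_nonneg)
  have nn2: "0 \<le> ?S (J \<union> K) w" for w :: "nat list \<Rightarrow> real" by (simp add: sum_nonneg)
  show "tame (\<lambda>w. F w * G w)"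
  proof (rule tameI[of _ "J \<union> K" "C + E"])
    fix w
    have "\<bar>F w * G w\<bar> \<le> exp (C * (1 + ?S J w)) * exp (E * (1 + ?S K w))"
      unfolding abs_mult by (intro mult_mono J K) auto
    also have "\<dots> \<le> exp ((C + E) * (1 + ?S (J \<union> K) w))"
      using 2 by (simp add: mult_exp_exp)
    finally show "\<bar>F w * G w\<bar> \<le> exp ((C + E) * (1 + ?S (J \<union> K) w))" .
  qed (use J K in auto)
  show "tame (\<lambda>w. F w + G w)"
  proof (rule tameI[of _ "J \<union> K" "C + E + 1"])
    fix w
    define a where "a = C * (1 + ?S J w)" define b where "b = E * (1 + ?S K w)"
    have ab: "a \<ge> 0" "b \<ge> 0" using J K nn by (auto simp: a_def b_def intro!: mult_nonneg_nonneg add_nonneg_nonneg)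
    have "\<bar>F w + G w\<bar> \<le> exp a + exp b"
      using J(3)[of w] K(3)[of w] by (simp add: a_def b_def)
    also have "\<dots> \<le> 2 * exp (a + b)" using ab by (smt (verit) exp_le_cancel_iff)
    also have "\<dots> \<le> exp 1 * exp (a + b)" using exp_ge_add_one_self[of "1::real"] by (intro mult_right_mono) auto
    also have "\<dots> = exp (1 + (a + b))" by (simp add: mult_exp_exp)
    also have "\<dots> \<le> exp ((C + E + 1) * (1 + ?S (J \<union> K) w))"
      using 2[of w] nn2[of w] unfolding a_def b_def exp_le_cancel_iff distrib_right mult_1_left by linarith
    finally show "\<bar>F w + G w\<bar> \<le> exp ((C + E + 1) * (1 + ?S (J \<union> K) w))" .
  qed (use J K in auto)
qed

lemma tame_sum: "(\<And>i. i \<in> A \<Longrightarrow> tame (F i)) \<Longrightarrow> tame (\<lambda>w. \<Sum>i\<in>A. F i w)"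
  by (induction A rule: infinite_finite_induct) (auto intro!: tame_add_mult)

lemma tame_cmult: "tame F \<Longrightarrow> tame (\<lambda>w. c * F w)"
  by (rule tame_add_mult(2)) auto

lemma tame_minus: "tame F \<Longrightarrow> tame (\<lambda>w. - F w)"
  using tame_cmult[of F "-1"] by simp

lemma tame_diff: "tame F \<Longrightarrow> tame G \<Longrightarrow> tame (\<lambda>w. F w - G w)"
  using tame_add_mult(1)[of F "\<lambda>w. - G w"] tame_minus by simp

lemma tame_dominated:
  assumes "tame G" "F \<in> borel_measurable disorder" "\<And>w. \<bar>F w\<bar> \<le> \<bar>G w\<bar>"
  shows "tame F"
  using assms unfolding tame_def by (meson order_trans)

lemma tame_abs: "tame F \<Longrightarrow> tame (\<lambda>w. \<bar>F w\<bar>)"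
  by (rule tame_dominated[of F]) auto

lemma tame_divide: "tame F \<Longrightarrow> tame (\<lambda>w. F w / c)"
  using tame_cmult[of F "1/c"] by simp

lemmas tame_intros = tame_const tame_coord tame_add_mult tame_sum tame_minus tame_diff tame_divide

section \<open>Integration by parts, translation and symmetries of the disorder\<close>

lemma gauss_ibp:
  assumes F: "\<And>w x. ((\<lambda>x. F (w(i := x))) has_real_derivative F' (w(i := x))) (at x)"
    and F'c: "\<And>w x. isCont (\<lambda>x. F' (w(i := x))) x"
    and [measurable]: "F \<in> borel_measurable disorder" "F' \<in> borel_measurable disorder"
    and B: "\<And>w. \<bar>F w\<bar> \<le> B" "\<And>w. \<bar>F' w\<bar> \<le> B"
  shows "(\<integral>w. w i * F w \<partial>disorder) = (\<integral>w. F' w \<partial>disorder)"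
proof -
  have t: "tame F" "tame F'" by (rule tame_bound[of _ B]; use B in simp)+
  have "(\<integral>w. w i * F w \<partial>disorder) = (\<integral>w. (\<integral>x. (w(i:=x)) i * F (w(i := x)) \<partial>N1) \<partial>disorder)"
    by (rule resample_int(1)) (intro tame_integrable tame_intros t)
  also have "\<dots> = (\<integral>w. (\<integral>x. F' (w(i := x)) \<partial>N1) \<partial>disorder)"
  proof (rule Bochner_Integration.integral_cong[OF refl])
    fix w
    show "(\<integral>x. (w(i:=x)) i * F (w(i := x)) \<partial>N1) = (\<integral>x. F' (w(i := x)) \<partial>N1)"
      using N1_ibp[of "\<lambda>x. F (w(i := x))" "\<lambda>x. F' (w(i := x))" B, OF F F'c B] by simp
  qed
  also have "\<dots> = (\<integral>w. F' w \<partial>disorder)"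
    by (rule resample_int(1)[symmetric]) (intro tame_integrable t)
  finally show ?thesis .
qed

text \<open>Cameron-Martin for finitely many coordinates. With \<open>h\<close> proportional to the
  coefficient vector of a configuration, the tilt is its normalised Gibbs weight and the translated
  array is the planted disorder.\<close>

lemma gauss_shift:
  assumes "finite I" and [measurable]: "F \<in> borel_measurable disorder"
  shows "(\<integral>\<^sup>+w. F w * ennreal (exp (\<Sum>i\<in>I. w i * h i - (h i)\<^sup>2/2)) \<partial>disorder)
     = (\<integral>\<^sup>+w. F (\<lambda>i. if i \<in> I then w i + h i else w i) \<partial>disorder)"
  using assms
proof (induction I arbitrary: F)
  case empty
  then show ?case by simp
next
  case (insert i I)
  note [measurable] = insert.prems
  have m1[measurable]: "(\<lambda>w. (\<lambda>k. if k \<in> I then w k + h k else w k)) \<in> measurable disorder disorder"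
    by (rule measurable_to_disorder) simp
  define G where "G w = F (w(i := w i + h i))" for w
  have [measurable]: "G \<in> borel_measurable disorder" unfolding G_def by measurable
  let ?e = "\<lambda>I w. ennreal (exp (\<Sum>i\<in>I. w i * h i - (h i)\<^sup>2/2))"
  have s: "(\<Sum>k\<in>I. (w(i:=x)) k * h k - (h k)\<^sup>2/2) = (\<Sum>k\<in>I. w k * h k - (h k)\<^sup>2/2)" for w x
    by (intro sum.cong) (use insert in auto)
  have "(\<integral>\<^sup>+w. F w * ?e (insert i I) w \<partial>disorder)
      = (\<integral>\<^sup>+w. \<integral>\<^sup>+x. F (w(i:=x)) * ?e (insert i I) (w(i:=x)) \<partial>N1 \<partial>disorder)"
    by (subst resample_nn[where i=i]) auto
  also have "\<dots> = (\<integral>\<^sup>+w. \<integral>\<^sup>+x. ?e I w * (F (w(i:=x)) * ennreal (exp (h i * x - (h i)\<^sup>2/2))) \<partial>N1 \<partial>disorder)"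
    by (intro nn_integral_cong)
       (use insert s in \<open>simp add: exp_add ennreal_mult' ac_simps\<close>)
  also have "\<dots> = (\<integral>\<^sup>+w. ?e I w * (\<integral>\<^sup>+x. F (w(i:=x + h i)) \<partial>N1) \<partial>disorder)"
  proof (rule nn_integral_cong)
    fix w :: "nat list \<Rightarrow> real"
    have [measurable]: "(\<lambda>x. F (w(i := x))) \<in> borel_measurable borel"
      by (rule measurable_compose[OF _ insert.prems]) measurable
    show "(\<integral>\<^sup>+x. ?e I w * (F (w(i:=x)) * ennreal (exp (h i * x - (h i)\<^sup>2/2))) \<partial>N1)
      = ?e I w * (\<integral>\<^sup>+x. F (w(i:=x + h i)) \<partial>N1)"
      by (subst nn_integral_cmult) (simp_all add: N1_shift)
  qed
  also have "\<dots> = (\<integral>\<^sup>+w. \<integral>\<^sup>+x. G (w(i:=x)) * ?e I (w(i:=x)) \<partial>N1 \<partial>disorder)"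
  proof (rule nn_integral_cong)
    fix w :: "nat list \<Rightarrow> real"
    have [measurable]: "(\<lambda>x. F (w(i := x))) \<in> borel_measurable borel"
      by (rule measurable_compose[OF _ insert.prems]) measurable
    show "?e I w * (\<integral>\<^sup>+x. F (w(i:=x + h i)) \<partial>N1) = (\<integral>\<^sup>+x. G (w(i:=x)) * ?e I (w(i:=x)) \<partial>N1)"
      unfolding G_def s by (subst nn_integral_multc) (simp_all add: mult.commute)
  qed
  also have "\<dots> = (\<integral>\<^sup>+w. G w * ?e I w \<partial>disorder)"
    by (subst resample_nn[where i=i, symmetric]) auto
  also have "\<dots> = (\<integral>\<^sup>+w. G (\<lambda>k. if k \<in> I then w k + h k else w k) \<partial>disorder)"
    by (rule insert.IH) measurable
  also have "\<dots> = (\<integral>\<^sup>+w. F (\<lambda>k. if k \<in> insert i I then w k + h k else w k) \<partial>disorder)"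
    unfolding G_def using insert by (intro nn_integral_cong arg_cong[where f=F]) (auto simp: fun_eq_iff)
  finally show ?case .
qed

text \<open>Each coordinate is symmetric. This is the source of the gauge invariance of the model:
  flipping spins amounts to flipping signs of disorder coordinates.\<close>

lemma gauss_flip:
  assumes "finite I" and [measurable]: "F \<in> borel_measurable disorder" and e: "\<And>i. e i \<in> {-1, 1 :: real}"
  shows "(\<integral>\<^sup>+w. F (\<lambda>i. if i \<in> I then e i * w i else w i) \<partial>disorder) = (\<integral>\<^sup>+w. F w \<partial>disorder)"
  using assms(1,2)
proof (induction I arbitrary: F)
  case empty
  then show ?case by simp
next
  case (insert i I)
  note [measurable] = insert.prems
  define G where "G w = F (w(i := e i * w i))" for w
  have [measurable]: "G \<in> borel_measurable disorder" unfolding G_def by measurable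
  have "(\<integral>\<^sup>+w. F (\<lambda>k. if k \<in> insert i I then e k * w k else w k) \<partial>disorder)
     = (\<integral>\<^sup>+w. G (\<lambda>k. if k \<in> I then e k * w k else w k) \<partial>disorder)"
    unfolding G_def using insert by (intro nn_integral_cong arg_cong[where f=F]) (auto simp: fun_eq_iff)
  also have "\<dots> = (\<integral>\<^sup>+w. G w \<partial>disorder)"
    by (rule insert.IH) measurable
  also have "\<dots> = (\<integral>\<^sup>+w. \<integral>\<^sup>+x. F (w(i := e i * x)) \<partial>N1 \<partial>disorder)"
    by (subst resample_nn[where i=i]) (auto simp: G_def)
  also have "\<dots> = (\<integral>\<^sup>+w. \<integral>\<^sup>+x. F (w(i := x)) \<partial>N1 \<partial>disorder)"
  proof (rule nn_integral_cong)
    fix w :: "nat list \<Rightarrow> real"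
    have [measurable]: "(\<lambda>x. F (w(i := x))) \<in> borel_measurable borel"
      by (rule measurable_compose[OF _ insert.prems]) measurable
    show "(\<integral>\<^sup>+x. F (w(i := e i * x)) \<partial>N1) = (\<integral>\<^sup>+x. F (w(i := x)) \<partial>N1)"
      using e[of i] N1_reflect[of "\<lambda>x. F (w(i := x))"] by auto
  qed
  also have "\<dots> = (\<integral>\<^sup>+w. F w \<partial>disorder)"
    by (subst resample_nn[where i=i, symmetric]) auto
  finally show ?case .
qed

text \<open>An injectively relabelled i.i.d. array has the same law; blocks can thus read tagged
  parts of the array and still be ordinary systems in law.\<close>

lemma gauss_reindex:
  fixes f :: "nat list \<Rightarrow> nat list"
  assumes "inj f"
  shows "distr disorder disorder (\<lambda>w i. w (f i)) = disorder"
  using distr_PiM_reindex[of UNIV "\<lambda>_. N1" f UNIV] assms prob_N1 by (simp add: disorder_N1 restrict_def)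

lemma gauss_reindex_int:
  fixes F :: "(nat list \<Rightarrow> real) \<Rightarrow> real"
  assumes "inj f" and [measurable]: "F \<in> borel_measurable disorder"
  shows "(\<integral>w. F (\<lambda>i. w (f i)) \<partial>disorder) = (\<integral>w. F w \<partial>disorder)"
proof -
  have m: "(\<lambda>w i. w (f i)) \<in> measurable disorder disorder"
    by (rule measurable_to_disorder) simp
  have "(\<integral>w. F w \<partial>disorder) = (\<integral>w. F w \<partial>(distr disorder disorder (\<lambda>w i. w (f i))))"
    by (simp only: gauss_reindex[OF assms(1)])
  also have "\<dots> = (\<integral>w. F (\<lambda>i. w (f i)) \<partial>disorder)"
    by (rule integral_distr[OF m assms(2)])
  finally show ?thesis ..
qed

subsection \<open>Concentration\<close>

lemma disorder_Collect: assumes p: "Measurable.pred disorder P" shows "{w. P w} \<in> sets disorder"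
  using predE[OF p] by (simp only: space_disorder UNIV_I simp_thms)

lemma UNIV_disorder[simp]: "UNIV \<in> sets disorder"
  using sets.top[of disorder] by simp

lemma exp_sym_mono:
  fixes a c :: real
  assumes "\<bar>a\<bar> \<le> \<bar>c\<bar>" shows "exp a + exp (- a) \<le> exp c + exp (- c)"
proof -
  have "cosh \<bar>a\<bar> \<le> cosh \<bar>c\<bar>" using assms by (subst cosh_real_nonneg_le_iff) auto
  then have "cosh a \<le> cosh c" by (simp add: abs_if split: if_splits)
  then show ?thesis by (simp add: cosh_def)
qed

lemma exp_abs_le: "exp \<bar>a\<bar> \<le> exp a + exp (- a)" for a :: real
  by (cases "a \<ge> 0") simp_all

text \<open>For an independent copy y, the difference f(x) - f(y) can be replaced by b (x - y)
  because cosh is even and increasing in absolute value, and Jensen for the copy turns this into a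
  bound with the mean. The exponent \<open>t\<^sup>2 * b\<^sup>2\<close> is twice the optimal
  one.\<close>

lemma N1_lipschitz_mgf:
  fixes f :: "real \<Rightarrow> real"
  assumes [measurable]: "f \<in> borel_measurable borel" and lip: "\<And>x y. \<bar>f x - f y\<bar> \<le> b * \<bar>x - y\<bar>"
  shows "integrable N1 f"
    and "(\<integral>\<^sup>+x. ennreal (exp (t * f x)) \<partial>N1) \<le> ennreal (exp (t\<^sup>2 * b\<^sup>2 + t * (\<integral>x. f x \<partial>N1)))"
proof -
  have b: "b \<ge> 0" using lip[of 1 0] by simp
  have fb: "\<bar>f x\<bar> \<le> \<bar>f 0\<bar> + b * \<bar>x\<bar>" for x using lip[of x 0] by simp
  show i: "integrable N1 f"
    by (rule Bochner_Integration.integrable_bound[of _ "\<lambda>x. \<bar>f 0\<bar> + b * \<bar>x\<bar>"])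
      (use fb N1_integrable_abs b in \<open>auto intro!: abs_ge_self[THEN order_trans[rotated]]\<close>)
  have ie: "integrable N1 (\<lambda>x. exp (r * f x))" for r
  proof (rule Bochner_Integration.integrable_bound)
    show "integrable N1 (\<lambda>x. exp (\<bar>r\<bar> * \<bar>f 0\<bar>) * exp ((\<bar>r\<bar> * b) * \<bar>x\<bar>))"
      by (intro integrable_mult_right N1_integrable_exp_abs)
    have "r * f x \<le> \<bar>r\<bar> * (\<bar>f 0\<bar> + b * \<bar>x\<bar>)" for x
    proof -
      have "r * f x \<le> \<bar>r\<bar> * \<bar>f x\<bar>" by (metis abs_ge_self abs_mult)
      also have "\<dots> \<le> \<bar>r\<bar> * (\<bar>f 0\<bar> + b * \<bar>x\<bar>)" by (intro mult_left_mono fb) auto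
      finally show ?thesis .
    qed
    then show "AE x in N1. norm (exp (r * f x)) \<le> norm (exp (\<bar>r\<bar> * \<bar>f 0\<bar>) * exp ((\<bar>r\<bar> * b) * \<bar>x\<bar>))"
      by (simp add: exp_add[symmetric] distrib_left mult.assoc)
  qed simp
  define P where "P = (\<integral>\<^sup>+x. ennreal (exp (t * f x)) \<partial>N1)"
  define Q where "Q = (\<integral>\<^sup>+x. ennreal (exp (- t * f x)) \<partial>N1)"
  define m where "m = (\<integral>x. f x \<partial>N1)"
  have "exp (- t * m) \<le> (\<integral>x. exp (- t * f x) \<partial>N1)"
    unfolding m_def
  proof (rule N1.jensens_inequality[where X=f and I=UNIV and q="\<lambda>y. exp (- t * y)"])
    show "convex_on UNIV (\<lambda>y. exp (- t * y))"
    proof (rule convex_on_realI[where f'="\<lambda>y. - t * exp (- t * y)"])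
      show "- t * exp (- t * x) \<le> - t * exp (- t * y)" if "x \<le> y" for x y
      proof (cases "t \<ge> 0")
        case True
        then have "exp (- t * y) \<le> exp (- t * x)" using that by (simp add: mult_left_mono)
        then show ?thesis using mult_left_mono[OF _ True] by simp
      next
        case False
        then have "exp (- t * x) \<le> exp (- t * y)" using that by (simp add: mult_left_mono)
        then show ?thesis using mult_left_mono[of _ _ "-t"] False by simp
      qed
    qed (auto intro!: derivative_eq_intros)
  qed (use i ie[of "-t"] in auto)
  then have 1: "ennreal (exp (- t * m)) \<le> Q"
    unfolding Q_def using ie[of "-t"]
    by (subst nn_integral_eq_integral) (auto intro!: ennreal_leI)
  \<comment> \<open>Symmetrising in x and y makes the integrand twice cosh of
    \<open>t * (f x - f y)\<close>, to which \<open>exp_sym_mono\<close> applies pointwise.\<close>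
  have Pm: "P * Q + Q * P = (\<integral>\<^sup>+x. \<integral>\<^sup>+y. ennreal (exp (t * f x)) * ennreal (exp (- t * f y))
      + ennreal (exp (- t * f x)) * ennreal (exp (t * f y)) \<partial>N1 \<partial>N1)"
    unfolding P_def Q_def
    by (simp add: nn_integral_add nn_integral_cmult nn_integral_multc)
  also have "\<dots> \<le> (\<integral>\<^sup>+x. \<integral>\<^sup>+y. ennreal (exp ((t * b) * x)) * ennreal (exp ((- t * b) * y))
      + ennreal (exp ((- t * b) * x)) * ennreal (exp ((t * b) * y)) \<partial>N1 \<partial>N1)"
  proof (intro nn_integral_mono)
    fix x y
    have "exp (t * (f x - f y)) + exp (- (t * (f x - f y))) \<le> exp (t * b * (x - y)) + exp (- (t * b * (x - y)))"
      by (rule exp_sym_mono) (use lip[of x y] b in \<open>auto simp: abs_mult mult.assoc intro!: mult_left_mono\<close>)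
    moreover have "exp (t * f x) * exp (- t * f y) = exp (t * (f x - f y))"
      "exp (- t * f x) * exp (t * f y) = exp (- (t * (f x - f y)))"
      "exp ((t * b) * x) * exp ((- t * b) * y) = exp (t * b * (x - y))"
      "exp ((- t * b) * x) * exp ((t * b) * y) = exp (- (t * b * (x - y)))"
      by (simp_all add: exp_add[symmetric] right_diff_distrib)
    ultimately show "ennreal (exp (t * f x)) * ennreal (exp (- t * f y))
      + ennreal (exp (- t * f x)) * ennreal (exp (t * f y)) \<le> ennreal (exp ((t * b) * x)) * ennreal (exp ((- t * b) * y))
      + ennreal (exp ((- t * b) * x)) * ennreal (exp ((t * b) * y))"
      by (simp add: ennreal_mult'[symmetric] ennreal_plus[symmetric] del: ennreal_plus)
  qed
  also have "\<dots> = ennreal (exp (t\<^sup>2 * b\<^sup>2)) + ennreal (exp (t\<^sup>2 * b\<^sup>2))"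
    using N1_mgf[of "t * b"] N1_mgf[of "- t * b"]
    by (simp add: nn_integral_add nn_integral_cmult nn_integral_multc)
      (simp add: ennreal_mult'[symmetric] exp_add[symmetric] power_mult_distrib ac_simps)
  finally have PQ: "P * Q + P * Q \<le> ennreal (exp (t\<^sup>2 * b\<^sup>2)) + ennreal (exp (t\<^sup>2 * b\<^sup>2))"
    by (simp add: mult.commute)
  have "P < \<infinity>" unfolding P_def by (subst nn_integral_eq_integral[OF ie]) auto
  then obtain p where p: "P = ennreal p" "p \<ge> 0" by (cases P) auto
  have "Q < \<infinity>" unfolding Q_def by (subst nn_integral_eq_integral[OF ie]) auto
  then obtain q where q: "Q = ennreal q" "q \<ge> 0" by (cases Q) auto
  have pq: "p * q \<le> exp (t\<^sup>2 * b\<^sup>2)"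
    using PQ p q by (simp add: ennreal_mult'[symmetric] ennreal_plus[symmetric] ennreal_le_iff del: ennreal_plus)
  have "exp (- t * m) \<le> q" using 1 q by (simp add: ennreal_le_iff)
  then have "p * exp (- t * m) \<le> exp (t\<^sup>2 * b\<^sup>2)" using pq p mult_left_mono[of _ q p] by (meson order_trans)
  then have "p * exp (- t * m) * exp (t * m) \<le> exp (t\<^sup>2 * b\<^sup>2) * exp (t * m)" by (intro mult_right_mono) auto
  then have "p \<le> exp (t\<^sup>2 * b\<^sup>2 + t * m)" by (simp add: exp_add mult.assoc exp_minus)
  then show "P \<le> ennreal (exp (t\<^sup>2 * b\<^sup>2 + t * m))" unfolding p by (rule ennreal_leI)
qed

lemma coord_lipschitz_bound:
  assumes "finite I"
    and "\<And>i w x y. i \<in> I \<Longrightarrow> \<bar>F (w(i:=x)) - F (w(i:=y)) :: real\<bar> \<le> b i * \<bar>x - y\<bar>"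
  shows "\<bar>F w - F (\<lambda>i. if i \<in> I then 0 else w i)\<bar> \<le> (\<Sum>i\<in>I. b i * \<bar>w i\<bar>)"
  using assms
proof (induction I)
  case empty
  then show ?case by simp
next
  case (insert i I)
  let ?w = "\<lambda>k. if k \<in> I then 0 else w k"
  have e: "(\<lambda>k. if k \<in> insert i I then 0 else w k) = ?w(i := 0)" "?w = ?w(i := w i)"
    using insert by (auto simp: fun_eq_iff)
  have "\<bar>F (?w(i := w i)) - F (?w(i := 0))\<bar> \<le> b i * \<bar>w i - 0\<bar>"
    using insert.prems by blast
  moreover have "\<bar>F w - F ?w\<bar> \<le> (\<Sum>i\<in>I. b i * \<bar>w i\<bar>)" using insert by auto
  ultimately show ?case unfolding e(1) using e(2) insert.hyps by (auto simp: sum.insert)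
qed

definition depends_on :: "'i set \<Rightarrow> (('i \<Rightarrow> real) \<Rightarrow> 'a) \<Rightarrow> bool" where
  "depends_on I F \<longleftrightarrow> (\<forall>w w'. (\<forall>i\<in>I. w i = w' i) \<longrightarrow> F w = F w')"

lemma lipschitz_tame:
  assumes I: "finite I" and dep: "depends_on I F" and [measurable]: "F \<in> borel_measurable disorder"
    and lip: "\<And>i w x y. i \<in> I \<Longrightarrow> \<bar>F (w(i:=x)) - F (w(i:=y))\<bar> \<le> b i * \<bar>x - y\<bar>"
  shows "tame F" "tame (\<lambda>w. exp (F w))"
proof -
  have b: "b i \<ge> 0" if "i \<in> I" for i using lip[OF that, of "\<lambda>_. 0" 1 0] by simp
  define C where "C = \<bar>F (\<lambda>_. 0)\<bar> + (\<Sum>i\<in>I. b i)"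
  have C: "C \<ge> 0" unfolding C_def using b by (intro add_nonneg_nonneg sum_nonneg) auto
  have le: "\<bar>F w\<bar> \<le> C * (1 + (\<Sum>i\<in>I. \<bar>w i\<bar>))" for w
  proof -
    have "F (\<lambda>i. if i \<in> I then 0 else w i) = F (\<lambda>_. 0)" using dep by (auto simp: depends_on_def)
    with coord_lipschitz_bound[OF I, of F b w] lip
    have "\<bar>F w\<bar> \<le> \<bar>F (\<lambda>_. 0)\<bar> + (\<Sum>i\<in>I. b i * \<bar>w i\<bar>)" by force
    also have "(\<Sum>i\<in>I. b i * \<bar>w i\<bar>) \<le> (\<Sum>i\<in>I. C * \<bar>w i\<bar>)"
    proof (intro sum_mono mult_right_mono)
      fix i assume "i \<in> I"
      then have "b i \<le> (\<Sum>i\<in>I. b i)" by (intro member_le_sum I) (auto simp: b)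
      then show "b i \<le> C" by (simp add: C_def)
    qed auto
    also have "\<bar>F (\<lambda>_. 0)\<bar> \<le> C" unfolding C_def using b by (simp add: sum_nonneg)
    finally show ?thesis by (simp add: distrib_left sum_distrib_left)
  qed
  show "tame F" "tame (\<lambda>w. exp (F w))"
    by (rule tame_exp_lin[OF assms(3) I C le])+
qed

text \<open>Integrating out coordinate \<open>i\<close> preserves the Lipschitz constants in the
  other coordinates and costs a factor \<open>exp (t\<^sup>2 * (b i)\<^sup>2)\<close>; the induction
  adds these up as a martingale-difference argument would.\<close>

lemma conc_mgf:
  assumes I: "finite I" and dep: "depends_on I F" and F: "F \<in> borel_measurable disorder"
    and lip: "\<And>i w x y. i \<in> I \<Longrightarrow> \<bar>F (w(i:=x)) - F (w(i:=y))\<bar> \<le> b i * \<bar>x - y\<bar>"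
  shows "(\<integral>\<^sup>+w. ennreal (exp (t * F w)) \<partial>disorder)
      \<le> ennreal (exp (t\<^sup>2 * (\<Sum>i\<in>I. (b i)\<^sup>2) + t * (\<integral>w. F w \<partial>disorder)))"
  using assms
proof (induction I arbitrary: F)
  case empty
  then have "F w = F (\<lambda>_. 0)" for w by (simp add: depends_on_def)
  then have "F = (\<lambda>w. F (\<lambda>_. 0))" by (rule ext)
  then obtain c where "F = (\<lambda>w. c)" by blast
  then show ?case by (simp add: D.emeasure_space_1[simplified] D.prob_space[simplified])
next
  case (insert i I)
  note [measurable] = insert.prems(2)
  define G where "G w = (\<integral>x. F (w(i:=x)) \<partial>N1)" for w
  have m[measurable]: "(\<lambda>x. F (w(i := x))) \<in> borel_measurable borel" for w
    by (rule measurable_compose[OF _ insert.prems(2)]) measurable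
  have l1: "\<bar>F (w(i:=x)) - F (w(i:=y))\<bar> \<le> b i * \<bar>x - y\<bar>" for w x y by (rule insert.prems(3)) simp
  have Fi: "integrable N1 (\<lambda>x. F (w(i := x)))" for w
    by (rule N1_lipschitz_mgf(1)[OF m, of w "b i"]) (rule l1)
  have tF: "tame F"
    by (rule lipschitz_tame[OF _ insert.prems(1-3)]) (use insert in auto)
  have GF: "(\<integral>w. G w \<partial>disorder) = (\<integral>w. F w \<partial>disorder)"
    unfolding G_def by (rule resample_int(1)[symmetric]) (rule tame_integrable[OF tF])
  have "(\<integral>\<^sup>+w. ennreal (exp (t * F w)) \<partial>disorder)
      = (\<integral>\<^sup>+w. \<integral>\<^sup>+x. ennreal (exp (t * F (w(i:=x)))) \<partial>N1 \<partial>disorder)"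
    by (rule resample_nn) simp
  also have "\<dots> \<le> (\<integral>\<^sup>+w. ennreal (exp (t\<^sup>2 * (b i)\<^sup>2)) * ennreal (exp (t * G w)) \<partial>disorder)"
  proof (rule nn_integral_mono)
    fix w
    show "(\<integral>\<^sup>+x. ennreal (exp (t * F (w(i:=x)))) \<partial>N1) \<le> ennreal (exp (t\<^sup>2 * (b i)\<^sup>2)) * ennreal (exp (t * G w))"
      using N1_lipschitz_mgf(2)[OF m, of w "b i" t, OF l1] unfolding G_def
      by (simp add: ennreal_mult'[symmetric] exp_add)
  qed
  also have "\<dots> = ennreal (exp (t\<^sup>2 * (b i)\<^sup>2)) * (\<integral>\<^sup>+w. ennreal (exp (t * G w)) \<partial>disorder)"
    unfolding G_def by (subst nn_integral_cmult) auto
  also have "\<dots> \<le> ennreal (exp (t\<^sup>2 * (b i)\<^sup>2)) * ennreal (exp (t\<^sup>2 * (\<Sum>i\<in>I. (b i)\<^sup>2) + t * (\<integral>w. G w \<partial>disorder)))"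
  proof (intro mult_left_mono insert.IH)
    show "depends_on I G"
      unfolding depends_on_def
    proof (intro allI impI)
      fix w w' :: "nat list \<Rightarrow> real" assume "\<forall>i\<in>I. w i = w' i"
      then have "F (w(i:=x)) = F (w'(i:=x))" for x
        using insert.prems(1) unfolding depends_on_def by (metis fun_upd_apply insert_iff)
      then show "G w = G w'" by (simp add: G_def)
    qed
    show "G \<in> borel_measurable disorder" unfolding G_def by measurable
    fix k w x y assume k: "k \<in> I"
    then have ki: "k \<noteq> i" using insert by auto
    have "\<bar>G (w(k:=x)) - G (w(k:=y))\<bar> = \<bar>\<integral>z. F ((w(i:=z))(k:=x)) - F ((w(i:=z))(k:=y)) \<partial>N1\<bar>"
      unfolding G_def using Fi[of "w(k:=x)"] Fi[of "w(k:=y)"] ki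
      by (subst Bochner_Integration.integral_diff) (auto simp: fun_upd_twist)
    also have "\<dots> \<le> (\<integral>z. \<bar>F ((w(i:=z))(k:=x)) - F ((w(i:=z))(k:=y))\<bar> \<partial>N1)"
      by (rule integral_abs_bound)
    also have "\<dots> \<le> (\<integral>z. b k * \<bar>x - y\<bar> \<partial>N1)"
    proof (rule integral_mono)
      have "integrable N1 (\<lambda>z. F ((w(i:=z))(k:=x)) - F ((w(i:=z))(k:=y)))"
        using Fi[of "w(k:=x)"] Fi[of "w(k:=y)"] ki
        by (intro Bochner_Integration.integrable_diff) (simp_all add: fun_upd_twist[OF ki])
      then show "integrable N1 (\<lambda>z. \<bar>F ((w(i:=z))(k:=x)) - F ((w(i:=z))(k:=y))\<bar>)" by (rule integrable_abs)
      show "\<bar>F ((w(i:=z))(k:=x)) - F ((w(i:=z))(k:=y))\<bar> \<le> b k * \<bar>x - y\<bar>" for z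
        by (rule insert.prems(3)) (use k in simp)
    qed simp
    also have "\<dots> = b k * \<bar>x - y\<bar>" by (simp add: N1.prob_space[simplified])
    finally show "\<bar>G (w(k:=x)) - G (w(k:=y))\<bar> \<le> b k * \<bar>x - y\<bar>" .
  qed auto
  also have "\<dots> = ennreal (exp (t\<^sup>2 * (\<Sum>i\<in>insert i I. (b i)\<^sup>2) + t * (\<integral>w. F w \<partial>disorder)))"
    using insert by (simp add: ennreal_mult'[symmetric] exp_add[symmetric] GF distrib_left)
  finally show ?case .
qed

text \<open>Markov's inequality for the exponential moment, with the sum of squared Lipschitz
  constants as variance proxy.\<close>

lemma concentration:
  assumes I: "finite I" and dep: "depends_on I F" and F[measurable]: "F \<in> borel_measurable disorder"
    and lip: "\<And>i w x y. i \<in> I \<Longrightarrow> \<bar>F (w(i:=x)) - F (w(i:=y))\<bar> \<le> b i * \<bar>x - y\<bar>"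
    and V: "(\<Sum>i\<in>I. (b i)\<^sup>2) \<le> V" "V > 0"
  shows "x \<ge> 0 \<Longrightarrow> measure disorder {w. F w \<ge> (\<integral>w. F w \<partial>disorder) + x} \<le> exp (- x\<^sup>2 / (4 * V))"
    and "x \<ge> 0 \<Longrightarrow> measure disorder {w. F w \<le> (\<integral>w. F w \<partial>disorder) - x} \<le> exp (- x\<^sup>2 / (4 * V))"
    and "(\<integral>w. \<bar>F w - (\<integral>w. F w \<partial>disorder)\<bar> \<partial>disorder) \<le> 6 * sqrt V"
proof -
  define m where "m = (\<integral>w. F w \<partial>disorder)"
  have tF: "tame F" by (rule lipschitz_tame[OF assms(1-3) lip])
  have mgf: "(\<integral>\<^sup>+w. ennreal (exp (t * (F w - m))) \<partial>disorder) \<le> ennreal (exp (t\<^sup>2 * V))" for t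
  proof -
    have "(\<integral>\<^sup>+w. ennreal (exp (t * (F w - m))) \<partial>disorder)
       = (\<integral>\<^sup>+w. ennreal (exp (- t * m)) * ennreal (exp (t * F w)) \<partial>disorder)"
      by (intro nn_integral_cong) (simp add: ennreal_mult'[symmetric] exp_add[symmetric] right_diff_distrib)
    also have "\<dots> = ennreal (exp (- t * m)) * (\<integral>\<^sup>+w. ennreal (exp (t * F w)) \<partial>disorder)"
      by (subst nn_integral_cmult) auto
    also have "\<dots> \<le> ennreal (exp (- t * m)) * ennreal (exp (t\<^sup>2 * (\<Sum>i\<in>I. (b i)\<^sup>2) + t * m))"
      unfolding m_def by (intro mult_left_mono conc_mgf[OF I dep F lip]) auto
    also have "\<dots> \<le> ennreal (exp (t\<^sup>2 * V))"
      using V by (simp add: ennreal_mult'[symmetric] exp_add[symmetric] mult_left_mono)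
    finally show ?thesis .
  qed
  have tail: "measure disorder {w. t * (F w - m) \<ge> t * x} \<le> exp (- t * x + t\<^sup>2 * V)" for t x
  proof -
    have "emeasure disorder {w\<in>space disorder. 1 \<le> ennreal (exp (-t * x)) * ennreal (exp (t * (F w - m)))}
        \<le> ennreal (exp (- t * x)) * (\<integral>\<^sup>+w. ennreal (exp (t * (F w - m))) * indicator (space disorder) w \<partial>disorder)"
      by (rule nn_integral_Markov_inequality) auto
    also have "\<dots> \<le> ennreal (exp (- t * x)) * ennreal (exp (t\<^sup>2 * V))"
      using mgf[of t] by (intro mult_left_mono) auto
    also have "\<dots> = ennreal (exp (- t * x + t\<^sup>2 * V))" by (simp add: ennreal_mult'[symmetric] exp_add[symmetric])
    finally have *: "emeasure disorder {w\<in>space disorder. 1 \<le> ennreal (exp (-t * x)) * ennreal (exp (t * (F w - m)))}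
        \<le> ennreal (exp (- t * x + t\<^sup>2 * V))" .
    have "{w\<in>space disorder. 1 \<le> ennreal (exp (-t * x)) * ennreal (exp (t * (F w - m)))}
        = {w. t * (F w - m) \<ge> t * x}"
      by (auto simp: ennreal_mult'[symmetric] exp_add[symmetric])
    with * show ?thesis by (simp add: D.emeasure_eq_measure)
  qed
  { assume x: "x \<ge> 0"
    \<comment> \<open>Minimises \<open>- t * x + t\<^sup>2 * V\<close>.\<close>
    define t where "t = x / (2 * V)"
    have e: "- t * x + t\<^sup>2 * V = - x\<^sup>2 / (4 * V)" using V(2) by (simp add: t_def power2_eq_square field_simps)
    have t: "t \<ge> 0" using x V by (simp add: t_def)
    have "measure disorder {w. F w \<ge> m + x} \<le> measure disorder {w. t * (F w - m) \<ge> t * x}"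
      by (rule D.finite_measure_mono) (use t in \<open>auto intro!: mult_left_mono disorder_Collect\<close>)
    also have "\<dots> \<le> exp (- x\<^sup>2 / (4 * V))" using tail[of t x] unfolding e .
    finally show "measure disorder {w. F w \<ge> m + x} \<le> exp (- x\<^sup>2 / (4 * V))" .
    have "measure disorder {w. F w \<le> m - x} \<le> measure disorder {w. (-t) * (F w - m) \<ge> (-t) * (-x)}"
    proof (rule D.finite_measure_mono)
      show "{w. F w \<le> m - x} \<subseteq> {w. (-t) * (F w - m) \<ge> (-t) * (-x)}"
      proof safe
        fix w assume "F w \<le> m - x"
        then have "t * x \<le> t * (m - F w)" using t by (intro mult_left_mono) auto
        then show "(-t) * (-x) \<le> (-t) * (F w - m)" by (simp add: algebra_simps)
      qed
    qed (rule disorder_Collect, measurable)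
    also have "\<dots> \<le> exp (- x\<^sup>2 / (4 * V))" using tail[of "-t" "-x"] e by simp
    finally show "measure disorder {w. F w \<le> m - x} \<le> exp (- x\<^sup>2 / (4 * V))" . }
  \<comment> \<open>At this scale \<open>t\<^sup>2 * V = 1\<close>, so each exponential moment is at
    most e; bounding |z| by exp z + exp (-z) gives 2 e <= 6.\<close>
  define t where "t = 1 / sqrt V"
  have t: "t > 0" "t\<^sup>2 * V = 1" using V by (auto simp: t_def power_divide)
  have te: "integrable disorder (\<lambda>w. exp (r * (F w - m)))" for r
    by (rule integrableI_bounded) (use mgf[of r] in \<open>auto intro: le_less_trans\<close>)
  have ti: "(\<integral>w. exp (r * (F w - m)) \<partial>disorder) \<le> exp (r\<^sup>2 * V)" for r
    using mgf[of r] by (subst (asm) nn_integral_eq_integral[OF te]) (auto simp: ennreal_le_iff)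
  have "t * (\<integral>w. \<bar>F w - m\<bar> \<partial>disorder) = (\<integral>w. t * \<bar>F w - m\<bar> \<partial>disorder)" by simp
  also have "\<dots> \<le> (\<integral>w. exp (t * (F w - m)) + exp ((-t) * (F w - m)) \<partial>disorder)"
  proof (rule integral_mono)
    show "integrable disorder (\<lambda>w. t * \<bar>F w - m\<bar>)"
      by (intro tame_integrable tame_cmult tame_abs tame_intros tF)
    show "integrable disorder (\<lambda>w. exp (t * (F w - m)) + exp ((-t) * (F w - m)))"
      by (intro Bochner_Integration.integrable_add te)
    fix w
    have "t * \<bar>F w - m\<bar> \<le> exp (t * \<bar>F w - m\<bar>)" using exp_ge_add_one_self[of "t * \<bar>F w - m\<bar>"] by linarith
    also have "\<dots> \<le> exp (t * (F w - m)) + exp ((-t) * (F w - m))"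
      using t(1) exp_abs_le[of "t * (F w - m)"] by (simp add: abs_mult)
    finally show "t * \<bar>F w - m\<bar> \<le> exp (t * (F w - m)) + exp ((-t) * (F w - m))" .
  qed
  also have "\<dots> \<le> exp (t\<^sup>2 * V) + exp ((-t)\<^sup>2 * V)"
    by (subst Bochner_Integration.integral_add[OF te te]) (intro add_mono ti)
  also have "\<dots> = 2 * exp 1" using t by simp
  also have "\<dots> \<le> 6" using e_less_272 by simp
  finally show "(\<integral>w. \<bar>F w - m\<bar> \<partial>disorder) \<le> 6 * sqrt V"
    using t V by (simp add: t_def field_simps)
qed

text \<open>Fubini between a finite set of coordinates and the rest, phrased by redrawing; it serves
  to freeze all disorder outside one block.\<close>

lemma resample_set_nn:
  assumes "finite J" and [measurable]: "F \<in> borel_measurable disorder"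
  shows "(\<integral>\<^sup>+w. F w \<partial>disorder) = (\<integral>\<^sup>+w. \<integral>\<^sup>+w'. F (\<lambda>i. if i \<in> J then w' i else w i) \<partial>disorder \<partial>disorder)"
  using assms(1)
proof (induction J)
  case empty
  then show ?case by (simp add: D.emeasure_space_1[simplified])
next
  case (insert i J)
  let ?m = "\<lambda>J w' w i. if i \<in> J then w' i else w i"
  define H where "H w = (\<integral>\<^sup>+w'. F (?m J w' w) \<partial>disorder)" for w
  have mH: "(\<lambda>(w, w'). F (?m J w' w)) \<in> borel_measurable (disorder \<Otimes>\<^sub>M disorder)"
    unfolding case_prod_beta' by (rule measurable_compose[OF measurable_to_disorder assms(2)]) simp
  have [measurable]: "H \<in> borel_measurable disorder"
    unfolding H_def using D.borel_measurable_nn_integral[OF mH] by simp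
  have "(\<integral>\<^sup>+w. F w \<partial>disorder) = (\<integral>\<^sup>+w. H w \<partial>disorder)"
    unfolding H_def by (rule insert.IH)
  also have "\<dots> = (\<integral>\<^sup>+w. \<integral>\<^sup>+x. H (w(i:=x)) \<partial>N1 \<partial>disorder)" by (rule resample_nn) simp
  also have "\<dots> = (\<integral>\<^sup>+w. \<integral>\<^sup>+w'. F (?m (insert i J) w' w) \<partial>disorder \<partial>disorder)"
  proof (rule nn_integral_cong)
    fix w :: "nat list \<Rightarrow> real"
    have m2: "(\<lambda>(x, w'). F (?m J w' (w(i:=x)))) \<in> borel_measurable (N1 \<Otimes>\<^sub>M disorder)"
      unfolding case_prod_beta' by (rule measurable_compose[OF measurable_to_disorder assms(2)]) (simp add: fun_upd_def)
    have m3: "(\<lambda>w'. F (?m (insert i J) w' w)) \<in> borel_measurable disorder"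
      by (rule measurable_compose[OF measurable_to_disorder assms(2)]) simp
    have "(\<integral>\<^sup>+w'. F (?m (insert i J) w' w) \<partial>disorder)
       = (\<integral>\<^sup>+w'. \<integral>\<^sup>+x. F (?m (insert i J) (w'(i:=x)) w) \<partial>N1 \<partial>disorder)"
      by (rule resample_nn[OF m3])
    also have "\<dots> = (\<integral>\<^sup>+w'. \<integral>\<^sup>+x. F (?m J w' (w(i:=x))) \<partial>N1 \<partial>disorder)"
      by (intro nn_integral_cong arg_cong[where f=F]) (use insert.hyps in \<open>auto simp: fun_eq_iff\<close>)
    also have "\<dots> = (\<integral>\<^sup>+x. \<integral>\<^sup>+w'. F (?m J w' (w(i:=x))) \<partial>disorder \<partial>N1)"
      by (rule ND.Fubini'[OF m2])
    finally show "(\<integral>\<^sup>+x. H (w(i:=x)) \<partial>N1) = (\<integral>\<^sup>+w'. F (?m (insert i J) w' w) \<partial>disorder)"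
      unfolding H_def by simp
  qed
  finally show ?case .
qed

subsection \<open>Gibbs averages\<close>

lemma borel_measurable_exp_real: "f \<in> borel_measurable M \<Longrightarrow> (\<lambda>w. exp (f w :: real)) \<in> borel_measurable M"
  by measurable

abbreviation EE :: "((nat list \<Rightarrow> real) \<Rightarrow> real) \<Rightarrow> real" where
  "EE F \<equiv> integral\<^sup>L disorder F"

text \<open>The index set is arbitrary so that the same calculus serves all spin configurations,
  subsets at a prescribed overlap level, and lists of replicas.\<close>

definition Zs :: "'a set \<Rightarrow> ('a \<Rightarrow> real) \<Rightarrow> real" where
  "Zs S e = (\<Sum>\<sigma>\<in>S. exp (e \<sigma>))"

definition lZ :: "'a set \<Rightarrow> ('a \<Rightarrow> real) \<Rightarrow> real" where
  "lZ S e = ln (Zs S e)"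

definition gav :: "'a set \<Rightarrow> ('a \<Rightarrow> real) \<Rightarrow> ('a \<Rightarrow> real) \<Rightarrow> real" where
  "gav S e f = (\<Sum>\<sigma>\<in>S. f \<sigma> * exp (e \<sigma>)) / Zs S e"

text \<open>A centred Gaussian field is encoded by its coefficient vector \<open>u\<close>;
  \<open>ip\<close> below is then the covariance of two fields, and covariance computations become
  bilinear algebra.\<close>

definition fld :: "'i set \<Rightarrow> ('i \<Rightarrow> real) \<Rightarrow> ('i \<Rightarrow> real) \<Rightarrow> real" where
  "fld I u w = (\<Sum>i\<in>I. w i * u i)"

definition ip :: "'i set \<Rightarrow> ('i \<Rightarrow> real) \<Rightarrow> ('i \<Rightarrow> real) \<Rightarrow> real" where
  "ip I u v = (\<Sum>i\<in>I. u i * v i)"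

lemma Zs_pos: "finite S \<Longrightarrow> S \<noteq> {} \<Longrightarrow> Zs S e > 0"
  unfolding Zs_def by (rule sum_pos) auto

lemma Zs_nonneg: "Zs S e \<ge> 0"
  unfolding Zs_def by (rule sum_nonneg) auto

lemma exp_lZ: "finite S \<Longrightarrow> S \<noteq> {} \<Longrightarrow> exp (lZ S e) = Zs S e"
  by (simp add: lZ_def Zs_pos)

lemma gav_const: "finite S \<Longrightarrow> S \<noteq> {} \<Longrightarrow> gav S e (\<lambda>_. c) = c"
  using Zs_pos[of S e] by (simp add: gav_def Zs_def sum_distrib_left[symmetric])

lemma gav_add: "gav S e (\<lambda>\<sigma>. f \<sigma> + g \<sigma>) = gav S e f + gav S e g"
  by (simp add: gav_def sum.distrib distrib_right add_divide_distrib)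

lemma gav_diff: "gav S e (\<lambda>\<sigma>. f \<sigma> - g \<sigma>) = gav S e f - gav S e g"
  by (simp add: gav_def sum_subtractf left_diff_distrib diff_divide_distrib)

lemma gav_cmult: "gav S e (\<lambda>\<sigma>. c * f \<sigma>) = c * gav S e f"
  by (simp add: gav_def sum_distrib_left mult.assoc)

lemma gav_multc: "gav S e (\<lambda>\<sigma>. f \<sigma> * c) = gav S e f * c"
  using gav_cmult[of S e c f] by (simp add: mult.commute)

lemma gav_sum: "gav S e (\<lambda>\<sigma>. \<Sum>k\<in>A. f k \<sigma>) = (\<Sum>k\<in>A. gav S e (f k))"
  by (simp add: gav_def sum_distrib_right sum.swap[of _ A] sum_divide_distrib)

lemma gav_cong: "(\<And>\<sigma>. \<sigma> \<in> S \<Longrightarrow> f \<sigma> = g \<sigma>) \<Longrightarrow> gav S e f = gav S e g"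
  by (simp add: gav_def)

lemma gav_mono: "(\<And>\<sigma>. \<sigma> \<in> S \<Longrightarrow> f \<sigma> \<le> g \<sigma>) \<Longrightarrow> gav S e f \<le> gav S e g"
  unfolding gav_def by (intro divide_right_mono sum_mono mult_right_mono) (auto simp: Zs_nonneg)

lemma gav_nonneg: "(\<And>\<sigma>. \<sigma> \<in> S \<Longrightarrow> f \<sigma> \<ge> 0) \<Longrightarrow> gav S e f \<ge> 0"
  unfolding gav_def by (intro divide_nonneg_nonneg sum_nonneg mult_nonneg_nonneg) (auto simp: Zs_nonneg)

lemma gav_le: "finite S \<Longrightarrow> S \<noteq> {} \<Longrightarrow> (\<And>\<sigma>. \<sigma> \<in> S \<Longrightarrow> f \<sigma> \<le> B) \<Longrightarrow> gav S e f \<le> B"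
  using gav_mono[of S f "\<lambda>_. B" e] by (simp add: gav_const)

lemma gav_ge: "finite S \<Longrightarrow> S \<noteq> {} \<Longrightarrow> (\<And>\<sigma>. \<sigma> \<in> S \<Longrightarrow> B \<le> f \<sigma>) \<Longrightarrow> B \<le> gav S e f"
  using gav_mono[of S "\<lambda>_. B" f e] by (simp add: gav_const)

lemma gav_abs: "\<bar>gav S e f\<bar> \<le> gav S e (\<lambda>\<sigma>. \<bar>f \<sigma>\<bar>)"
  unfolding gav_def abs_divide abs_of_nonneg[OF Zs_nonneg]
  by (intro divide_right_mono order_trans[OF sum_abs]) (auto simp: abs_mult Zs_nonneg)

lemma gav_abs_le: "finite S \<Longrightarrow> S \<noteq> {} \<Longrightarrow> (\<And>\<sigma>. \<sigma> \<in> S \<Longrightarrow> \<bar>f \<sigma>\<bar> \<le> B) \<Longrightarrow> \<bar>gav S e f\<bar> \<le> B"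
  by (rule order_trans[OF gav_abs gav_le])

lemma gav_abs_sum: "finite S \<Longrightarrow> \<bar>gav S e f\<bar> \<le> (\<Sum>\<sigma>\<in>S. \<bar>f \<sigma>\<bar>)"
proof (cases "S = {}")
  case False
  assume S: "finite S"
  then show ?thesis using False by (intro gav_abs_le) (auto intro: member_le_sum)
qed (simp add: gav_def)

text \<open>Exchanging sums gives a sum of squared Gibbs means. This sign is behind the monotonicity
  of the free energy gaps and bounds the cost of the perturbation.\<close>

lemma gav_ip_nonneg:
  "0 \<le> gav S e (\<lambda>\<sigma>. gav S e (\<lambda>\<tau>. ip I (u \<sigma>) (u \<tau>)))"
proof -
  have "gav S e (\<lambda>\<sigma>. gav S e (\<lambda>\<tau>. ip I (u \<sigma>) (u \<tau>))) = (\<Sum>i\<in>I. (gav S e (\<lambda>\<sigma>. u \<sigma> i))\<^sup>2)"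
    unfolding ip_def gav_sum gav_cmult gav_multc by (simp add: power2_eq_square)
  then show ?thesis by (simp add: sum_nonneg)
qed

lemma gav_sq_le: "finite S \<Longrightarrow> S \<noteq> {} \<Longrightarrow> (gav S e f)\<^sup>2 \<le> gav S e (\<lambda>\<sigma>. (f \<sigma>)\<^sup>2)"
proof -
  assume S: "finite S" "S \<noteq> {}"
  have "0 \<le> gav S e (\<lambda>\<sigma>. (f \<sigma> - gav S e f)\<^sup>2)" by (rule gav_nonneg) simp
  also have "\<dots> = gav S e (\<lambda>\<sigma>. (f \<sigma>)\<^sup>2 + ((- 2 * gav S e f) * f \<sigma> + (gav S e f)\<^sup>2))"
    by (rule gav_cong) (simp add: power2_eq_square algebra_simps)
  also have "\<dots> = gav S e (\<lambda>\<sigma>. (f \<sigma>)\<^sup>2) + (- 2 * gav S e f * gav S e f + (gav S e f)\<^sup>2)"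
    unfolding gav_add gav_cmult gav_const[OF S] by simp
  finally show ?thesis by (simp add: power2_eq_square)
qed

text \<open>Jensen for the exponential under the Gibbs measure: the log-partition function lies
  above its tangents. Many later estimates use this form of convexity and avoid derivatives.\<close>

lemma lZ_tangent:
  assumes "finite S" "S \<noteq> {}"
  shows "lZ S (\<lambda>\<sigma>. e \<sigma> + y \<sigma>) \<ge> lZ S e + gav S e y"
proof -
  have Z: "Zs S e > 0" by (rule Zs_pos[OF assms])
  have "exp (gav S e y) \<le> gav S e (\<lambda>\<sigma>. exp (y \<sigma>))"
  proof -
    let ?m = "gav S e y"
    have "exp ?m = exp ?m * (1 + (gav S e y - ?m))" by simp
    also have "\<dots> = gav S e (\<lambda>\<sigma>. exp ?m * (1 + (y \<sigma> - ?m)))"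
      by (simp add: gav_cmult gav_add gav_diff gav_const[OF assms])
    also have "\<dots> \<le> gav S e (\<lambda>\<sigma>. exp (y \<sigma>))"
    proof (rule gav_mono)
      fix \<sigma>
      have "exp ?m * (1 + (y \<sigma> - ?m)) \<le> exp ?m * exp (y \<sigma> - ?m)"
        by (intro mult_left_mono exp_ge_add_one_self) auto
      then show "exp ?m * (1 + (y \<sigma> - ?m)) \<le> exp (y \<sigma>)" by (simp add: exp_add[symmetric])
    qed
    finally show ?thesis .
  qed
  also have "\<dots> = Zs S (\<lambda>\<sigma>. e \<sigma> + y \<sigma>) / Zs S e"
    by (simp add: gav_def Zs_def exp_add mult.commute)
  finally have "gav S e y \<le> ln (Zs S (\<lambda>\<sigma>. e \<sigma> + y \<sigma>) / Zs S e)"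
    using Z Zs_pos[OF assms] by (subst ln_ge_iff) auto
  then show ?thesis using Z Zs_pos[OF assms, of "\<lambda>\<sigma>. e \<sigma> + y \<sigma>"] by (simp add: lZ_def ln_div)
qed

lemma lZ_mono:
  assumes "finite S" "S \<noteq> {}" "\<And>\<sigma>. \<sigma> \<in> S \<Longrightarrow> e \<sigma> \<le> e' \<sigma>" shows "lZ S e \<le> lZ S e'"
  unfolding lZ_def using assms Zs_pos[of S e] Zs_pos[of S e']
  by (subst ln_le_cancel_iff) (auto simp: Zs_def intro!: sum_mono)

lemma lZ_add_const: "finite S \<Longrightarrow> S \<noteq> {} \<Longrightarrow> lZ S (\<lambda>\<sigma>. e \<sigma> + c) = lZ S e + c"
  using Zs_pos[of S e] by (simp add: lZ_def Zs_def exp_add sum_distrib_right[symmetric] ln_mult)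

lemma lZ_lipschitz:
  assumes "finite S" "S \<noteq> {}" "\<And>\<sigma>. \<sigma> \<in> S \<Longrightarrow> \<bar>e \<sigma> - e' \<sigma>\<bar> \<le> B" shows "\<bar>lZ S e - lZ S e'\<bar> \<le> B"
proof -
  have "lZ S e \<le> lZ S (\<lambda>\<sigma>. e' \<sigma> + B)" "lZ S e' \<le> lZ S (\<lambda>\<sigma>. e \<sigma> + B)"
    using assms(3) by (intro lZ_mono assms; force simp: abs_le_iff)+
  then show ?thesis by (simp add: lZ_add_const assms)
qed

lemma lZ_zero: "finite S \<Longrightarrow> S \<noteq> {} \<Longrightarrow> lZ S (\<lambda>_. 0) = ln (card S)"
  by (simp add: lZ_def Zs_def)

lemma lZ_cong: "(\<And>\<sigma>. \<sigma> \<in> S \<Longrightarrow> e \<sigma> = e' \<sigma>) \<Longrightarrow> lZ S e = lZ S e'"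
  by (simp add: lZ_def Zs_def)

lemma gav_cong2: "(\<And>\<sigma>. \<sigma> \<in> S \<Longrightarrow> e \<sigma> = e' \<sigma>) \<Longrightarrow> (\<And>\<sigma>. \<sigma> \<in> S \<Longrightarrow> f \<sigma> = g \<sigma>) \<Longrightarrow> gav S e f = gav S e' g"
  by (simp add: gav_def Zs_def)

lemma lZ_abs:
  assumes "finite S" "S \<noteq> {}" shows "\<bar>lZ S e\<bar> \<le> \<bar>ln (card S)\<bar> + (\<Sum>\<sigma>\<in>S. \<bar>e \<sigma>\<bar>)"
proof -
  have "\<bar>lZ S e - lZ S (\<lambda>_. 0)\<bar> \<le> (\<Sum>\<sigma>\<in>S. \<bar>e \<sigma>\<bar>)"
    by (rule lZ_lipschitz[OF assms]) (auto intro: member_le_sum assms)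
  then show ?thesis by (simp add: lZ_zero assms)
qed

lemma Zs_measurable:
  "(\<And>\<sigma>. (\<lambda>w. e w \<sigma>) \<in> borel_measurable M) \<Longrightarrow> (\<lambda>w. Zs S (e w)) \<in> borel_measurable M"
  unfolding Zs_def by (intro borel_measurable_sum borel_measurable_exp_real)

lemma lZ_measurable:
  "(\<And>\<sigma>. (\<lambda>w. e w \<sigma>) \<in> borel_measurable M) \<Longrightarrow> (\<lambda>w. lZ S (e w)) \<in> borel_measurable M"
  unfolding lZ_def by (intro borel_measurable_ln Zs_measurable)

lemma gav_measurable:
  "(\<And>\<sigma>. (\<lambda>w. e w \<sigma>) \<in> borel_measurable M) \<Longrightarrow> (\<And>\<sigma>. (\<lambda>w. f w \<sigma>) \<in> borel_measurable M) \<Longrightarrow>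
     (\<lambda>w. gav S (e w) (f w)) \<in> borel_measurable M"
  unfolding gav_def
  by (intro borel_measurable_divide borel_measurable_sum borel_measurable_times borel_measurable_exp_real Zs_measurable)

lemma fld_measurable[measurable]: "fld I u \<in> borel_measurable disorder"
  unfolding fld_def by measurable

lemma tame_fld: "tame (fld I u)"
  unfolding fld_def by (intro tame_intros)

lemma tame_gav:
  assumes S: "finite S" and e: "\<And>\<sigma>. (\<lambda>w. e w \<sigma>) \<in> borel_measurable disorder" and f: "\<And>\<sigma>. tame (\<lambda>w. f w \<sigma>)"
  shows "tame (\<lambda>w. gav S (e w) (f w))"
proof (rule tame_dominated)
  show "tame (\<lambda>w. \<Sum>\<sigma>\<in>S. \<bar>f w \<sigma>\<bar>)" by (intro tame_sum tame_abs f)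
  show "(\<lambda>w. gav S (e w) (f w)) \<in> borel_measurable disorder"
    by (rule gav_measurable[OF e tame_meas[OF f]])
  show "\<bar>gav S (e w) (f w)\<bar> \<le> \<bar>\<Sum>\<sigma>\<in>S. \<bar>f w \<sigma>\<bar>\<bar>" for w
    using gav_abs_sum[OF S] by (simp add: sum_nonneg)
qed

lemma tame_lZ:
  assumes S: "finite S" "S \<noteq> {}" and e: "\<And>\<sigma>. tame (\<lambda>w. e w \<sigma>)"
  shows "tame (\<lambda>w. lZ S (e w))"
proof (rule tame_dominated)
  show "tame (\<lambda>w. \<bar>ln (card S)\<bar> + (\<Sum>\<sigma>\<in>S. \<bar>e w \<sigma>\<bar>))" by (intro tame_sum tame_intros tame_abs e)
  show "(\<lambda>w. lZ S (e w)) \<in> borel_measurable disorder"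
    by (rule lZ_measurable[OF tame_meas[OF e]])
  show "\<bar>lZ S (e w)\<bar> \<le> \<bar>\<bar>ln (card S)\<bar> + (\<Sum>\<sigma>\<in>S. \<bar>e w \<sigma>\<bar>)\<bar>" for w
    using lZ_abs[OF S] by (simp add: sum_nonneg)
qed

lemma DERIV_Zs:
  "(\<And>\<sigma>. \<sigma> \<in> S \<Longrightarrow> ((\<lambda>x. e x \<sigma>) has_real_derivative e' \<sigma>) (at x)) \<Longrightarrow>
   ((\<lambda>x. Zs S (e x)) has_real_derivative (\<Sum>\<sigma>\<in>S. e' \<sigma> * exp (e x \<sigma>))) (at x)"
  unfolding Zs_def by (auto intro!: derivative_eq_intros DERIV_sum simp: mult.commute)

lemma DERIV_lZ:
  assumes "finite S" "S \<noteq> {}" "\<And>\<sigma>. \<sigma> \<in> S \<Longrightarrow> ((\<lambda>x. e x \<sigma>) has_real_derivative e' \<sigma>) (at x)"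
  shows "((\<lambda>x. lZ S (e x)) has_real_derivative gav S (e x) e') (at x)"
  unfolding lZ_def gav_def
  using DERIV_chain2[OF DERIV_ln[OF Zs_pos[OF assms(1,2)]] DERIV_Zs[OF assms(3)]]
  by (simp add: divide_inverse mult.commute)

lemma DERIV_gav:
  assumes S: "finite S" "S \<noteq> {}" and e: "\<And>\<sigma>. \<sigma> \<in> S \<Longrightarrow> ((\<lambda>x. e x \<sigma>) has_real_derivative e' \<sigma>) (at x)"
  shows "((\<lambda>x. gav S (e x) f) has_real_derivative
     gav S (e x) (\<lambda>\<sigma>. f \<sigma> * e' \<sigma>) - gav S (e x) f * gav S (e x) e') (at x)"
proof -
  have Z: "Zs S (e x) \<noteq> 0" using Zs_pos[OF S, of "e x"] by simp
  have 1: "((\<lambda>x. \<Sum>\<sigma>\<in>S. f \<sigma> * exp (e x \<sigma>)) has_real_derivative (\<Sum>\<sigma>\<in>S. f \<sigma> * e' \<sigma> * exp (e x \<sigma>))) (at x)"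
    by (intro DERIV_sum) (auto intro!: derivative_eq_intros e)
  show ?thesis unfolding gav_def
    by (rule DERIV_cong[OF DERIV_divide[OF 1 DERIV_Zs[OF e] Z]]) (use Z in \<open>auto simp: field_simps\<close>)
qed

subsection \<open>Gaussian integration by parts for Gibbs averages\<close>

lemma fld_upd:
  "finite I \<Longrightarrow> fld I u (w(i:=x)) = (if i \<in> I then fld I u w + (x - w i) * u i else fld I u w)"
proof (cases "i \<in> I")
  case True
  assume I: "finite I"
  have "fld I u (w(i:=x)) = x * u i + (\<Sum>k\<in>I - {i}. w k * u k)"
    unfolding fld_def using sum.remove[OF I True, of "\<lambda>k. (w(i:=x)) k * u k"] by simp
  moreover have "fld I u w = w i * u i + (\<Sum>k\<in>I - {i}. w k * u k)"
    unfolding fld_def using sum.remove[OF I True, of "\<lambda>k. w k * u k"] by simp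
  ultimately show ?thesis using True by (simp add: algebra_simps)
next
  case False
  then show ?thesis unfolding fld_def by (auto intro!: sum.cong)
qed

lemma fld_depends: "(\<And>i. i \<in> I \<Longrightarrow> w i = w' i) \<Longrightarrow> fld I u w = fld I u w'"
  unfolding fld_def by simp

lemma ip_commute: "ip I u v = ip I v u"
  by (simp add: ip_def mult.commute)

text \<open>Differentiating a Gibbs average in one disorder coordinate yields a Gibbs covariance;
  summed over coordinates this is the self-covariance term minus the covariance with an independent
  second sample.\<close>

theorem gibbs_ibp:
  fixes d f :: "'a \<Rightarrow> real" and u a :: "'a \<Rightarrow> nat list \<Rightarrow> real"
  assumes S: "finite S" "S \<noteq> {}" and I: "finite I"
  defines "e \<equiv> \<lambda>w \<sigma>. d \<sigma> + fld I (u \<sigma>) w"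
  shows "EE (\<lambda>w. gav S (e w) (\<lambda>\<sigma>. f \<sigma> * fld I (a \<sigma>) w))
    = EE (\<lambda>w. gav S (e w) (\<lambda>\<sigma>. f \<sigma> * ip I (a \<sigma>) (u \<sigma>))
        - gav S (e w) (\<lambda>\<sigma>. f \<sigma> * gav S (e w) (\<lambda>\<tau>. ip I (a \<sigma>) (u \<tau>))))"
proof -
  have em[measurable]: "(\<lambda>w. e w \<sigma>) \<in> borel_measurable disorder" for \<sigma>
    unfolding e_def by measurable
  define F where "F i w = gav S (e w) (\<lambda>\<sigma>. f \<sigma> * a \<sigma> i)" for i w
  define F' where "F' i w = gav S (e w) (\<lambda>\<sigma>. (f \<sigma> * a \<sigma> i) * u \<sigma> i)
      - gav S (e w) (\<lambda>\<sigma>. f \<sigma> * a \<sigma> i) * gav S (e w) (\<lambda>\<sigma>. u \<sigma> i)" for i w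
  have tF: "tame (F i)" "tame (F' i)" for i
    unfolding F_def F'_def by (intro tame_intros tame_gav S em)+
  have ibp: "EE (\<lambda>w. w i * F i w) = EE (F' i)" if i: "i \<in> I" for i
  proof -
    have De: "((\<lambda>x. e (w(i:=x)) \<sigma>) has_real_derivative u \<sigma> i) (at x)" for w \<sigma> x
      unfolding e_def fld_upd[OF I] using i by (auto intro!: derivative_eq_intros)
    note Dg = DERIV_gav[OF S De]
    define B1 B2 B3 where "B1 = (\<Sum>\<sigma>\<in>S. \<bar>f \<sigma> * a \<sigma> i\<bar>)" and "B2 = (\<Sum>\<sigma>\<in>S. \<bar>(f \<sigma> * a \<sigma> i) * u \<sigma> i\<bar>)"
      and "B3 = (\<Sum>\<sigma>\<in>S. \<bar>u \<sigma> i\<bar>)"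
    have nn: "B1 \<ge> 0" "B2 \<ge> 0" "B3 \<ge> 0" unfolding B1_def B2_def B3_def by (auto intro!: sum_nonneg)
    have b1: "\<bar>F i w\<bar> \<le> B1" for w
      unfolding F_def B1_def by (rule gav_abs_sum[OF S(1)])
    have b2: "\<bar>F' i w\<bar> \<le> B2 + B1 * B3" for w
    proof -
      have "\<bar>F' i w\<bar> \<le> \<bar>gav S (e w) (\<lambda>\<sigma>. (f \<sigma> * a \<sigma> i) * u \<sigma> i)\<bar> + \<bar>F i w\<bar> * \<bar>gav S (e w) (\<lambda>\<sigma>. u \<sigma> i)\<bar>"
        unfolding F'_def F_def by (simp add: abs_mult[symmetric])
      also have "\<dots> \<le> B2 + B1 * B3"
        using b1[of w] unfolding B2_def B3_def by (intro add_mono mult_mono gav_abs_sum[OF S(1)]) (auto simp: nn)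
      finally show ?thesis .
    qed
    show ?thesis
    proof (rule gauss_ibp[where B="B1 + B2 + B1 * B3"])
      show "((\<lambda>x. F i (w(i := x))) has_real_derivative F' i (w(i := x))) (at x)" for w x
        unfolding F_def F'_def by (rule Dg)
      show "isCont (\<lambda>x. F' i (w(i := x))) x" for w x
        unfolding F'_def by (intro continuous_intros DERIV_isCont[OF Dg])
      show "F i \<in> borel_measurable disorder" "F' i \<in> borel_measurable disorder"
        using tF by (auto simp: tame_def)
      show "\<bar>F i w\<bar> \<le> B1 + B2 + B1 * B3" for w using b1[of w] nn mult_nonneg_nonneg[OF nn(1,3)] by linarith
      show "\<bar>F' i w\<bar> \<le> B1 + B2 + B1 * B3" for w using b2[of w] nn by linarith
    qed
  qed
  have "EE (\<lambda>w. gav S (e w) (\<lambda>\<sigma>. f \<sigma> * fld I (a \<sigma>) w)) = EE (\<lambda>w. \<Sum>i\<in>I. w i * F i w)"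
    unfolding fld_def F_def sum_distrib_left gav_sum gav_cmult[symmetric] by (simp add: ac_simps)
  also have "\<dots> = (\<Sum>i\<in>I. EE (\<lambda>w. w i * F i w))"
    by (rule Bochner_Integration.integral_sum) (intro tame_integrable tame_intros tF)
  also have "\<dots> = (\<Sum>i\<in>I. EE (F' i))" by (intro sum.cong refl ibp)
  also have "\<dots> = EE (\<lambda>w. \<Sum>i\<in>I. F' i w)"
    by (rule Bochner_Integration.integral_sum[symmetric]) (rule tame_integrable[OF tF(2)])
  also have "(\<lambda>w. \<Sum>i\<in>I. F' i w) = (\<lambda>w. gav S (e w) (\<lambda>\<sigma>. f \<sigma> * ip I (a \<sigma>) (u \<sigma>))
        - gav S (e w) (\<lambda>\<sigma>. f \<sigma> * gav S (e w) (\<lambda>\<tau>. ip I (a \<sigma>) (u \<tau>))))"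
  proof
    fix w
    have "gav S (e w) (\<lambda>\<sigma>. f \<sigma> * gav S (e w) (\<lambda>\<tau>. ip I (a \<sigma>) (u \<tau>)))
      = (\<Sum>i\<in>I. gav S (e w) (\<lambda>\<sigma>. f \<sigma> * a \<sigma> i) * gav S (e w) (\<lambda>\<sigma>. u \<sigma> i))"
      by (simp only: ip_def gav_sum gav_cmult sum_distrib_left mult.assoc[symmetric] gav_multc)
    moreover have "gav S (e w) (\<lambda>\<sigma>. f \<sigma> * ip I (a \<sigma>) (u \<sigma>)) = (\<Sum>i\<in>I. gav S (e w) (\<lambda>\<sigma>. (f \<sigma> * a \<sigma> i) * u \<sigma> i))"
      by (simp only: ip_def gav_sum sum_distrib_left mult.assoc)
    ultimately show "(\<Sum>i\<in>I. F' i w) = gav S (e w) (\<lambda>\<sigma>. f \<sigma> * ip I (a \<sigma>) (u \<sigma>))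
        - gav S (e w) (\<lambda>\<sigma>. f \<sigma> * gav S (e w) (\<lambda>\<tau>. ip I (a \<sigma>) (u \<tau>)))"
      unfolding F'_def sum_subtractf by simp
  qed
  finally show ?thesis .
qed

section \<open>Differentiating mean log-partition functions\<close>

lemma DERIV_integral:
  fixes F :: "real \<Rightarrow> (nat list \<Rightarrow> real) \<Rightarrow> real"
  assumes D: "\<And>s w. \<bar>s\<bar> < T \<Longrightarrow> ((\<lambda>s. F s w) has_real_derivative F' s w) (at s)"
    and F: "\<And>s. integrable disorder (F s)" and F': "F' s \<in> borel_measurable disorder"
    and G: "integrable disorder G" "\<And>s w. \<bar>s\<bar> < T \<Longrightarrow> \<bar>F' s w\<bar> \<le> G w" and s: "\<bar>s\<bar> < T"
  shows "((\<lambda>s. EE (F s)) has_real_derivative EE (F' s)) (at s)"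
  unfolding has_field_derivative_def DERIV_def
proof -
  have "((\<lambda>h. (EE (F (s + h)) - EE (F s)) / h) \<longlongrightarrow> EE (F' s)) (at 0)"
    unfolding tendsto_at_iff_sequentially comp_def
  proof (intro allI impI)
    fix X :: "nat \<Rightarrow> real" assume X: "\<forall>i. X i \<in> UNIV - {0}" "X \<longlonglongrightarrow> 0"
    have "eventually (\<lambda>n. dist (X n) 0 < T - \<bar>s\<bar>) sequentially"
      by (rule tendstoD[OF X(2)]) (use s in simp)
    then obtain n0 where n0: "\<And>n. n \<ge> n0 \<Longrightarrow> \<bar>X n\<bar> < T - \<bar>s\<bar>"
      by (auto simp: eventually_sequentially dist_real_def)
    define Y where "Y n = X (n + n0)" for n
    have Y: "\<bar>Y n\<bar> < T - \<bar>s\<bar>" "Y n \<noteq> 0" for n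
      using n0[of "n + n0"] X by (auto simp: Y_def)
    have Y0: "Y \<longlonglongrightarrow> 0"
      unfolding Y_def by (rule LIMSEQ_ignore_initial_segment[OF X(2)])
    have "(\<lambda>n. EE (\<lambda>w. (F (s + Y n) w - F s w) / Y n)) \<longlonglongrightarrow> EE (F' s)"
    proof (rule integral_dominated_convergence[where w=G])
      show "(\<lambda>w. (F (s + Y n) w - F s w) / Y n) \<in> borel_measurable disorder" for n
        using F[of "s + Y n"] F[of s] by (auto intro!: borel_measurable_divide borel_measurable_diff)
      have "(\<lambda>n. (F (s + Y n) w - F s w) / Y n) \<longlonglongrightarrow> F' s w" for w
      proof -
        have "((\<lambda>h. (F (s + h) w - F s w) / h) \<longlongrightarrow> F' s w) (at 0)"
          using D[OF s, of w] by (simp add: DERIV_def)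
        then show ?thesis using Y Y0 unfolding tendsto_at_iff_sequentially comp_def by auto
      qed
      then show "AE w in disorder. (\<lambda>n. (F (s + Y n) w - F s w) / Y n) \<longlonglongrightarrow> F' s w" by simp
      have "\<bar>(F (s + Y n) w - F s w) / Y n\<bar> \<le> G w" for n w
      proof -
        have in_T: "\<bar>z\<bar> < T" if "z \<in> closed_segment s (s + Y n)" for z
          using that Y(1)[of n] by (auto simp: closed_segment_eq_real_ivl split: if_splits)
        have "norm (F (s + Y n) w - F s w) \<le> G w * norm (s + Y n - s)"
          by (rule field_differentiable_bound[where S="closed_segment s (s + Y n)" and f'="\<lambda>s. F' s w"])
            (use in_T D G in \<open>auto intro: has_field_derivative_at_within\<close>)
        then show ?thesis using Y(2)[of n] by (simp add: abs_divide pos_divide_le_eq)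
      qed
      then show "AE w in disorder. norm ((F (s + Y n) w - F s w) / Y n) \<le> G w" for n by simp
    qed (use G F' in auto)
    moreover have "EE (\<lambda>w. (F (s + Y n) w - F s w) / Y n) = (EE (F (s + Y n)) - EE (F s)) / Y n" for n
      by (subst integral_divide_zero) (subst Bochner_Integration.integral_diff[OF F F], rule refl)
    ultimately have "(\<lambda>n. (EE (F (s + Y n)) - EE (F s)) / Y n) \<longlonglongrightarrow> EE (F' s)"
      by (simp only:)
    then have "(\<lambda>n. (EE (F (s + X (n + n0))) - EE (F s)) / X (n + n0)) \<longlonglongrightarrow> EE (F' s)"
      by (simp only: Y_def)
    then show "(\<lambda>n. (EE (F (s + X n)) - EE (F s)) / X n) \<longlonglongrightarrow> EE (F' s)"
      by (rule LIMSEQ_offset)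
  qed
  then have "((\<lambda>s. EE (F s)) has_real_derivative EE (F' s)) (at s)" by (simp add: DERIV_def)
  then show "((\<lambda>s. EE (F s)) has_derivative (*) (EE (F' s))) (at s)"
    by (simp add: has_field_derivative_def)
qed

text \<open>One formula for a path along which both the deterministic weights and the field
  coefficients move. It covers the temperature derivatives of the null and planted free energies and
  the block interpolation. Bounds are asked for on an interval only, as the weights may grow with
  \<open>s\<close>.\<close>

theorem lZ_path_deriv:
  fixes d d' :: "real \<Rightarrow> 'a \<Rightarrow> real" and u u' :: "real \<Rightarrow> 'a \<Rightarrow> nat list \<Rightarrow> real"
  assumes S: "finite S" "S \<noteq> {}" and I: "finite I"
    and d: "\<And>s \<sigma>. \<bar>s\<bar> < T \<Longrightarrow> \<sigma> \<in> S \<Longrightarrow> ((\<lambda>s. d s \<sigma>) has_real_derivative d' s \<sigma>) (at s)"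
    and u: "\<And>s \<sigma> i. \<bar>s\<bar> < T \<Longrightarrow> \<sigma> \<in> S \<Longrightarrow> i \<in> I \<Longrightarrow> ((\<lambda>s. u s \<sigma> i) has_real_derivative u' s \<sigma> i) (at s)"
    and B: "\<And>s \<sigma>. \<bar>s\<bar> < T \<Longrightarrow> \<sigma> \<in> S \<Longrightarrow> \<bar>d' s \<sigma>\<bar> \<le> B"
           "\<And>s \<sigma> i. \<bar>s\<bar> < T \<Longrightarrow> \<sigma> \<in> S \<Longrightarrow> i \<in> I \<Longrightarrow> \<bar>u' s \<sigma> i\<bar> \<le> B"
    and s: "\<bar>s\<bar> < T"
  defines "e \<equiv> \<lambda>s w \<sigma>. d s \<sigma> + fld I (u s \<sigma>) w"
  shows "((\<lambda>s. EE (\<lambda>w. lZ S (e s w))) has_real_derivative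
     EE (\<lambda>w. gav S (e s w) (\<lambda>\<sigma>. d' s \<sigma> + ip I (u' s \<sigma>) (u s \<sigma>))
        - gav S (e s w) (\<lambda>\<sigma>. gav S (e s w) (\<lambda>\<tau>. ip I (u' s \<sigma>) (u s \<tau>))))) (at s)"
proof -
  have te: "tame (\<lambda>w. e s w \<sigma>)" for s \<sigma>
    unfolding e_def by (intro tame_intros tame_fld)
  have em: "(\<lambda>w. e s w \<sigma>) \<in> borel_measurable disorder" for s \<sigma>
    by (rule tame_meas[OF te])
  have De: "((\<lambda>s. e s w \<sigma>) has_real_derivative d' s \<sigma> + fld I (u' s \<sigma>) w) (at s)"
    if "\<bar>s\<bar> < T" "\<sigma> \<in> S" for s w \<sigma>
    unfolding e_def fld_def using that by (auto intro!: derivative_eq_intros d u DERIV_sum simp: mult.commute)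
  have "((\<lambda>s. EE (\<lambda>w. lZ S (e s w))) has_real_derivative
     EE (\<lambda>w. gav S (e s w) (\<lambda>\<sigma>. d' s \<sigma> + fld I (u' s \<sigma>) w))) (at s)"
  proof (rule DERIV_integral[where T=T and G="\<lambda>w. B * (1 + (\<Sum>i\<in>I. \<bar>w i\<bar>))"])
    show "((\<lambda>s. lZ S (e s w)) has_real_derivative gav S (e s w) (\<lambda>\<sigma>. d' s \<sigma> + fld I (u' s \<sigma>) w)) (at s)"
      if "\<bar>s\<bar> < T" for s w by (rule DERIV_lZ[OF S De[OF that]])
    show "integrable disorder (\<lambda>w. lZ S (e s w))" for s by (intro tame_integrable tame_lZ S te)
    show "(\<lambda>w. gav S (e s w) (\<lambda>\<sigma>. d' s \<sigma> + fld I (u' s \<sigma>) w)) \<in> borel_measurable disorder"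
      by (intro tame_meas tame_gav S em tame_intros tame_fld)
    show "integrable disorder (\<lambda>w. B * (1 + (\<Sum>i\<in>I. \<bar>w i\<bar>)))"
      by (intro tame_integrable tame_intros tame_abs)
    fix s w assume sT: "\<bar>s\<bar> < T"
    show "\<bar>gav S (e s w) (\<lambda>\<sigma>. d' s \<sigma> + fld I (u' s \<sigma>) w)\<bar> \<le> B * (1 + (\<Sum>i\<in>I. \<bar>w i\<bar>))"
    proof (rule gav_abs_le[OF S])
      fix \<sigma> assume \<sigma>: "\<sigma> \<in> S"
      have "\<bar>fld I (u' s \<sigma>) w\<bar> \<le> (\<Sum>i\<in>I. \<bar>w i * u' s \<sigma> i\<bar>)" unfolding fld_def by (rule sum_abs)
      also have "\<dots> \<le> (\<Sum>i\<in>I. B * \<bar>w i\<bar>)"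
        unfolding abs_mult using B(2)[OF sT \<sigma>] by (intro sum_mono) (auto simp: mult.commute[of B] intro!: mult_left_mono)
      finally have 1: "\<bar>fld I (u' s \<sigma>) w\<bar> \<le> B * (\<Sum>i\<in>I. \<bar>w i\<bar>)" by (simp add: sum_distrib_left)
      have "\<bar>d' s \<sigma> + fld I (u' s \<sigma>) w\<bar> \<le> \<bar>d' s \<sigma>\<bar> + \<bar>fld I (u' s \<sigma>) w\<bar>" by (rule abs_triangle_ineq)
      also have "\<dots> \<le> B + B * (\<Sum>i\<in>I. \<bar>w i\<bar>)" by (intro add_mono 1 B(1)[OF sT \<sigma>])
      finally show "\<bar>d' s \<sigma> + fld I (u' s \<sigma>) w\<bar> \<le> B * (1 + (\<Sum>i\<in>I. \<bar>w i\<bar>))" by (simp add: distrib_left)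
    qed
  qed fact
  moreover have "EE (\<lambda>w. gav S (e s w) (\<lambda>\<sigma>. d' s \<sigma> + fld I (u' s \<sigma>) w))
    = EE (\<lambda>w. gav S (e s w) (\<lambda>\<sigma>. d' s \<sigma> + ip I (u' s \<sigma>) (u s \<sigma>))
        - gav S (e s w) (\<lambda>\<sigma>. gav S (e s w) (\<lambda>\<tau>. ip I (u' s \<sigma>) (u s \<tau>))))"
  proof -
    have t1: "tame (\<lambda>w. gav S (e s w) f)" "tame (\<lambda>w. gav S (e s w) (\<lambda>\<sigma>. fld I (g \<sigma>) w))"
      "tame (\<lambda>w. gav S (e s w) (\<lambda>\<sigma>. gav S (e s w) (h \<sigma>)))" for f g h
      by (intro tame_gav S em tame_fld tame_const)+
    have "EE (\<lambda>w. gav S (e s w) (\<lambda>\<sigma>. d' s \<sigma> + fld I (u' s \<sigma>) w))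
      = EE (\<lambda>w. gav S (e s w) (d' s)) + EE (\<lambda>w. gav S (e s w) (\<lambda>\<sigma>. 1 * fld I (u' s \<sigma>) w))"
      unfolding gav_add mult_1_left by (intro Bochner_Integration.integral_add tame_integrable t1)
    also have "EE (\<lambda>w. gav S (e s w) (\<lambda>\<sigma>. 1 * fld I (u' s \<sigma>) w))
      = EE (\<lambda>w. gav S (e s w) (\<lambda>\<sigma>. ip I (u' s \<sigma>) (u s \<sigma>))
        - gav S (e s w) (\<lambda>\<sigma>. gav S (e s w) (\<lambda>\<tau>. ip I (u' s \<sigma>) (u s \<tau>))))"
      unfolding e_def by (subst gibbs_ibp[OF S I]) simp
    also have "EE (\<lambda>w. gav S (e s w) (d' s)) + \<dots> = EE (\<lambda>w. gav S (e s w) (d' s) + (gav S (e s w) (\<lambda>\<sigma>. ip I (u' s \<sigma>) (u s \<sigma>))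
        - gav S (e s w) (\<lambda>\<sigma>. gav S (e s w) (\<lambda>\<tau>. ip I (u' s \<sigma>) (u s \<tau>)))))"
      by (intro Bochner_Integration.integral_add[symmetric] tame_integrable tame_intros t1)
    finally show ?thesis by (simp add: gav_add add_diff_eq)
  qed
  ultimately show ?thesis by simp
qed

text \<open>Changing one coordinate moves every energy by at most
  \<open>b i * \<bar>x - y\<bar>\<close>, and the log-partition function is 1-Lipschitz in the
  supremum norm.\<close>

lemma lZ_concentration:
  fixes u :: "'a \<Rightarrow> nat list \<Rightarrow> real" and d :: "'a \<Rightarrow> real"
  assumes S: "finite S" "S \<noteq> {}" and I: "finite I"
    and b: "\<And>\<sigma> i. \<sigma> \<in> S \<Longrightarrow> i \<in> I \<Longrightarrow> \<bar>u \<sigma> i\<bar> \<le> b i"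
  defines "F \<equiv> \<lambda>w. lZ S (\<lambda>\<sigma>. d \<sigma> + fld I (u \<sigma>) w)"
  shows "depends_on I F" "F \<in> borel_measurable disorder"
    "i \<in> I \<Longrightarrow> \<bar>F (w(i:=x)) - F (w(i:=y))\<bar> \<le> b i * \<bar>x - y\<bar>"
proof -
  show "depends_on I F" 
    unfolding depends_on_def F_def by (intro allI impI lZ_cong arg_cong2[where f="(+)"] fld_depends) auto
  show "F \<in> borel_measurable disorder" unfolding F_def by (rule lZ_measurable) measurable
  assume i: "i \<in> I"
  show "\<bar>F (w(i:=x)) - F (w(i:=y))\<bar> \<le> b i * \<bar>x - y\<bar>"
    unfolding F_def
  proof (rule lZ_lipschitz[OF S])
    fix \<sigma> assume "\<sigma> \<in> S"
    have "d \<sigma> + fld I (u \<sigma>) (w(i := x)) - (d \<sigma> + fld I (u \<sigma>) (w(i := y))) = u \<sigma> i * (x - y)"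
      using i by (simp add: fld_upd[OF I] algebra_simps)
    then show "\<bar>d \<sigma> + fld I (u \<sigma>) (w(i := x)) - (d \<sigma> + fld I (u \<sigma>) (w(i := y)))\<bar> \<le> b i * \<bar>x - y\<bar>"
      using b[OF \<open>\<sigma> \<in> S\<close> i] by (simp add: abs_mult mult_right_mono)
  qed
qed

subsection \<open>The p-spin model\<close>

lemma finite_idx[simp]: "finite (idx p N)"
proof -
  have "idx p N = {is. set is \<subseteq> {..<N} \<and> length is = p}" by (auto simp: idx_def)
  then show ?thesis by (simp add: finite_lists_length_eq)
qed

lemma idx_Suc: "idx (Suc p) N = (\<lambda>(x, is). x # is) ` ({..<N} \<times> idx p N)"
  by (auto simp: idx_def length_Suc_conv image_iff)

lemma sum_idx_prod:
  fixes a :: "nat \<Rightarrow> real"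
  shows "(\<Sum>is\<in>idx p N. \<Prod>j<p. a (is ! j)) = (\<Sum>i<N. a i) ^ p"
proof (induction p)
  case 0
  have "idx 0 N = {[]}" by (auto simp: idx_def)
  then show ?case by simp
next
  case (Suc p)
  have inj: "inj_on (\<lambda>(x, is). x # is) ({..<N} \<times> idx p N)" by (auto simp: inj_on_def)
  have "(\<Sum>is\<in>idx (Suc p) N. \<Prod>j<Suc p. a (is ! j))
     = (\<Sum>(x, is)\<in>{..<N} \<times> idx p N. \<Prod>j<Suc p. a ((x # is) ! j))"
    unfolding idx_Suc by (subst sum.reindex[OF inj]) (simp add: case_prod_beta')
  also have "\<dots> = (\<Sum>(x, is)\<in>{..<N} \<times> idx p N. a x * (\<Prod>j<p. a (is ! j)))"
    by (intro sum.cong refl) (auto simp: prod.lessThan_Suc_shift simp del: prod.lessThan_Suc)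
  also have "\<dots> = (\<Sum>x<N. a x) * (\<Sum>is\<in>idx p N. \<Prod>j<p. a (is ! j))"
    by (simp add: sum.cartesian_product[symmetric] sum_product)
  finally show ?case by (simp add: Suc)
qed

text \<open>The index tuples of a block of \<open>M\<close> sites starting at site \<open>b\<close> carry a tag \<open>t\<close>,
  so that different blocks use disjoint parts of one disorder array.\<close>

definition bidx :: "nat list \<Rightarrow> nat \<Rightarrow> nat \<Rightarrow> nat list set" where
  "bidx t p M = (\<lambda>is. t @ is) ` idx p M"

text \<open>\<open>n\<close> is the length of the tag, which is skipped when sites are read off the
  index; \<open>b\<close> is the first site of the block.\<close>

definition bvec :: "nat \<Rightarrow> nat \<Rightarrow> nat \<Rightarrow> nat \<Rightarrow> (nat \<Rightarrow> real) \<Rightarrow> nat list \<Rightarrow> real" where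
  "bvec n p M b \<sigma> i = real M powr (- (real p - 1) / 2) * (\<Prod>j<p. \<sigma> (b + i ! (n + j)))"

definition bover :: "nat \<Rightarrow> nat \<Rightarrow> (nat \<Rightarrow> real) \<Rightarrow> (nat \<Rightarrow> real) \<Rightarrow> real" where
  "bover M b \<sigma> \<tau> = (\<Sum>i<M. \<sigma> (b + i) * \<tau> (b + i)) / real M"

lemma finite_bidx[simp]: "finite (bidx t p M)"
  by (simp add: bidx_def)

lemma powr_half_sq: "M \<ge> 1 \<Longrightarrow> p \<ge> 1 \<Longrightarrow> (real M powr (- (real p - 1) / 2))\<^sup>2 * real M ^ p = real M"
proof -
  assume M: "M \<ge> 1" "p \<ge> 1"
  have "(real M powr (- (real p - 1) / 2))\<^sup>2 = real M powr (- (real p - 1))"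
    unfolding power2_eq_square powr_add[symmetric] by (rule arg_cong[where f="\<lambda>x. _ powr x"]) simp
  then have "(real M powr (- (real p - 1) / 2))\<^sup>2 * real M ^ p = real M powr (- (real p - 1)) * real M powr (real p)"
    using M by (simp add: powr_realpow)
  also have "\<dots> = real M powr 1" unfolding powr_add[symmetric] by simp
  finally show ?thesis using M by simp
qed

lemma ip_bvec:
  assumes "M \<ge> 1" "p \<ge> 1"
  shows "ip (bidx t p M) (bvec (length t) p M b \<sigma>) (bvec (length t) p M b \<tau>) = real M * bover M b \<sigma> \<tau> ^ p"
proof -
  let ?c = "real M powr (- (real p - 1) / 2)"
  have inj: "inj_on (\<lambda>is. t @ is) (idx p M)" by (auto simp: inj_on_def)
  have "ip (bidx t p M) (bvec (length t) p M b \<sigma>) (bvec (length t) p M b \<tau>)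
     = (\<Sum>is\<in>idx p M. ?c\<^sup>2 * (\<Prod>j<p. \<sigma> (b + is ! j) * \<tau> (b + is ! j)))"
    unfolding ip_def bidx_def bvec_def sum.reindex[OF inj]
    by (simp add: prod.distrib power2_eq_square ac_simps nth_append)
  also have "\<dots> = ?c\<^sup>2 * (\<Sum>i<M. \<sigma> (b + i) * \<tau> (b + i)) ^ p"
    unfolding sum_distrib_left[symmetric] using sum_idx_prod[of "\<lambda>i. \<sigma> (b + i) * \<tau> (b + i)" p M] by simp
  also have "(\<Sum>i<M. \<sigma> (b + i) * \<tau> (b + i)) = real M * bover M b \<sigma> \<tau>"
    using assms by (simp add: bover_def)
  finally show ?thesis using powr_half_sq[OF assms] by (simp add: power_mult_distrib mult.assoc[symmetric])
qed

lemma finite_spins[simp]: "finite (spins N)"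
  unfolding spins_def by (rule finite_PiE) auto

lemma spins_ne[simp]: "spins N \<noteq> {}"
  unfolding spins_def by (simp add: PiE_eq_empty_iff)

lemma card_spins: "card (spins N) = 2 ^ N"
  unfolding spins_def by (subst card_PiE) (simp_all add: card_insert_if numeral_2_eq_2)

lemma spinsD: "\<sigma> \<in> spins N \<Longrightarrow> i < N \<Longrightarrow> \<sigma> i = -1 \<or> \<sigma> i = 1"
  unfolding spins_def by (auto simp: PiE_iff)

lemma spins_sq: "\<sigma> \<in> spins N \<Longrightarrow> i < N \<Longrightarrow> \<sigma> i * \<sigma> i = 1"
  using spinsD[of \<sigma> N i] by auto

lemma abs_bvec:
  assumes \<sigma>: "\<sigma> \<in> spins N" and b: "b + M \<le> N" and i: "i \<in> bidx t p M"
  shows "\<bar>bvec (length t) p M b \<sigma> i\<bar> = real M powr (- (real p - 1) / 2)"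
proof -
  from i obtain js where i: "i = t @ js" "js \<in> idx p M" by (auto simp: bidx_def)
  have "\<bar>\<sigma> (b + js ! j)\<bar> = 1" if "j < p" for j
  proof -
    have "js ! j < M" using i that by (auto simp: idx_def subset_iff)
    then show ?thesis using spinsD[OF \<sigma>, of "b + js ! j"] b by auto
  qed
  then have "(\<Prod>j<p. \<bar>\<sigma> (b + js ! j)\<bar>) = 1" by (intro prod.neutral) auto
  then show ?thesis by (simp add: bvec_def i abs_mult abs_prod nth_append)
qed

lemma card_idx: "real (card (idx p M)) = real M ^ p"
  using sum_idx_prod[of "\<lambda>_. 1" p M] by simp

lemma card_bidx: "card (bidx t p M) = card (idx p M)"
  unfolding bidx_def by (rule card_image) (auto simp: inj_on_def)

lemma sum_sq_bidx: "M \<ge> 1 \<Longrightarrow> p \<ge> 1 \<Longrightarrow> (\<Sum>i\<in>bidx t p M. (c * real M powr (- (real p - 1) / 2))\<^sup>2) = c\<^sup>2 * real M"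
  using powr_half_sq[of M p] by (simp add: card_bidx card_idx power_mult_distrib mult.commute mult.left_commute)

lemma bover_self: "\<sigma> \<in> spins N \<Longrightarrow> b + M \<le> N \<Longrightarrow> M \<ge> 1 \<Longrightarrow> bover M b \<sigma> \<sigma> = 1"
  unfolding bover_def by (simp add: spins_sq)

lemma bover_abs: assumes "\<sigma> \<in> spins N" "\<tau> \<in> spins N" "b + M \<le> N" shows "\<bar>bover M b \<sigma> \<tau>\<bar> \<le> 1"
proof -
  have "\<bar>\<Sum>i<M. \<sigma> (b + i) * \<tau> (b + i)\<bar> \<le> (\<Sum>i<M. \<bar>\<sigma> (b + i) * \<tau> (b + i)\<bar>)" by (rule sum_abs)
  also have "\<dots> \<le> (\<Sum>i<M. 1)"
  proof (rule sum_mono)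
    fix i assume "i \<in> {..<M}"
    then have "b + i < N" using assms by auto
    then show "\<bar>\<sigma> (b + i) * \<tau> (b + i)\<bar> \<le> 1"
      using spinsD[OF assms(1), of "b + i"] spinsD[OF assms(2), of "b + i"] by auto
  qed
  finally show ?thesis unfolding bover_def by (auto simp: abs_divide divide_le_eq_1)
qed

lemma bover_commute: "bover M b \<sigma> \<tau> = bover M b \<tau> \<sigma>"
  by (simp add: bover_def mult.commute)

lemma overlap_bover: "overlap N = bover N 0"
  by (intro ext) (simp add: overlap_def bover_def)

lemmas overlap_commute = bover_commute[of N 0 for N, folded overlap_bover]

lemma overlap_self: "\<sigma> \<in> spins N \<Longrightarrow> N \<ge> 1 \<Longrightarrow> overlap N \<sigma> \<sigma> = 1"
  by (simp add: overlap_bover bover_self)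

lemma overlap_abs: "\<sigma> \<in> spins N \<Longrightarrow> \<tau> \<in> spins N \<Longrightarrow> \<bar>overlap N \<sigma> \<tau>\<bar> \<le> 1"
  by (simp add: overlap_bover bover_abs)

lemma overlap_pow_abs: "\<sigma> \<in> spins N \<Longrightarrow> \<tau> \<in> spins N \<Longrightarrow> \<bar>overlap N \<sigma> \<tau> ^ p\<bar> \<le> 1"
  by (simp add: power_abs overlap_abs power_le_one)

definition hv :: "nat \<Rightarrow> nat \<Rightarrow> (nat \<Rightarrow> real) \<Rightarrow> nat list \<Rightarrow> real" where
  "hv p N = bvec 0 p N 0"

lemma bidx_Nil: "bidx [] p N = idx p N"
  by (simp add: bidx_def)

lemma ip_hv: "N \<ge> 1 \<Longrightarrow> p \<ge> 1 \<Longrightarrow> ip (idx p N) (hv p N \<sigma>) (hv p N \<tau>) = real N * overlap N \<sigma> \<tau> ^ p"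
  using ip_bvec[of N p "[]" 0 \<sigma> \<tau>] by (simp add: hv_def bidx_Nil overlap_bover)

lemma abs_hv: "\<sigma> \<in> spins N \<Longrightarrow> i \<in> idx p N \<Longrightarrow> \<bar>hv p N \<sigma> i\<bar> = real N powr (- (real p - 1) / 2)"
  using abs_bvec[of \<sigma> N 0 N i "[]" p] by (simp add: hv_def bidx_Nil)

lemma sum_sq_idx: "N \<ge> 1 \<Longrightarrow> p \<ge> 1 \<Longrightarrow> (\<Sum>i\<in>idx p N. (c * real N powr (- (real p - 1) / 2))\<^sup>2) = c\<^sup>2 * real N"
  using sum_sq_bidx[of N p c "[]"] by (simp add: bidx_Nil)

text \<open>The temperature enters as s = \<beta> / sqrt 2 and sits inside the coefficients, so that
  the covariance of two energies is s^2 N R^p.\<close>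

definition hen :: "nat \<Rightarrow> nat \<Rightarrow> real \<Rightarrow> (nat list \<Rightarrow> real) \<Rightarrow> (nat \<Rightarrow> real) \<Rightarrow> real" where
  "hen p N s w \<sigma> = fld (idx p N) (\<lambda>i. s * hv p N \<sigma> i) w"

abbreviation den :: "((nat \<Rightarrow> real) \<Rightarrow> real) \<Rightarrow> nat \<Rightarrow> nat \<Rightarrow> real \<Rightarrow> (nat list \<Rightarrow> real) \<Rightarrow> (nat \<Rightarrow> real) \<Rightarrow> real" where
  "den d p N s w \<equiv> \<lambda>\<sigma>. d \<sigma> + hen p N s w \<sigma>"

lemma hen_hamil: "hen p N s w \<sigma> = s * hamil p N w \<sigma>"
  unfolding hen_def fld_def hv_def bvec_def hamil_def by (simp add: sum_distrib_left ac_simps)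

lemma ip_scale: "ip I (\<lambda>i. s * u i) (\<lambda>i. t * v i) = s * t * ip I u v"
  unfolding ip_def by (simp add: sum_distrib_left ac_simps)

lemma ip_add_right: "ip I u (\<lambda>i. v i + v' i) = ip I u v + ip I u v'"
  unfolding ip_def by (simp add: sum.distrib distrib_left)

lemma ip_add_left: "ip I (\<lambda>i. v i + v' i) u = ip I v u + ip I v' u"
  unfolding ip_def by (simp add: sum.distrib distrib_right)

lemma hen_measurable[measurable]: "(\<lambda>w. hen p N s w \<sigma>) \<in> borel_measurable disorder"
  unfolding hen_def by measurable

lemma tame_hen: "tame (\<lambda>w. hen p N s w \<sigma>)"
  unfolding hen_def by (rule tame_fld)

text \<open>The set \<open>S\<close> allows restriction to an overlap level and \<open>d\<close> a
  deterministic weight: zero for the null model, the covariance with the plant for the planted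
  one.\<close>

definition PS :: "nat \<Rightarrow> nat \<Rightarrow> (nat \<Rightarrow> real) set \<Rightarrow> real \<Rightarrow> ((nat \<Rightarrow> real) \<Rightarrow> real) \<Rightarrow> real" where
  "PS p N S s d = EE (\<lambda>w. lZ S (den d p N s w))"

lemma tame_lZ_hen: "finite S \<Longrightarrow> S \<noteq> {} \<Longrightarrow> tame (\<lambda>w. lZ S (den d p N s w))"
  by (intro tame_lZ tame_intros tame_hen)

text \<open>The deterministic weight scales with \<open>s\<^sup>2\<close> because planting adds a
  covariance, which is quadratic in \<open>s\<close>; hence both contributions share the factor
  \<open>s\<close>.\<close>

lemma PS_deriv:
  fixes c :: "(nat \<Rightarrow> real) \<Rightarrow> real"
  assumes S: "S \<subseteq> spins N" "S \<noteq> {}" and N: "N \<ge> 1" "p \<ge> 1"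
  defines "e \<equiv> \<lambda>s w \<sigma>. s\<^sup>2 * c \<sigma> + hen p N s w \<sigma>"
  shows "((\<lambda>s. PS p N S s (\<lambda>\<sigma>. s\<^sup>2 * c \<sigma>)) has_real_derivative
     s * EE (\<lambda>w. gav S (e s w) (\<lambda>\<sigma>. real N + 2 * c \<sigma>)
        - real N * gav S (e s w) (\<lambda>\<sigma>. gav S (e s w) (\<lambda>\<tau>. overlap N \<sigma> \<tau> ^ p)))) (at s)"
proof -
  have fS: "finite S" using S finite_subset finite_spins by blast
  define T where "T = \<bar>s\<bar> + 1"
  define B where "B = 2 * T * (\<Sum>\<sigma>\<in>S. \<bar>c \<sigma>\<bar>) + real N powr (- (real p - 1) / 2)"
  have T: "T > 0" by (simp add: T_def)
  have B0: "2 * T * (\<Sum>\<sigma>\<in>S. \<bar>c \<sigma>\<bar>) \<ge> 0" using T by (simp add: sum_nonneg)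
  have "((\<lambda>s. EE (\<lambda>w. lZ S (\<lambda>\<sigma>. s\<^sup>2 * c \<sigma> + fld (idx p N) (\<lambda>i. s * hv p N \<sigma> i) w))) has_real_derivative
     EE (\<lambda>w. gav S (\<lambda>\<sigma>. s\<^sup>2 * c \<sigma> + fld (idx p N) (\<lambda>i. s * hv p N \<sigma> i) w) (\<lambda>\<sigma>. 2 * s * c \<sigma> + ip (idx p N) (hv p N \<sigma>) (\<lambda>i. s * hv p N \<sigma> i))
        - gav S (\<lambda>\<sigma>. s\<^sup>2 * c \<sigma> + fld (idx p N) (\<lambda>i. s * hv p N \<sigma> i) w)
          (\<lambda>\<sigma>. gav S (\<lambda>\<sigma>. s\<^sup>2 * c \<sigma> + fld (idx p N) (\<lambda>i. s * hv p N \<sigma> i) w) (\<lambda>\<tau>. ip (idx p N) (hv p N \<sigma>) (\<lambda>i. s * hv p N \<tau> i))))) (at s)"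
  proof (rule lZ_path_deriv[where T=T and B=B and u="\<lambda>s \<sigma> i. s * hv p N \<sigma> i" and d="\<lambda>s \<sigma>. s\<^sup>2 * c \<sigma>"
        and d'="\<lambda>s \<sigma>. 2 * s * c \<sigma>" and u'="\<lambda>s \<sigma>. hv p N \<sigma>", OF fS S(2) finite_idx])
    show "\<bar>s\<bar> < T" by (simp add: T_def)
    show "\<bar>2 * s * c \<sigma>\<bar> \<le> B" if "\<bar>s\<bar> < T" "\<sigma> \<in> S" for s \<sigma>
    proof -
      have "\<bar>2 * s * c \<sigma>\<bar> = 2 * \<bar>s\<bar> * \<bar>c \<sigma>\<bar>" by (simp add: abs_mult)
      also have "\<dots> \<le> 2 * T * (\<Sum>\<sigma>\<in>S. \<bar>c \<sigma>\<bar>)"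
        using that T by (intro mult_mono member_le_sum fS) (auto simp: sum_nonneg)
      finally show ?thesis unfolding B_def by (rule order_trans) simp
    qed
    show "\<bar>hv p N \<sigma> i\<bar> \<le> B" if "\<bar>s\<bar> < T" "\<sigma> \<in> S" "i \<in> idx p N" for s \<sigma> i
      using abs_hv[of \<sigma> N i p] that S B0 by (auto simp: B_def)
  qed (auto intro!: derivative_eq_intros)
  moreover have "EE (\<lambda>w. gav S (\<lambda>\<sigma>. s\<^sup>2 * c \<sigma> + fld (idx p N) (\<lambda>i. s * hv p N \<sigma> i) w) (\<lambda>\<sigma>. 2 * s * c \<sigma> + ip (idx p N) (hv p N \<sigma>) (\<lambda>i. s * hv p N \<sigma> i))
        - gav S (\<lambda>\<sigma>. s\<^sup>2 * c \<sigma> + fld (idx p N) (\<lambda>i. s * hv p N \<sigma> i) w)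
          (\<lambda>\<sigma>. gav S (\<lambda>\<sigma>. s\<^sup>2 * c \<sigma> + fld (idx p N) (\<lambda>i. s * hv p N \<sigma> i) w) (\<lambda>\<tau>. ip (idx p N) (hv p N \<sigma>) (\<lambda>i. s * hv p N \<tau> i))))
     = EE (\<lambda>w. s * (gav S (e s w) (\<lambda>\<sigma>. real N + 2 * c \<sigma>)
        - real N * gav S (e s w) (\<lambda>\<sigma>. gav S (e s w) (\<lambda>\<tau>. overlap N \<sigma> \<tau> ^ p))))"
  proof (rule arg_cong[where f=EE], rule ext)
    fix w
    have 1: "ip (idx p N) (hv p N \<sigma>) (\<lambda>i. s * hv p N \<tau> i) = s * (real N * overlap N \<sigma> \<tau> ^ p)" for \<sigma> \<tau>
      using ip_scale[of "idx p N" 1 "hv p N \<sigma>" s "hv p N \<tau>"] ip_hv[OF N] by simp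
    have e': "(\<lambda>\<sigma>. s\<^sup>2 * c \<sigma> + hen p N s w \<sigma>) = e s w" by (simp add: e_def)
    have 2: "gav S (e s w) (\<lambda>\<sigma>. 2 * s * c \<sigma> + s * (real N * overlap N \<sigma> \<sigma> ^ p)) = s * gav S (e s w) (\<lambda>\<sigma>. real N + 2 * c \<sigma>)"
      unfolding gav_cmult[symmetric] using S
      by (intro gav_cong) (auto simp: overlap_self N subset_iff algebra_simps)
    show "gav S (\<lambda>\<sigma>. s\<^sup>2 * c \<sigma> + fld (idx p N) (\<lambda>i. s * hv p N \<sigma> i) w) (\<lambda>\<sigma>. 2 * s * c \<sigma> + ip (idx p N) (hv p N \<sigma>) (\<lambda>i. s * hv p N \<sigma> i))
        - gav S (\<lambda>\<sigma>. s\<^sup>2 * c \<sigma> + fld (idx p N) (\<lambda>i. s * hv p N \<sigma> i) w)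
          (\<lambda>\<sigma>. gav S (\<lambda>\<sigma>. s\<^sup>2 * c \<sigma> + fld (idx p N) (\<lambda>i. s * hv p N \<sigma> i) w) (\<lambda>\<tau>. ip (idx p N) (hv p N \<sigma>) (\<lambda>i. s * hv p N \<tau> i)))
      = s * (gav S (e s w) (\<lambda>\<sigma>. real N + 2 * c \<sigma>)
        - real N * gav S (e s w) (\<lambda>\<sigma>. gav S (e s w) (\<lambda>\<tau>. overlap N \<sigma> \<tau> ^ p)))"
      unfolding 1 hen_def[symmetric] e' 2 gav_cmult by (simp add: right_diff_distrib)
  qed
  ultimately show ?thesis unfolding PS_def e_def hen_def by simp
qed

text \<open>The coefficients of each energy have squared norm s^2 N, and neither \<open>d\<close>
  nor the restriction to \<open>S\<close> changes this; so one tail bound serves the null, planted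
  and restricted models.\<close>

lemma PS_conc:
  assumes S: "S \<subseteq> spins N" "S \<noteq> {}" and N: "N \<ge> 1" "p \<ge> 1" and V: "s\<^sup>2 * real N \<le> V" "V > 0" and x: "x \<ge> 0"
  shows "measure disorder {w. lZ S (den d p N s w) \<ge> PS p N S s d + x} \<le> exp (- x\<^sup>2 / (4 * V))"
    and "measure disorder {w. lZ S (den d p N s w) \<le> PS p N S s d - x} \<le> exp (- x\<^sup>2 / (4 * V))"
proof -
  have fS: "finite S" using S finite_subset finite_spins by blast
  let ?b = "\<lambda>i::nat list. \<bar>s\<bar> * real N powr (- (real p - 1) / 2)"
  have b: "\<bar>s * hv p N \<sigma> i\<bar> \<le> ?b i" if "\<sigma> \<in> S" "i \<in> idx p N" for \<sigma> i
    using abs_hv[of \<sigma> N i p] that S by (auto simp: abs_mult)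
  let ?F = "\<lambda>w. lZ S (\<lambda>\<sigma>. d \<sigma> + fld (idx p N) (\<lambda>i. s * hv p N \<sigma> i) w)"
  have L: "depends_on (idx p N) ?F" "?F \<in> borel_measurable disorder"
    "\<And>i w x y. i \<in> idx p N \<Longrightarrow> \<bar>?F (w(i:=x)) - ?F (w(i:=y))\<bar> \<le> ?b i * \<bar>x - y\<bar>"
    by (rule lZ_concentration[where b="?b", OF fS S(2) finite_idx]; use b in blast)+
  have V': "(\<Sum>i\<in>idx p N. (?b i)\<^sup>2) \<le> V" using V sum_sq_idx[OF N, of "\<bar>s\<bar>"] by simp
  show "measure disorder {w. lZ S (den d p N s w) \<ge> PS p N S s d + x} \<le> exp (- x\<^sup>2 / (4 * V))"
    unfolding hen_def PS_def by (rule concentration(1)[OF finite_idx L(1,2) _ V' V(2) x]) (rule L(3))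
  show "measure disorder {w. lZ S (den d p N s w) \<le> PS p N S s d - x} \<le> exp (- x\<^sup>2 / (4 * V))"
    unfolding hen_def PS_def by (rule concentration(2)[OF finite_idx L(1,2) _ V' V(2) x]) (rule L(3))
qed

section \<open>The almost sure free energy and its mean\<close>

definition fN :: "nat \<Rightarrow> nat \<Rightarrow> real \<Rightarrow> real" where
  "fN p N s = PS p N (spins N) s (\<lambda>_. 0) / real N - ln 2"

lemma free_energy_N_lZ:
  assumes "N \<ge> 1"
  shows "free_energy_N p N \<beta> w = lZ (spins N) (\<lambda>\<sigma>. 0 + hen p N (\<beta> / sqrt 2) w \<sigma>) / real N - ln 2"
proof -
  have "(\<Sum>\<sigma>\<in>spins N. 2 powr (- real N) * gibbs_weight p N \<beta> w \<sigma>) = 2 powr (- real N) * Zs (spins N) (hen p N (\<beta> / sqrt 2) w)"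
    by (simp add: Zs_def gibbs_weight_def hen_hamil sum_distrib_left)
  then show ?thesis
    using assms Zs_pos[of "spins N" "hen p N (\<beta> / sqrt 2) w"]
    by (simp add: free_energy_N_def lZ_def ln_mult ln_powr field_simps)
qed

lemma free_energy_conc:
  assumes N: "N \<ge> 1" "p \<ge> 1" and x: "x \<ge> 0"
  shows "measure disorder {w. \<bar>free_energy_N p N \<beta> w - fN p N (\<beta> / sqrt 2)\<bar> \<ge> x} \<le> 2 * exp (- (x\<^sup>2 / (4 * (\<beta>\<^sup>2 + 1))) * real N)"
proof -
  define s where "s = \<beta> / sqrt 2"
  define V where "V = (\<beta>\<^sup>2 + 1) * real N"
  have V: "s\<^sup>2 * real N \<le> V" "V > 0"
    unfolding s_def V_def using N by (auto simp: power_divide intro!: mult_right_mono mult_pos_pos add_nonneg_pos)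
  have ex: "- (x * real N)\<^sup>2 / (4 * V) = - (x\<^sup>2 / (4 * (\<beta>\<^sup>2 + 1))) * real N"
    using N by (simp add: V_def power2_eq_square)
  have xN: "x * real N \<ge> 0" using x by simp
  let ?F = "\<lambda>w. lZ (spins N) (\<lambda>\<sigma>. 0 + hen p N s w \<sigma>)" and ?P = "PS p N (spins N) s (\<lambda>_. 0)"
  note C = PS_conc[OF order_refl spins_ne N V xN, where d="\<lambda>_. 0"]
  have [measurable]: "?F \<in> borel_measurable disorder" by (rule lZ_measurable) measurable
  have "{w. \<bar>free_energy_N p N \<beta> w - fN p N s\<bar> \<ge> x}
     \<subseteq> {w. ?F w \<ge> ?P + x * real N} \<union> {w. ?F w \<le> ?P - x * real N}"
  proof
    fix w assume "w \<in> {w. \<bar>free_energy_N p N \<beta> w - fN p N s\<bar> \<ge> x}"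
    then have "x \<le> \<bar>(?F w - ?P) / real N\<bar>"
      using free_energy_N_lZ[OF N(1), of p \<beta> w] by (simp add: fN_def s_def diff_divide_distrib)
    then have "x * real N \<le> \<bar>?F w - ?P\<bar>" using N by (simp add: abs_divide pos_le_divide_eq)
    then show "w \<in> {w. ?F w \<ge> ?P + x * real N} \<union> {w. ?F w \<le> ?P - x * real N}" by auto
  qed
  then have "measure disorder {w. \<bar>free_energy_N p N \<beta> w - fN p N s\<bar> \<ge> x}
     \<le> measure disorder ({w. ?F w \<ge> ?P + x * real N} \<union> {w. ?F w \<le> ?P - x * real N})"
    by (intro D.finite_measure_mono sets.Un disorder_Collect) measurable
  also have "\<dots> \<le> measure disorder {w. ?F w \<ge> ?P + x * real N} + measure disorder {w. ?F w \<le> ?P - x * real N}"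
    by (intro measure_Un_le disorder_Collect) measurable
  also have "\<dots> \<le> 2 * exp (- (x * real N)\<^sup>2 / (4 * V))" using C by simp
  finally show ?thesis unfolding ex s_def .
qed

text \<open>Borel-Cantelli with exponentially small tails. The almost sure limit is thereby reduced
  to the deterministic sequence \<open>fN\<close>.\<close>

lemma free_energy_AE:
  assumes p: "p \<ge> 1"
  shows "AE w in disorder. (\<lambda>N. free_energy_N p N \<beta> w - fN p N (\<beta> / sqrt 2)) \<longlonglongrightarrow> 0"
proof -
  have "AE w in disorder. \<forall>m::nat. \<forall>\<^sub>F N in sequentially. \<bar>free_energy_N p N \<beta> w - fN p N (\<beta> / sqrt 2)\<bar> < 1 / real (Suc m)"
    unfolding AE_all_countable
  proof
    fix m :: nat
    define x where "x = 1 / real (Suc m)"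
    define c where "c = x\<^sup>2 / (4 * (\<beta>\<^sup>2 + 1))"
    have x: "x > 0" by (simp add: x_def)
    have c: "c > 0" unfolding c_def using x by (auto intro!: divide_pos_pos mult_pos_pos add_nonneg_pos)
    have m: "(\<lambda>w. free_energy_N p N \<beta> w) \<in> borel_measurable disorder" for N
      unfolding free_energy_N_def gibbs_weight_def hamil_def by measurable
    define A where "A N = {w. x \<le> \<bar>free_energy_N p N \<beta> w - fN p N (\<beta> / sqrt 2)\<bar>}" for N
    have A: "A N \<in> sets disorder" for N
      unfolding A_def by (rule disorder_Collect) (use m in measurable)
    \<comment> \<open>The shift by one keeps the system size positive, as the tail bound
      requires.\<close>
    have "AE w in disorder. \<forall>\<^sub>F N in sequentially. w \<in> space disorder - A (Suc N)"
    proof (rule borel_cantelli_AE1)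
      show "A (Suc N) \<in> sets disorder" for N by (rule A)
      show "emeasure disorder (A (Suc N)) < \<infinity>" for N by (simp add: D.emeasure_eq_measure)
      show "summable (\<lambda>N. measure disorder (A (Suc N)))"
      proof (rule summable_comparison_test')
        have "summable (\<lambda>N. 2 * exp (- c) * exp (- c) ^ N)"
          using c by (intro summable_mult summable_geometric) simp
        moreover have "2 * exp (- c * real (Suc N)) = 2 * exp (- c) * exp (- c) ^ N" for N
          unfolding exp_of_nat_mult[symmetric] mult.assoc exp_add[symmetric] by (simp add: algebra_simps)
        ultimately show "summable (\<lambda>N. 2 * exp (- c * real (Suc N)))"
          by (simp only:)
        show "norm (measure disorder (A (Suc N))) \<le> 2 * exp (- c * real (Suc N))" if "0 \<le> N" for N
          unfolding A_def c_def using free_energy_conc[of "Suc N" p x \<beta>] p x by simp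
      qed
    qed
    then show "AE w in disorder. \<forall>\<^sub>F N in sequentially. \<bar>free_energy_N p N \<beta> w - fN p N (\<beta> / sqrt 2)\<bar> < 1 / real (Suc m)"
    proof eventually_elim
      case (elim w)
      then have "\<forall>\<^sub>F N in sequentially. \<bar>free_energy_N p (Suc N) \<beta> w - fN p (Suc N) (\<beta> / sqrt 2)\<bar> < x"
        by (auto simp: A_def elim: eventually_mono)
      then show ?case unfolding x_def by (subst (asm) eventually_sequentially_Suc)
    qed
  qed
  then show ?thesis
  proof eventually_elim
    case (elim w)
    show ?case
    proof (rule LIMSEQ_I)
      fix r :: real assume "r > 0"
      then obtain m where m: "1 / real (Suc m) < r" using nat_approx_posE by blast
      from elim obtain n0 where "\<forall>N\<ge>n0. \<bar>free_energy_N p N \<beta> w - fN p N (\<beta> / sqrt 2)\<bar> < 1 / real (Suc m)"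
        unfolding eventually_sequentially by blast
      then show "\<exists>no. \<forall>n\<ge>no. norm (free_energy_N p n \<beta> w - fN p n (\<beta> / sqrt 2) - 0) < r"
        using m by (intro exI[of _ n0]) (auto intro: less_trans)
    qed
  qed
qed

text \<open>Two almost sure limits agree somewhere, hence as constants; this makes the definite
  description well defined once the means converge.\<close>

lemma free_energy_eq_lim:
  assumes p: "p \<ge> 1" and L: "(\<lambda>N. fN p N (\<beta> / sqrt 2)) \<longlonglongrightarrow> L"
  shows "free_energy p \<beta> = L"
  unfolding free_energy_def
proof (rule the_equality)
  show 1: "AE w in disorder. (\<lambda>N. free_energy_N p N \<beta> w) \<longlonglongrightarrow> L"
    using free_energy_AE[OF p, of \<beta>]
  proof eventually_elim
    case (elim w)
    from tendsto_add[OF this L] show ?case by simp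
  qed
  fix c assume "AE w in disorder. (\<lambda>N. free_energy_N p N \<beta> w) \<longlonglongrightarrow> c"
  with 1 have "AE w in disorder. c = L"
    by eventually_elim (rule LIMSEQ_unique)
  then show "c = L" using D.AE_const by simp
qed

subsection \<open>Elementary properties of the free energy\<close>

text \<open>The p-th power of the overlap is a covariance, so its two-sample average is nonnegative
  for odd \<open>p\<close> too, although single overlaps may be negative.\<close>

lemma gav_KK_nonneg:
  assumes "N \<ge> 1" "p \<ge> 1"
  shows "0 \<le> gav S e (\<lambda>\<sigma>. gav S e (\<lambda>\<tau>. overlap N \<sigma> \<tau> ^ p))"
proof -
  have "0 \<le> gav S e (\<lambda>\<sigma>. gav S e (\<lambda>\<tau>. real N * overlap N \<sigma> \<tau> ^ p))"
    using gav_ip_nonneg[of S e "idx p N" "hv p N"] unfolding ip_hv[OF assms] .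
  then show ?thesis using assms unfolding gav_cmult by (simp add: zero_le_mult_iff)
qed

lemma gav_KK_le:
  assumes "S \<subseteq> spins N" "S \<noteq> {}"
  shows "gav S e (\<lambda>\<sigma>. gav S e (\<lambda>\<tau>. overlap N \<sigma> \<tau> ^ p)) \<le> 1"
proof -
  have fS: "finite S" using assms finite_subset finite_spins by blast
  show ?thesis
    by (intro gav_le fS assms(2) order_trans[OF abs_ge_self overlap_pow_abs]) (use assms in auto)
qed

lemma tame_gav_hen:
  assumes "finite S"
  shows "tame (\<lambda>w. gav S (den d p N s w) f)"
    "tame (\<lambda>w. gav S (den d p N s w) (\<lambda>\<sigma>. gav S (den d p N s w) (g \<sigma>)))"
proof -
  have m: "(\<lambda>w. d \<sigma> + hen p N s w \<sigma>) \<in> borel_measurable disorder" for \<sigma> by measurable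
  show "tame (\<lambda>w. gav S (den d p N s w) f)"
    "tame (\<lambda>w. gav S (den d p N s w) (\<lambda>\<sigma>. gav S (den d p N s w) (g \<sigma>)))"
    by (intro tame_gav assms m tame_const)+
qed

definition GK :: "nat \<Rightarrow> nat \<Rightarrow> real \<Rightarrow> real" where
  "GK p N s = EE (\<lambda>w. gav (spins N) (\<lambda>\<sigma>. 0 + hen p N s w \<sigma>)
      (\<lambda>\<sigma>. gav (spins N) (\<lambda>\<sigma>. 0 + hen p N s w \<sigma>) (\<lambda>\<tau>. overlap N \<sigma> \<tau> ^ p)))"

lemma GK_bounds:
  assumes "N \<ge> 1" "p \<ge> 1" shows "0 \<le> GK p N s" "GK p N s \<le> 1"
proof -
  show "0 \<le> GK p N s" unfolding GK_def by (rule Bochner_Integration.integral_nonneg) (rule gav_KK_nonneg[OF assms])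
  have "GK p N s \<le> EE (\<lambda>w. 1)"
    unfolding GK_def by (intro integral_mono tame_integrable tame_gav_hen tame_const gav_KK_le) auto
  then show "GK p N s \<le> 1" by (simp add: D.prob_space[simplified])
qed

lemma fN_deriv:
  assumes N: "N \<ge> 1" "p \<ge> 1"
  shows "(fN p N has_real_derivative s * (1 - GK p N s)) (at s)"
proof -
  let ?e = "\<lambda>w \<sigma>. 0 + hen p N s w \<sigma>"
  have D: "((\<lambda>s. PS p N (spins N) s (\<lambda>_. 0)) has_real_derivative
     s * EE (\<lambda>w. gav (spins N) (?e w) (\<lambda>\<sigma>. real N)
        - real N * gav (spins N) (?e w) (\<lambda>\<sigma>. gav (spins N) (?e w) (\<lambda>\<tau>. overlap N \<sigma> \<tau> ^ p)))) (at s)"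
    using PS_deriv[OF order_refl spins_ne N, of "\<lambda>_. 0" s] by simp
  have "EE (\<lambda>w. gav (spins N) (?e w) (\<lambda>\<sigma>. real N)
        - real N * gav (spins N) (?e w) (\<lambda>\<sigma>. gav (spins N) (?e w) (\<lambda>\<tau>. overlap N \<sigma> \<tau> ^ p)))
     = real N - real N * GK p N s"
    unfolding GK_def gav_const[OF finite_spins spins_ne]
    by (subst Bochner_Integration.integral_diff[OF tame_integrable[OF tame_const]
          tame_integrable[OF tame_cmult[OF tame_gav_hen(2)[OF finite_spins]]]])
      (simp add: D.prob_space[simplified])
  with D have "((\<lambda>s. PS p N (spins N) s (\<lambda>_. 0) / real N - ln 2) has_real_derivative
     s * (real N - real N * GK p N s) / real N - 0) (at s)"
    by (intro DERIV_diff DERIV_const DERIV_cdivide) simp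
  then show ?thesis using N unfolding fN_def[abs_def] by (simp add: right_diff_distrib diff_divide_distrib)
qed

lemma fN_zero: assumes "N \<ge> 1" shows "fN p N 0 = 0"
proof -
  have "hen p N 0 w \<sigma> = 0" for w \<sigma> by (simp add: hen_def fld_def)
  then have "PS p N (spins N) 0 (\<lambda>_. 0) = real N * ln 2"
    unfolding PS_def by (simp add: lZ_zero card_spins D.prob_space[simplified] ln_realpow)
  then show ?thesis using assms by (simp add: fN_def)
qed

text \<open>The derivative is s (1 - E <R_12^p>) with the two-sample average between 0 and 1. The
  second part says that the gap to the annealed value s^2/2 never shrinks.\<close>

lemma fN_mono:
  assumes N: "N \<ge> 1" "p \<ge> 1" and st: "0 \<le> s" "s \<le> t"
  shows "fN p N s \<le> fN p N t" "s\<^sup>2/2 - fN p N s \<le> t\<^sup>2/2 - fN p N t"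
proof -
  show "fN p N s \<le> fN p N t"
  proof (rule DERIV_nonneg_imp_nondecreasing[OF st(2)])
    fix x assume "s \<le> x" "x \<le> t"
    then show "\<exists>y. (fN p N has_real_derivative y) (at x) \<and> 0 \<le> y"
      using fN_deriv[OF N, of x] GK_bounds[OF N, of x] st by (intro exI[of _ "x * (1 - GK p N x)"]) auto
  qed
  show "s\<^sup>2/2 - fN p N s \<le> t\<^sup>2/2 - fN p N t"
  proof (rule DERIV_nonneg_imp_nondecreasing[OF st(2), of "\<lambda>s. s\<^sup>2/2 - fN p N s"])
    fix x assume "s \<le> x" "x \<le> t"
    moreover have "((\<lambda>s. s\<^sup>2/2 - fN p N s) has_real_derivative x * GK p N x) (at x)"
      by (rule DERIV_cong[OF DERIV_diff[OF _ fN_deriv[OF N]]]) (auto intro!: derivative_eq_intros simp: algebra_simps)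
    ultimately show "\<exists>y. ((\<lambda>s. s\<^sup>2/2 - fN p N s) has_real_derivative y) (at x) \<and> 0 \<le> y"
      using GK_bounds[OF N, of x] st by (intro exI[of _ "x * GK p N x"]) auto
  qed
qed

lemma fN_le: assumes "N \<ge> 1" "p \<ge> 1" "0 \<le> s" shows "fN p N s \<le> s\<^sup>2/2" "0 \<le> fN p N s"
  using fN_mono[of N p 0 s] assms by (simp_all add: fN_zero)

text \<open>A sum of squares is at most the square of the sum, so Z(s) <= Z(s/2)^2; combined with
  the annealed bound at s/2. The growth s^2/4 in place of s^2/2 shows that replica symmetry fails
  for large s.\<close>

lemma fN_quarter:
  assumes N: "N \<ge> 1" "p \<ge> 1" and s: "s \<ge> 0" shows "fN p N s \<le> s\<^sup>2/4 + ln 2"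
proof -
  have le: "lZ (spins N) (\<lambda>\<sigma>. 0 + hen p N s w \<sigma>) \<le> 2 * lZ (spins N) (\<lambda>\<sigma>. 0 + hen p N (s/2) w \<sigma>)" for w
  proof -
    have "Zs (spins N) (hen p N s w) = (\<Sum>\<sigma>\<in>spins N. (exp (hen p N (s/2) w \<sigma>))\<^sup>2)"
      unfolding Zs_def by (simp add: hen_hamil power2_eq_square exp_add[symmetric])
    also have "\<dots> \<le> (\<Sum>\<sigma>\<in>spins N. exp (hen p N (s/2) w \<sigma>) * Zs (spins N) (hen p N (s/2) w))"
      unfolding power2_eq_square Zs_def by (intro sum_mono mult_left_mono member_le_sum) auto
    also have "\<dots> = (Zs (spins N) (hen p N (s/2) w))\<^sup>2"
      by (simp add: sum_distrib_right[symmetric] power2_eq_square) (simp add: Zs_def)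
    finally have "ln (Zs (spins N) (hen p N s w)) \<le> ln ((Zs (spins N) (hen p N (s/2) w))\<^sup>2)"
      using Zs_pos[of "spins N" "hen p N s w"] by (simp add: ln_mono)
    then show ?thesis by (simp add: lZ_def ln_realpow Zs_pos)
  qed
  have "PS p N (spins N) s (\<lambda>_. 0) \<le> EE (\<lambda>w. 2 * lZ (spins N) (\<lambda>\<sigma>. 0 + hen p N (s/2) w \<sigma>))"
    unfolding PS_def by (intro integral_mono tame_integrable tame_cmult tame_lZ_hen le) auto
  also have "\<dots> = 2 * PS p N (spins N) (s/2) (\<lambda>_. 0)" unfolding PS_def by simp
  finally have "fN p N s + ln 2 \<le> 2 * (fN p N (s/2) + ln 2)"
    using N unfolding fN_def by (simp add: divide_right_mono[of _ _ "real N", simplified] divide_le_cancel)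
  also have "fN p N (s/2) \<le> (s/2)\<^sup>2/2" by (rule fN_le) (use N s in auto)
  finally show ?thesis by (simp add: power_divide)
qed

subsection \<open>Second moments\<close>

lemma cosh_le: "exp x + exp (- x) \<le> 2 * exp (x\<^sup>2/2)" for x :: real
proof -
  have 1: "sinh y \<le> y * cosh y" if "y \<ge> 0" for y :: real
  proof -
    have "0 * cosh 0 - sinh 0 \<le> y * cosh y - sinh y"
    proof (rule DERIV_nonneg_imp_nondecreasing[OF that, of "\<lambda>y. y * cosh y - sinh y"])
      fix z :: real assume "0 \<le> z"
      then show "\<exists>d. ((\<lambda>y. y * cosh y - sinh y) has_real_derivative d) (at z) \<and> 0 \<le> d"
        by (intro exI[of _ "z * sinh z"] conjI) (auto intro!: derivative_eq_intros)
    qed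
    then show ?thesis by simp
  qed
  have 2: "cosh y \<le> exp (y\<^sup>2/2)" if "y \<ge> 0" for y :: real
  proof -
    have "exp (- (0::real)\<^sup>2/2) * cosh 0 \<ge> exp (- y\<^sup>2/2) * cosh y"
    proof (rule DERIV_nonpos_imp_nonincreasing[OF that, of "\<lambda>y. exp (- y\<^sup>2/2) * cosh y"])
      fix z :: real assume z: "0 \<le> z"
      have "((\<lambda>y. exp (- y\<^sup>2/2) * cosh y) has_real_derivative exp (- z\<^sup>2/2) * (sinh z - z * cosh z)) (at z)"
        by (auto intro!: derivative_eq_intros simp: algebra_simps)
      moreover have "exp (- z\<^sup>2/2) * (sinh z - z * cosh z) \<le> 0"
        using 1[OF z] by (intro mult_nonneg_nonpos) auto
      ultimately show "\<exists>d. ((\<lambda>y. exp (- y\<^sup>2/2) * cosh y) has_real_derivative d) (at z) \<and> d \<le> 0" by blast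
    qed
    then have "exp (y\<^sup>2/2) * (exp (- y\<^sup>2/2) * cosh y) \<le> exp (y\<^sup>2/2) * 1" by (intro mult_left_mono) auto
    then show ?thesis by (simp add: mult.assoc[symmetric] exp_add[symmetric])
  qed
  have "cosh \<bar>x\<bar> \<le> exp (\<bar>x\<bar>\<^sup>2/2)" by (rule 2) simp
  then have "cosh x \<le> exp (x\<^sup>2/2)" by (simp add: abs_if split: if_splits)
  then show ?thesis by (simp add: cosh_def)
qed

lemma N1_exp_sq: "(\<integral>\<^sup>+z. ennreal (exp (z\<^sup>2/4)) \<partial>N1) = ennreal (sqrt 2)"
proof -
  have "(\<integral>\<^sup>+z. ennreal (exp (z\<^sup>2/4)) \<partial>N1) = (\<integral>\<^sup>+z. ennreal (sqrt 2) * ennreal (normal_density 0 (sqrt 2) z) \<partial>lborel)"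
    by (subst N1_nn) (auto intro!: nn_integral_cong
        simp: ennreal_mult'[symmetric] normal_density_def exp_add[symmetric] real_sqrt_mult field_simps)
  also have "\<dots> = ennreal (sqrt 2) * (\<integral>\<^sup>+z. ennreal (normal_density 0 (sqrt 2) z) \<partial>lborel)"
    by (rule nn_integral_cmult) simp
  also have "(\<integral>\<^sup>+z. ennreal (normal_density 0 (sqrt 2) z) \<partial>lborel) = 1"
    by (subst nn_integral_eq_integral) auto
  finally show ?thesis by simp
qed

text \<open>Linearising the square with an auxiliary Gaussian variable decouples the spins.\<close>

lemma sum_exp_overlap_sq:
  assumes \<tau>: "\<tau> \<in> spins N" and N: "N \<ge> 1"
  shows "(\<Sum>\<sigma>\<in>spins N. exp (real N * (overlap N \<sigma> \<tau>)\<^sup>2 / 4)) \<le> sqrt 2 * 2 ^ N"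
proof -
  \<comment> \<open>Chosen so that the target equals exp ((b T)^2 / 2), a Gaussian moment generating
    function at b T, and so that the N decoupled cosh bounds multiply to exp (z^2 / 4), which is
    still integrable.\<close>
  define b where "b = sqrt (1 / (2 * real N))"
  have b2: "b\<^sup>2 = 1 / (2 * real N)" by (simp add: b_def)
  define T where "T \<sigma> = (\<Sum>i<N. \<sigma> i * \<tau> i)" for \<sigma>
  have e1: "real N * (overlap N \<sigma> \<tau>)\<^sup>2 / 4 = (b * T \<sigma>)\<^sup>2 / 2" for \<sigma>
    using N by (simp add: overlap_def T_def power_mult_distrib b2 power_divide) (simp add: power2_eq_square field_simps)
  have "ennreal (\<Sum>\<sigma>\<in>spins N. exp (real N * (overlap N \<sigma> \<tau>)\<^sup>2 / 4))
     = (\<Sum>\<sigma>\<in>spins N. \<integral>\<^sup>+z. ennreal (exp (b * T \<sigma> * z)) \<partial>N1)"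
    by (simp add: N1_mgf e1)
  also have "\<dots> = (\<integral>\<^sup>+z. (\<Sum>\<sigma>\<in>spins N. ennreal (exp (b * T \<sigma> * z))) \<partial>N1)"
    by (rule nn_integral_sum[symmetric]) simp
  also have "\<dots> \<le> (\<integral>\<^sup>+z. ennreal (2 ^ N) * ennreal (exp (z\<^sup>2/4)) \<partial>N1)"
  proof (rule nn_integral_mono)
    fix z
    have "(\<Sum>\<sigma>\<in>spins N. exp (b * T \<sigma> * z)) = (\<Sum>\<sigma>\<in>spins N. \<Prod>i<N. exp (b * z * \<sigma> i * \<tau> i))"
      by (simp add: T_def exp_sum[symmetric] sum_distrib_left sum_distrib_right ac_simps)
    also have "\<dots> = (\<Prod>i<N. \<Sum>x\<in>{-1, 1}. exp (b * z * x * \<tau> i))"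
      unfolding spins_def by (rule prod_sum_PiE[symmetric]) auto
    also have "\<dots> \<le> (\<Prod>i<N. 2 * exp ((b * z)\<^sup>2/2))"
    proof (rule prod_mono)
      fix i assume "i \<in> {..<N}"
      then have "\<tau> i = -1 \<or> \<tau> i = 1" using spinsD[OF \<tau>] by auto
      then have "(\<Sum>x\<in>{-1, 1}. exp (b * z * x * \<tau> i)) = exp (b * z) + exp (- (b * z))" by auto
      then show "0 \<le> (\<Sum>x\<in>{-1, 1}. exp (b * z * x * \<tau> i)) \<and> (\<Sum>x\<in>{-1, 1}. exp (b * z * x * \<tau> i)) \<le> 2 * exp ((b * z)\<^sup>2/2)"
        using cosh_le[of "b * z"] by (simp add: add_nonneg_nonneg)
    qed
    also have "\<dots> = 2 ^ N * exp (z\<^sup>2/4)"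
      using N by (simp add: power_mult_distrib b2 exp_of_nat_mult[symmetric])
    finally show "(\<Sum>\<sigma>\<in>spins N. ennreal (exp (b * T \<sigma> * z))) \<le> ennreal (2 ^ N) * ennreal (exp (z\<^sup>2/4))"
      by (simp add: ennreal_mult'[symmetric] ennreal_leI)
  qed
  also have "\<dots> = ennreal (sqrt 2 * 2 ^ N)"
    by (subst nn_integral_cmult) (auto simp: N1_exp_sq ennreal_mult'[symmetric] mult.commute)
  finally show ?thesis by (simp add: ennreal_le_iff)
qed

lemma tame_exp_fld: "finite I \<Longrightarrow> tame (\<lambda>w. exp (fld I u w))"
proof (rule tame_exp_lin(1)[where J=I and C="\<Sum>i\<in>I. \<bar>u i\<bar>"])
  fix w assume I: "finite I"
  have "\<bar>fld I u w\<bar> \<le> (\<Sum>i\<in>I. \<bar>w i\<bar> * \<bar>u i\<bar>)" unfolding fld_def by (rule order_trans[OF sum_abs]) (simp add: abs_mult)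
  also have "\<dots> \<le> (\<Sum>i\<in>I. \<bar>w i\<bar> * (\<Sum>i\<in>I. \<bar>u i\<bar>))" by (intro sum_mono mult_left_mono member_le_sum I) auto
  also have "\<dots> \<le> (\<Sum>i\<in>I. \<bar>u i\<bar>) * (1 + (\<Sum>i\<in>I. \<bar>w i\<bar>))"
    by (simp add: sum_distrib_right[symmetric] distrib_left mult.commute sum_nonneg)
  finally show "\<bar>fld I u w\<bar> \<le> (\<Sum>i\<in>I. \<bar>u i\<bar>) * (1 + (\<Sum>i\<in>I. \<bar>w i\<bar>))" .
qed (auto simp: sum_nonneg)

lemma gauss_mgf:
  assumes I: "finite I" shows "EE (\<lambda>w. exp (fld I u w)) = exp (ip I u u / 2)"
proof -
  have e: "(\<Sum>i\<in>I. w i * u i - (u i)\<^sup>2/2) = fld I u w - ip I u u / 2" for w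
    by (simp add: fld_def ip_def sum_subtractf sum_divide_distrib power2_eq_square)
  have "(\<integral>\<^sup>+w. ennreal (exp (fld I u w - ip I u u / 2)) \<partial>disorder) = 1"
    using gauss_shift[OF I, of "\<lambda>_. 1" u] by (simp add: e D.emeasure_space_1[simplified])
  then have "EE (\<lambda>w. exp (fld I u w - ip I u u / 2)) = 1"
    by (subst integral_eq_nn_integral) auto
  then have "EE (\<lambda>w. exp (- (ip I u u / 2)) * exp (fld I u w)) = 1"
    by (simp add: exp_add[symmetric])
  then have "exp (ip I u u / 2) * (exp (- (ip I u u / 2)) * EE (\<lambda>w. exp (fld I u w))) = exp (ip I u u / 2)" by simp
  then show ?thesis by (simp add: mult.assoc[symmetric] exp_add[symmetric])
qed

lemma tame_exp_hen: "tame (\<lambda>w. exp (hen p N s w \<sigma>))"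
  unfolding hen_def by (rule tame_exp_fld) simp

lemma hen_mgf:
  assumes "N \<ge> 1" "p \<ge> 1" "\<sigma> \<in> spins N"
  shows "EE (\<lambda>w. exp (hen p N s w \<sigma>)) = exp (s\<^sup>2 * real N / 2)"
  unfolding hen_def using assms
  by (subst gauss_mgf) (simp_all add: ip_scale ip_hv overlap_self power2_eq_square)

lemma hen_mgf2:
  assumes "N \<ge> 1" "p \<ge> 1" "\<sigma> \<in> spins N" "\<tau> \<in> spins N"
  shows "EE (\<lambda>w. exp (hen p N s w \<sigma>) * exp (hen p N s w \<tau>)) = exp (s\<^sup>2 * real N) * exp (s\<^sup>2 * real N * overlap N \<sigma> \<tau> ^ p)"
proof -
  have "exp (hen p N s w \<sigma>) * exp (hen p N s w \<tau>) = exp (fld (idx p N) (\<lambda>i. s * hv p N \<sigma> i + s * hv p N \<tau> i) w)" for w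
    unfolding hen_def exp_add[symmetric] by (simp add: fld_def sum.distrib[symmetric] distrib_left)
  moreover have "ip (idx p N) (\<lambda>i. s * hv p N \<sigma> i + s * hv p N \<tau> i) (\<lambda>i. s * hv p N \<sigma> i + s * hv p N \<tau> i) / 2
     = s\<^sup>2 * real N + s\<^sup>2 * real N * overlap N \<sigma> \<tau> ^ p"
    using assms by (simp add: ip_add_left ip_add_right ip_scale ip_hv overlap_self overlap_commute[of N \<tau> \<sigma>] power2_eq_square)
  ultimately show ?thesis by (simp only: gauss_mgf finite_idx exp_add)
qed

lemma gav_indicator:
  assumes "S \<subseteq> T" "finite T" "T \<noteq> {}" "S \<noteq> {}"
  shows "gav T e (\<lambda>\<sigma>. if \<sigma> \<in> S then 1 else 0) = exp (lZ S e - lZ T e)"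
proof -
  have fS: "finite S" using assms finite_subset by blast
  have "(\<Sum>\<sigma>\<in>T. (if \<sigma> \<in> S then 1 else 0) * exp (e \<sigma>)) = Zs S e"
    unfolding Zs_def using assms by (intro sum.mono_neutral_cong_right) auto
  then show ?thesis by (simp add: gav_def exp_diff exp_lZ fS assms)
qed

lemma lZ_subset: "S \<subseteq> T \<Longrightarrow> finite T \<Longrightarrow> S \<noteq> {} \<Longrightarrow> lZ S e \<le> lZ T e"
  unfolding lZ_def using Zs_pos[of S e] finite_subset[of S T]
  by (intro ln_mono) (auto simp: Zs_def intro!: sum_mono2)

lemma tame_indicator: "A \<in> sets disorder \<Longrightarrow> tame (indicator A)"
  by (rule tame_bound[of _ 1]) (auto simp: indicator_def)

text \<open>Second moment method at s = 1/2: E Z^2 / (E Z)^2 is the mean of exp (N R^p / 4), at most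
  that of exp (N R^2 / 4) and hence below 2. So Z >= E Z / 2 with probability at least 1/8, which
  concentration contradicts unless the mean of log Z is within O(sqrt N) of log E Z.\<close>

lemma RS_small_bound:
  assumes N: "N \<ge> 1" and p: "p \<ge> 2"
  shows "1/8 - fN p N (1/2) \<le> ln 2 / real N + sqrt (ln 8 / real N)"
proof -
  have p1: "p \<ge> 1" using p by simp
  define Z where "Z w = Zs (spins N) (hen p N (1/2) w)" for w
  define \<mu> where "\<mu> = 2 ^ N * exp (real N / 8)"
  have \<mu>: "\<mu> > 0" by (simp add: \<mu>_def)
  have tZ: "tame Z" unfolding Z_def Zs_def by (intro tame_sum tame_exp_hen)
  have EZ: "EE Z = \<mu>"
  proof -
    have "EE Z = (\<Sum>\<sigma>\<in>spins N. EE (\<lambda>w. exp (hen p N (1/2) w \<sigma>)))"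
      unfolding Z_def Zs_def by (intro Bochner_Integration.integral_sum tame_integrable tame_exp_hen)
    also have "\<dots> = (\<Sum>\<sigma>\<in>spins N. exp (real N / 8))"
      by (intro sum.cong refl) (simp only: hen_mgf[OF N p1], simp add: power2_eq_square)
    finally show ?thesis by (simp add: \<mu>_def card_spins)
  qed
  have "EE (\<lambda>w. Z w * Z w) = (\<Sum>\<sigma>\<in>spins N. \<Sum>\<tau>\<in>spins N. EE (\<lambda>w. exp (hen p N (1/2) w \<sigma>) * exp (hen p N (1/2) w \<tau>)))"
    unfolding Z_def Zs_def sum_product
    by (subst Bochner_Integration.integral_sum, (intro tame_integrable tame_sum tame_add_mult tame_exp_hen)[1],
        intro sum.cong refl Bochner_Integration.integral_sum tame_integrable tame_add_mult tame_exp_hen)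
  also have "\<dots> = (\<Sum>\<tau>\<in>spins N. \<Sum>\<sigma>\<in>spins N. exp (real N / 4) * exp (real N * overlap N \<sigma> \<tau> ^ p / 4))"
    by (subst sum.swap, intro sum.cong refl) (simp only: hen_mgf2[OF N p1], simp add: power2_eq_square)
  also have "\<dots> \<le> (\<Sum>\<tau>\<in>spins N. exp (real N / 4) * (2 * 2 ^ N))"
  proof (rule sum_mono)
    fix \<tau> assume \<tau>: "\<tau> \<in> spins N"
    have "(\<Sum>\<sigma>\<in>spins N. exp (real N * overlap N \<sigma> \<tau> ^ p / 4)) \<le> (\<Sum>\<sigma>\<in>spins N. exp (real N * (overlap N \<sigma> \<tau>)\<^sup>2 / 4))"
    proof (rule sum_mono)
      fix \<sigma> assume \<sigma>: "\<sigma> \<in> spins N"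
      have "overlap N \<sigma> \<tau> ^ p \<le> \<bar>overlap N \<sigma> \<tau>\<bar> ^ p" by (metis abs_ge_self power_abs)
      also have "\<dots> \<le> \<bar>overlap N \<sigma> \<tau>\<bar> ^ 2" using overlap_abs[OF \<sigma> \<tau>] p by (intro power_decreasing) auto
      finally show "exp (real N * overlap N \<sigma> \<tau> ^ p / 4) \<le> exp (real N * (overlap N \<sigma> \<tau>)\<^sup>2 / 4)"
        by (simp add: mult_left_mono)
    qed
    also have "\<dots> \<le> sqrt 2 * 2 ^ N" by (rule sum_exp_overlap_sq[OF \<tau> N])
    also have "\<dots> \<le> 2 * 2 ^ N" by (intro mult_right_mono) (auto intro: real_le_lsqrt)
    finally have "(\<Sum>\<sigma>\<in>spins N. exp (real N * overlap N \<sigma> \<tau> ^ p / 4)) \<le> 2 * 2 ^ N" .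
    then show "(\<Sum>\<sigma>\<in>spins N. exp (real N / 4) * exp (real N * overlap N \<sigma> \<tau> ^ p / 4)) \<le> exp (real N / 4) * (2 * 2 ^ N)"
      unfolding sum_distrib_left[symmetric] by (intro mult_left_mono) auto
  qed
  also have "\<dots> = 2 * \<mu>\<^sup>2"
    by (simp add: card_spins \<mu>_def power_mult_distrib power2_eq_square exp_add[symmetric])
  finally have EZ2: "EE (\<lambda>w. Z w * Z w) \<le> 2 * \<mu>\<^sup>2" .
  have [measurable]: "Z \<in> borel_measurable disorder" by (rule tame_meas[OF tZ])
  define A where "A = {w. Z w \<ge> \<mu> / 2}"
  have A: "A \<in> sets disorder" unfolding A_def by (rule disorder_Collect) measurable
  have iA: "integrable disorder (indicator A :: _ \<Rightarrow> real)" using A by (simp add: D.emeasure_eq_measure)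
  have "\<mu> = EE Z" using EZ by simp
  also have "\<dots> \<le> EE (\<lambda>w. \<mu>/2 + ((1 / (8 * \<mu>)) * (Z w * Z w) + 2 * \<mu> * indicator A w))"
  proof (rule integral_mono)
    show "integrable disorder (\<lambda>w. \<mu>/2 + ((1 / (8 * \<mu>)) * (Z w * Z w) + 2 * \<mu> * indicator A w))"
      by (intro tame_integrable tame_add_mult tame_cmult tame_const tZ tame_indicator A)
    fix w
    define q where "q = (1 / (8 * \<mu>)) * (Z w * Z w)"
    \<comment> \<open>Paley-Zygmund by completing a square: Z <= Z^2 / (8 \<mu>) + 2 \<mu> on A and
      Z < \<mu>/2 off A. Taking means leaves \<mu> <= \<mu>/2 + \<mu>/4 + 2 \<mu> P(A).\<close>
    have "0 \<le> (Z w - 4 * \<mu>)\<^sup>2 / (8 * \<mu>)" using \<mu> by simp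
    also have "\<dots> = q + 2 * \<mu> - Z w"
      using \<mu> by (simp add: q_def power2_eq_square field_simps)
    finally have "Z w \<le> q + 2 * \<mu>" by simp
    moreover have "0 \<le> q"
      unfolding q_def using \<mu> zero_le_square[of "Z w"] by (intro mult_nonneg_nonneg[of "1 / (8 * \<mu>)"]) auto
    moreover have "w \<notin> A \<Longrightarrow> Z w < \<mu> / 2" by (simp add: A_def)
    ultimately show "Z w \<le> \<mu>/2 + ((1 / (8 * \<mu>)) * (Z w * Z w) + 2 * \<mu> * indicator A w)"
      unfolding q_def[symmetric] using \<mu> by (cases "w \<in> A") auto
  qed (rule tame_integrable[OF tZ])
  also have "\<dots> = \<mu>/2 + ((1 / (8 * \<mu>)) * EE (\<lambda>w. Z w * Z w) + 2 * \<mu> * measure disorder A)"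
    using iA A tame_integrable[OF tame_add_mult(2)[OF tZ tZ]]
    by (simp add: D.prob_space[simplified])
  also have "\<dots> \<le> \<mu>/2 + ((1 / (8 * \<mu>)) * (2 * \<mu>\<^sup>2) + 2 * \<mu> * measure disorder A)"
    using EZ2 \<mu> by (intro add_mono mult_left_mono) auto
  finally have "\<mu> \<le> \<mu>/2 + ((1 / (8 * \<mu>)) * (2 * \<mu>\<^sup>2) + 2 * \<mu> * measure disorder A)" .
  moreover have "(1 / (8 * \<mu>)) * (2 * \<mu>\<^sup>2) = \<mu> / 4" using \<mu> by (simp add: power2_eq_square)
  ultimately have "\<mu> * (1/4) \<le> \<mu> * (2 * measure disorder A)" by linarith
  then have "1/4 \<le> 2 * measure disorder A" using \<mu> by (simp only: mult_le_cancel_left_pos)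
  then have mA: "1/8 \<le> measure disorder A" by simp
  define P where "P = PS p N (spins N) (1/2) (\<lambda>_. 0)"
  \<comment> \<open>If positive, \<open>A\<close> is an upper deviation of log Z by
    \<open>x\<close>, so its probability 1/8 limits \<open>x\<close>.\<close>
  define x where "x = ln (\<mu>/2) - P"
  have x_eq: "x = real N * (1/8 - fN p N (1/2)) - ln 2"
    using N unfolding x_def \<mu>_def P_def fN_def by (simp add: ln_div ln_mult ln_realpow field_simps)
  have "x \<le> sqrt (ln 8 * real N)"
  proof (cases "x \<ge> 0")
    case True
    have "A = {w. lZ (spins N) (\<lambda>\<sigma>. 0 + hen p N (1/2) w \<sigma>) \<ge> P + x}"
      unfolding A_def Z_def x_def lZ_def using \<mu> by (auto simp: ln_le_cancel_iff Zs_pos)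
    then have "measure disorder A \<le> exp (- x\<^sup>2 / (4 * (real N / 4)))"
      unfolding P_def using PS_conc(1)[OF order_refl spins_ne N p1, of "1/2" "real N / 4" x "\<lambda>_. 0"] True N
      by (simp add: power2_eq_square)
    with mA have "1/8 \<le> exp (- x\<^sup>2 / real N)" by simp
    then have "ln (1/8) \<le> - x\<^sup>2 / real N" 
      using ln_le_cancel_iff[of "1/8" "exp (- x\<^sup>2 / real N)"] by simp
    moreover have "ln (1/8::real) = - ln 8" by (simp add: ln_div)
    ultimately have "- ln 8 * real N \<le> - x\<^sup>2"
      using N pos_le_divide_eq[of "real N" "- ln 8" "- x\<^sup>2"] by simp
    then have "x\<^sup>2 \<le> ln 8 * real N" by simp
    then show ?thesis by (rule real_le_rsqrt)
  next
    case False
    moreover have "0 \<le> sqrt (ln 8 * real N)" by simp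
    ultimately show ?thesis by linarith
  qed
  then have "(1/8 - fN p N (1/2)) \<le> (ln 2 + sqrt (ln 8 * real N)) / real N"
    using N unfolding x_eq by (subst pos_le_divide_eq) (auto simp: mult.commute)
  also have "\<dots> = ln 2 / real N + sqrt (ln 8 / real N)"
  proof -
    have "sqrt (ln 8 * real N) / real N = sqrt (ln 8 * real N / (real N)\<^sup>2)"
      using N by (simp add: real_sqrt_divide)
    also have "ln 8 * real N / (real N)\<^sup>2 = ln 8 / real N" using N by (simp add: power2_eq_square)
    finally show ?thesis by (simp add: add_divide_distrib)
  qed
  finally show ?thesis .
qed

text \<open>Provides an element of the replica symmetric set, whose greatest element would otherwise
  be meaningless.\<close>

lemma RS_small:
  assumes p: "p \<ge> 2" shows "(\<lambda>N. fN p N (1/2)) \<longlonglongrightarrow> 1/8"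
proof -
  have "(\<lambda>N. ln 2 / real N + sqrt (ln 8 / real N)) \<longlonglongrightarrow> 0 + sqrt 0"
    by (intro tendsto_add tendsto_real_sqrt lim_const_over_n)
  then have "(\<lambda>N. 1/8 - (ln 2 / real N + sqrt (ln 8 / real N))) \<longlonglongrightarrow> 1/8 - 0"
    by (intro tendsto_diff tendsto_const) simp
  then have l: "(\<lambda>N. 1/8 - (ln 2 / real N + sqrt (ln 8 / real N))) \<longlonglongrightarrow> 1/8" by simp
  show ?thesis
  proof (rule tendsto_sandwich[OF _ _ l tendsto_const])
    show "\<forall>\<^sub>F N in sequentially. 1/8 - (ln 2 / real N + sqrt (ln 8 / real N)) \<le> fN p N (1/2)"
      using eventually_ge_at_top[of 1] by eventually_elim (use RS_small_bound[OF _ p] in force)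
    show "\<forall>\<^sub>F N in sequentially. fN p N (1/2) \<le> 1/8"
      using eventually_ge_at_top[of 1] by eventually_elim (use fN_le(1)[of _ p "1/2"] p in \<open>auto simp: power2_eq_square\<close>)
  qed
qed

subsection \<open>The planted model\<close>

text \<open>By gauge symmetry all plants are equivalent, so the all-plus configuration is taken as
  the plant. The restriction is there because members of \<open>spins N\<close> are extensional
  functions.\<close>

definition ones :: "nat \<Rightarrow> nat \<Rightarrow> real" where
  "ones N = (\<lambda>i\<in>{..<N}. 1)"

definition gm :: "nat \<Rightarrow> (nat \<Rightarrow> real) \<Rightarrow> (nat \<Rightarrow> real) \<Rightarrow> nat \<Rightarrow> real" where
  "gm N \<rho> \<sigma> = (\<lambda>i\<in>{..<N}. \<rho> i * \<sigma> i)"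

text \<open>Energy in disorder translated along the coefficient vector of \<open>\<tau>\<close>:
  every configuration gains its covariance with the plant.\<close>

abbreviation pen :: "nat \<Rightarrow> nat \<Rightarrow> real \<Rightarrow> (nat \<Rightarrow> real) \<Rightarrow> (nat list \<Rightarrow> real) \<Rightarrow> (nat \<Rightarrow> real) \<Rightarrow> real" where
  "pen p N s \<tau> w \<equiv> \<lambda>\<sigma>. s\<^sup>2 * (real N * overlap N \<sigma> \<tau> ^ p) + hen p N s w \<sigma>"

abbreviation pen1 :: "nat \<Rightarrow> nat \<Rightarrow> real \<Rightarrow> (nat list \<Rightarrow> real) \<Rightarrow> (nat \<Rightarrow> real) \<Rightarrow> real" where
  "pen1 p N s \<equiv> pen p N s (ones N)"

abbreviation mag :: "nat \<Rightarrow> (nat \<Rightarrow> real) \<Rightarrow> real" where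
  "mag N \<sigma> \<equiv> overlap N \<sigma> (ones N)"

lemma ones_spins[simp]: "ones N \<in> spins N"
  by (auto simp: ones_def spins_def)

lemma gm_spins: assumes "\<rho> \<in> spins N" "\<sigma> \<in> spins N" shows "gm N \<rho> \<sigma> \<in> spins N"
proof -
  have "\<rho> i * \<sigma> i \<in> {-1, 1}" if "i < N" for i
    using spinsD[OF assms(1) that] spinsD[OF assms(2) that] by auto
  then show ?thesis by (auto simp: gm_def spins_def PiE_iff)
qed

lemma spins_ext: "\<sigma> \<in> spins N \<Longrightarrow> \<not> i < N \<Longrightarrow> \<sigma> i = undefined"
  by (auto simp: spins_def PiE_iff extensional_def)

lemma gm_gm: assumes "\<rho> \<in> spins N" "\<sigma> \<in> spins N" shows "gm N \<rho> (gm N \<rho> \<sigma>) = \<sigma>"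
proof
  fix i show "gm N \<rho> (gm N \<rho> \<sigma>) i = \<sigma> i"
    using spins_sq[OF assms(1), of i] spins_ext[OF assms(2), of i]
    by (cases "i < N") (simp_all add: gm_def mult.assoc[symmetric])
qed

lemma gm_ones: assumes "\<rho> \<in> spins N" shows "gm N \<rho> (ones N) = \<rho>" "gm N \<rho> \<rho> = ones N"
  using spins_sq[OF assms] spins_ext[OF assms]
  by (auto simp: gm_def ones_def fun_eq_iff)

lemma gm_bij: "\<rho> \<in> spins N \<Longrightarrow> bij_betw (gm N \<rho>) (spins N) (spins N)"
  by (rule bij_betw_byWitness[where f'="gm N \<rho>"]) (auto simp: gm_gm gm_spins)

lemma overlap_gm: assumes "\<rho> \<in> spins N" shows "overlap N (gm N \<rho> \<sigma>) (gm N \<rho> \<tau>) = overlap N \<sigma> \<tau>"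
proof -
  have "gm N \<rho> \<sigma> i * gm N \<rho> \<tau> i = \<sigma> i * \<tau> i" if "i < N" for i
  proof -
    have "gm N \<rho> \<sigma> i * gm N \<rho> \<tau> i = (\<rho> i * \<rho> i) * (\<sigma> i * \<tau> i)" using that by (simp add: gm_def)
    then show ?thesis using spins_sq[OF assms that] by simp
  qed
  then show ?thesis by (simp add: overlap_def)
qed

lemma overlap_gm_ones: "\<tau> \<in> spins N \<Longrightarrow> overlap N (gm N \<tau> \<sigma>) (ones N) = overlap N \<sigma> \<tau>"
  using overlap_gm[of \<tau> N \<sigma> \<tau>] gm_ones[of \<tau> N] by simp

lemma flip_distr:
  assumes I: "finite I" and e: "\<And>i. e i \<in> {-1, 1 :: real}"
  shows "distr disorder disorder (\<lambda>w i. if i \<in> I then e i * w i else w i) = disorder"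
proof (rule measure_eqI)
  fix A assume "A \<in> sets (distr disorder disorder (\<lambda>w i. if i \<in> I then e i * w i else w i))"
  then have A: "A \<in> sets disorder" by simp
  have m: "(\<lambda>w i. if i \<in> I then e i * w i else w i) \<in> measurable disorder disorder"
    by (rule measurable_to_disorder) simp
  have "emeasure (distr disorder disorder (\<lambda>w i. if i \<in> I then e i * w i else w i)) A
     = (\<integral>\<^sup>+w. indicator A w \<partial>distr disorder disorder (\<lambda>w i. if i \<in> I then e i * w i else w i))"
    using A by simp
  also have "\<dots> = (\<integral>\<^sup>+w. indicator A (\<lambda>i. if i \<in> I then e i * w i else w i) \<partial>disorder)"
    by (rule nn_integral_distr[OF m]) (use A in simp)
  also have "\<dots> = (\<integral>\<^sup>+w. indicator A w \<partial>disorder)"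
    by (rule gauss_flip[OF I _ e]) (use A in simp)
  also have "\<dots> = emeasure disorder A" using A by simp
  finally show "emeasure (distr disorder disorder (\<lambda>w i. if i \<in> I then e i * w i else w i)) A = emeasure disorder A" .
qed simp

text \<open>Multiplying each disorder coordinate by the product of \<open>\<rho>\<close> over its
  index tuple preserves the law and carries the energy of \<open>\<sigma>\<close> to that of the
  site-wise product \<open>gm N \<rho> \<sigma>\<close>.\<close>

lemma gauge_EE:
  assumes \<rho>: "\<rho> \<in> spins N" and m: "(\<lambda>w. F (hen p N s w)) \<in> borel_measurable disorder"
  shows "EE (\<lambda>w. F (hen p N s w)) = EE (\<lambda>w. F (\<lambda>\<sigma>. hen p N s w (gm N \<rho> \<sigma>)))"
proof -
  define e where "e i = (if i \<in> idx p N then \<Prod>j<p. \<rho> (i ! j) else 1)" for i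
  have lt: "i ! j < N" if "i \<in> idx p N" "j < p" for i j using that by (auto simp: idx_def subset_iff)
  have "(\<Prod>j<n. \<rho> (i ! j)) \<in> {-1, 1}" if "i \<in> idx p N" "n \<le> p" for n i
    using that(2)
  proof (induction n)
    case (Suc n)
    then show ?case using spinsD[OF \<rho>, of "i ! n"] lt[OF that(1), of n] by auto
  qed simp
  then have e: "e i \<in> {-1, 1}" for i by (simp add: e_def del: insert_iff) auto
  let ?f = "\<lambda>w i. if i \<in> idx p N then e i * w i else w i"
  have m1: "?f \<in> measurable disorder disorder"
    by (rule measurable_to_disorder) simp
  have h: "hen p N s (?f w) = (\<lambda>\<sigma>. hen p N s w (gm N \<rho> \<sigma>))" for w
  proof
    fix \<sigma>
    show "hen p N s (?f w) \<sigma> = hen p N s w (gm N \<rho> \<sigma>)"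
      unfolding hen_def fld_def
    proof (rule sum.cong[OF refl])
      fix i assume i: "i \<in> idx p N"
      have "(\<Prod>j<p. gm N \<rho> \<sigma> (i ! j)) = e i * (\<Prod>j<p. \<sigma> (i ! j))"
        unfolding e_def using i lt[OF i] by (simp add: gm_def prod.distrib[symmetric])
      then show "?f w i * (s * hv p N \<sigma> i) = w i * (s * hv p N (gm N \<rho> \<sigma>) i)"
        using i by (simp add: hv_def bvec_def)
    qed
  qed
  have "EE (\<lambda>w. F (hen p N s w)) = integral\<^sup>L (distr disorder disorder ?f) (\<lambda>w. F (hen p N s w))"
    by (simp only: flip_distr[OF finite_idx e])
  also have "\<dots> = EE (\<lambda>w. F (hen p N s (?f w)))" by (rule integral_distr[OF m1 m])
  finally show ?thesis unfolding h .
qed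

lemma hen_shift:
  assumes "N \<ge> 1" "p \<ge> 1"
  shows "hen p N s (\<lambda>i. if i \<in> idx p N then w i + s * hv p N \<tau> i else w i) = pen p N s \<tau> w"
proof
  fix \<sigma>
  have "hen p N s (\<lambda>i. if i \<in> idx p N then w i + s * hv p N \<tau> i else w i) \<sigma>
     = hen p N s w \<sigma> + ip (idx p N) (\<lambda>i. s * hv p N \<tau> i) (\<lambda>i. s * hv p N \<sigma> i)"
    unfolding hen_def fld_def ip_def by (simp add: sum.distrib[symmetric] distrib_right)
  then show "hen p N s (\<lambda>i. if i \<in> idx p N then w i + s * hv p N \<tau> i else w i) \<sigma> = pen p N s \<tau> w \<sigma>"
    by (simp add: ip_scale ip_hv[OF assms] power2_eq_square overlap_commute[of N \<tau>])
qed

text \<open>Cameron-Martin with translation vector \<open>s * hv p N \<tau>\<close>: the normalised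
  Gibbs weight of \<open>\<tau>\<close> is the density of the disorder planted at
  \<open>\<tau>\<close>.\<close>

lemma planted_EE:
  assumes \<tau>: "\<tau> \<in> spins N" and N: "N \<ge> 1" "p \<ge> 1" and F: "\<And>e. F e \<ge> 0"
    and m: "(\<lambda>w. F (hen p N s w)) \<in> borel_measurable disorder"
  shows "EE (\<lambda>w. F (hen p N s w) * exp (hen p N s w \<tau> - s\<^sup>2 * real N / 2)) = EE (\<lambda>w. F (pen p N s \<tau> w))"
proof -
  let ?h = "\<lambda>i. s * hv p N \<tau> i"
  let ?f = "\<lambda>w i. if i \<in> idx p N then w i + s * hv p N \<tau> i else w i"
  have m1: "?f \<in> measurable disorder disorder" by (rule measurable_to_disorder) simp
  have e: "(\<Sum>i\<in>idx p N. w i * ?h i - (?h i)\<^sup>2/2) = hen p N s w \<tau> - s\<^sup>2 * real N / 2" for w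
  proof -
    have "(\<Sum>i\<in>idx p N. w i * ?h i - (?h i)\<^sup>2/2) = hen p N s w \<tau> - ip (idx p N) ?h ?h / 2"
      by (simp add: hen_def fld_def ip_def sum_subtractf sum_divide_distrib power2_eq_square)
    then show ?thesis using overlap_self[OF \<tau> N(1)]
      by (simp add: ip_scale ip_hv[OF N] power2_eq_square)
  qed
  have m2: "(\<lambda>w. ennreal (F (hen p N s w))) \<in> borel_measurable disorder" using m by simp
  have m3: "(\<lambda>w. F (pen p N s \<tau> w)) \<in> borel_measurable disorder"
    using measurable_compose[OF m1 m] unfolding hen_shift[OF N] .
  have m4: "(\<lambda>w. F (hen p N s w) * exp (hen p N s w \<tau> - s\<^sup>2 * real N / 2)) \<in> borel_measurable disorder"
    by (intro borel_measurable_times m borel_measurable_exp_real) measurable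
  have "(\<integral>\<^sup>+w. ennreal (F (hen p N s w) * exp (hen p N s w \<tau> - s\<^sup>2 * real N / 2)) \<partial>disorder)
     = (\<integral>\<^sup>+w. ennreal (F (pen p N s \<tau> w)) \<partial>disorder)"
    using gauss_shift[OF finite_idx[of p N] m2, of ?h] unfolding e hen_shift[OF N] by (simp add: ennreal_mult' F)
  then show ?thesis
    using m3 m4 F by (simp add: integral_eq_nn_integral)
qed

text \<open>Writing the partition function as a sum of weights, size biasing by it is the same as
  planting at a uniformly chosen configuration.\<close>

lemma planted_avg:
  assumes N: "N \<ge> 1" "p \<ge> 1" and F: "\<And>e. F e \<ge> 0" "\<And>e. F e \<le> B"
    and m: "(\<lambda>w. F (hen p N s w)) \<in> borel_measurable disorder"
  shows "EE (\<lambda>w. F (hen p N s w) * Zs (spins N) (hen p N s w))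
     = exp (s\<^sup>2 * real N / 2) * (\<Sum>\<tau>\<in>spins N. EE (\<lambda>w. F (pen p N s \<tau> w)))"
proof -
  have tF: "tame (\<lambda>w. F (hen p N s w))" by (rule tame_bound[OF m, of B]) (use F in simp)
  have "EE (\<lambda>w. F (hen p N s w) * Zs (spins N) (hen p N s w))
     = EE (\<lambda>w. \<Sum>\<tau>\<in>spins N. F (hen p N s w) * exp (hen p N s w \<tau>))"
    by (simp add: Zs_def sum_distrib_left)
  also have "\<dots> = (\<Sum>\<tau>\<in>spins N. EE (\<lambda>w. F (hen p N s w) * exp (hen p N s w \<tau>)))"
    by (intro Bochner_Integration.integral_sum tame_integrable tame_add_mult tF tame_exp_hen)
  also have "\<dots> = (\<Sum>\<tau>\<in>spins N. exp (s\<^sup>2 * real N / 2) * EE (\<lambda>w. F (pen p N s \<tau> w)))"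
  proof (rule sum.cong[OF refl])
    fix \<tau> assume \<tau>: "\<tau> \<in> spins N"
    have "F (hen p N s w) * exp (hen p N s w \<tau>)
      = exp (s\<^sup>2 * real N / 2) * (F (hen p N s w) * exp (hen p N s w \<tau> - s\<^sup>2 * real N / 2))" for w
      by (simp add: exp_diff)
    then have "EE (\<lambda>w. F (hen p N s w) * exp (hen p N s w \<tau>))
      = exp (s\<^sup>2 * real N / 2) * EE (\<lambda>w. F (hen p N s w) * exp (hen p N s w \<tau> - s\<^sup>2 * real N / 2))"
      by (simp only: integral_mult_right_zero)
    then show "EE (\<lambda>w. F (hen p N s w) * exp (hen p N s w \<tau>)) = exp (s\<^sup>2 * real N / 2) * EE (\<lambda>w. F (pen p N s \<tau> w))"
      using planted_EE[OF \<tau> N F(1) m] by simp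
  qed
  finally show ?thesis by (simp only: sum_distrib_left)
qed

lemma planted_gauge:
  assumes \<tau>: "\<tau> \<in> spins N" and cong: "\<And>e e'. (\<And>\<sigma>. \<sigma> \<in> spins N \<Longrightarrow> e \<sigma> = e' \<sigma>) \<Longrightarrow> F e = F e'"
    and m: "\<And>d. (\<lambda>w. F (den d p N s w)) \<in> borel_measurable disorder"
  shows "EE (\<lambda>w. F (pen p N s \<tau> w)) = EE (\<lambda>w. F (\<lambda>\<sigma>. pen1 p N s w (gm N \<tau> \<sigma>)))"
proof -
  have "EE (\<lambda>w. F (pen p N s \<tau> w))
     = EE (\<lambda>w. F (\<lambda>\<sigma>. s\<^sup>2 * (real N * overlap N \<sigma> \<tau> ^ p) + hen p N s w (gm N \<tau> \<sigma>)))"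
    by (rule gauge_EE[OF \<tau>, where F="\<lambda>e. F (\<lambda>\<sigma>. s\<^sup>2 * (real N * overlap N \<sigma> \<tau> ^ p) + e \<sigma>)"]) (rule m)
  then show ?thesis unfolding overlap_gm_ones[OF \<tau>] .
qed

lemma Zs_gm: "\<rho> \<in> spins N \<Longrightarrow> Zs (spins N) (\<lambda>\<sigma>. e (gm N \<rho> \<sigma>)) = Zs (spins N) e"
  unfolding Zs_def by (rule sum.reindex_bij_betw[OF gm_bij])

lemma lZ_gm: "\<rho> \<in> spins N \<Longrightarrow> lZ (spins N) (\<lambda>\<sigma>. e (gm N \<rho> \<sigma>)) = lZ (spins N) e"
  by (simp add: lZ_def Zs_gm)

lemma gav_gm: "\<rho> \<in> spins N \<Longrightarrow> gav (spins N) (\<lambda>\<sigma>. e (gm N \<rho> \<sigma>)) (\<lambda>\<sigma>. f (gm N \<rho> \<sigma>)) = gav (spins N) e f"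
  unfolding gav_def Zs_gm
  using sum.reindex_bij_betw[OF gm_bij, of \<rho> N "\<lambda>\<sigma>. f \<sigma> * exp (e \<sigma>)"] by simp

lemma hen_gav_meas:
  "(\<lambda>w. gav S (den d p N s w) f) \<in> borel_measurable disorder"
  "(\<lambda>w. gav S (den d p N s w) (\<lambda>\<sigma>. gav S (den d p N s w) (g \<sigma>))) \<in> borel_measurable disorder"
  "(\<lambda>w. lZ S (den d p N s w)) \<in> borel_measurable disorder"
proof -
  have m: "(\<lambda>w. d \<sigma> + hen p N s w \<sigma>) \<in> borel_measurable disorder" for \<sigma> by measurable
  show "(\<lambda>w. gav S (den d p N s w) f) \<in> borel_measurable disorder"
    "(\<lambda>w. gav S (den d p N s w) (\<lambda>\<sigma>. gav S (den d p N s w) (g \<sigma>))) \<in> borel_measurable disorder"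
    "(\<lambda>w. lZ S (den d p N s w)) \<in> borel_measurable disorder"
    by (intro gav_measurable lZ_measurable m borel_measurable_const)+
qed

lemma hen_gav_meas0:
  "(\<lambda>w. gav S (hen p N s w) f) \<in> borel_measurable disorder"
  "(\<lambda>w. gav S (hen p N s w) (\<lambda>\<sigma>. gav S (hen p N s w) (g \<sigma>))) \<in> borel_measurable disorder"
  "(\<lambda>w. lZ S (hen p N s w)) \<in> borel_measurable disorder"
  using hen_gav_meas[where d="\<lambda>_. 0"] by simp_all

text \<open>The mean of F Z, for F the two-sample Gibbs average, is evaluated twice. Size biasing
  makes it a planted two-sample average; cancelling Z against one normalisation turns that sample
  into the plant. So under the planted law the plant is indistinguishable from a sample.\<close>

theorem nishimori:
  assumes N: "N \<ge> 1" "p \<ge> 1" and f0: "\<And>\<sigma> \<tau>. 0 \<le> f \<sigma> \<tau>" and f1: "\<And>\<sigma> \<tau>. f \<sigma> \<tau> \<le> 1"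
    and inv: "\<And>\<rho> \<sigma> \<tau>. \<rho> \<in> spins N \<Longrightarrow> f (gm N \<rho> \<sigma>) (gm N \<rho> \<tau>) = f \<sigma> \<tau>"
  shows "EE (\<lambda>w. gav (spins N) (pen1 p N s w) (\<lambda>\<sigma>. gav (spins N) (pen1 p N s w) (f \<sigma>)))
     = EE (\<lambda>w. gav (spins N) (pen1 p N s w) (f (ones N)))"
proof -
  let ?F = "\<lambda>e. gav (spins N) e (\<lambda>\<sigma>. gav (spins N) e (f \<sigma>))"
  define A where "A = EE (\<lambda>w. ?F (pen1 p N s w))"
  define B where "B = EE (\<lambda>w. gav (spins N) (pen1 p N s w) (f (ones N)))"
  have A\<tau>: "EE (\<lambda>w. ?F (pen p N s \<tau> w)) = A" if \<tau>: "\<tau> \<in> spins N" for \<tau>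
  proof -
    have "EE (\<lambda>w. ?F (pen p N s \<tau> w)) = EE (\<lambda>w. ?F (\<lambda>\<sigma>. pen1 p N s w (gm N \<tau> \<sigma>)))"
      by (rule planted_gauge[OF \<tau>, where F="?F"]) (auto intro!: gav_cong2 hen_gav_meas)
    moreover have inv_F: "?F (\<lambda>\<sigma>. e (gm N \<tau> \<sigma>)) = ?F e" for e
    proof -
      have "gav (spins N) (\<lambda>\<sigma>. e (gm N \<tau> \<sigma>)) (f \<sigma>) = gav (spins N) e (f (gm N \<tau> \<sigma>))" for \<sigma>
        using gav_gm[OF \<tau>, of e "f (gm N \<tau> \<sigma>)"] by (simp add: inv[OF \<tau>])
      then show ?thesis using gav_gm[OF \<tau>, of e "\<lambda>\<sigma>. gav (spins N) e (f \<sigma>)"] by simp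
    qed
    moreover have "?F (\<lambda>\<sigma>. pen1 p N s w (gm N \<tau> \<sigma>)) = ?F (pen1 p N s w)" for w
      by (rule inv_F)
    ultimately show ?thesis by (simp only: A_def)
  qed
  have B\<tau>: "EE (\<lambda>w. gav (spins N) (pen p N s \<tau> w) (f \<tau>)) = B" if \<tau>: "\<tau> \<in> spins N" for \<tau>
  proof -
    have "EE (\<lambda>w. gav (spins N) (pen p N s \<tau> w) (f \<tau>)) = EE (\<lambda>w. gav (spins N) (\<lambda>\<sigma>. pen1 p N s w (gm N \<tau> \<sigma>)) (f \<tau>))"
      by (rule planted_gauge[OF \<tau>, where F="\<lambda>e. gav (spins N) e (f \<tau>)"]) (auto intro!: gav_cong2 hen_gav_meas)
    moreover have inv_F: "gav (spins N) (\<lambda>\<sigma>. e (gm N \<tau> \<sigma>)) (f \<tau>) = gav (spins N) e (f (ones N))" for e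
      using gav_gm[OF \<tau>, of e "f (ones N)"] inv[OF \<tau>, of \<tau>] gm_ones[OF \<tau>] by simp
    moreover have "gav (spins N) (\<lambda>\<sigma>. pen1 p N s w (gm N \<tau> \<sigma>)) (f \<tau>) = gav (spins N) (pen1 p N s w) (f (ones N))" for w
      by (rule inv_F)
    ultimately show ?thesis by (simp only: B_def)
  qed
  have gb: "0 \<le> gav (spins N) e (f \<sigma>)" "gav (spins N) e (f \<sigma>) \<le> 1" for e \<sigma>
    using f0 f1 by (auto intro: gav_nonneg gav_le)
  have "EE (\<lambda>w. ?F (hen p N s w) * Zs (spins N) (hen p N s w)) = exp (s\<^sup>2 * real N / 2) * (\<Sum>\<tau>\<in>spins N. EE (\<lambda>w. ?F (pen p N s \<tau> w)))"
    by (rule planted_avg[OF N, where B=1]) (auto intro!: gav_nonneg gav_le gb hen_gav_meas0)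
  also have "\<dots> = exp (s\<^sup>2 * real N / 2) * (2 ^ N * A)" by (simp add: A\<tau> card_spins)
  finally have 1: "EE (\<lambda>w. ?F (hen p N s w) * Zs (spins N) (hen p N s w)) = exp (s\<^sup>2 * real N / 2) * (2 ^ N * A)" .
  \<comment> \<open>Second evaluation: the factor Z cancels the normalisation of the outer average,
    and the outer sample \<open>\<tau>\<close> becomes the plant.\<close>
  have "EE (\<lambda>w. ?F (hen p N s w) * Zs (spins N) (hen p N s w))
     = EE (\<lambda>w. \<Sum>\<tau>\<in>spins N. gav (spins N) (hen p N s w) (f \<tau>) * exp (hen p N s w \<tau>))"
    unfolding gav_def[of _ _ "\<lambda>\<sigma>. gav _ _ (f \<sigma>)"] using Zs_pos[OF finite_spins spins_ne, of N] by (simp add: less_imp_neq[symmetric])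
  also have "\<dots> = (\<Sum>\<tau>\<in>spins N. EE (\<lambda>w. gav (spins N) (hen p N s w) (f \<tau>) * exp (hen p N s w \<tau>)))"
    by (intro Bochner_Integration.integral_sum tame_integrable tame_add_mult tame_exp_hen
        tame_bound[OF hen_gav_meas0(1), where B=1]) (use gb in simp)
  also have "\<dots> = (\<Sum>\<tau>\<in>spins N. exp (s\<^sup>2 * real N / 2) * B)"
  proof (rule sum.cong[OF refl])
    fix \<tau> assume \<tau>: "\<tau> \<in> spins N"
    have "gav (spins N) (hen p N s w) (f \<tau>) * exp (hen p N s w \<tau>)
      = exp (s\<^sup>2 * real N / 2) * (gav (spins N) (hen p N s w) (f \<tau>) * exp (hen p N s w \<tau> - s\<^sup>2 * real N / 2))" for w
      by (simp add: exp_diff)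
    then have "EE (\<lambda>w. gav (spins N) (hen p N s w) (f \<tau>) * exp (hen p N s w \<tau>))
      = exp (s\<^sup>2 * real N / 2) * EE (\<lambda>w. gav (spins N) (hen p N s w) (f \<tau>) * exp (hen p N s w \<tau> - s\<^sup>2 * real N / 2))"
      by (simp only: integral_mult_right_zero)
    also have "EE (\<lambda>w. gav (spins N) (hen p N s w) (f \<tau>) * exp (hen p N s w \<tau> - s\<^sup>2 * real N / 2)) = B"
      using planted_EE[OF \<tau> N, of "\<lambda>e. gav (spins N) e (f \<tau>)" s] gb hen_gav_meas0(1) B\<tau>[OF \<tau>] by simp
    finally show "EE (\<lambda>w. gav (spins N) (hen p N s w) (f \<tau>) * exp (hen p N s w \<tau>)) = exp (s\<^sup>2 * real N / 2) * B" .
  qed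
  also have "\<dots> = exp (s\<^sup>2 * real N / 2) * (2 ^ N * B)" by (simp add: card_spins)
  finally have "A = B" using 1 by simp
  then show ?thesis by (simp add: A_def B_def)
qed

text \<open>Under the planted law the disorder has density \<open>Z / E Z\<close>. If \<open>log Z\<close> is close to
  \<open>log E Z\<close> with substantial probability under the null law, then the planted law charges the same
  event with probability at least \<open>exp (-o(N))\<close>; concentration of \<open>log Z\<close> under the
  planted law then forces its planted mean to be close to \<open>log E Z\<close> as well.\<close>

lemma planted_upper:
  fixes p N :: nat and s x V :: real
  defines "P \<equiv> PS p N (spins N) s (\<lambda>_. 0)"
    and "Q \<equiv> PS p N (spins N) s (\<lambda>\<sigma>. s\<^sup>2 * (real N * mag N \<sigma> ^ p))"
  assumes N: "N \<ge> 1" "p \<ge> 1" and V: "s\<^sup>2 * real N \<le> V" "V > 0" and x: "x \<ge> 0" "exp (- x\<^sup>2 / (4 * V)) \<le> 1/4"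
    and s: "s \<ge> 0"
  shows "Q - P - x \<le> 2 * sqrt (V * ((real N * ln 2 + s\<^sup>2 * real N / 2 - P) + x + ln 2))"
proof (cases "Q - P - x > 0")
  case False
  have "fN p N s \<le> s\<^sup>2/2" by (rule fN_le(1)[OF N s])
  then have "P / real N - ln 2 \<le> s\<^sup>2/2" unfolding fN_def P_def .
  then have "P / real N \<le> s\<^sup>2/2 + ln 2" by linarith
  then have "P \<le> (s\<^sup>2/2 + ln 2) * real N" using N by (simp add: pos_divide_le_eq)
  then have "0 \<le> real N * ln 2 + s\<^sup>2 * real N / 2 - P" by (simp add: algebra_simps)
  moreover have "ln 2 \<ge> (0::real)" by simp
  ultimately have "0 \<le> V * ((real N * ln 2 + s\<^sup>2 * real N / 2 - P) + x + ln 2)"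
    using V x by (intro mult_nonneg_nonneg) auto
  then have "0 \<le> 2 * sqrt (V * ((real N * ln 2 + s\<^sup>2 * real N / 2 - P) + x + ln 2))" by simp
  then show ?thesis using False by linarith
next
  case True
  \<comment> \<open>Gap between log E Z and the mean of log Z; the planted probability of the
    typical null event is at least exp (-D - x) / 2.\<close>
  define D where "D = real N * ln 2 + s\<^sup>2 * real N / 2 - P"
  let ?X = "\<lambda>w. lZ (spins N) (\<lambda>\<sigma>. 0 + hen p N s w \<sigma>)"
  have mX: "?X \<in> borel_measurable disorder" by (rule hen_gav_meas(3))
  define A where "A = {w. P - x \<le> ?X w \<and> ?X w \<le> P + x}"
  have A: "A \<in> sets disorder" unfolding A_def by (rule disorder_Collect) (use mX in measurable)
  have "1 = measure disorder UNIV" using D.prob_space by simp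
  also have "\<dots> \<le> measure disorder (A \<union> ({w. ?X w \<ge> P + x} \<union> {w. ?X w \<le> P - x}))"
    by (intro D.finite_measure_mono sets.Un A disorder_Collect) (use mX in \<open>auto simp: A_def\<close>)
  also have "\<dots> \<le> measure disorder A + (measure disorder {w. ?X w \<ge> P + x} + measure disorder {w. ?X w \<le> P - x})"
    by (intro order_trans[OF measure_Un_le] add_mono measure_Un_le sets.Un A disorder_Collect order_refl) (use mX in measurable)
  also have "\<dots> \<le> measure disorder A + (1/4 + 1/4)"
    using PS_conc[OF order_refl spins_ne N V x(1), of "\<lambda>_. 0"] x(2) unfolding P_def by (intro add_mono) auto
  finally have mA: "1/2 \<le> measure disorder A" by simp
  let ?F = "\<lambda>e. if lZ (spins N) e \<le> P + x then 1 else 0 :: real"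
  define q where "q = measure disorder {w. lZ (spins N) (pen1 p N s w) \<le> P + x}"
  have mF: "(\<lambda>w. ?F (den d p N s w)) \<in> borel_measurable disorder" for d
    using hen_gav_meas(3)[of "spins N" d p N s] by measurable
  have q\<tau>: "EE (\<lambda>w. ?F (pen p N s \<tau> w)) = q" if \<tau>: "\<tau> \<in> spins N" for \<tau>
  proof -
    have "EE (\<lambda>w. ?F (pen p N s \<tau> w)) = EE (\<lambda>w. ?F (\<lambda>\<sigma>. pen1 p N s w (gm N \<tau> \<sigma>)))"
    proof (rule planted_gauge[OF \<tau>, where F="?F"])
      fix e e' :: "(nat \<Rightarrow> real) \<Rightarrow> real" assume "\<And>\<sigma>. \<sigma> \<in> spins N \<Longrightarrow> e \<sigma> = e' \<sigma>"
      then have "lZ (spins N) e = lZ (spins N) e'" by (rule lZ_cong)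
      then show "?F e = ?F e'" by simp
    qed (rule mF)
    also have "\<dots> = EE (indicator {w. lZ (spins N) (pen1 p N s w) \<le> P + x})"
    proof (rule Bochner_Integration.integral_cong[OF refl])
      fix w
      have "lZ (spins N) (\<lambda>\<sigma>. pen1 p N s w (gm N \<tau> \<sigma>)) = lZ (spins N) (pen1 p N s w)"
        by (rule lZ_gm[OF \<tau>])
      then show "?F (\<lambda>\<sigma>. pen1 p N s w (gm N \<tau> \<sigma>)) = indicator {w. lZ (spins N) (pen1 p N s w) \<le> P + x} w"
        by (simp add: indicator_def)
    qed
    also have "\<dots> = q" unfolding q_def by simp
    finally show ?thesis .
  qed
  have "exp (P - x) * (1/2) \<le> exp (P - x) * measure disorder A" using mA by simp
  also have "\<dots> = EE (\<lambda>w. exp (P - x) * indicator A w)" using A by simp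
  also have "\<dots> \<le> EE (\<lambda>w. ?F (hen p N s w) * Zs (spins N) (hen p N s w))"
  proof (rule integral_mono)
    show "integrable disorder (\<lambda>w. exp (P - x) * indicator A w)"
      by (intro tame_integrable tame_cmult tame_indicator A)
    have "tame (\<lambda>w. ?F (hen p N s w))"
      by (rule tame_bound[of _ 1]) (use mF[of "\<lambda>_. 0"] in auto)
    then show "integrable disorder (\<lambda>w. ?F (hen p N s w) * Zs (spins N) (hen p N s w))"
      unfolding Zs_def by (intro tame_integrable tame_add_mult tame_sum tame_exp_hen)
    fix w
    show "exp (P - x) * indicator A w \<le> ?F (hen p N s w) * Zs (spins N) (hen p N s w)"
    proof (cases "w \<in> A")
      case True
      then have "exp (P - x) \<le> exp (lZ (spins N) (hen p N s w))" by (simp add: A_def)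
      then show ?thesis using True by (simp add: A_def exp_lZ)
    qed (simp add: Zs_nonneg)
  qed
  also have "\<dots> = exp (s\<^sup>2 * real N / 2) * (\<Sum>\<tau>\<in>spins N. EE (\<lambda>w. ?F (pen p N s \<tau> w)))"
    by (rule planted_avg[OF N, where B=1]) (use mF[of "\<lambda>_. 0"] in auto)
  also have "\<dots> = exp (s\<^sup>2 * real N / 2) * (2 ^ N * q)" by (simp add: q\<tau> card_spins)
  also have "\<dots> = exp (s\<^sup>2 * real N / 2 + real N * ln 2) * q"
    by (simp add: exp_add exp_of_nat_mult)
  \<comment> \<open>From the planted side the same event is a lower deviation of log Z by Q - P -
    x.\<close>
  also have "q \<le> exp (- (Q - P - x)\<^sup>2 / (4 * V))"
    using PS_conc(2)[OF order_refl spins_ne N V, of "Q - P - x" "\<lambda>\<sigma>. s\<^sup>2 * (real N * mag N \<sigma> ^ p)"] True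
    unfolding q_def Q_def[symmetric] by simp
  finally have "exp (P - x) * (1/2) \<le> exp (s\<^sup>2 * real N / 2 + real N * ln 2) * exp (- (Q - P - x)\<^sup>2 / (4 * V))" by simp
  moreover have "exp (P - x) * (1/2) = exp (P - x - ln 2)" by (simp add: exp_diff)
  ultimately have "P - x - ln 2 \<le> s\<^sup>2 * real N / 2 + real N * ln 2 + - (Q - P - x)\<^sup>2 / (4 * V)"
    unfolding exp_add[symmetric] by simp
  then have "(Q - P - x)\<^sup>2 / (4 * V) \<le> D + x + ln 2" unfolding D_def by simp
  then have "(Q - P - x)\<^sup>2 \<le> 4 * (V * (D + x + ln 2))" using V by (simp add: pos_divide_le_eq algebra_simps)
  then have "Q - P - x \<le> sqrt (4 * (V * (D + x + ln 2)))" by (rule real_le_rsqrt)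
  then show ?thesis unfolding D_def real_sqrt_mult[of 4] by simp
qed

subsection \<open>Exponential decay of the overlap with the planted spin\<close>

text \<open>Excess per spin of the restricted planted free energy over the annealed value ln 2 +
  s^2/2. For \<open>S = spins N\<close> it is nonnegative and nondecreasing, and tends to zero where
  the null free energy is asymptotically annealed.\<close>

definition US :: "nat \<Rightarrow> nat \<Rightarrow> (nat \<Rightarrow> real) set \<Rightarrow> real \<Rightarrow> real" where
  "US p N S s = PS p N S s (\<lambda>\<sigma>. s\<^sup>2 * (real N * mag N \<sigma> ^ p)) / real N - ln 2 - s\<^sup>2/2"

abbreviation PhiN :: "nat \<Rightarrow> nat \<Rightarrow> real \<Rightarrow> real" where
  "PhiN p N \<equiv> US p N (spins N)"

definition KS :: "nat \<Rightarrow> nat \<Rightarrow> (nat \<Rightarrow> real) set \<Rightarrow> real \<Rightarrow> real" where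
  "KS p N S s = EE (\<lambda>w. gav S (pen1 p N s w) (\<lambda>\<sigma>. mag N \<sigma> ^ p))"

definition KK :: "nat \<Rightarrow> nat \<Rightarrow> (nat \<Rightarrow> real) set \<Rightarrow> real \<Rightarrow> real" where
  "KK p N S s = EE (\<lambda>w. gav S (pen1 p N s w) (\<lambda>\<sigma>. gav S (pen1 p N s w) (\<lambda>\<tau>. overlap N \<sigma> \<tau> ^ p)))"

lemma EE_add: "tame X \<Longrightarrow> tame Y \<Longrightarrow> EE (\<lambda>w. X w + Y w) = EE X + EE Y"
  by (intro Bochner_Integration.integral_add tame_integrable)

lemma EE_diff: "tame X \<Longrightarrow> tame Y \<Longrightarrow> EE (\<lambda>w. X w - Y w) = EE X - EE Y"
  by (intro Bochner_Integration.integral_diff tame_integrable)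

lemma EE_const: "EE (\<lambda>w. c) = c"
  by (simp add: D.prob_space[simplified])

lemma EE_cmult: "EE (\<lambda>w. c * X w) = c * EE X"
  by simp

lemma EE_mono: "tame X \<Longrightarrow> tame Y \<Longrightarrow> (\<And>w. X w \<le> Y w) \<Longrightarrow> EE X \<le> EE Y"
  by (intro integral_mono tame_integrable)

text \<open>The factor 2 comes from differentiating the planted weight s^2 N R^p, the minus sign
  from integration by parts in the noise. The growth argument exploits this imbalance.\<close>

lemma US_deriv:
  assumes S: "S \<subseteq> spins N" "S \<noteq> {}" and N: "N \<ge> 1" "p \<ge> 1"
  shows "(US p N S has_real_derivative s * (2 * KS p N S s - KK p N S s)) (at s)"
proof -
  have fS: "finite S" using S finite_subset finite_spins by blast
  let ?e = "\<lambda>w. pen1 p N s w"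
  have D: "((\<lambda>s. PS p N S s (\<lambda>\<sigma>. s\<^sup>2 * (real N * mag N \<sigma> ^ p))) has_real_derivative
     s * EE (\<lambda>w. gav S (?e w) (\<lambda>\<sigma>. real N + 2 * (real N * mag N \<sigma> ^ p))
        - real N * gav S (?e w) (\<lambda>\<sigma>. gav S (?e w) (\<lambda>\<tau>. overlap N \<sigma> \<tau> ^ p)))) (at s)"
    by (rule PS_deriv[OF S N])
  have "EE (\<lambda>w. gav S (?e w) (\<lambda>\<sigma>. real N + 2 * (real N * mag N \<sigma> ^ p))
        - real N * gav S (?e w) (\<lambda>\<sigma>. gav S (?e w) (\<lambda>\<tau>. overlap N \<sigma> \<tau> ^ p)))
     = EE (\<lambda>w. (real N + (2 * real N) * gav S (?e w) (\<lambda>\<sigma>. mag N \<sigma> ^ p))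
        - real N * gav S (?e w) (\<lambda>\<sigma>. gav S (?e w) (\<lambda>\<tau>. overlap N \<sigma> \<tau> ^ p)))"
    unfolding gav_add gav_const[OF fS S(2)] gav_cmult by (simp add: mult.assoc)
  also have "\<dots> = (real N + (2 * real N) * KS p N S s) - real N * KK p N S s"
    unfolding KS_def KK_def
    by (simp only: EE_diff[OF tame_add_mult(1)[OF tame_const tame_cmult[OF tame_gav_hen(1)[OF fS]]] tame_cmult[OF tame_gav_hen(2)[OF fS]]]
        EE_add[OF tame_const tame_cmult[OF tame_gav_hen(1)[OF fS]]] EE_const EE_cmult)
  finally have "((\<lambda>s. PS p N S s (\<lambda>\<sigma>. s\<^sup>2 * (real N * mag N \<sigma> ^ p)) / real N - ln 2 - s\<^sup>2/2) has_real_derivative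
     s * ((real N + (2 * real N) * KS p N S s) - real N * KK p N S s) / real N - 0 - s) (at s)"
    using D by (intro DERIV_diff DERIV_const DERIV_cdivide) (auto intro!: derivative_eq_intros)
  moreover have "s * ((real N + (2 * real N) * KS p N S s) - real N * KK p N S s) / real N - 0 - s = s * (2 * KS p N S s - KK p N S s)"
    using N by (simp add: field_simps)
  ultimately show ?thesis
    unfolding US_def[abs_def] by (simp only:)
qed

lemma KS_KK_bounds:
  assumes S: "S \<subseteq> spins N" "S \<noteq> {}" and N: "N \<ge> 1" "p \<ge> 1"
  shows "\<bar>KS p N S s\<bar> \<le> 1" "0 \<le> KK p N S s" "KK p N S s \<le> 1"
proof -
  have fS: "finite S" using S finite_subset finite_spins by blast
  have "\<bar>KS p N S s\<bar> \<le> EE (\<lambda>w. \<bar>gav S (pen1 p N s w) (\<lambda>\<sigma>. mag N \<sigma> ^ p)\<bar>)"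
    unfolding KS_def by (rule integral_abs_bound)
  also have "\<dots> \<le> EE (\<lambda>w. 1)"
    by (intro integral_mono tame_integrable tame_abs tame_gav_hen fS tame_const gav_abs_le S(2) overlap_pow_abs) (use S in auto)
  finally show "\<bar>KS p N S s\<bar> \<le> 1" by (simp add: D.prob_space[simplified])
  show "0 \<le> KK p N S s" unfolding KK_def by (rule Bochner_Integration.integral_nonneg) (rule gav_KK_nonneg[OF N])
  have "KK p N S s \<le> EE (\<lambda>w. 1)"
    unfolding KK_def by (intro integral_mono tame_integrable tame_gav_hen fS tame_const gav_KK_le S)
  then show "KK p N S s \<le> 1" by (simp add: D.prob_space[simplified])
qed

text \<open>The Nishimori identity for an affine image of R^p, clipped to [0,1]; the clipping does
  nothing on spin configurations. The planted derivative becomes s times a nonnegative two-sample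
  average.\<close>

lemma KS_spins:
  assumes N: "N \<ge> 1" "p \<ge> 1" shows "KS p N (spins N) s = KK p N (spins N) s"
proof -
  define f where "f \<sigma> \<tau> = max 0 (min 1 ((overlap N \<sigma> \<tau> ^ p + 1) / 2))" for \<sigma> \<tau>
  have f: "f \<sigma> \<tau> = (overlap N \<sigma> \<tau> ^ p + 1) / 2" if "\<sigma> \<in> spins N" "\<tau> \<in> spins N" for \<sigma> \<tau>
    using overlap_pow_abs[OF that, of p] by (simp add: f_def)
  let ?e = "\<lambda>w. pen1 p N s w"
  have "EE (\<lambda>w. gav (spins N) (?e w) (\<lambda>\<sigma>. gav (spins N) (?e w) (f \<sigma>))) = EE (\<lambda>w. gav (spins N) (?e w) (f (ones N)))"
    by (rule nishimori[OF N]) (auto simp: f_def overlap_gm)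
  moreover have "gav (spins N) (?e w) (\<lambda>\<sigma>. gav (spins N) (?e w) (f \<sigma>))
     = (1/2) * gav (spins N) (?e w) (\<lambda>\<sigma>. gav (spins N) (?e w) (\<lambda>\<tau>. overlap N \<sigma> \<tau> ^ p)) + 1/2" for w
  proof -
    have "gav (spins N) (?e w) (\<lambda>\<sigma>. gav (spins N) (?e w) (f \<sigma>))
      = gav (spins N) (?e w) (\<lambda>\<sigma>. gav (spins N) (?e w) (\<lambda>\<tau>. (1/2) * overlap N \<sigma> \<tau> ^ p + 1/2))"
      by (intro gav_cong) (simp add: f add_divide_distrib)
    then show ?thesis by (simp only: gav_add gav_cmult gav_const[OF finite_spins spins_ne])
  qed
  moreover have "gav (spins N) (?e w) (f (ones N)) = (1/2) * gav (spins N) (?e w) (\<lambda>\<sigma>. mag N \<sigma> ^ p) + 1/2" for w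
  proof -
    have "gav (spins N) (?e w) (f (ones N)) = gav (spins N) (?e w) (\<lambda>\<sigma>. (1/2) * mag N \<sigma> ^ p + 1/2)"
      by (intro gav_cong) (simp add: f add_divide_distrib overlap_commute[of N "ones N"])
    then show ?thesis by (simp only: gav_add gav_cmult gav_const[OF finite_spins spins_ne])
  qed
  moreover have "EE (\<lambda>w. (1/2) * X w + 1/2) = (1/2) * EE X + 1/2" if "tame X" for X
    using tame_integrable[OF that] by (simp add: D.prob_space[simplified])
  ultimately show ?thesis
    unfolding KS_def KK_def by (simp add: tame_gav_hen)
qed

lemma Phi_deriv:
  assumes N: "N \<ge> 1" "p \<ge> 1"
  shows "(PhiN p N has_real_derivative s * KK p N (spins N) s) (at s)"
  using US_deriv[OF order_refl spins_ne N, of s] by (simp add: KS_spins[OF N])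

lemma Phi_zero: assumes "N \<ge> 1" shows "PhiN p N 0 = 0"
proof -
  have "hen p N 0 w \<sigma> = 0" for w \<sigma> by (simp add: hen_def fld_def)
  then have "PS p N (spins N) 0 (\<lambda>\<sigma>. 0\<^sup>2 * (real N * mag N \<sigma> ^ p)) = real N * ln 2"
    unfolding PS_def by (simp add: lZ_zero card_spins D.prob_space[simplified] ln_realpow)
  then show ?thesis using assms unfolding US_def by simp
qed

lemma Phi_mono:
  assumes N: "N \<ge> 1" "p \<ge> 1" and st: "0 \<le> s" "s \<le> t" shows "PhiN p N s \<le> PhiN p N t" "0 \<le> PhiN p N s"
proof -
  have m: "PhiN p N x \<le> PhiN p N y" if "0 \<le> x" "x \<le> y" for x y
  proof (rule DERIV_nonneg_imp_nondecreasing[OF that(2)])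
    fix z assume "x \<le> z" "z \<le> y"
    then show "\<exists>d. (PhiN p N has_real_derivative d) (at z) \<and> 0 \<le> d"
      using Phi_deriv[OF N, of z] KS_KK_bounds(2)[OF order_refl spins_ne N, of z] that
      by (intro exI[of _ "z * KK p N (spins N) z"]) auto
  qed
  show "PhiN p N s \<le> PhiN p N t" by (rule m[OF st])
  show "0 \<le> PhiN p N s" using m[of 0 s] st Phi_zero[OF N(1), of p] by simp
qed

lemma exp_neg_lim: "k > 0 \<Longrightarrow> (\<lambda>N. exp (- k * real N)) \<longlonglongrightarrow> 0"
proof -
  assume k: "k > 0"
  have "(\<lambda>N. exp (- k) ^ N) \<longlonglongrightarrow> 0" by (rule LIMSEQ_power_zero) (use k in simp)
  then show ?thesis by (simp add: exp_of_nat_mult[symmetric] mult.commute)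
qed

lemma ev_exp_neg_le: "k > 0 \<Longrightarrow> e > 0 \<Longrightarrow> \<forall>\<^sub>F N in sequentially. exp (- k * real N) \<le> e"
  using order_tendstoD(2)[OF exp_neg_lim, of k e] by (auto elim: eventually_mono)

text \<open>Deviations of size \<delta> N have exponentially small probability, so
  \<open>planted_upper\<close> is applied with \<open>x = \<delta> * real N\<close>; mere
  convergence of the null free energy then suffices.\<close>

lemma Phi_tendsto:
  assumes p: "p \<ge> 1" and t: "t > 0" and L: "(\<lambda>N. fN p N t) \<longlonglongrightarrow> t\<^sup>2/2" and \<epsilon>: "\<epsilon> > 0"
  shows "\<forall>\<^sub>F N in sequentially. PhiN p N t \<le> \<epsilon>"
proof -
  \<comment> \<open>Three error terms of size \<delta> N stand under the root, and 48 = 3 * 16 makes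
    2 sqrt (3 \<delta> t^2) at most \<epsilon>/2.\<close>
  define \<delta> where "\<delta> = min (\<epsilon> / 2) (\<epsilon>\<^sup>2 / (48 * t\<^sup>2))"
  have \<delta>: "\<delta> > 0" "\<delta> \<le> \<epsilon>/2" "\<delta> \<le> \<epsilon>\<^sup>2 / (48 * t\<^sup>2)" using \<epsilon> t by (auto simp: \<delta>_def)
  have "\<forall>\<^sub>F N in sequentially. t\<^sup>2/2 - \<delta> < fN p N t"
    by (rule order_tendstoD(1)[OF L]) (use \<delta> in simp)
  moreover have "\<forall>\<^sub>F N in sequentially. ln 2 / real N < \<delta>"
    by (rule order_tendstoD(2)[OF lim_const_over_n \<delta>(1)])
  moreover have "\<forall>\<^sub>F N in sequentially. exp (- (\<delta>\<^sup>2 / (4 * t\<^sup>2)) * real N) \<le> 1/4"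
    by (rule ev_exp_neg_le) (use \<delta> t in auto)
  ultimately show ?thesis using eventually_ge_at_top[of 1]
  proof eventually_elim
    case (elim N)
    note N = elim(4) p
    define P where "P = PS p N (spins N) t (\<lambda>_. 0)"
    define Q where "Q = PS p N (spins N) t (\<lambda>\<sigma>. t\<^sup>2 * (real N * mag N \<sigma> ^ p))"
    define V where "V = t\<^sup>2 * real N"
    define x where "x = \<delta> * real N"
    have n: "real N > 0" using N by simp
    have V: "V > 0" using n t by (simp add: V_def)
    have xx: "- x\<^sup>2 / (4 * V) = - (\<delta>\<^sup>2 / (4 * t\<^sup>2)) * real N"
      using n t by (simp add: x_def V_def power2_eq_square)
    have "Q - P - x \<le> 2 * sqrt (V * ((real N * ln 2 + t\<^sup>2 * real N / 2 - P) + x + ln 2))"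
      unfolding P_def Q_def
      by (rule planted_upper[OF N]) (use V elim(3) xx n \<delta> t in \<open>auto simp: V_def x_def\<close>)
    also have "\<dots> \<le> 2 * sqrt (V * (\<delta> * real N + \<delta> * real N + \<delta> * real N))"
    proof -
      have "P = (fN p N t + ln 2) * real N" using n by (simp add: fN_def P_def)
      then have "real N * ln 2 + t\<^sup>2 * real N / 2 - P = (t\<^sup>2/2 - fN p N t) * real N" by (simp add: algebra_simps)
      also have "\<dots> \<le> \<delta> * real N" using elim(1) n by (intro mult_right_mono) auto
      finally have 1: "real N * ln 2 + t\<^sup>2 * real N / 2 - P \<le> \<delta> * real N" .
      have 2: "ln 2 \<le> \<delta> * real N" using elim(2) n by (simp add: pos_divide_less_eq)
      show ?thesis using 1 2 V by (intro mult_left_mono real_sqrt_le_mono) (auto simp: x_def)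
    qed
    also have "V * (\<delta> * real N + \<delta> * real N + \<delta> * real N) = (3 * \<delta> * t\<^sup>2) * (real N)\<^sup>2"
      by (simp add: V_def power2_eq_square)
    also have "2 * sqrt ((3 * \<delta> * t\<^sup>2) * (real N)\<^sup>2) \<le> 2 * sqrt ((\<epsilon>/4)\<^sup>2 * (real N)\<^sup>2)"
    proof -
      have "\<delta> * t\<^sup>2 \<le> \<epsilon>\<^sup>2 / 48" using \<delta>(3) t by (simp add: pos_le_divide_eq mult.commute mult.left_commute)
      then have "3 * \<delta> * t\<^sup>2 \<le> (\<epsilon>/4)\<^sup>2" by (simp add: power_divide)
      then show ?thesis by (intro mult_left_mono real_sqrt_le_mono mult_right_mono) auto
    qed
    also have "\<dots> = \<epsilon>/2 * real N" using \<epsilon> n by (simp add: power_mult_distrib[symmetric])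
    finally have "Q \<le> P + (\<delta> + \<epsilon>/2) * real N" by (simp add: x_def algebra_simps)
    then have "Q / real N \<le> P / real N + (\<delta> + \<epsilon>/2)" using n by (simp add: pos_divide_le_eq algebra_simps)
    moreover have "P / real N - ln 2 \<le> t\<^sup>2/2" using fN_le(1)[OF N, of t] t unfolding fN_def P_def by simp
    ultimately show "PhiN p N t \<le> \<epsilon>" unfolding US_def Q_def[symmetric] using \<delta>(2) by linarith
  qed
qed

lemma US_le: "S \<subseteq> spins N \<Longrightarrow> S \<noteq> {} \<Longrightarrow> US p N S s \<le> PhiN p N s"
proof -
  assume S: "S \<subseteq> spins N" "S \<noteq> {}"
  then have "finite S" using finite_subset finite_spins by blast
  then have "PS p N S s d \<le> PS p N (spins N) s d" for d
    unfolding PS_def by (intro integral_mono tame_integrable tame_lZ_hen lZ_subset) (use S in auto)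
  then show ?thesis unfolding US_def by (simp add: divide_right_mono)
qed

text \<open>\<open>r\<close> is the logarithm of the Gibbs weight of \<open>S\<close>. Each of its
  two log-partition functions may deviate by \<delta> N / 2, whence 16 = 4 * 4 in the rate and the
  prefactor 2.\<close>

lemma ratio_conc:
  assumes S: "S \<subseteq> spins N" "S \<noteq> {}" and N: "N \<ge> 1" "p \<ge> 1" and s: "0 \<le> s" "s \<le> T" "T > 0" and \<delta>: "\<delta> > 0"
  defines "r \<equiv> \<lambda>w. lZ S (pen1 p N s w) - lZ (spins N) (pen1 p N s w)"
  shows "measure disorder {w. r w \<le> real N * (US p N S s - PhiN p N s) - \<delta> * real N} \<le> 2 * exp (- (\<delta>\<^sup>2 / (16 * T\<^sup>2)) * real N)"
    "measure disorder {w. r w \<ge> real N * (US p N S s - PhiN p N s) + \<delta> * real N} \<le> 2 * exp (- (\<delta>\<^sup>2 / (16 * T\<^sup>2)) * real N)"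
proof -
  define V where "V = T\<^sup>2 * real N"
  define x where "x = \<delta> * real N / 2"
  let ?d = "\<lambda>\<sigma>. s\<^sup>2 * (real N * mag N \<sigma> ^ p)"
  let ?A = "\<lambda>w. lZ S (pen1 p N s w)" and ?B = "\<lambda>w. lZ (spins N) (pen1 p N s w)"
  define P where "P = PS p N S s ?d"
  define Q where "Q = PS p N (spins N) s ?d"
  have n: "real N > 0" using N by simp
  have V: "s\<^sup>2 * real N \<le> V" "V > 0" using n s by (auto simp: V_def intro!: mult_right_mono power_mono)
  have x: "x \<ge> 0" using \<delta> by (simp add: x_def)
  have ex: "- x\<^sup>2 / (4 * V) = - (\<delta>\<^sup>2 / (16 * T\<^sup>2)) * real N"
    using n s by (simp add: x_def V_def power2_eq_square field_simps)
  note C1 = PS_conc[OF S N V x, of ?d, folded P_def, unfolded ex]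
  note C2 = PS_conc[OF order_refl spins_ne N V x, of ?d, folded Q_def, unfolded ex]
  have mA: "?A \<in> borel_measurable disorder" "?B \<in> borel_measurable disorder"
    by (rule hen_gav_meas)+
  have PQ: "real N * (US p N S s - PhiN p N s) = P - Q"
    using n unfolding US_def P_def Q_def by (simp add: diff_divide_distrib[symmetric])
  have "measure disorder {w. r w \<le> P - Q - \<delta> * real N} \<le> measure disorder ({w. ?A w \<le> P - x} \<union> {w. ?B w \<ge> Q + x})"
    by (intro D.finite_measure_mono sets.Un disorder_Collect) (use mA in \<open>auto simp: r_def x_def\<close>)
  also have "\<dots> \<le> measure disorder {w. ?A w \<le> P - x} + measure disorder {w. ?B w \<ge> Q + x}"
    by (intro measure_Un_le disorder_Collect) (use mA in measurable)
  finally show "measure disorder {w. r w \<le> real N * (US p N S s - PhiN p N s) - \<delta> * real N} \<le> 2 * exp (- (\<delta>\<^sup>2 / (16 * T\<^sup>2)) * real N)"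
    unfolding PQ using C1(2) C2(1) by linarith
  have "measure disorder {w. r w \<ge> P - Q + \<delta> * real N} \<le> measure disorder ({w. ?A w \<ge> P + x} \<union> {w. ?B w \<le> Q - x})"
    by (intro D.finite_measure_mono sets.Un disorder_Collect) (use mA in \<open>auto simp: r_def x_def\<close>)
  also have "\<dots> \<le> measure disorder {w. ?A w \<ge> P + x} + measure disorder {w. ?B w \<le> Q - x}"
    by (intro measure_Un_le disorder_Collect) (use mA in measurable)
  finally show "measure disorder {w. r w \<ge> real N * (US p N S s - PhiN p N s) + \<delta> * real N} \<le> 2 * exp (- (\<delta>\<^sup>2 / (16 * T\<^sup>2)) * real N)"
    unfolding PQ using C1(1) C2(2) by linarith
qed

lemma EE_split:
  assumes X: "tame X" "\<And>w. X w \<le> 1" and Y: "tame Y" "\<And>w. Y w \<ge> 0" and A: "A \<in> sets disorder"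
    and le: "\<And>w. w \<notin> A \<Longrightarrow> X w \<le> Y w"
  shows "EE X \<le> EE Y + measure disorder A"
proof -
  have "EE X \<le> EE (\<lambda>w. Y w + indicator A w)"
  proof (intro integral_mono tame_integrable X Y tame_add_mult tame_indicator A)
    fix w show "X w \<le> Y w + indicator A w" using X(2)[of w] Y(2)[of w] le[of w] by (cases "w \<in> A") auto
  qed
  also have "\<dots> = EE Y + measure disorder A"
    using A tame_integrable[OF Y(1)] tame_integrable[OF tame_indicator[OF A]]
    by (simp add: Bochner_Integration.integral_add)
  finally show ?thesis .
qed

text \<open>Conditioning on \<open>S\<close> inflates averages of nonnegative functions by at most
  the inverse Gibbs weight of \<open>S\<close>.\<close>

lemma gav_restrict:
  assumes "S \<subseteq> T" "finite T" "S \<noteq> {}" "\<And>\<sigma>. \<sigma> \<in> T \<Longrightarrow> g \<sigma> \<ge> 0"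
  shows "gav S e g \<le> exp (lZ T e - lZ S e) * gav T e g"
proof -
  have fS: "finite S" "T \<noteq> {}" using assms finite_subset by auto
  have Z: "Zs S e > 0" "Zs T e > 0" using Zs_pos fS assms by auto
  have "gav S e g \<le> (\<Sum>\<sigma>\<in>T. g \<sigma> * exp (e \<sigma>)) / Zs S e"
    unfolding gav_def by (intro divide_right_mono sum_mono2) (use assms Z in auto)
  also have "\<dots> = exp (lZ T e - lZ S e) * gav T e g"
    using Z by (simp add: gav_def exp_diff exp_lZ fS assms)
  finally show ?thesis .
qed

text \<open>The rate is uniform over \<open>s\<close> up to \<open>T\<close>, because the growth
  argument integrates over an interval of \<open>s\<close>.\<close>

definition Hyp :: "nat \<Rightarrow> real \<Rightarrow> real \<Rightarrow> bool" where
  "Hyp p T a \<longleftrightarrow> (\<exists>c>0. \<exists>N0. \<forall>N\<ge>N0. \<forall>s\<in>{0..T}.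
     EE (\<lambda>w. gav (spins N) (pen1 p N s w) (\<lambda>\<sigma>. if a \<le> mag N \<sigma> ^ p then 1 else 0)) \<le> exp (- c * real N))"

text \<open>If the overlap level \<open>2a/3\<close> were not exponentially unlikely while level \<open>a\<close> is, two samples
  conditioned on level \<open>2a/3\<close> would have mutual overlap at most \<open>a < 2 (2a/3)\<close>, so the restricted
  free energy would grow in \<open>s\<close> strictly faster than the full one, which it can never exceed.\<close>

lemma growth:
  assumes p: "p \<ge> 1" and T: "0 \<le> T'" "T' < T" "T \<le> t" and L: "(\<lambda>N. fN p N t) \<longlonglongrightarrow> t\<^sup>2/2"
    and a: "a > 0" and H: "Hyp p T a"
  shows "Hyp p T' (2 * a / 3)"
proof -
  have T0: "T > 0" "t > 0" using T by auto
  from H obtain c N0 where c: "c > 0" and N0: "\<And>N s. N \<ge> N0 \<Longrightarrow> s \<in> {0..T} \<Longrightarrow>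
     EE (\<lambda>w. gav (spins N) (pen1 p N s w) (\<lambda>\<sigma>. if a \<le> mag N \<sigma> ^ p then 1 else 0)) \<le> exp (- c * real N)"
    unfolding Hyp_def by blast
  \<comment> \<open>Length of the \<open>s\<close>-interval used. The restricted free energy has
    slope at least - 3 T, so it loses at most c/16 there.\<close>
  define \<tau> where "\<tau> = min (T - T') (c / (48 * T))"
  \<comment> \<open>The guaranteed gain over the interval is (a/12) \<tau>^2, whereas starting above
    -c' and ending below c' allows a rise of at most 2 c', which is half of that gain or
    less.\<close>
  define c' where "c' = min (c / 16) (a * \<tau>\<^sup>2 / 48)"
  define \<delta> where "\<delta> = c / 16"
  \<comment> \<open>Half of the rate of the final estimate; the other half absorbs the prefactor
    3.\<close>
  define k where "k = min (c' / 2) ((c'/2)\<^sup>2 / (16 * T\<^sup>2)) / 2"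
  have \<tau>: "\<tau> > 0" "\<tau> \<le> T - T'" "3 * T * \<tau> \<le> c / 16"
  proof -
    show "\<tau> > 0" "\<tau> \<le> T - T'" using T T0 c by (auto simp: \<tau>_def)
    have "\<tau> \<le> c / (48 * T)" by (simp add: \<tau>_def)
    then show "3 * T * \<tau> \<le> c / 16" using T0 by (simp add: field_simps)
  qed
  have c': "c' > 0" "c' \<le> c/16" "c' \<le> a * \<tau>\<^sup>2 / 48" using c a \<tau> by (auto simp: c'_def)
  have \<delta>: "\<delta> > 0" using c by (simp add: \<delta>_def)
  have k: "k > 0" "2 * k \<le> c'/2" "2 * k \<le> (c'/2)\<^sup>2 / (16 * T\<^sup>2)" using c' T0 by (auto simp: k_def)
  have k2: "c / 2 > 0" "\<delta>\<^sup>2 / (16 * T\<^sup>2) > 0" using c \<delta> T0 by auto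
  have "\<forall>\<^sub>F N in sequentially. N \<ge> 1 \<and> N \<ge> N0 \<and> PhiN p N t \<le> c' \<and> exp (- (c/2) * real N) \<le> a/12
     \<and> exp (- (\<delta>\<^sup>2 / (16 * T\<^sup>2)) * real N) \<le> a/24 \<and> exp (- k * real N) \<le> 1/3"
    by (intro eventually_conj eventually_ge_at_top Phi_tendsto[OF p T0(2) L c'(1)] ev_exp_neg_le k2 k) (use a in auto)
  then obtain N1 where N1: "\<And>N. N \<ge> N1 \<Longrightarrow> N \<ge> 1 \<and> N \<ge> N0 \<and> PhiN p N t \<le> c' \<and> exp (- (c/2) * real N) \<le> a/12
     \<and> exp (- (\<delta>\<^sup>2 / (16 * T\<^sup>2)) * real N) \<le> a/24 \<and> exp (- k * real N) \<le> 1/3"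
    unfolding eventually_sequentially by blast
  have "EE (\<lambda>w. gav (spins N) (pen p N s0 (ones N) w) (\<lambda>\<sigma>. if 2 * a / 3 \<le> mag N \<sigma> ^ p then 1 else 0)) \<le> exp (- k * real N)"
    if NN: "N \<ge> N1" and s0: "s0 \<in> {0..T'}" for N s0
  proof -
    note F = N1[OF NN]
    have N: "N \<ge> 1" "p \<ge> 1" using F p by auto
    have n: "real N > 0" using N by simp
    define S where "S = {\<sigma> \<in> spins N. 2 * a / 3 \<le> mag N \<sigma> ^ p}"
    let ?e = "\<lambda>s w. pen1 p N s w"
    have ind: "gav (spins N) (?e s0 w) (\<lambda>\<sigma>. if 2 * a / 3 \<le> mag N \<sigma> ^ p then 1 else 0)
       = gav (spins N) (?e s0 w) (\<lambda>\<sigma>. if \<sigma> \<in> S then 1 else 0)" for w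
      by (intro gav_cong) (simp add: S_def)
    show ?thesis
    proof (cases "S = {}")
      case True
      have "gav (spins N) (?e s0 w) (\<lambda>\<sigma>. if \<sigma> \<in> S then 1 else 0) = 0" for w
        using True gav_const[OF finite_spins spins_ne] by simp
      then show ?thesis unfolding ind by simp
    next
      case False
      have S: "S \<subseteq> spins N" "S \<noteq> {}" using False by (auto simp: S_def)
      have fS: "finite S" using S finite_subset finite_spins by blast
      have Phi: "0 \<le> PhiN p N s" "PhiN p N s \<le> c'" if "0 \<le> s" "s \<le> T" for s
        using Phi_mono[OF N, of s t] that T F by auto
      have main: "US p N S s0 < - c'"
      proof (rule ccontr)
        assume "\<not> US p N S s0 < - c'"
        then have ge: "US p N S s0 \<ge> - c'" by simp
        have rng: "0 \<le> s \<and> s \<le> T" if "s0 \<le> s" "s \<le> s0 + \<tau>" for s using that s0 \<tau> T by auto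
        \<comment> \<open>Keeps the Gibbs weight of \<open>S\<close> above roughly exp (- c N / 4)
          on the whole interval.\<close>
        have U_low: "US p N S s \<ge> - (c/8)" if s: "s0 \<le> s" "s \<le> s0 + \<tau>" for s
        proof -
          have "US p N S s0 + (3 * T) * s0 \<le> US p N S s + (3 * T) * s"
          proof (rule DERIV_nonneg_imp_nondecreasing[OF s(1), of "\<lambda>s. US p N S s + (3 * T) * s"])
            fix x assume x: "s0 \<le> x" "x \<le> s"
            have "((\<lambda>s. US p N S s + (3 * T) * s) has_real_derivative x * (2 * KS p N S x - KK p N S x) + 3 * T) (at x)"
              by (intro DERIV_add US_deriv[OF S N]) (auto intro!: derivative_eq_intros)
            moreover have "0 \<le> x * (2 * KS p N S x - KK p N S x) + 3 * T"
            proof -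
              have "- 3 \<le> 2 * KS p N S x - KK p N S x" using KS_KK_bounds[OF S N, of x] by auto
              then have "x * (- 3) \<le> x * (2 * KS p N S x - KK p N S x)"
                using rng[of x] x s by (intro mult_left_mono) auto
              then show ?thesis using rng[of x] x s by auto
            qed
            ultimately show "\<exists>y. ((\<lambda>s. US p N S s + (3 * T) * s) has_real_derivative y) (at x) \<and> 0 \<le> y" by blast
          qed
          moreover have "3 * T * (s - s0) \<le> 3 * T * \<tau>" using s T0 by (intro mult_left_mono) auto
          ultimately show ?thesis using ge \<tau>(3) c'(2) c unfolding right_diff_distrib by linarith
        qed
        \<comment> \<open>Restricting both samples to \<open>S\<close> costs at most exp (c N / 2)
          off an unlikely event, while by Nishimori the unrestricted pair overlap has the rarity exp
          (- c N) of the plant overlap.\<close>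
        have B: "EE (\<lambda>w. gav S (?e s w) (\<lambda>\<sigma>. gav S (?e s w) (\<lambda>\<tau>. if a \<le> overlap N \<sigma> \<tau> ^ p then 1 else 0))) \<le> a / 6"
          if s: "s0 \<le> s" "s \<le> s0 + \<tau>" for s
        proof -
          let ?g = "\<lambda>\<sigma> \<tau>. if a \<le> overlap N \<sigma> \<tau> ^ p then 1 else 0 :: real"
          let ?r = "\<lambda>w. lZ S (?e s w) - lZ (spins N) (?e s w)"
          define A where "A = {w. ?r w \<le> real N * (US p N S s - PhiN p N s) - \<delta> * real N}"
          have sT: "0 \<le> s" "s \<le> T" using rng[OF s] by auto
          have A: "A \<in> sets disorder" unfolding A_def
            by (rule disorder_Collect) (use hen_gav_meas(3) in measurable)
          have gg: "0 \<le> gav S e (?g \<sigma>)" "gav S e (?g \<sigma>) \<le> 1" for S :: "(nat \<Rightarrow> real) set" and e \<sigma>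
          proof -
            show "0 \<le> gav S e (?g \<sigma>)" by (rule gav_nonneg) simp
            have "gav S e (?g \<sigma>) \<le> gav S e (\<lambda>_. 1)" by (rule gav_mono) simp
            also have "\<dots> \<le> 1" by (simp add: gav_def Zs_def)
            finally show "gav S e (?g \<sigma>) \<le> 1" .
          qed
          have "EE (\<lambda>w. gav S (?e s w) (\<lambda>\<sigma>. gav S (?e s w) (?g \<sigma>)))
             \<le> EE (\<lambda>w. exp (c/2 * real N) * gav (spins N) (?e s w) (\<lambda>\<sigma>. gav (spins N) (?e s w) (?g \<sigma>))) + measure disorder A"
          proof (rule EE_split[OF tame_gav_hen(2)[OF fS] _ tame_cmult[OF tame_gav_hen(2)[OF finite_spins]] _ A])
            show "gav S (?e s w) (\<lambda>\<sigma>. gav S (?e s w) (?g \<sigma>)) \<le> 1" for w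
              by (intro gav_le fS S gg)
            show "0 \<le> exp (c/2 * real N) * gav (spins N) (?e s w) (\<lambda>\<sigma>. gav (spins N) (?e s w) (?g \<sigma>))" for w
              by (intro mult_nonneg_nonneg gav_nonneg gg) auto
            fix w assume "w \<notin> A"
            then have "?r w > real N * (US p N S s - PhiN p N s) - \<delta> * real N" by (simp add: A_def)
            moreover have "real N * (US p N S s - PhiN p N s) \<ge> real N * (- (c/8) - c/16)"
              using U_low[OF s] Phi[OF sT] c' n by (intro mult_left_mono) auto
            ultimately have q: "lZ (spins N) (?e s w) - lZ S (?e s w) \<le> c/4 * real N"
              by (simp add: \<delta>_def algebra_simps)
            define q where "q = exp (lZ (spins N) (?e s w) - lZ S (?e s w))"
            have "gav S (?e s w) (\<lambda>\<sigma>. gav S (?e s w) (?g \<sigma>)) \<le> q * gav (spins N) (?e s w) (\<lambda>\<sigma>. gav S (?e s w) (?g \<sigma>))"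
              unfolding q_def by (rule gav_restrict[OF S(1) finite_spins S(2)]) (rule gg)
            also have "\<dots> \<le> q * gav (spins N) (?e s w) (\<lambda>\<sigma>. q * gav (spins N) (?e s w) (?g \<sigma>))"
              unfolding q_def by (intro mult_left_mono gav_mono gav_restrict[OF S(1) finite_spins S(2)]) auto
            also have "\<dots> = (q * q) * gav (spins N) (?e s w) (\<lambda>\<sigma>. gav (spins N) (?e s w) (?g \<sigma>))"
              unfolding gav_cmult by simp
            also have "q * q \<le> exp (c/2 * real N)" unfolding q_def exp_add[symmetric] using q by simp
            finally show "gav S (?e s w) (\<lambda>\<sigma>. gav S (?e s w) (?g \<sigma>))
               \<le> exp (c/2 * real N) * gav (spins N) (?e s w) (\<lambda>\<sigma>. gav (spins N) (?e s w) (?g \<sigma>))"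
              by (simp add: mult_right_mono gav_nonneg gg)
          qed
          also have "EE (\<lambda>w. exp (c/2 * real N) * gav (spins N) (?e s w) (\<lambda>\<sigma>. gav (spins N) (?e s w) (?g \<sigma>)))
             = exp (c/2 * real N) * EE (\<lambda>w. gav (spins N) (?e s w) (?g (ones N)))"
            by (subst nishimori[OF N, of ?g s, symmetric]) (auto simp: overlap_gm)
          also have "\<dots> \<le> exp (c/2 * real N) * exp (- c * real N)"
            using N0[of N s] F sT overlap_commute[of N "ones N"] by (intro mult_left_mono) auto
          also have "\<dots> = exp (- (c/2) * real N)" by (simp add: exp_add[symmetric])
          also have "\<dots> \<le> a/12" using F by blast
          also have "measure disorder A \<le> 2 * exp (- (\<delta>\<^sup>2 / (16 * T\<^sup>2)) * real N)"
            unfolding A_def by (rule ratio_conc(1)[OF S N sT T0(1) \<delta>])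
          also have "\<dots> \<le> 2 * (a/24)" using F by (intro mult_left_mono) auto
          finally show ?thesis by simp
        qed
        have "US p N S s0 - (a/12) * s0\<^sup>2 \<le> US p N S (s0 + \<tau>) - (a/12) * (s0 + \<tau>)\<^sup>2"
        proof (rule DERIV_nonneg_imp_nondecreasing[of s0 "s0 + \<tau>" "\<lambda>s. US p N S s - (a/12) * s\<^sup>2"])
          show "s0 \<le> s0 + \<tau>" using \<tau> by simp
          fix s assume s: "s0 \<le> s" "s \<le> s0 + \<tau>"
          have D: "((\<lambda>s. US p N S s - (a/12) * s\<^sup>2) has_real_derivative s * (2 * KS p N S s - KK p N S s) - (a/6) * s) (at s)"
            by (intro DERIV_diff US_deriv[OF S N]) (auto intro!: derivative_eq_intros)
          have "2 * a / 3 \<le> KS p N S s"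
          proof -
            have "EE (\<lambda>w. 2 * a / 3) \<le> KS p N S s"
              unfolding KS_def by (intro integral_mono tame_integrable tame_gav_hen tame_const fS gav_ge S) (auto simp: S_def)
            then show ?thesis by (simp add: D.prob_space[simplified])
          qed
          moreover have "KK p N S s \<le> a + a/6"
          proof -
            let ?G = "\<lambda>w. gav S (?e s w) (\<lambda>\<sigma>. gav S (?e s w) (\<lambda>\<tau>. if a \<le> overlap N \<sigma> \<tau> ^ p then 1 else 0))"
            have "KK p N S s \<le> EE (\<lambda>w. a + ?G w)"
              unfolding KK_def
            proof (intro integral_mono tame_integrable tame_add_mult tame_gav_hen tame_const fS)
              fix w
              have "gav S (?e s w) (\<lambda>\<sigma>. gav S (?e s w) (\<lambda>\<tau>. overlap N \<sigma> \<tau> ^ p))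
                \<le> gav S (?e s w) (\<lambda>\<sigma>. gav S (?e s w) (\<lambda>\<tau>. a + (if a \<le> overlap N \<sigma> \<tau> ^ p then 1 else 0)))"
              proof (intro gav_mono)
                fix \<sigma> \<tau> assume "\<sigma> \<in> S" "\<tau> \<in> S"
                then have "\<bar>overlap N \<sigma> \<tau> ^ p\<bar> \<le> 1" using S by (intro overlap_pow_abs) auto
                then show "overlap N \<sigma> \<tau> ^ p \<le> a + (if a \<le> overlap N \<sigma> \<tau> ^ p then 1 else 0)" using a by auto
              qed
              also have "\<dots> = a + ?G w" by (simp only: gav_add gav_const[OF fS S(2)])
              finally show "gav S (?e s w) (\<lambda>\<sigma>. gav S (?e s w) (\<lambda>\<tau>. overlap N \<sigma> \<tau> ^ p)) \<le> a + ?G w" .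
            qed
            also have "\<dots> = a + EE ?G"
              by (simp only: EE_add[OF tame_const tame_gav_hen(2)[OF fS]] EE_const)
            finally show ?thesis using B[OF s] by simp
          qed
          \<comment> \<open>2 (2a/3) - (a + a/6) = a/6: any level above a/2 would leave a positive
            margin before errors, and 2a/3 leaves room for the error a/6.\<close>
          ultimately have "a/6 \<le> 2 * KS p N S s - KK p N S s" by simp
          then have "s * (a/6) \<le> s * (2 * KS p N S s - KK p N S s)" using rng[OF s] by (intro mult_left_mono) auto
          then show "\<exists>y. ((\<lambda>s. US p N S s - (a/12) * s\<^sup>2) has_real_derivative y) (at s) \<and> 0 \<le> y"
            using D by (intro exI conjI) (auto simp: mult.commute)
        qed
        moreover have "(a/12) * s0\<^sup>2 + (a/12) * \<tau>\<^sup>2 \<le> (a/12) * (s0 + \<tau>)\<^sup>2"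
          using s0 \<tau> a unfolding distrib_left[symmetric] by (intro mult_left_mono) (auto simp: power2_sum)
        moreover have "US p N S (s0 + \<tau>) \<le> c'"
          using US_le[OF S, of p "s0 + \<tau>"] Phi[of "s0 + \<tau>"] rng[of "s0 + \<tau>"] \<tau> by auto
        ultimately have "(a/12) * \<tau>\<^sup>2 \<le> 2 * c'" using ge by linarith
        also have "\<dots> \<le> 2 * (a * \<tau>\<^sup>2 / 48)" using c'(3) by simp
        finally have "a * \<tau>\<^sup>2 \<le> 0" by simp
        then show False using a \<tau> by (simp add: mult_le_0_iff)
      qed
      let ?r = "\<lambda>w. lZ S (?e s0 w) - lZ (spins N) (?e s0 w)"
      define A where "A = {w. ?r w \<ge> real N * (US p N S s0 - PhiN p N s0) + c'/2 * real N}"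
      have sT: "0 \<le> s0" "s0 \<le> T" using s0 T by auto
      have A: "A \<in> sets disorder" unfolding A_def
        by (rule disorder_Collect) (use hen_gav_meas(3) in measurable)
      have i1: "gav (spins N) (?e s0 w) (\<lambda>\<sigma>. if \<sigma> \<in> S then 1 else 0) = exp (?r w)" for w
        by (rule gav_indicator[OF S(1) finite_spins spins_ne S(2)])
      have "EE (\<lambda>w. gav (spins N) (?e s0 w) (\<lambda>\<sigma>. if \<sigma> \<in> S then 1 else 0)) \<le> EE (\<lambda>w. exp (- (c'/2) * real N)) + measure disorder A"
      proof (rule EE_split[OF tame_gav_hen(1)[OF finite_spins] _ tame_const _ A])
        show "gav (spins N) (?e s0 w) (\<lambda>\<sigma>. if \<sigma> \<in> S then 1 else 0) \<le> 1" for w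
          by (rule gav_le) auto
        fix w assume "w \<notin> A"
        then have "?r w < real N * (US p N S s0 - PhiN p N s0) + c'/2 * real N" by (simp add: A_def)
        moreover have "real N * (US p N S s0 - PhiN p N s0) \<le> real N * (- c')"
          using main Phi[OF sT] n by (intro mult_left_mono) auto
        ultimately have "?r w \<le> - (c'/2) * real N" by (simp add: algebra_simps)
        then show "gav (spins N) (?e s0 w) (\<lambda>\<sigma>. if \<sigma> \<in> S then 1 else 0) \<le> exp (- (c'/2) * real N)"
          unfolding i1 by simp
      qed auto
      also have "EE (\<lambda>w. exp (- (c'/2) * real N)) = exp (- (c'/2) * real N)" by (simp add: D.prob_space[simplified])
      also have "\<dots> \<le> exp (- (2 * k) * real N)" using k(2) n by (simp add: mult_right_mono)
      also have "measure disorder A \<le> 2 * exp (- ((c'/2)\<^sup>2 / (16 * T\<^sup>2)) * real N)"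
        unfolding A_def by (rule ratio_conc(2)[OF S N sT T0(1)]) (use c' in simp)
      also have "\<dots> \<le> 2 * exp (- (2 * k) * real N)" using mult_right_mono[OF k(3), of "real N"] n by simp
      finally have "EE (\<lambda>w. gav (spins N) (?e s0 w) (\<lambda>\<sigma>. if \<sigma> \<in> S then 1 else 0)) \<le> 3 * exp (- (2 * k) * real N)" by simp
      also have "\<dots> = (3 * exp (- k * real N)) * exp (- k * real N)" by (simp add: exp_add[symmetric])
      also have "\<dots> \<le> 1 * exp (- k * real N)" using F by (intro mult_right_mono) auto
      finally show ?thesis unfolding ind by simp
    qed
  qed
  then show ?thesis unfolding Hyp_def using k(1) by blast
qed

text \<open>Overlap powers never exceed 1, so the level 3/2 starts the descent; the rate 1 is
  arbitrary.\<close>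

lemma Hyp_base: "Hyp p T (3/2)"
  unfolding Hyp_def
proof (intro exI[of _ 1] conjI exI[of _ 0] allI impI ballI)
  fix N s
  have "gav (spins N) e (\<lambda>\<sigma>. if 3/2 \<le> mag N \<sigma> ^ p then 1 else 0) = gav (spins N) e (\<lambda>_. 0)" for e
  proof (rule gav_cong)
    fix \<sigma> assume "\<sigma> \<in> spins N"
    then show "(if 3/2 \<le> mag N \<sigma> ^ p then 1 else 0) = (0::real)"
      using overlap_pow_abs[of \<sigma> N "ones N" p] by auto
  qed
  then show "EE (\<lambda>w. gav (spins N) (pen1 p N s w) (\<lambda>\<sigma>. if 3/2 \<le> mag N \<sigma> ^ p then 1 else 0)) \<le> exp (- 1 * real N)"
    by (simp add: gav_const)
qed simp

lemma Hyp_power: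
  assumes p: "p \<ge> 1" and L: "(\<lambda>N. fN p N t) \<longlonglongrightarrow> t\<^sup>2/2" and T: "0 \<le> T" "T < t"
  shows "Hyp p T ((2/3) ^ n * (3/2))"
  using T
proof (induction n arbitrary: T)
  case 0
  then show ?case using Hyp_base by simp
next
  case (Suc n)
  \<comment> \<open>Each descent loses a little temperature; spending half of the remaining distance
    to \<open>t\<close> leaves room for any number of steps.\<close>
  have "Hyp p ((T + t)/2) ((2/3) ^ n * (3/2))" by (rule Suc.IH) (use Suc.prems in auto)
  then have "Hyp p T (2 * ((2/3) ^ n * (3/2)) / 3)"
    by (rule growth[OF p _ _ _ L, rotated -1]) (use Suc.prems in auto)
  then show ?case by simp
qed

theorem Hyp_all:
  assumes p: "p \<ge> 1" and L: "(\<lambda>N. fN p N t) \<longlonglongrightarrow> t\<^sup>2/2" and T: "0 \<le> T" "T < t" and a: "a > 0"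
  shows "Hyp p T a"
proof -
  obtain n where n: "(2/3::real) ^ n < a / (3/2)" using real_arch_pow_inv[of "a / (3/2)" "2/3"] a by auto
  have le: "(2/3) ^ n * (3/2) \<le> a" using n by simp
  have "EE (\<lambda>w. gav (spins N) (pen1 p N s w) (\<lambda>\<sigma>. if a \<le> mag N \<sigma> ^ p then 1 else 0))
    \<le> EE (\<lambda>w. gav (spins N) (pen1 p N s w) (\<lambda>\<sigma>. if (2/3) ^ n * (3/2) \<le> mag N \<sigma> ^ p then 1 else 0))" for N s
    by (intro integral_mono tame_integrable tame_gav_hen gav_mono) (use le in auto)
  with Hyp_power[OF p L T, of n] show ?thesis unfolding Hyp_def by (meson order_trans)
qed

subsection \<open>Moments of the overlap\<close>

lemma power_le_fact_exp: "x \<ge> 0 \<Longrightarrow> c > 0 \<Longrightarrow> x ^ m \<le> (fact m / c ^ m) * exp (c * x)" for x c :: real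
proof -
  assume x: "x \<ge> 0" and c: "c > 0"
  have "(\<lambda>n. (c * x) ^ n /\<^sub>R fact n) sums exp (c * x)" by (rule exp_converges)
  then have "(\<Sum>n\<in>{m}. (c * x) ^ n /\<^sub>R fact n) \<le> exp (c * x)"
    unfolding sums_iff using x c sum_le_suminf[of "\<lambda>n. (c * x) ^ n /\<^sub>R fact n" "{m}"] by auto
  then have "(c * x) ^ m \<le> fact m * exp (c * x)" by (simp add: field_simps)
  then show ?thesis using c by (simp add: power_mult_distrib field_simps)
qed

text \<open>Of the available exponent N R^2 / 4, one half absorbs the power of N R^2 and the other
  half remains as the room into which the planted tilt must fit.\<close>

lemma sum_overlap_moment:
  assumes \<tau>: "\<tau> \<in> spins N" and N: "N \<ge> 1"
  shows "(\<Sum>\<sigma>\<in>spins N. overlap N \<sigma> \<tau> ^ (2 * m) * exp (real N * (overlap N \<sigma> \<tau>)\<^sup>2 / 8)) \<le> 2 * fact m * 8 ^ m / real N ^ m * 2 ^ N"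
proof -
  have n: "real N > 0" using N by simp
  have "(\<Sum>\<sigma>\<in>spins N. overlap N \<sigma> \<tau> ^ (2 * m) * exp (real N * (overlap N \<sigma> \<tau>)\<^sup>2 / 8))
    \<le> (\<Sum>\<sigma>\<in>spins N. fact m * 8 ^ m / real N ^ m * exp (real N * (overlap N \<sigma> \<tau>)\<^sup>2 / 4))"
  proof (rule sum_mono)
    fix \<sigma>
    define x where "x = real N * (overlap N \<sigma> \<tau>)\<^sup>2"
    have x: "x \<ge> 0" by (simp add: x_def)
    have "x ^ m * exp (x / 8) \<le> (fact m / (1/8) ^ m) * exp ((1/8) * x) * exp (x / 8)"
      by (intro mult_right_mono power_le_fact_exp x) auto
    also have "\<dots> = fact m * 8 ^ m * exp (x / 4)" by (simp add: power_one_over mult.assoc exp_add[symmetric])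
    finally have "x ^ m * exp (x / 8) / real N ^ m \<le> fact m * 8 ^ m * exp (x / 4) / real N ^ m"
      using n by (intro divide_right_mono) auto
    moreover have "x ^ m / real N ^ m = overlap N \<sigma> \<tau> ^ (2 * m)"
      using n by (simp add: x_def power_mult_distrib power_mult)
    ultimately show "overlap N \<sigma> \<tau> ^ (2 * m) * exp (real N * (overlap N \<sigma> \<tau>)\<^sup>2 / 8) \<le> fact m * 8 ^ m / real N ^ m * exp (real N * (overlap N \<sigma> \<tau>)\<^sup>2 / 4)"
      unfolding x_def[symmetric] by (metis times_divide_eq_left)
  qed
  also have "\<dots> \<le> fact m * 8 ^ m / real N ^ m * (sqrt 2 * 2 ^ N)"
    unfolding sum_distrib_left[symmetric] by (intro mult_left_mono sum_exp_overlap_sq[OF \<tau> N]) auto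
  also have "\<dots> \<le> fact m * 8 ^ m / real N ^ m * (2 * 2 ^ N)"
    by (intro mult_left_mono mult_right_mono) (auto intro: real_le_lsqrt)
  finally show ?thesis by (simp add: mult_ac)
qed

lemma sum_overlap_moment0:
  assumes \<tau>: "\<tau> \<in> spins N" and N: "N \<ge> 1"
  shows "(\<Sum>\<sigma>\<in>spins N. overlap N \<sigma> \<tau> ^ (2 * m)) \<le> 2 * fact m * 8 ^ m / real N ^ m * 2 ^ N"
proof -
  have "(\<Sum>\<sigma>\<in>spins N. overlap N \<sigma> \<tau> ^ (2 * m) * 1) \<le> (\<Sum>\<sigma>\<in>spins N. overlap N \<sigma> \<tau> ^ (2 * m) * exp (real N * (overlap N \<sigma> \<tau>)\<^sup>2 / 8))"
    by (intro sum_mono mult_left_mono) (auto simp: power_mult)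
  then show ?thesis using sum_overlap_moment[OF assms, of m] by simp
qed

text \<open>The planted disorder has density Z / E Z with respect to the null law, which cancels 1 /
  Z; so the planted mean of 1 / Z is exactly 1 / E Z. Integrability follows by keeping only the
  plant's own weight in Z.\<close>

lemma inverse_Zs:
  assumes N: "N \<ge> 1" "p \<ge> 1"
  shows "tame (\<lambda>w. 1 / Zs (spins N) (pen1 p N s w))"
    "EE (\<lambda>w. 1 / Zs (spins N) (pen1 p N s w)) = 1 / (2 ^ N * exp (s\<^sup>2 * real N / 2))"
proof -
  have mZ: "(\<lambda>w. 1 / Zs (spins N) (den d p N s w)) \<in> borel_measurable disorder" for d
    by (intro borel_measurable_divide borel_measurable_const Zs_measurable) measurable
  have ZZ: "Zs (spins N) e > 0" for e :: "(nat \<Rightarrow> real) \<Rightarrow> real" by (rule Zs_pos) auto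
  show "tame (\<lambda>w. 1 / Zs (spins N) (pen1 p N s w))"
  proof (rule tame_dominated[OF _ mZ])
    let ?d = "s\<^sup>2 * (real N * overlap N (ones N) (ones N) ^ p)"
    show "tame (\<lambda>w. exp (- ?d) * exp (hen p N (- s) w (ones N)))" by (intro tame_cmult tame_exp_hen)
    fix w
    have "exp (pen1 p N s w (ones N)) \<le> Zs (spins N) (pen1 p N s w)"
      unfolding Zs_def by (rule member_le_sum) auto
    then have "1 / Zs (spins N) (pen1 p N s w) \<le> 1 / exp (pen1 p N s w (ones N))"
      by (intro divide_left_mono mult_pos_pos ZZ) auto
    also have "\<dots> = exp (- ?d) * exp (hen p N (- s) w (ones N))"
      by (simp add: hen_hamil exp_add[symmetric] exp_minus[symmetric] inverse_eq_divide[symmetric])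
    finally show "\<bar>1 / Zs (spins N) (pen1 p N s w)\<bar> \<le> \<bar>exp (- ?d) * exp (hen p N (- s) w (ones N))\<bar>"
      using ZZ[of "pen1 p N s w"] by simp
  qed
  define q where "q = EE (\<lambda>w. 1 / Zs (spins N) (pen1 p N s w))"
  let ?g = "\<lambda>\<tau> w. 1 / Zs (spins N) (hen p N s w) * exp (hen p N s w \<tau>)"
  have t: "EE (?g \<tau>) = exp (s\<^sup>2 * real N / 2) * q" if \<tau>: "\<tau> \<in> spins N" for \<tau>
  proof -
    have "?g \<tau> w = exp (s\<^sup>2 * real N / 2) * (1 / Zs (spins N) (hen p N s w) * exp (hen p N s w \<tau> - s\<^sup>2 * real N / 2))" for w
      by (simp add: exp_diff)
    then have "EE (?g \<tau>) = exp (s\<^sup>2 * real N / 2) * EE (\<lambda>w. 1 / Zs (spins N) (hen p N s w) * exp (hen p N s w \<tau> - s\<^sup>2 * real N / 2))"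
      by (simp only: EE_cmult)
    also have "EE (\<lambda>w. 1 / Zs (spins N) (hen p N s w) * exp (hen p N s w \<tau> - s\<^sup>2 * real N / 2))
       = EE (\<lambda>w. 1 / Zs (spins N) (pen p N s \<tau> w))"
      by (rule planted_EE[OF \<tau> N, where F="\<lambda>e. 1 / Zs (spins N) e"]) (use mZ[of "\<lambda>_. 0"] in \<open>auto simp: Zs_nonneg\<close>)
    also have "\<dots> = EE (\<lambda>w. 1 / Zs (spins N) (\<lambda>\<sigma>. pen1 p N s w (gm N \<tau> \<sigma>)))"
      by (rule planted_gauge[OF \<tau>, where F="\<lambda>e. 1 / Zs (spins N) e"]) (rule arg_cong[where f="\<lambda>x. 1/x"], simp add: Zs_def, rule mZ)
    also have "\<dots> = q" unfolding q_def
    proof (rule arg_cong[where f=EE], rule ext)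
      fix w show "1 / Zs (spins N) (\<lambda>\<sigma>. pen1 p N s w (gm N \<tau> \<sigma>)) = 1 / Zs (spins N) (pen1 p N s w)"
        using Zs_gm[OF \<tau>, of "pen1 p N s w"] by simp
    qed
    finally show ?thesis .
  qed
  have tg: "tame (?g \<tau>)" if \<tau>: "\<tau> \<in> spins N" for \<tau>
  proof (rule tame_bound[of _ 1])
    show "?g \<tau> \<in> borel_measurable disorder"
      using mZ[of "\<lambda>_. 0"] by (intro borel_measurable_times borel_measurable_exp_real hen_measurable) simp
    fix w
    have "exp (hen p N s w \<tau>) \<le> Zs (spins N) (hen p N s w)"
      unfolding Zs_def by (rule member_le_sum[OF \<tau>]) auto
    then show "\<bar>?g \<tau> w\<bar> \<le> 1" using ZZ[of "hen p N s w"] by (simp add: abs_mult)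
  qed
  have "1 = EE (\<lambda>w. \<Sum>\<tau>\<in>spins N. ?g \<tau> w)"
    unfolding sum_distrib_left[symmetric] Zs_def[symmetric]
    using ZZ by (simp add: less_imp_neq[symmetric] D.prob_space[simplified])
  also have "\<dots> = (\<Sum>\<tau>\<in>spins N. EE (?g \<tau>))"
    by (intro Bochner_Integration.integral_sum tame_integrable tg)
  also have "\<dots> = (\<Sum>\<tau>\<in>spins N. exp (s\<^sup>2 * real N / 2) * q)" by (intro sum.cong refl t)
  also have "\<dots> = 2 ^ N * (exp (s\<^sup>2 * real N / 2) * q)" by (simp add: card_spins)
  finally show "q = 1 / (2 ^ N * exp (s\<^sup>2 * real N / 2))" by (simp add: field_simps)
qed

text \<open>Cauchy-Schwarz under the Gibbs measure bounds the square of the average by an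
  unnormalised second moment times 1 / Z, and both factors have explicit planted means. For overlaps
  below \<epsilon> the tilt s^2 N R^p is at most N R^2 / 8, the room left in
  \<open>sum_overlap_moment\<close>.\<close>

lemma planted_moment_small:
  fixes k :: nat
  assumes N: "N \<ge> 1" and p: "p \<ge> 3" and \<epsilon>: "0 < \<epsilon>" "\<epsilon> \<le> 1" "s\<^sup>2 * \<epsilon> \<le> 1/8"
  defines "C \<equiv> 2 * fact (2 * k) * 8 ^ (2 * k) :: real"
  shows "EE (\<lambda>w. gav (spins N) (pen1 p N s w) (\<lambda>\<sigma>. if \<epsilon> ^ p \<le> mag N \<sigma> ^ p then 0 else mag N \<sigma> ^ (2 * k)))
     \<le> (C + 1) / real N ^ k"
proof -
  have n: "real N > 0" using N by simp
  have p1: "p \<ge> 1" using p by simp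
  define \<mu> where "\<mu> = 2 ^ N * exp (s\<^sup>2 * real N / 2)"
  have \<mu>: "\<mu> > 0" by (simp add: \<mu>_def)
  define g where "g \<sigma> = (if \<epsilon> ^ p \<le> mag N \<sigma> ^ p then 0 else mag N \<sigma> ^ (2 * k))" for \<sigma>
  let ?e = "\<lambda>w. pen1 p N s w"
  define d where "d \<sigma> = s\<^sup>2 * (real N * mag N \<sigma> ^ p)" for \<sigma>
  define Yu where "Yu w = (\<Sum>\<sigma>\<in>spins N. ((g \<sigma>)\<^sup>2 * exp (d \<sigma>)) * exp (hen p N s w \<sigma>))" for w
  have tY: "tame Yu" unfolding Yu_def by (intro tame_sum tame_cmult tame_exp_hen)
  have "EE Yu = (\<Sum>\<sigma>\<in>spins N. ((g \<sigma>)\<^sup>2 * exp (d \<sigma>)) * EE (\<lambda>w. exp (hen p N s w \<sigma>)))"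
    unfolding Yu_def by (subst Bochner_Integration.integral_sum) (auto intro!: tame_integrable tame_cmult tame_exp_hen)
  also have "\<dots> = exp (s\<^sup>2 * real N / 2) * (\<Sum>\<sigma>\<in>spins N. (g \<sigma>)\<^sup>2 * exp (d \<sigma>))"
    unfolding sum_distrib_left by (intro sum.cong refl) (simp only: hen_mgf[OF N p1] mult.commute)
  also have "\<dots> \<le> exp (s\<^sup>2 * real N / 2) * (C / real N ^ (2 * k) * 2 ^ N)"
  proof (intro mult_left_mono)
    have "(\<Sum>\<sigma>\<in>spins N. (g \<sigma>)\<^sup>2 * exp (d \<sigma>)) \<le> (\<Sum>\<sigma>\<in>spins N. mag N \<sigma> ^ (2 * (2 * k)) * exp (real N * (mag N \<sigma>)\<^sup>2 / 8))"
    proof (rule sum_mono)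
      fix \<sigma> assume \<sigma>: "\<sigma> \<in> spins N"
      define R where "R = mag N \<sigma>"
      have R1: "\<bar>R\<bar> \<le> 1" unfolding R_def by (rule overlap_abs[OF \<sigma>]) simp
      show "(g \<sigma>)\<^sup>2 * exp (d \<sigma>) \<le> mag N \<sigma> ^ (2 * (2 * k)) * exp (real N * (mag N \<sigma>)\<^sup>2 / 8)"
      proof (cases "\<epsilon> ^ p \<le> R ^ p")
        case True
        then have "g \<sigma> = 0" by (simp add: g_def R_def)
        then show ?thesis by (simp add: power_mult)
      next
        case False
        \<comment> \<open>Here p >= 3 enters: beyond R^2 at least one factor |R| < \<epsilon> is
          left over.\<close>
        have "R ^ p \<le> \<epsilon> * R\<^sup>2"
        proof (cases "R ^ p \<le> 0")
          case True
          then show ?thesis using \<epsilon> by (smt (verit) mult_nonneg_nonneg zero_le_power2)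
        next
          case pos: False
          then have Rp: "\<bar>R\<bar> ^ p = R ^ p" by (simp add: power_abs[symmetric])
          have "\<bar>R\<bar> < \<epsilon>"
          proof (rule ccontr)
            assume "\<not> \<bar>R\<bar> < \<epsilon>"
            then have "\<epsilon> ^ p \<le> \<bar>R\<bar> ^ p" using \<epsilon> by (intro power_mono) auto
            then show False using False Rp by simp
          qed
          have "\<bar>R\<bar> ^ p = \<bar>R\<bar> ^ (p - 2) * \<bar>R\<bar> ^ 2" 
            unfolding power_add[symmetric] using p by (intro arg_cong[where f="power \<bar>R\<bar>"]) simp
          also have "\<bar>R\<bar> ^ (p - 2) \<le> \<bar>R\<bar> ^ 1" using p R1 by (intro power_decreasing) auto
          finally have "\<bar>R\<bar> ^ p \<le> \<bar>R\<bar> * R\<^sup>2" by (simp add: mult_right_mono)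
          also have "\<dots> \<le> \<epsilon> * R\<^sup>2" using \<open>\<bar>R\<bar> < \<epsilon>\<close> by (intro mult_right_mono) auto
          finally show ?thesis using Rp by simp
        qed
        then have "s\<^sup>2 * (real N * R ^ p) \<le> s\<^sup>2 * (real N * (\<epsilon> * R\<^sup>2))" using n by (intro mult_left_mono) auto
        also have "\<dots> = (s\<^sup>2 * \<epsilon>) * (real N * R\<^sup>2)" by (simp add: mult_ac)
        also have "\<dots> \<le> (1/8) * (real N * R\<^sup>2)" using \<epsilon>(3) n by (intro mult_right_mono) auto
        finally have "exp (d \<sigma>) \<le> exp (real N * R\<^sup>2 / 8)" by (simp add: d_def R_def)
        moreover have "(g \<sigma>)\<^sup>2 = R ^ (2 * (2 * k))" using False by (simp add: g_def R_def power_mult[symmetric] mult.commute)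
        ultimately show ?thesis unfolding R_def[symmetric] by (simp add: mult_left_mono power_mult)
      qed
    qed
    also have "\<dots> \<le> C / real N ^ (2 * k) * 2 ^ N" unfolding C_def by (rule sum_overlap_moment[OF ones_spins N])
    finally show "(\<Sum>\<sigma>\<in>spins N. (g \<sigma>)\<^sup>2 * exp (d \<sigma>)) \<le> C / real N ^ (2 * k) * 2 ^ N" .
  qed simp
  finally have EY: "EE Yu \<le> \<mu> * (C / real N ^ (2 * k))" by (simp add: \<mu>_def mult_ac)
  \<comment> \<open>Balances the two factors: their means are of order \<mu> N^(-2k) and 1 / \<mu>,
    so both weighted terms become of order N^(-k).\<close>
  define l where "l = real N ^ k / \<mu>"
  have l: "l > 0" using n \<mu> by (simp add: l_def)
  have le: "gav (spins N) (?e w) g \<le> l * Yu w + (1/l) * (1 / Zs (spins N) (?e w))" for w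
  proof -
    define Z where "Z = Zs (spins N) (?e w)"
    have Z: "Z > 0" unfolding Z_def by (rule Zs_pos) auto
    have y0: "Yu w \<ge> 0" unfolding Yu_def by (intro sum_nonneg) auto
    have "(gav (spins N) (?e w) g)\<^sup>2 \<le> gav (spins N) (?e w) (\<lambda>\<sigma>. (g \<sigma>)\<^sup>2)" by (rule gav_sq_le) auto
    also have "\<dots> = Yu w * (1/Z)"
      unfolding gav_def Yu_def Z_def d_def by (simp add: exp_add mult.assoc)
    also have "\<dots> = (l * Yu w) * ((1/l) * (1/Z))" using l by simp
    also have "\<dots> \<le> (l * Yu w + (1/l) * (1/Z))\<^sup>2"
    proof -
      have ab: "a * b \<le> (a + b)\<^sup>2" if "a \<ge> 0" "b \<ge> 0" for a b :: real
        using that by (simp add: power2_sum add_increasing)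
      show ?thesis by (rule ab) (use l y0 Z in auto)
    qed
    finally show ?thesis unfolding Z_def[symmetric]
      by (rule power2_le_imp_le) (use l y0 Z in simp)
  qed
  have "EE (\<lambda>w. gav (spins N) (?e w) g) \<le> EE (\<lambda>w. l * Yu w + (1/l) * (1 / Zs (spins N) (?e w)))"
    by (intro EE_mono tame_gav_hen finite_spins tame_add_mult(1) tame_cmult tY inverse_Zs[OF N p1] le)
  also have "\<dots> = l * EE Yu + (1/l) * (1 / \<mu>)"
    by (simp only: EE_add[OF tame_cmult[OF tY] tame_cmult[OF inverse_Zs(1)[OF N p1]]] EE_cmult inverse_Zs(2)[OF N p1] \<mu>_def)
  also have "\<dots> \<le> l * (\<mu> * (C / real N ^ (2 * k))) + (1/l) * (1 / \<mu>)"
    by (intro add_mono mult_left_mono order_refl EY) (use l in simp)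
  also have "\<dots> = (C + 1) / real N ^ k"
  proof -
    have lm: "l * \<mu> = real N ^ k" using \<mu> by (simp add: l_def)
    have "l * (\<mu> * (C / real N ^ (2 * k))) = (l * \<mu>) * (C / (real N ^ k * real N ^ k))"
      by (simp add: mult_2 power_add)
    also have "\<dots> = C / real N ^ k" unfolding lm using n by simp
    finally have 1: "l * (\<mu> * (C / real N ^ (2 * k))) = C / real N ^ k" .
    have "(1/l) * (1 / \<mu>) = 1 / (l * \<mu>)" by simp
    then show ?thesis unfolding 1 lm by (simp add: add_divide_distrib)
  qed
  finally show ?thesis unfolding g_def .
qed

lemma planted_moments:
  assumes p: "p \<ge> 3" and T: "T \<ge> 0" and H: "\<And>a. a > 0 \<Longrightarrow> Hyp p T a"
  shows "\<exists>C>0. \<forall>N\<ge>1. \<forall>s\<in>{0..T}. EE (\<lambda>w. gav (spins N) (pen1 p N s w) (\<lambda>\<sigma>. mag N \<sigma> ^ (2 * k))) \<le> C / real N ^ k"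
proof -
  define \<epsilon> where "\<epsilon> = min 1 (1 / (8 * (T\<^sup>2 + 1)))"
  have T1: "T\<^sup>2 + 1 > 0" by (simp add: add_nonneg_pos)
  have \<epsilon>: "0 < \<epsilon>" "\<epsilon> \<le> 1" using T1 by (auto simp: \<epsilon>_def)
  have \<epsilon>3: "s\<^sup>2 * \<epsilon> \<le> 1/8" if "s \<in> {0..T}" for s
  proof -
    have "s\<^sup>2 * \<epsilon> \<le> (T\<^sup>2 + 1) * (1 / (8 * (T\<^sup>2 + 1)))"
      using that \<epsilon> T1 by (intro mult_mono) (auto simp: \<epsilon>_def intro!: add_increasing2 power_mono)
    also have "\<dots> = 1/8" using T1 by (simp add: field_simps)
    finally show ?thesis .
  qed
  obtain c N0 where c: "c > 0" and N0: "\<And>N s. N \<ge> N0 \<Longrightarrow> s \<in> {0..T} \<Longrightarrow>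
     EE (\<lambda>w. gav (spins N) (pen1 p N s w) (\<lambda>\<sigma>. if \<epsilon> ^ p \<le> mag N \<sigma> ^ p then 1 else 0)) \<le> exp (- c * real N)"
    using H[of "\<epsilon> ^ p"] \<epsilon> unfolding Hyp_def by (meson zero_less_power)
  define C1 :: real where "C1 = 2 * fact (2 * k) * 8 ^ (2 * k)"
  \<comment> \<open>The three summands pay for small overlaps, for the exponentially rare large
    ones, and for sizes below \<open>N0\<close>, where the trivial bound 1 is used.\<close>
  define C where "C = (C1 + 1) + (fact k / c ^ k) + real N0 ^ k"
  have C1: "C1 \<ge> 0" "fact k / c ^ k \<ge> 0" using c by (auto simp: C1_def)
  have C: "C > 0" using C1 unfolding C_def by (simp add: add_pos_nonneg)
  have "EE (\<lambda>w. gav (spins N) (pen1 p N s w) (\<lambda>\<sigma>. mag N \<sigma> ^ (2 * k))) \<le> C / real N ^ k"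
    if N: "N \<ge> 1" and s: "s \<in> {0..T}" for N s
  proof -
    let ?e = "\<lambda>w. pen1 p N s w" and ?R = "\<lambda>\<sigma>. mag N \<sigma>"
    have n: "real N > 0" using N by simp
    have R1: "?R \<sigma> ^ (2 * k) \<le> 1" if "\<sigma> \<in> spins N" for \<sigma>
      using overlap_pow_abs[OF that ones_spins, of "2 * k"] by simp
    show ?thesis
    proof (cases "N \<ge> N0")
      case False
      have "EE (\<lambda>w. gav (spins N) (?e w) (\<lambda>\<sigma>. ?R \<sigma> ^ (2 * k))) \<le> EE (\<lambda>w. 1)"
        by (intro EE_mono tame_gav_hen finite_spins tame_const gav_le spins_ne R1)
      also have "\<dots> = real N ^ k / real N ^ k" unfolding EE_const using n by simp
      also have "\<dots> \<le> C / real N ^ k"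
      proof (intro divide_right_mono)
        have "real N ^ k \<le> real N0 ^ k" using False by (intro power_mono) auto
        then show "real N ^ k \<le> C" using C1 unfolding C_def by linarith
      qed (use n in auto)
      finally show ?thesis .
    next
      case True
      have "EE (\<lambda>w. gav (spins N) (?e w) (\<lambda>\<sigma>. ?R \<sigma> ^ (2 * k)))
        \<le> EE (\<lambda>w. gav (spins N) (?e w) (\<lambda>\<sigma>. if \<epsilon> ^ p \<le> ?R \<sigma> ^ p then 0 else ?R \<sigma> ^ (2 * k)) + gav (spins N) (?e w) (\<lambda>\<sigma>. if \<epsilon> ^ p \<le> ?R \<sigma> ^ p then 1 else 0))"
        unfolding gav_add[symmetric]
        by (intro EE_mono tame_gav_hen finite_spins gav_mono) (use R1 in auto)
      also have "\<dots> = EE (\<lambda>w. gav (spins N) (?e w) (\<lambda>\<sigma>. if \<epsilon> ^ p \<le> ?R \<sigma> ^ p then 0 else ?R \<sigma> ^ (2 * k))) + EE (\<lambda>w. gav (spins N) (?e w) (\<lambda>\<sigma>. if \<epsilon> ^ p \<le> ?R \<sigma> ^ p then 1 else 0))"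
        by (intro EE_add tame_gav_hen finite_spins)
      also have "\<dots> \<le> (C1 + 1) / real N ^ k + exp (- c * real N)"
        unfolding C1_def by (intro add_mono planted_moment_small[OF N p \<epsilon> \<epsilon>3[OF s]] N0[OF True s])
      also have "exp (- c * real N) \<le> (fact k / c ^ k) / real N ^ k"
      proof -
        have "real N ^ k \<le> (fact k / c ^ k) * exp (c * real N)" by (rule power_le_fact_exp) (use c in auto)
        then have "exp (- c * real N) * real N ^ k \<le> exp (- c * real N) * ((fact k / c ^ k) * exp (c * real N))"
          by (intro mult_left_mono) auto
        also have "\<dots> = fact k / c ^ k" by (simp add: exp_minus)
        finally show ?thesis using n by (subst pos_le_divide_eq) auto
      qed
      also have "(C1 + 1) / real N ^ k + (fact k / c ^ k) / real N ^ k = ((C1 + 1) + fact k / c ^ k) / real N ^ k"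
        by (rule add_divide_distrib[symmetric])
      also have "\<dots> \<le> C / real N ^ k" using n by (intro divide_right_mono) (auto simp: C_def)
      finally show ?thesis by simp
    qed
  qed
  then show ?thesis using C by blast
qed

text \<open>A spin that is independent of the disorder and uniform has the same overlap distribution with a
  Gibbs sample as with a fixed configuration.\<close>

lemma null_overlap_ones:
  assumes N: "N \<ge> 1"
  shows "EE (\<lambda>w. gav (spins N) (hen p N s w) (\<lambda>\<sigma>. mag N \<sigma> ^ (2 * m))) \<le> 2 * fact m * 8 ^ m / real N ^ m"
proof -
  let ?q = "EE (\<lambda>w. gav (spins N) (hen p N s w) (\<lambda>\<sigma>. mag N \<sigma> ^ (2 * m)))"
  have t: "tame (\<lambda>w. gav (spins N) (hen p N s w) f)" for f
    using tame_gav_hen(1)[OF finite_spins, of N "\<lambda>_. 0"] by simp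
  have q: "?q = EE (\<lambda>w. gav (spins N) (hen p N s w) (\<lambda>\<sigma>. overlap N \<sigma> \<tau> ^ (2 * m)))" if \<tau>: "\<tau> \<in> spins N" for \<tau>
  proof -
    have "?q = EE (\<lambda>w. gav (spins N) (\<lambda>\<sigma>. hen p N s w (gm N \<tau> \<sigma>)) (\<lambda>\<sigma>. mag N \<sigma> ^ (2 * m)))"
      by (rule gauge_EE[OF \<tau>, where F="\<lambda>e. gav (spins N) e (\<lambda>\<sigma>. mag N \<sigma> ^ (2 * m))"]) (rule hen_gav_meas0)
    also have "\<dots> = EE (\<lambda>w. gav (spins N) (hen p N s w) (\<lambda>\<sigma>. overlap N \<sigma> \<tau> ^ (2 * m)))"
    proof (rule arg_cong[where f=EE], rule ext)
      fix w
      have "mag N \<sigma> = overlap N (gm N \<tau> \<sigma>) \<tau>" for \<sigma>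
        using overlap_gm[OF \<tau>, of \<sigma> "ones N"] gm_ones(1)[OF \<tau>] by simp
      then show "gav (spins N) (\<lambda>\<sigma>. hen p N s w (gm N \<tau> \<sigma>)) (\<lambda>\<sigma>. mag N \<sigma> ^ (2 * m))
        = gav (spins N) (hen p N s w) (\<lambda>\<sigma>. overlap N \<sigma> \<tau> ^ (2 * m))"
        using gav_gm[OF \<tau>, of "hen p N s w" "\<lambda>\<sigma>. overlap N \<sigma> \<tau> ^ (2 * m)"] by simp
    qed
    finally show ?thesis .
  qed
  have "2 ^ N * ?q = (\<Sum>\<tau>\<in>spins N. ?q)" by (simp add: card_spins)
  also have "\<dots> = (\<Sum>\<tau>\<in>spins N. EE (\<lambda>w. gav (spins N) (hen p N s w) (\<lambda>\<sigma>. overlap N \<sigma> \<tau> ^ (2 * m))))"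
    by (intro sum.cong refl q)
  also have "\<dots> = EE (\<lambda>w. \<Sum>\<tau>\<in>spins N. gav (spins N) (hen p N s w) (\<lambda>\<sigma>. overlap N \<sigma> \<tau> ^ (2 * m)))"
    by (intro Bochner_Integration.integral_sum[symmetric] tame_integrable t)
  also have "\<dots> \<le> EE (\<lambda>w. 2 * fact m * 8 ^ m / real N ^ m * 2 ^ N)"
  proof (intro EE_mono tame_sum t tame_const)
    fix w
    have "gav (spins N) (hen p N s w) (\<lambda>\<sigma>. \<Sum>\<tau>\<in>spins N. overlap N \<sigma> \<tau> ^ (2 * m)) \<le> 2 * fact m * 8 ^ m / real N ^ m * 2 ^ N"
    proof (intro gav_le finite_spins spins_ne)
      fix \<sigma> assume "\<sigma> \<in> spins N"
      then show "(\<Sum>\<tau>\<in>spins N. overlap N \<sigma> \<tau> ^ (2 * m)) \<le> 2 * fact m * 8 ^ m / real N ^ m * 2 ^ N"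
        using sum_overlap_moment0[of \<sigma> N m] N unfolding overlap_commute[of N \<sigma>] by simp
    qed
    then show "(\<Sum>\<tau>\<in>spins N. gav (spins N) (hen p N s w) (\<lambda>\<sigma>. overlap N \<sigma> \<tau> ^ (2 * m))) \<le> 2 * fact m * 8 ^ m / real N ^ m * 2 ^ N"
      by (simp only: gav_sum)
  qed
  finally have "2 ^ N * ?q \<le> 2 ^ N * (2 * fact m * 8 ^ m / real N ^ m)"
    unfolding EE_const by (simp only: mult.commute)
  then show ?thesis by (rule mult_left_le_imp_le) simp
qed

text \<open>The planted and the null Gibbs measures built from the same noise differ by the factor
  \<open>exp (s\<^sup>2 N K)\<close>, which is bounded unless the overlap with the planted spin is atypically large.\<close>

lemma null_le_planted:
  assumes N: "N \<ge> 1" "p \<ge> 1" and k: "k \<ge> 1" and f0: "\<And>\<sigma> \<tau>. 0 \<le> f \<sigma> \<tau>" and f1: "\<And>\<sigma> \<tau>. \<sigma> \<in> spins N \<Longrightarrow> \<tau> \<in> spins N \<Longrightarrow> f \<sigma> \<tau> \<le> 1"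
  shows "gav (spins N) (hen p N s w) (\<lambda>\<sigma>. gav (spins N) (hen p N s w) (f \<sigma>))
    \<le> 2 * (real N ^ (2 * k) * gav (spins N) (hen p N s w) (\<lambda>\<sigma>. mag N \<sigma> ^ (2 * (k * p))))
      + exp (4 * s\<^sup>2) * gav (spins N) (pen1 p N s w) (\<lambda>\<sigma>. gav (spins N) (pen1 p N s w) (f \<sigma>))
      + (2 * real N) ^ (2 * k) * gav (spins N) (pen1 p N s w) (\<lambda>\<sigma>. mag N \<sigma> ^ (2 * (k * p)))"
proof -
  let ?S = "spins N" and ?h = "hen p N s w" and ?e = "pen1 p N s w"
  have n: "real N > 0" using N by simp
  have S: "finite ?S" "?S \<noteq> {}" by auto
  define K where "K \<sigma> = mag N \<sigma> ^ p" for \<sigma>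
  have K2: "K \<sigma> ^ (2 * k) = mag N \<sigma> ^ (2 * (k * p))" for \<sigma>
    by (simp add: K_def power_mult[symmetric] mult_ac)
  have gf: "gav ?S e (f \<sigma>) \<le> 1" if "\<sigma> \<in> ?S" for e \<sigma> by (intro gav_le S f1 that)
  have gf0: "0 \<le> gav ?S e (f \<sigma>)" for e \<sigma> by (intro gav_nonneg f0)
  \<comment> \<open>Marks configurations whose planted tilt s^2 N K is bounded; the others are
    charged to a high moment of K under the null measure.\<close>
  define B where "B \<sigma> = (if real N * \<bar>K \<sigma>\<bar> \<le> 1 then 1 else 0 :: real)" for \<sigma>
  have B: "1 - B \<sigma> \<le> real N ^ (2 * k) * K \<sigma> ^ (2 * k)" for \<sigma>
  proof (cases "real N * \<bar>K \<sigma>\<bar> \<le> 1")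
    case False
    then have "1 \<le> (real N * \<bar>K \<sigma>\<bar>) ^ (2 * k)" by (intro one_le_power) simp
    also have "\<dots> = real N ^ (2 * k) * K \<sigma> ^ (2 * k)" by (simp add: power_mult_distrib power_even_abs)
    finally show ?thesis using False by (simp add: B_def)
  qed (simp add: B_def power_mult)
  have B01: "0 \<le> B \<sigma>" "B \<sigma> \<le> 1" for \<sigma> by (auto simp: B_def)
  define W where "W = gav ?S ?h (\<lambda>\<sigma>. 1 - B \<sigma>)"
  have W: "W \<le> real N ^ (2 * k) * gav ?S ?h (\<lambda>\<sigma>. mag N \<sigma> ^ (2 * (k * p)))"
    unfolding W_def gav_cmult[symmetric] by (intro gav_mono order_trans[OF B]) (simp add: K2)
  have split: "gav ?S ?h (\<lambda>\<sigma>. gav ?S ?h (f \<sigma>)) \<le> 2 * W + gav ?S ?h (\<lambda>\<sigma>. gav ?S ?h (\<lambda>\<tau>. f \<sigma> \<tau> * (B \<sigma> * B \<tau>)))"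
  proof -
    have "gav ?S ?h (\<lambda>\<sigma>. gav ?S ?h (f \<sigma>)) \<le> gav ?S ?h (\<lambda>\<sigma>. gav ?S ?h (\<lambda>\<tau>. (1 - B \<sigma>) + ((1 - B \<tau>) + f \<sigma> \<tau> * (B \<sigma> * B \<tau>))))"
    proof (intro gav_mono)
      fix \<sigma> \<tau> assume "\<sigma> \<in> ?S" "\<tau> \<in> ?S"
      then show "f \<sigma> \<tau> \<le> (1 - B \<sigma>) + ((1 - B \<tau>) + f \<sigma> \<tau> * (B \<sigma> * B \<tau>))"
        using f1[of \<sigma> \<tau>] by (simp add: B_def)
    qed
    also have "\<dots> = 2 * W + gav ?S ?h (\<lambda>\<sigma>. gav ?S ?h (\<lambda>\<tau>. f \<sigma> \<tau> * (B \<sigma> * B \<tau>)))"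
      by (simp only: gav_add gav_const[OF S] W_def mult_2 add.assoc)
    finally show ?thesis .
  qed
  show ?thesis
  proof (cases "real N * \<bar>gav ?S ?e K\<bar> \<le> 1")
    case True
    define q where "q = Zs ?S ?e / Zs ?S ?h"
    have Z: "Zs ?S ?e > 0" "Zs ?S ?h > 0" by (auto intro: Zs_pos)
    \<comment> \<open>The tangent at the planted energy bounds the ratio of partition functions by
      exp (s^2 N <K>), with the planted average, which is at most exp (s^2) in this case.\<close>
    have "lZ ?S ?e + gav ?S ?e (\<lambda>\<sigma>. - (s\<^sup>2 * real N) * K \<sigma>) \<le> lZ ?S (\<lambda>\<sigma>. ?e \<sigma> + - (s\<^sup>2 * real N) * K \<sigma>)"
      by (rule lZ_tangent[OF S])
    also have "(\<lambda>\<sigma>. ?e \<sigma> + - (s\<^sup>2 * real N) * K \<sigma>) = ?h" by (simp add: K_def fun_eq_iff)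
    finally have "lZ ?S ?e - lZ ?S ?h \<le> s\<^sup>2 * (real N * gav ?S ?e K)" unfolding gav_cmult by simp
    also have "\<dots> \<le> s\<^sup>2 * 1"
    proof (intro mult_left_mono)
      have "real N * gav ?S ?e K \<le> real N * \<bar>gav ?S ?e K\<bar>" by (intro mult_left_mono) auto
      then show "real N * gav ?S ?e K \<le> 1" using True by linarith
    qed simp
    finally have "exp (lZ ?S ?e - lZ ?S ?h) \<le> exp (s\<^sup>2)" by simp
    then have q: "q \<le> exp (s\<^sup>2)" unfolding q_def using Z by (simp add: exp_diff exp_lZ)
    have q0: "q > 0" using Z by (simp add: q_def)
    \<comment> \<open>One factor compares weights pointwise on B, the other compares partition
      functions. Two samples give exp (4 s^2).\<close>
    have step: "gav ?S ?h (\<lambda>\<sigma>. g \<sigma> * B \<sigma>) \<le> (exp (s\<^sup>2) * exp (s\<^sup>2)) * gav ?S ?e g" if g: "\<And>\<sigma>. g \<sigma> \<ge> 0" for g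
    proof -
      have "gav ?S ?h (\<lambda>\<sigma>. g \<sigma> * B \<sigma>) \<le> (\<Sum>\<sigma>\<in>?S. exp (s\<^sup>2) * (g \<sigma> * exp (?e \<sigma>))) / Zs ?S ?h"
        unfolding gav_def
      proof (intro divide_right_mono sum_mono)
        fix \<sigma>
        show "g \<sigma> * B \<sigma> * exp (?h \<sigma>) \<le> exp (s\<^sup>2) * (g \<sigma> * exp (?e \<sigma>))"
        proof (cases "real N * \<bar>K \<sigma>\<bar> \<le> 1")
          case True
          have "- (real N * K \<sigma>) \<le> 1" using True n by (metis abs_le_iff abs_minus_cancel abs_mult abs_of_nat order_trans abs_ge_self)
          then have "s\<^sup>2 * (- (real N * K \<sigma>)) \<le> s\<^sup>2 * 1" by (intro mult_left_mono) auto
          then have "exp (?h \<sigma>) \<le> exp (s\<^sup>2 + ?e \<sigma>)" by (simp add: K_def)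
          then have "g \<sigma> * exp (?h \<sigma>) \<le> g \<sigma> * exp (s\<^sup>2 + ?e \<sigma>)" using g by (intro mult_left_mono)
          then show ?thesis using True by (simp add: B_def exp_add mult_ac)
        qed (simp add: B_def g)
      qed (use Z in simp)
      also have "\<dots> = (exp (s\<^sup>2) * q) * gav ?S ?e g"
        unfolding gav_def q_def sum_distrib_left[symmetric] using Z by simp
      also have "\<dots> \<le> (exp (s\<^sup>2) * exp (s\<^sup>2)) * gav ?S ?e g"
        by (intro mult_right_mono mult_left_mono q gav_nonneg g) auto
      finally show ?thesis .
    qed
    have "gav ?S ?h (\<lambda>\<sigma>. gav ?S ?h (\<lambda>\<tau>. f \<sigma> \<tau> * (B \<sigma> * B \<tau>))) = gav ?S ?h (\<lambda>\<sigma>. gav ?S ?h (\<lambda>\<tau>. f \<sigma> \<tau> * B \<tau>) * B \<sigma>)"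
      unfolding gav_multc[symmetric] by (simp add: mult_ac)
    also have "\<dots> \<le> (exp (s\<^sup>2) * exp (s\<^sup>2)) * gav ?S ?e (\<lambda>\<sigma>. gav ?S ?h (\<lambda>\<tau>. f \<sigma> \<tau> * B \<tau>))"
      by (rule step) (intro gav_nonneg mult_nonneg_nonneg f0 B01)
    also have "\<dots> \<le> (exp (s\<^sup>2) * exp (s\<^sup>2)) * gav ?S ?e (\<lambda>\<sigma>. (exp (s\<^sup>2) * exp (s\<^sup>2)) * gav ?S ?e (f \<sigma>))"
      by (intro mult_left_mono gav_mono step f0) auto
    also have "\<dots> = exp (4 * s\<^sup>2) * gav ?S ?e (\<lambda>\<sigma>. gav ?S ?e (f \<sigma>))"
      unfolding gav_cmult mult.assoc[symmetric] exp_add[symmetric] by simp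
    finally have *: "gav ?S ?h (\<lambda>\<sigma>. gav ?S ?h (\<lambda>\<tau>. f \<sigma> \<tau> * (B \<sigma> * B \<tau>))) \<le> exp (4 * s\<^sup>2) * gav ?S ?e (\<lambda>\<sigma>. gav ?S ?e (f \<sigma>))" .
    have "0 \<le> (2 * real N) ^ (2 * k) * gav ?S ?e (\<lambda>\<sigma>. mag N \<sigma> ^ (2 * (k * p)))"
      by (intro mult_nonneg_nonneg gav_nonneg) (auto simp: power_mult)
    then show ?thesis using split * W by linarith
  next
    case False
    \<comment> \<open>Averaged, with |<K>| > 1/N, this forces the planted moment term on the
      right-hand side of the claim to be at least 1, so that the trivial bound on \<open>f\<close>
      finishes the case.\<close>
    have pt: "\<bar>K \<sigma>\<bar> \<le> 1 / (2 * real N) + (2 * real N) ^ (2 * k - 1) * K \<sigma> ^ (2 * k)" for \<sigma>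
    proof (cases "2 * real N * \<bar>K \<sigma>\<bar> \<le> 1")
      case True
      then have "\<bar>K \<sigma>\<bar> \<le> 1 / (2 * real N)" using n by (simp add: pos_le_divide_eq mult.commute)
      moreover have "0 \<le> (2 * real N) ^ (2 * k - 1) * K \<sigma> ^ (2 * k)" by (intro mult_nonneg_nonneg) (auto simp: power_mult)
      ultimately show ?thesis by linarith
    next
      case False
      then have "1 \<le> (2 * real N * \<bar>K \<sigma>\<bar>) ^ (2 * k - 1)" by (intro one_le_power) simp
      then have "\<bar>K \<sigma>\<bar> * 1 \<le> \<bar>K \<sigma>\<bar> * (2 * real N * \<bar>K \<sigma>\<bar>) ^ (2 * k - 1)" by (intro mult_left_mono) auto
      also have "\<dots> = (2 * real N) ^ (2 * k - 1) * (\<bar>K \<sigma>\<bar> * \<bar>K \<sigma>\<bar> ^ (2 * k - 1))" by (simp add: power_mult_distrib mult_ac)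
      also have "\<bar>K \<sigma>\<bar> * \<bar>K \<sigma>\<bar> ^ (2 * k - 1) = \<bar>K \<sigma>\<bar> ^ (2 * k)" using k by (metis Suc_pred' mult_is_0 neq0_conv not_one_le_zero power_Suc zero_neq_numeral)
      also have "\<bar>K \<sigma>\<bar> ^ (2 * k) = K \<sigma> ^ (2 * k)" by (simp add: power_even_abs)
      finally show ?thesis using n by (simp add: add_increasing)
    qed
    define M where "M = gav ?S ?e (\<lambda>\<sigma>. K \<sigma> ^ (2 * k))"
    have "\<bar>gav ?S ?e K\<bar> \<le> gav ?S ?e (\<lambda>\<sigma>. \<bar>K \<sigma>\<bar>)" by (rule gav_abs)
    also have "\<dots> \<le> gav ?S ?e (\<lambda>\<sigma>. 1 / (2 * real N) + (2 * real N) ^ (2 * k - 1) * K \<sigma> ^ (2 * k))"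
      by (intro gav_mono pt)
    also have "\<dots> = 1 / (2 * real N) + (2 * real N) ^ (2 * k - 1) * M"
      by (simp only: gav_add gav_const[OF S] gav_cmult M_def)
    finally have "real N * \<bar>gav ?S ?e K\<bar> \<le> real N * (1 / (2 * real N) + (2 * real N) ^ (2 * k - 1) * M)"
      using n by (intro mult_left_mono) auto
    also have "\<dots> = 1/2 + (1/2) * ((2 * real N * (2 * real N) ^ (2 * k - 1)) * M)" using n by (simp add: distrib_left)
    also have "2 * real N * (2 * real N) ^ (2 * k - 1) = (2 * real N) ^ (2 * k)"
      using k by (metis Suc_pred' mult_is_0 neq0_conv not_one_le_zero power_Suc zero_neq_numeral)
    finally have "1 \<le> (2 * real N) ^ (2 * k) * M" using False by simp
    then have 1: "1 \<le> (2 * real N) ^ (2 * k) * gav ?S ?e (\<lambda>\<sigma>. mag N \<sigma> ^ (2 * (k * p)))"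
      unfolding M_def K2 .
    have "gav ?S ?h (\<lambda>\<sigma>. gav ?S ?h (f \<sigma>)) \<le> 1" by (intro gav_le S gf)
    moreover have "0 \<le> exp (4 * s\<^sup>2) * gav ?S ?e (\<lambda>\<sigma>. gav ?S ?e (f \<sigma>))" by (intro mult_nonneg_nonneg gav_nonneg gf0) auto
    moreover have "0 \<le> 2 * (real N ^ (2 * k) * gav ?S ?h (\<lambda>\<sigma>. mag N \<sigma> ^ (2 * (k * p))))"
      by (intro mult_nonneg_nonneg gav_nonneg) (auto simp: power_mult)
    ultimately show ?thesis using 1 by linarith
  qed
qed

text \<open>The comparison with the planted measure costs a factor N^(2k), but only on moments of
  order 2kp, which are O(N^(-kp)). Again p >= 3 is decisive: 2k - kp <= -k.\<close>

theorem null_moments: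
  assumes p: "p \<ge> 3" and L: "(\<lambda>N. fN p N t) \<longlonglongrightarrow> t\<^sup>2/2" and T: "0 \<le> T" "T < t" and k: "k \<ge> 1"
  shows "\<exists>C>0. \<forall>N\<ge>1. \<forall>s\<in>{0..T}. EE (\<lambda>w. gav (spins N) (hen p N s w) (\<lambda>\<sigma>. gav (spins N) (hen p N s w) (\<lambda>\<tau>. overlap N \<sigma> \<tau> ^ (2 * k)))) \<le> C / real N ^ k"
proof -
  have p1: "p \<ge> 1" using p by simp
  note H = Hyp_all[OF p1 L T]
  obtain C1 where C1: "C1 > 0" "\<And>N s. N \<ge> 1 \<Longrightarrow> s \<in> {0..T} \<Longrightarrow> EE (\<lambda>w. gav (spins N) (pen1 p N s w) (\<lambda>\<sigma>. mag N \<sigma> ^ (2 * k))) \<le> C1 / real N ^ k"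
    using planted_moments[OF p T(1) H, of k] by blast
  obtain C2 where C2: "C2 > 0" "\<And>N s. N \<ge> 1 \<Longrightarrow> s \<in> {0..T} \<Longrightarrow> EE (\<lambda>w. gav (spins N) (pen1 p N s w) (\<lambda>\<sigma>. mag N \<sigma> ^ (2 * (k * p)))) \<le> C2 / real N ^ (k * p)"
    using planted_moments[OF p T(1) H, of "k * p"] by blast
  define C3 :: real where "C3 = 2 * fact (k * p) * 8 ^ (k * p)"
  define C where "C = 2 * C3 + exp (4 * T\<^sup>2) * C1 + 2 ^ (2 * k) * C2"
  have C3: "C3 > 0" by (simp add: C3_def)
  have C: "C > 0" unfolding C_def using C1 C2 C3 by (intro add_pos_pos) auto
  have "EE (\<lambda>w. gav (spins N) (hen p N s w) (\<lambda>\<sigma>. gav (spins N) (hen p N s w) (\<lambda>\<tau>. overlap N \<sigma> \<tau> ^ (2 * k)))) \<le> C / real N ^ k"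
    if N: "N \<ge> 1" and s: "s \<in> {0..T}" for N s
  proof -
    let ?S = "spins N" and ?h = "\<lambda>w. hen p N s w" and ?e = "\<lambda>w. pen1 p N s w"
    let ?f = "\<lambda>\<sigma> \<tau>. overlap N \<sigma> \<tau> ^ (2 * k)" and ?g = "\<lambda>\<sigma>. mag N \<sigma> ^ (2 * (k * p))"
    have n: "real N \<ge> 1" using N by simp
    have th: "tame (\<lambda>w. gav ?S (?h w) f)" "tame (\<lambda>w. gav ?S (?h w) (\<lambda>\<sigma>. gav ?S (?h w) (g \<sigma>)))" for f g
      using tame_gav_hen[OF finite_spins, of N "\<lambda>_. 0"] by simp_all
    note te = tame_gav_hen[OF finite_spins, of N "\<lambda>\<sigma>. s\<^sup>2 * (real N * mag N \<sigma> ^ p)" p N s]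
    have "EE (\<lambda>w. gav ?S (?h w) (\<lambda>\<sigma>. gav ?S (?h w) (?f \<sigma>)))
      \<le> EE (\<lambda>w. 2 * (real N ^ (2 * k) * gav ?S (?h w) ?g) + exp (4 * s\<^sup>2) * gav ?S (?e w) (\<lambda>\<sigma>. gav ?S (?e w) (?f \<sigma>)) + (2 * real N) ^ (2 * k) * gav ?S (?e w) ?g)"
    proof (intro EE_mono th tame_add_mult(1) tame_cmult te null_le_planted[OF N p1 k])
      show "0 \<le> overlap N \<sigma> \<tau> ^ (2 * k)" for \<sigma> \<tau> by (simp add: power_mult)
      show "overlap N \<sigma> \<tau> ^ (2 * k) \<le> 1" if "\<sigma> \<in> ?S" "\<tau> \<in> ?S" for \<sigma> \<tau>
        using overlap_pow_abs[OF that, of "2 * k"] by simp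
    qed
    also have "\<dots> = 2 * (real N ^ (2 * k) * EE (\<lambda>w. gav ?S (?h w) ?g)) + exp (4 * s\<^sup>2) * EE (\<lambda>w. gav ?S (?e w) (\<lambda>\<sigma>. gav ?S (?e w) (?f \<sigma>)))
        + (2 * real N) ^ (2 * k) * EE (\<lambda>w. gav ?S (?e w) ?g)"
      by (simp only: EE_add[OF tame_add_mult(1)[OF tame_cmult[OF tame_cmult[OF th(1)]] tame_cmult[OF te(2)]] tame_cmult[OF te(1)]]
          EE_add[OF tame_cmult[OF tame_cmult[OF th(1)]] tame_cmult[OF te(2)]] EE_cmult)
    also have "EE (\<lambda>w. gav ?S (?e w) (\<lambda>\<sigma>. gav ?S (?e w) (?f \<sigma>))) = EE (\<lambda>w. gav ?S (?e w) (\<lambda>\<sigma>. mag N \<sigma> ^ (2 * k)))"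
    proof -
      \<comment> \<open>Truncation, inactive on spins, to meet the global bounds in the Nishimori
        identity.\<close>
      let ?f' = "\<lambda>\<sigma> \<tau>. min 1 (overlap N \<sigma> \<tau> ^ (2 * k))"
      have ff: "?f' \<sigma> \<tau> = ?f \<sigma> \<tau>" if "\<sigma> \<in> ?S" "\<tau> \<in> ?S" for \<sigma> \<tau>
        using overlap_pow_abs[OF that, of "2 * k"] by simp
      have "EE (\<lambda>w. gav ?S (?e w) (\<lambda>\<sigma>. gav ?S (?e w) (?f' \<sigma>))) = EE (\<lambda>w. gav ?S (?e w) (?f' (ones N)))"
        by (rule nishimori[OF N p1]) (auto simp: overlap_gm power_mult)
      moreover have "gav ?S (?e w) (\<lambda>\<sigma>. gav ?S (?e w) (?f' \<sigma>)) = gav ?S (?e w) (\<lambda>\<sigma>. gav ?S (?e w) (?f \<sigma>))" for w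
        by (intro gav_cong ff)
      moreover have "gav ?S (?e w) (?f' (ones N)) = gav ?S (?e w) (\<lambda>\<sigma>. mag N \<sigma> ^ (2 * k))" for w
        unfolding overlap_commute[of N "ones N"] by (intro gav_cong) (use ff in auto)
      ultimately show ?thesis by simp
    qed
    also have "2 * (real N ^ (2 * k) * EE (\<lambda>w. gav ?S (?h w) ?g)) + exp (4 * s\<^sup>2) * EE (\<lambda>w. gav ?S (?e w) (\<lambda>\<sigma>. mag N \<sigma> ^ (2 * k)))
        + (2 * real N) ^ (2 * k) * EE (\<lambda>w. gav ?S (?e w) ?g)
       \<le> 2 * (real N ^ (2 * k) * (C3 / real N ^ (k * p))) + exp (4 * T\<^sup>2) * (C1 / real N ^ k) + (2 * real N) ^ (2 * k) * (C2 / real N ^ (k * p))"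
    proof (intro add_mono mult_mono order_refl)
      show "EE (\<lambda>w. gav ?S (?h w) ?g) \<le> C3 / real N ^ (k * p)" unfolding C3_def by (rule null_overlap_ones[OF N])
      show "0 \<le> EE (\<lambda>w. gav ?S (?h w) ?g)" by (intro Bochner_Integration.integral_nonneg gav_nonneg) (simp add: power_mult)
      show "exp (4 * s\<^sup>2) \<le> exp (4 * T\<^sup>2)" using s by (simp add: power_mono)
      show "0 \<le> EE (\<lambda>w. gav ?S (?e w) (\<lambda>\<sigma>. mag N \<sigma> ^ (2 * k)))" by (intro Bochner_Integration.integral_nonneg gav_nonneg) (simp add: power_mult)
      show "0 \<le> EE (\<lambda>w. gav ?S (?e w) ?g)" by (intro Bochner_Integration.integral_nonneg gav_nonneg) (simp add: power_mult)
      show "0 \<le> real N ^ (2 * k) * EE (\<lambda>w. gav ?S (?h w) ?g)" by (intro mult_nonneg_nonneg Bochner_Integration.integral_nonneg gav_nonneg) (simp_all add: power_mult)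
    qed (use C1(2)[OF N s] C2(2)[OF N s] in auto)
    also have "\<dots> \<le> 2 * (C3 * (1 / real N ^ k)) + exp (4 * T\<^sup>2) * (C1 / real N ^ k) + 2 ^ (2 * k) * (C2 * (1 / real N ^ k))"
    proof -
      have r: "real N ^ (2 * k) / real N ^ (k * p) \<le> 1 / real N ^ k"
      proof -
        have "real N ^ (2 * k) * real N ^ k = real N ^ (k * 3)"
          unfolding power_add[symmetric] by (rule arg_cong[where f="power (real N)"]) simp
        also have "\<dots> \<le> real N ^ (k * p)" using n p by (intro power_increasing) auto
        finally show ?thesis using n by (simp add: field_simps)
      qed
      have "2 * (real N ^ (2 * k) * (C3 / real N ^ (k * p))) = 2 * (C3 * (real N ^ (2 * k) / real N ^ (k * p)))" by simp
      also have "\<dots> \<le> 2 * (C3 * (1 / real N ^ k))" using r C3 by (intro mult_left_mono) auto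
      finally have a: "2 * (real N ^ (2 * k) * (C3 / real N ^ (k * p))) \<le> 2 * (C3 * (1 / real N ^ k))" .
      have "(2 * real N) ^ (2 * k) * (C2 / real N ^ (k * p)) = 2 ^ (2 * k) * (C2 * (real N ^ (2 * k) / real N ^ (k * p)))"
        by (simp add: power_mult_distrib)
      also have "\<dots> \<le> 2 ^ (2 * k) * (C2 * (1 / real N ^ k))" using r C2 by (intro mult_left_mono) auto
      finally show ?thesis using a by linarith
    qed
    also have "\<dots> = C / real N ^ k" by (simp add: C_def add_divide_distrib)
    finally show ?thesis .
  qed
  then show ?thesis using C by blast
qed

lemmas tame_add = tame_add_mult(1)

subsection \<open>Replicas\<close>

text \<open>Replicas are lists with the newest in front. With energies summed by \<open>eL\<close>,
  the product Gibbs measure is again a Gibbs average over a finite set, so the earlier calculus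
  applies and adding a replica is a \<open>#\<close>.\<close>

definition RR :: "'a set \<Rightarrow> nat \<Rightarrow> 'a list set" where
  "RR S n = {l. length l = n \<and> set l \<subseteq> S}"

definition eL :: "('a \<Rightarrow> real) \<Rightarrow> 'a list \<Rightarrow> real" where
  "eL e l = (\<Sum>\<sigma>\<leftarrow>l. e \<sigma>)"

lemma RR_0: "RR S 0 = {[]}"
  by (auto simp: RR_def)

lemma RR_Suc: "RR S (Suc n) = (\<lambda>(\<sigma>, l). \<sigma> # l) ` (S \<times> RR S n)"
  by (auto simp: RR_def length_Suc_conv image_iff)

lemma finite_RR: "finite S \<Longrightarrow> finite (RR S n)"
  unfolding RR_def using finite_lists_length_eq[of S n] by (simp add: conj_commute)

lemma RR_ne: "S \<noteq> {} \<Longrightarrow> RR S n \<noteq> {}"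
  by (induction n) (auto simp: RR_0 RR_Suc)

lemma RR_D: "l \<in> RR S n \<Longrightarrow> length l = n" "l \<in> RR S n \<Longrightarrow> j < n \<Longrightarrow> l ! j \<in> S" "l \<in> RR S n \<Longrightarrow> set l \<subseteq> S"
  by (auto simp: RR_def)

lemma sum_RR_Suc: "(\<Sum>l\<in>RR S (Suc n). F l) = (\<Sum>l\<in>RR S n. \<Sum>\<sigma>\<in>S. F (\<sigma> # l))"
proof -
  have inj: "inj_on (\<lambda>(\<sigma>, l). \<sigma> # l) (S \<times> RR S n)" by (auto simp: inj_on_def)
  have "(\<Sum>l\<in>RR S (Suc n). F l) = (\<Sum>\<sigma>\<in>S. \<Sum>l\<in>RR S n. F (\<sigma> # l))"
    unfolding RR_Suc sum.reindex[OF inj] by (simp add: sum.cartesian_product case_prod_beta')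
  then show ?thesis by (subst sum.swap) simp
qed

lemma gav_RR_Suc:
  "gav (RR S (Suc n)) (eL e) F = gav (RR S n) (eL e) (\<lambda>l. gav S e (\<lambda>\<sigma>. F (\<sigma> # l)))"
proof -
  have Z: "Zs (RR S (Suc n)) (eL e) = Zs (RR S n) (eL e) * Zs S e"
    unfolding Zs_def sum_RR_Suc sum_product by (simp add: eL_def exp_add mult.commute)
  have N: "(\<Sum>l\<in>RR S (Suc n). F l * exp (eL e l)) = (\<Sum>l\<in>RR S n. (\<Sum>\<sigma>\<in>S. F (\<sigma> # l) * exp (e \<sigma>)) * exp (eL e l))"
    unfolding sum_RR_Suc sum_distrib_right by (simp add: eL_def exp_add mult_ac)
  show ?thesis unfolding gav_def N Z by (simp add: sum_divide_distrib[symmetric] mult.commute)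
qed

lemma gav_RR_marg:
  assumes S: "finite S" "S \<noteq> {}" and j: "j < n"
  shows "gav (RR S n) (eL e) (\<lambda>l. h (l ! j)) = gav S e h"
  using j
proof (induction n arbitrary: j)
  case (Suc n)
  show ?case
  proof (cases j)
    case 0
    then show ?thesis by (simp add: gav_RR_Suc gav_const[OF finite_RR[OF S(1)] RR_ne[OF S(2)]])
  next
    case (Suc i)
    then show ?thesis using Suc.IH[of i] Suc.prems by (simp add: gav_RR_Suc gav_const[OF S])
  qed
qed simp

lemma eL_fld: "eL (\<lambda>\<sigma>. d \<sigma> + fld J (u \<sigma>) w) l = eL d l + fld J (\<lambda>i. eL (\<lambda>\<sigma>. u \<sigma> i) l) w"
  by (induction l) (auto simp: eL_def fld_def sum.distrib distrib_left)

lemma ip_eL: "ip J a (\<lambda>i. eL (\<lambda>\<sigma>. u \<sigma> i) l) = eL (\<lambda>\<sigma>. ip J a (u \<sigma>)) l"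
  by (induction l) (auto simp: eL_def ip_def sum.distrib distrib_left)

lemma eL_cmult: "eL (\<lambda>\<sigma>. c * g \<sigma>) l = c * eL g l"
  by (induction l) (auto simp: eL_def distrib_left)

lemma eL_nth: "eL g l = (\<Sum>i<length l. g (l ! i))"
  unfolding eL_def by (simp add: sum_list_sum_nth atLeast0LessThan)

lemma eL_sum: "eL (\<lambda>\<sigma>. \<Sum>q\<in>A. g q \<sigma>) l = (\<Sum>q\<in>A. eL (g q) l)"
  unfolding eL_nth by (rule sum.swap)

lemma gav_eL:
  assumes "finite S" "S \<noteq> {}" shows "gav (RR S n) (eL e) (eL g) = real n * gav S e g"
proof -
  have "gav (RR S n) (eL e) (eL g) = gav (RR S n) (eL e) (\<lambda>l. \<Sum>i<n. g (l ! i))"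
    by (intro gav_cong) (auto simp: eL_nth RR_def)
  also have "\<dots> = (\<Sum>i<n. gav S e g)" unfolding gav_sum by (intro sum.cong refl gav_RR_marg assms) auto
  finally show ?thesis by simp
qed

subsection \<open>Ghirlanda-Guerra identities\<close>

text \<open>\<open>V q\<close> represents an auxiliary Gaussian field with covariance \<open>M r^q\<close>; the base weights \<open>d\<close> of
  the system it perturbs are arbitrary.\<close>

definition ggsys :: "(nat \<Rightarrow> real) set \<Rightarrow> nat list set \<Rightarrow> (nat \<Rightarrow> (nat \<Rightarrow> real) \<Rightarrow> nat list \<Rightarrow> real) \<Rightarrow>
    ((nat \<Rightarrow> real) \<Rightarrow> (nat \<Rightarrow> real) \<Rightarrow> real) \<Rightarrow> nat \<Rightarrow> nat \<Rightarrow> bool" where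
  "ggsys S J V r M D \<longleftrightarrow> finite S \<and> S \<noteq> {} \<and> finite J \<and> M \<ge> 1 \<and>
    (\<forall>\<sigma>\<in>S. \<forall>\<tau>\<in>S. \<forall>q\<in>{1..D}. \<forall>q'\<in>{1..D}. ip J (V q \<sigma>) (V q' \<tau>) = (if q = q' then real M * r \<sigma> \<tau> ^ q else 0)) \<and>
    (\<exists>b. (\<forall>q\<in>{1..D}. (\<Sum>i\<in>J. (b q i)\<^sup>2) \<le> real M) \<and> (\<forall>q\<in>{1..D}. \<forall>\<sigma>\<in>S. \<forall>i\<in>J. \<bar>V q \<sigma> i\<bar> \<le> b q i)) \<and>
    (\<forall>\<sigma>\<in>S. \<forall>\<tau>\<in>S. r \<sigma> \<tau> = r \<tau> \<sigma>) \<and> (\<forall>\<sigma>\<in>S. r \<sigma> \<sigma> = 1) \<and> (\<forall>\<sigma>\<in>S. \<forall>\<tau>\<in>S. \<bar>r \<sigma> \<tau>\<bar> \<le> 1) \<and>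
    (\<forall>l. set l \<subseteq> S \<longrightarrow> 0 \<le> (\<Sum>i<length l. \<Sum>j<length l. r (l ! i) (l ! j)))"

text \<open>\<open>c\<close> fixes the overall size of the perturbation, and \<open>x q\<close> the
  relative strength of the q-th field, later averaged over a grid.\<close>

definition uu :: "(nat \<Rightarrow> (nat \<Rightarrow> real) \<Rightarrow> nat list \<Rightarrow> real) \<Rightarrow> nat \<Rightarrow> real \<Rightarrow> (nat \<Rightarrow> real) \<Rightarrow> (nat \<Rightarrow> real) \<Rightarrow> nat list \<Rightarrow> real" where
  "uu V D c x \<sigma> i = c * (\<Sum>q\<in>{1..D}. x q * V q \<sigma> i)"

text \<open>Continuous cutoffs at \<open>K\<close> staggered thresholds between - 2 \<epsilon> and -
  \<epsilon>: the n-th is 1 up to - 2 \<epsilon> + n \<epsilon> / K and 0 from one step further on.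
  Staggering makes a later ramp equal to 1 wherever an earlier one is nonzero; continuity permits
  polynomial approximation.\<close>

definition ramp :: "real \<Rightarrow> nat \<Rightarrow> nat \<Rightarrow> real \<Rightarrow> real" where
  "ramp \<epsilon> K n y = max 0 (min 1 (real n + 1 - (y + 2 * \<epsilon>) * real K / \<epsilon>))"

lemma ramp_bounds: "0 \<le> ramp \<epsilon> K n y" "ramp \<epsilon> K n y \<le> 1"
  by (auto simp: ramp_def)

lemma ramp_next: "m < n \<Longrightarrow> ramp \<epsilon> K m y \<noteq> 0 \<Longrightarrow> ramp \<epsilon> K n y = 1"
proof -
  assume a: "m < n" "ramp \<epsilon> K m y \<noteq> 0"
  then have "(y + 2 * \<epsilon>) * real K / \<epsilon> < real m + 1" by (auto simp: ramp_def max_def min_def split: if_splits)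
  moreover have "real m + 1 \<le> real n" using a by simp
  ultimately show ?thesis by (simp add: ramp_def)
qed

lemma ramp_supp: "\<epsilon> > 0 \<Longrightarrow> m < K \<Longrightarrow> ramp \<epsilon> K m y \<noteq> 0 \<Longrightarrow> y \<le> - \<epsilon>"
proof -
  assume a: "\<epsilon> > 0" "m < K" "ramp \<epsilon> K m y \<noteq> 0"
  then have "(y + 2 * \<epsilon>) * real K / \<epsilon> < real m + 1" by (auto simp: ramp_def max_def min_def split: if_splits)
  also have "\<dots> \<le> real K" using a by simp
  finally have "(y + 2 * \<epsilon>) * real K < \<epsilon> * real K" using a by (simp add: field_simps)
  then show ?thesis using a by simp
qed

lemma ramp_ind: "\<epsilon> > 0 \<Longrightarrow> (if y \<le> - 2 * \<epsilon> then 1 else 0) \<le> ramp \<epsilon> K n y"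
proof (cases "y \<le> - 2 * \<epsilon>")
  case True
  assume "\<epsilon> > 0"
  then have "(y + 2 * \<epsilon>) * real K / \<epsilon> \<le> 0" using True by (intro divide_nonpos_pos mult_nonpos_nonneg) auto
  then show ?thesis by (simp add: ramp_def)
qed (simp add: ramp_bounds)

lemma continuous_ramp: "continuous_on X (ramp \<epsilon> K n)"
  unfolding ramp_def[abs_def] times_divide_eq_right[symmetric]
  by (intro continuous_on_max continuous_on_min continuous_on_diff continuous_on_mult continuous_on_add continuous_on_const continuous_on_id)

lemma prod_ge_1_sum:
  fixes a :: "nat \<Rightarrow> real"
  assumes "\<And>j. j < n \<Longrightarrow> 0 \<le> a j \<and> a j \<le> 1" shows "1 - (\<Sum>j<n. 1 - a j) \<le> (\<Prod>j<n. a j)"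
  using assms
proof (induction n)
  case (Suc n)
  have p: "0 \<le> (\<Prod>j<n. a j)" "(\<Prod>j<n. a j) \<le> 1" using Suc.prems by (auto intro!: prod_nonneg prod_le_1)
  have "(1 - a n) * (1 - (\<Prod>j<n. a j)) \<ge> 0" using p Suc.prems[of n] by (intro mult_nonneg_nonneg) auto
  then show ?case using Suc.IH Suc.prems by (simp add: algebra_simps) 
qed simp

locale gg =
  fixes S J V r M D and d :: "(nat \<Rightarrow> real) \<Rightarrow> real" and c :: real
  assumes sys: "ggsys S J V r M D" and c: "c > 0"
begin

lemma S: "finite S" "S \<noteq> {}" and J: "finite J" and M: "M \<ge> 1"
  and ipV: "\<sigma> \<in> S \<Longrightarrow> \<tau> \<in> S \<Longrightarrow> q \<in> {1..D} \<Longrightarrow> q' \<in> {1..D} \<Longrightarrow> ip J (V q \<sigma>) (V q' \<tau>) = (if q = q' then real M * r \<sigma> \<tau> ^ q else 0)"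
  and rsym: "\<sigma> \<in> S \<Longrightarrow> \<tau> \<in> S \<Longrightarrow> r \<sigma> \<tau> = r \<tau> \<sigma>" and r1: "\<sigma> \<in> S \<Longrightarrow> r \<sigma> \<sigma> = 1" and rb: "\<sigma> \<in> S \<Longrightarrow> \<tau> \<in> S \<Longrightarrow> \<bar>r \<sigma> \<tau>\<bar> \<le> 1"
  and psd: "set l \<subseteq> S \<Longrightarrow> 0 \<le> (\<Sum>i<length l. \<Sum>j<length l. r (l ! i) (l ! j))"
  using sys unfolding ggsys_def by blast+

lemma n: "real M > 0" using M by simp

definition en :: "(nat \<Rightarrow> real) \<Rightarrow> (nat list \<Rightarrow> real) \<Rightarrow> (nat \<Rightarrow> real) \<Rightarrow> real" where
  "en x w \<sigma> = d \<sigma> + fld J (uu V D c x \<sigma>) w"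

abbreviation gS :: "(nat \<Rightarrow> real) \<Rightarrow> (nat list \<Rightarrow> real) \<Rightarrow> ((nat \<Rightarrow> real) \<Rightarrow> real) \<Rightarrow> real" where
  "gS x w \<equiv> gav S (en x w)"

abbreviation gR :: "nat \<Rightarrow> (nat \<Rightarrow> real) \<Rightarrow> (nat list \<Rightarrow> real) \<Rightarrow> ((nat \<Rightarrow> real) list \<Rightarrow> real) \<Rightarrow> real" where
  "gR k x w \<equiv> gav (RR S k) (eL (en x w))"

lemma ip_uu: "\<sigma> \<in> S \<Longrightarrow> \<tau> \<in> S \<Longrightarrow> q \<in> {1..D} \<Longrightarrow> ip J (V q \<sigma>) (uu V D c x \<tau>) = (c * x q * real M) * r \<sigma> \<tau> ^ q"
proof -
  assume *: "\<sigma> \<in> S" "\<tau> \<in> S" "q \<in> {1..D}"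
  have "ip J (V q \<sigma>) (uu V D c x \<tau>) = c * (\<Sum>q'\<in>{1..D}. x q' * ip J (V q \<sigma>) (V q' \<tau>))"
    unfolding ip_def uu_def
    by (simp add: sum_distrib_left sum.swap[of _ J] mult_ac)
  also have "(\<Sum>q'\<in>{1..D}. x q' * ip J (V q \<sigma>) (V q' \<tau>)) = (\<Sum>q'\<in>{1..D}. if q = q' then x q * (real M * r \<sigma> \<tau> ^ q) else 0)"
  proof (intro sum.cong refl)
    fix q' assume q': "q' \<in> {1..D}"
    show "x q' * ip J (V q \<sigma>) (V q' \<tau>) = (if q = q' then x q * (real M * r \<sigma> \<tau> ^ q) else 0)"
      unfolding ipV[OF *(1,2,3) q'] by (cases "q = q'") auto
  qed
  also have "\<dots> = x q * (real M * r \<sigma> \<tau> ^ q)" using * by (simp add: sum.delta)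
  finally show ?thesis by simp
qed

definition A :: "(nat \<Rightarrow> real) \<Rightarrow> nat \<Rightarrow> ((nat \<Rightarrow> real) list \<Rightarrow> real) \<Rightarrow> real" where
  "A x k f = EE (\<lambda>w. gR k x w f)"

text \<open>Left-hand side of a Ghirlanda-Guerra identity: \<open>f\<close> sees \<open>k\<close>
  replicas, \<open>\<phi>\<close> the overlap of the j-th one with a fresh replica. \<open>G\<close>
  below is the mean over two fresh replicas.\<close>

definition NEW :: "(nat \<Rightarrow> real) \<Rightarrow> nat \<Rightarrow> ((nat \<Rightarrow> real) list \<Rightarrow> real) \<Rightarrow> nat \<Rightarrow> (real \<Rightarrow> real) \<Rightarrow> real" where
  "NEW x k f j \<phi> = EE (\<lambda>w. gR k x w (\<lambda>l. f l * gS x w (\<lambda>\<sigma>. \<phi> (r (l ! j) \<sigma>))))"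

definition G :: "(nat \<Rightarrow> real) \<Rightarrow> (real \<Rightarrow> real) \<Rightarrow> real" where
  "G x \<phi> = EE (\<lambda>w. gS x w (\<lambda>\<sigma>. gS x w (\<lambda>\<tau>. \<phi> (r \<sigma> \<tau>))))"

lemma RRf: "finite (RR S k)" "RR S k \<noteq> {}"
  by (rule finite_RR[OF S(1)], rule RR_ne[OF S(2)])

lemma en_meas: "(\<lambda>w. en x w \<sigma>) \<in> borel_measurable disorder" "(\<lambda>w. eL (en x w) l) \<in> borel_measurable disorder"
proof -
  show "(\<lambda>w. en x w \<sigma>) \<in> borel_measurable disorder" for \<sigma> unfolding en_def by measurable
  have "eL (en x w) l = eL d l + fld J (\<lambda>i. eL (\<lambda>\<sigma>. uu V D c x \<sigma> i) l) w" for w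
    using eL_fld[of d J "uu V D c x" w l] unfolding en_def[abs_def] .
  then show "(\<lambda>w. eL (en x w) l) \<in> borel_measurable disorder" by simp
qed

lemma tame_S: "(\<And>\<sigma>. tame (\<lambda>w. f w \<sigma>)) \<Longrightarrow> tame (\<lambda>w. gS x w (f w))"
  by (rule tame_gav[OF S(1) en_meas(1)])

lemma tame_RR: "(\<And>l. tame (\<lambda>w. f w l)) \<Longrightarrow> tame (\<lambda>w. gR k x w (f w))"
  by (rule tame_gav[OF RRf(1) en_meas(2)])

lemma tame_NEW: "tame (\<lambda>w. gR k x w (\<lambda>l. f l * gS x w (\<lambda>\<sigma>. \<phi> (r (l ! j) \<sigma>))))"
  by (intro tame_RR tame_cmult tame_S tame_const)

lemma A_mono: "(\<And>l. l \<in> RR S k \<Longrightarrow> f l \<le> g l) \<Longrightarrow> A x k f \<le> A x k g"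
  unfolding A_def by (intro EE_mono tame_RR tame_const gav_mono)

lemma A_cong: "(\<And>l. l \<in> RR S k \<Longrightarrow> f l = g l) \<Longrightarrow> A x k f = A x k g"
  unfolding A_def by (intro arg_cong[where f=EE] ext gav_cong)

lemma A_const: "A x k (\<lambda>_. a) = a"
  unfolding A_def gav_const[OF RRf] by (rule EE_const)

lemma A_add: "A x k (\<lambda>l. f l + g l) = A x k f + A x k g"
  unfolding A_def gav_add by (intro EE_add tame_RR tame_const)

lemma A_diff: "A x k (\<lambda>l. f l - g l) = A x k f - A x k g"
  unfolding A_def gav_diff by (intro EE_diff tame_RR tame_const)

lemma A_cmult: "A x k (\<lambda>l. a * f l) = a * A x k f"
  unfolding A_def gav_cmult by simp

lemma A_sum: "finite Q \<Longrightarrow> A x k (\<lambda>l. \<Sum>q\<in>Q. f q l) = (\<Sum>q\<in>Q. A x k (f q))"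
  by (induction Q rule: finite_induct) (auto simp: A_add A_const[of _ _ 0, simplified])

lemma A_abs: assumes "\<And>l. l \<in> RR S k \<Longrightarrow> \<bar>f l\<bar> \<le> B" shows "\<bar>A x k f\<bar> \<le> B"
proof -
  have "A x k f \<le> A x k (\<lambda>_. B)" "A x k (\<lambda>_. - B) \<le> A x k f"
    by (rule A_mono, use assms in \<open>force simp: abs_le_iff\<close>)+
  then show ?thesis by (simp add: A_const)
qed

text \<open>\<open>gibbs_ibp\<close> for the system whose configurations are lists. Its second,
  independent list contributes \<open>k\<close> replicas with equal marginals, which explains the
  factor \<open>k\<close> in front of \<open>NEW\<close>.\<close>

lemma gg_ibp:
  assumes q: "q \<in> {1..D}" and j: "j < k"
  shows "EE (\<lambda>w. gR k x w (\<lambda>l. f l * fld J (V q (l ! j)) w))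
    = (c * x q * real M) * (A x k (\<lambda>l. f l * eL (\<lambda>\<sigma>. r (l ! j) \<sigma> ^ q) l) - real k * NEW x k f j (\<lambda>y. y ^ q))"
proof -
  let ?m = "c * x q * real M" and ?uL = "\<lambda>l i. eL (\<lambda>\<sigma>. uu V D c x \<sigma> i) l" and ?\<rho> = "\<lambda>l \<sigma>. r (l ! j) \<sigma> ^ q"
  have e: "(\<lambda>l. eL d l + fld J (?uL l) w) = eL (en x w)" for w
    using eL_fld[of d J "uu V D c x" w] unfolding en_def[abs_def] by (auto simp: fun_eq_iff)
  have ip: "ip J (V q (l ! j)) (?uL l') = ?m * eL (?\<rho> l) l'"
    if "l \<in> RR S k" "l' \<in> RR S k" for l l'
    unfolding ip_eL eL_cmult[symmetric] unfolding eL_def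
    by (intro arg_cong[where f=sum_list] map_cong refl ip_uu q) (use that j in \<open>auto simp: RR_def\<close>)
  have "EE (\<lambda>w. gR k x w (\<lambda>l. f l * fld J (V q (l ! j)) w))
    = EE (\<lambda>w. gR k x w (\<lambda>l. f l * ip J (V q (l ! j)) (?uL l))
        - gR k x w (\<lambda>l. f l * gR k x w (\<lambda>l'. ip J (V q (l ! j)) (?uL l'))))"
    using gibbs_ibp[OF RRf J, of k "eL d" "?uL" f "\<lambda>l. V q (l ! j)"] unfolding e .
  also have "\<dots> = EE (\<lambda>w. ?m * gR k x w (\<lambda>l. f l * eL (?\<rho> l) l)
        - ?m * (real k * gR k x w (\<lambda>l. f l * gS x w (?\<rho> l))))"
  proof (rule arg_cong[where f=EE], rule ext)
    fix w
    have a1: "gR k x w (\<lambda>l. f l * ip J (V q (l ! j)) (?uL l))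
      = ?m * gR k x w (\<lambda>l. f l * eL (?\<rho> l) l)"
      unfolding gav_cmult[symmetric]
    proof (rule gav_cong)
      fix l assume l: "l \<in> RR S k"
      show "f l * ip J (V q (l ! j)) (?uL l) = ?m * (f l * eL (?\<rho> l) l)"
        unfolding ip[OF l l] by simp
    qed
    have a2: "gR k x w (\<lambda>l. f l * gR k x w (\<lambda>l'. ip J (V q (l ! j)) (?uL l')))
      = ?m * (real k * gR k x w (\<lambda>l. f l * gS x w (?\<rho> l)))"
    proof -
      have "gR k x w (\<lambda>l. f l * gR k x w (\<lambda>l'. ip J (V q (l ! j)) (?uL l')))
        = gR k x w (\<lambda>l. ?m * (real k * (f l * gS x w (?\<rho> l))))"
    proof (rule gav_cong)
      fix l assume l: "l \<in> RR S k"
      have "gR k x w (\<lambda>l'. ip J (V q (l ! j)) (?uL l'))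
        = gR k x w (\<lambda>l'. ?m * eL (?\<rho> l) l')"
        by (intro gav_cong ip l)
      also have "\<dots> = ?m * (real k * gS x w (?\<rho> l))"
        unfolding gav_cmult gav_eL[OF S] ..
      finally show "f l * gR k x w (\<lambda>l'. ip J (V q (l ! j)) (?uL l'))
        = ?m * (real k * (f l * gS x w (?\<rho> l)))" by simp
    qed
      then show ?thesis by (simp only: gav_cmult)
    qed
    show "gR k x w (\<lambda>l. f l * ip J (V q (l ! j)) (?uL l))
        - gR k x w (\<lambda>l. f l * gR k x w (\<lambda>l'. ip J (V q (l ! j)) (?uL l')))
      = ?m * gR k x w (\<lambda>l. f l * eL (?\<rho> l) l)
        - ?m * (real k * gR k x w (\<lambda>l. f l * gS x w (?\<rho> l)))"
      unfolding a1 a2 ..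
  qed
  also have "\<dots> = ?m * A x k (\<lambda>l. f l * eL (?\<rho> l) l) - ?m * (real k * NEW x k f j (\<lambda>y. y ^ q))"
    unfolding A_def NEW_def EE_cmult[symmetric]
    by (intro EE_diff tame_cmult tame_NEW tame_RR tame_const)
  finally show ?thesis by (simp only: right_diff_distrib)
qed

lemma gg_mean:
  assumes q: "q \<in> {1..D}"
  shows "EE (\<lambda>w. gS x w (\<lambda>\<sigma>. fld J (V q \<sigma>) w)) = (c * x q * real M) * (1 - G x (\<lambda>y. y ^ q))"
proof -
  have 1: "gS x w h = gR 1 x w (\<lambda>l. 1 * h (l ! 0))" for w h
    using gav_RR_marg[OF S, of 0 1] by simp
  have "EE (\<lambda>w. gS x w (\<lambda>\<sigma>. fld J (V q \<sigma>) w)) = EE (\<lambda>w. gR 1 x w (\<lambda>l. 1 * fld J (V q (l ! 0)) w))"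
    by (subst 1) simp
  also have "\<dots> = (c * x q * real M) * (A x 1 (\<lambda>l. 1 * eL (\<lambda>\<sigma>. r (l ! 0) \<sigma> ^ q) l) - real 1 * NEW x 1 (\<lambda>_. 1) 0 (\<lambda>y. y ^ q))"
    by (rule gg_ibp[OF q]) simp
  also have "A x 1 (\<lambda>l. 1 * eL (\<lambda>\<sigma>. r (l ! 0) \<sigma> ^ q) l) = A x 1 (\<lambda>_. 1)"
  proof (rule A_cong)
    fix l assume l: "l \<in> RR S 1"
    show "1 * eL (\<lambda>\<sigma>. r (l ! 0) \<sigma> ^ q) l = 1"
      unfolding eL_nth RR_D(1)[OF l] using r1[OF RR_D(2)[OF l, of 0]] by simp
  qed
  also have "NEW x 1 (\<lambda>_. 1) 0 (\<lambda>y. y ^ q) = G x (\<lambda>y. y ^ q)"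
    unfolding NEW_def G_def by (intro arg_cong[where f=EE] ext 1[symmetric])
  finally show ?thesis by (simp add: A_const)
qed

text \<open>If the q-th field is nearly constant, equal to \<open>m\<close>, then E <f H> and E <f>
  E <H> differ by at most 2 \<Delta>. Integrating both by parts and dividing by the size of the
  covariance gives the identity; the -1 is the self-overlap of replica \<open>j\<close>.\<close>

lemma gg_identity:
  assumes q: "q \<in> {1..D}" and j: "j < k" and f: "\<And>l. l \<in> RR S k \<Longrightarrow> \<bar>f l\<bar> \<le> 1" and xq: "x q > 0"
    and \<Delta>: "EE (\<lambda>w. gS x w (\<lambda>\<sigma>. \<bar>fld J (V q \<sigma>) w - m\<bar>)) \<le> \<Delta>"
  shows "\<bar>real k * NEW x k f j (\<lambda>y. y ^ q) - A x k f * G x (\<lambda>y. y ^ q) - A x k (\<lambda>l. f l * (eL (\<lambda>\<sigma>. r (l ! j) \<sigma> ^ q) l - 1))\<bar>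
    \<le> 2 * \<Delta> / (c * x q * real M)"
proof -
  define a where "a = c * x q * real M"
  have a: "a > 0" using c xq n by (simp add: a_def)
  define X where "X = EE (\<lambda>w. gR k x w (\<lambda>l. f l * fld J (V q (l ! j)) w))"
  define Y where "Y = EE (\<lambda>w. gS x w (\<lambda>\<sigma>. fld J (V q \<sigma>) w))"
  have Xe: "X = a * (A x k (\<lambda>l. f l * eL (\<lambda>\<sigma>. r (l ! j) \<sigma> ^ q) l) - real k * NEW x k f j (\<lambda>y. y ^ q))"
    unfolding X_def a_def by (rule gg_ibp[OF q j])
  have Ye: "Y = a * (1 - G x (\<lambda>y. y ^ q))" unfolding Y_def a_def by (rule gg_mean[OF q])
  have tD: "tame (\<lambda>w. gS x w (\<lambda>\<sigma>. \<bar>fld J (V q \<sigma>) w - m\<bar>))"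
    by (intro tame_S tame_abs tame_diff tame_fld tame_const)
  have "\<bar>X - m * A x k f\<bar> = \<bar>EE (\<lambda>w. gR k x w (\<lambda>l. f l * (fld J (V q (l ! j)) w - m)))\<bar>"
  proof -
    have "X - m * A x k f = EE (\<lambda>w. gR k x w (\<lambda>l. f l * fld J (V q (l ! j)) w) - m * gR k x w f)"
      unfolding X_def A_def EE_cmult[symmetric]
      by (intro EE_diff[symmetric] tame_cmult tame_RR tame_const tame_fld)
    also have "\<dots> = EE (\<lambda>w. gR k x w (\<lambda>l. f l * (fld J (V q (l ! j)) w - m)))"
      unfolding right_diff_distrib gav_diff gav_multc by (simp only: mult.commute)
    finally show ?thesis by simp
  qed
  also have "\<dots> \<le> EE (\<lambda>w. \<bar>gR k x w (\<lambda>l. f l * (fld J (V q (l ! j)) w - m))\<bar>)"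
    by (rule integral_abs_bound)
  also have "\<dots> \<le> EE (\<lambda>w. gS x w (\<lambda>\<sigma>. \<bar>fld J (V q \<sigma>) w - m\<bar>))"
  proof (intro EE_mono tame_abs tame_RR tame_cmult tame_diff tame_fld tame_const tD)
    fix w
    have "\<bar>gR k x w (\<lambda>l. f l * (fld J (V q (l ! j)) w - m))\<bar>
      \<le> gR k x w (\<lambda>l. \<bar>f l * (fld J (V q (l ! j)) w - m)\<bar>)" by (rule gav_abs)
    also have "\<dots> \<le> gR k x w (\<lambda>l. \<bar>fld J (V q (l ! j)) w - m\<bar>)"
      by (intro gav_mono) (use f in \<open>auto simp: abs_mult intro!: mult_left_le_one_le\<close>)
    also have "\<dots> = gS x w (\<lambda>\<sigma>. \<bar>fld J (V q \<sigma>) w - m\<bar>)"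
      by (rule gav_RR_marg[OF S j, of "en x w" "\<lambda>\<sigma>. \<bar>fld J (V q \<sigma>) w - m\<bar>"])
    finally show "\<bar>gR k x w (\<lambda>l. f l * (fld J (V q (l ! j)) w - m))\<bar> \<le> gS x w (\<lambda>\<sigma>. \<bar>fld J (V q \<sigma>) w - m\<bar>)" .
  qed
  finally have 1: "\<bar>X - m * A x k f\<bar> \<le> \<Delta>" using \<Delta> by simp
  have "\<bar>Y - m\<bar> = \<bar>EE (\<lambda>w. gS x w (\<lambda>\<sigma>. fld J (V q \<sigma>) w - m))\<bar>"
  proof -
    have "EE (\<lambda>w. gS x w (\<lambda>\<sigma>. fld J (V q \<sigma>) w) - m) = Y - EE (\<lambda>w. m)"
      unfolding Y_def by (intro EE_diff tame_S tame_fld tame_const)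
    then show ?thesis unfolding gav_diff gav_const[OF S] EE_const by simp
  qed
  also have "\<dots> \<le> EE (\<lambda>w. \<bar>gS x w (\<lambda>\<sigma>. fld J (V q \<sigma>) w - m)\<bar>)" by (rule integral_abs_bound)
  also have "\<dots> \<le> EE (\<lambda>w. gS x w (\<lambda>\<sigma>. \<bar>fld J (V q \<sigma>) w - m\<bar>))"
  proof (rule EE_mono[OF _ tD])
    have "tame (\<lambda>w. gS x w (\<lambda>\<sigma>. fld J (V q \<sigma>) w - m))" by (rule tame_S) (rule tame_diff[OF tame_fld tame_const])
    then show "tame (\<lambda>w. \<bar>gS x w (\<lambda>\<sigma>. fld J (V q \<sigma>) w - m)\<bar>)" by (rule tame_abs)
    show "\<bar>gS x w (\<lambda>\<sigma>. fld J (V q \<sigma>) w - m)\<bar> \<le> gS x w (\<lambda>\<sigma>. \<bar>fld J (V q \<sigma>) w - m\<bar>)" for w by (rule gav_abs)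
  qed
  finally have 2: "\<bar>Y - m\<bar> \<le> \<Delta>" using \<Delta> by simp
  have Af: "\<bar>A x k f\<bar> \<le> 1" by (rule A_abs[OF f])
  have "\<bar>(Y - m) * A x k f\<bar> \<le> \<Delta> * 1" unfolding abs_mult using 2 Af by (intro mult_mono) auto
  moreover have "X - Y * A x k f = (X - m * A x k f) - (Y - m) * A x k f" by (simp add: algebra_simps)
  ultimately have 3: "\<bar>X - Y * A x k f\<bar> \<le> 2 * \<Delta>" using 1 by linarith
  have As: "A x k (\<lambda>l. f l * (eL (\<lambda>\<sigma>. r (l ! j) \<sigma> ^ q) l - 1)) = A x k (\<lambda>l. f l * eL (\<lambda>\<sigma>. r (l ! j) \<sigma> ^ q) l) - A x k f"
    unfolding right_diff_distrib A_diff by simp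
  have "X - Y * A x k f = - a * (real k * NEW x k f j (\<lambda>y. y ^ q) - A x k f * G x (\<lambda>y. y ^ q) - A x k (\<lambda>l. f l * (eL (\<lambda>\<sigma>. r (l ! j) \<sigma> ^ q) l - 1)))"
    unfolding Xe Ye As by (simp add: algebra_simps)
  with 3 have "a * \<bar>real k * NEW x k f j (\<lambda>y. y ^ q) - A x k f * G x (\<lambda>y. y ^ q) - A x k (\<lambda>l. f l * (eL (\<lambda>\<sigma>. r (l ! j) \<sigma> ^ q) l - 1))\<bar> \<le> 2 * \<Delta>"
    using a by (simp add: abs_mult)
  then show ?thesis unfolding a_def[symmetric] using a by (simp add: pos_le_divide_eq mult.commute)
qed

lemma NEW_sum: "finite Q \<Longrightarrow> NEW x k f j (\<lambda>y. \<Sum>q\<in>Q. a q * \<phi> q y) = (\<Sum>q\<in>Q. a q * NEW x k f j (\<phi> q))"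
proof -
  assume Q: "finite Q"
  have "NEW x k f j (\<lambda>y. \<Sum>q\<in>Q. a q * \<phi> q y) = EE (\<lambda>w. \<Sum>q\<in>Q. a q * gR k x w (\<lambda>l. f l * gS x w (\<lambda>\<sigma>. \<phi> q (r (l ! j) \<sigma>))))"
    unfolding NEW_def gav_sum gav_cmult sum_distrib_left
    by (intro arg_cong[where f=EE] ext sum.cong refl) (simp add: gav_cmult[symmetric] mult_ac)
  also have "\<dots> = (\<Sum>q\<in>Q. a q * NEW x k f j (\<phi> q))"
    unfolding NEW_def EE_cmult[symmetric]
    by (intro Bochner_Integration.integral_sum tame_integrable tame_cmult tame_NEW)
  finally show ?thesis .
qed

lemma G_sum: "finite Q \<Longrightarrow> G x (\<lambda>y. \<Sum>q\<in>Q. a q * \<phi> q y) = (\<Sum>q\<in>Q. a q * G x (\<phi> q))"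
proof -
  assume Q: "finite Q"
  have "G x (\<lambda>y. \<Sum>q\<in>Q. a q * \<phi> q y) = EE (\<lambda>w. \<Sum>q\<in>Q. a q * gS x w (\<lambda>\<sigma>. gS x w (\<lambda>\<tau>. \<phi> q (r \<sigma> \<tau>))))"
    unfolding G_def gav_sum gav_cmult ..
  also have "\<dots> = (\<Sum>q\<in>Q. a q * G x (\<phi> q))"
    unfolding G_def EE_cmult[symmetric]
    by (intro Bochner_Integration.integral_sum tame_integrable tame_cmult tame_S tame_const)
  finally show ?thesis .
qed

text \<open>Defect of the identity for the test function \<open>\<phi>\<close>. It is linear in
  \<open>\<phi>\<close>, so bounds pass from monomials to polynomials and by uniform approximation
  to ramps. Subtracting \<open>\<phi> 1\<close> removes the overlap of replica \<open>j\<close> with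
  itself.\<close>

definition GGE :: "(nat \<Rightarrow> real) \<Rightarrow> nat \<Rightarrow> ((nat \<Rightarrow> real) list \<Rightarrow> real) \<Rightarrow> nat \<Rightarrow> (real \<Rightarrow> real) \<Rightarrow> real" where
  "GGE x k f j \<phi> = real k * NEW x k f j \<phi> - A x k f * G x \<phi> - A x k (\<lambda>l. f l * (eL (\<lambda>\<sigma>. \<phi> (r (l ! j) \<sigma>)) l - \<phi> 1))"

lemma GGE_sum:
  assumes Q: "finite Q" shows "GGE x k f j (\<lambda>y. \<Sum>q\<in>Q. a q * \<phi> q y) = (\<Sum>q\<in>Q. a q * GGE x k f j (\<phi> q))"
proof -
  have "A x k (\<lambda>l. f l * (eL (\<lambda>\<sigma>. \<Sum>q\<in>Q. a q * \<phi> q (r (l ! j) \<sigma>)) l - (\<Sum>q\<in>Q. a q * \<phi> q 1)))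
     = A x k (\<lambda>l. \<Sum>q\<in>Q. a q * (f l * (eL (\<lambda>\<sigma>. \<phi> q (r (l ! j) \<sigma>)) l - \<phi> q 1)))"
    unfolding eL_sum eL_cmult sum_subtractf[symmetric] sum_distrib_left
    by (intro A_cong sum.cong refl) (simp add: algebra_simps)
  also have "\<dots> = (\<Sum>q\<in>Q. a q * A x k (\<lambda>l. f l * (eL (\<lambda>\<sigma>. \<phi> q (r (l ! j) \<sigma>)) l - \<phi> q 1)))"
    unfolding A_sum[OF Q] A_cmult ..
  finally show ?thesis
    unfolding GGE_def NEW_sum[OF Q] G_sum[OF Q]
    by (simp add: sum_distrib_left sum_subtractf right_diff_distrib mult_ac)
qed

lemma GGE_zero: assumes j: "j < k" shows "GGE x k f j (\<lambda>y. y ^ 0) = 0"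
proof -
  have "NEW x k f j (\<lambda>y. y ^ 0) = A x k f" unfolding NEW_def A_def by (simp add: gav_const[OF S])
  moreover have "G x (\<lambda>y. y ^ 0) = 1" unfolding G_def power_0 gav_const[OF S] by (rule EE_const)
  moreover have "A x k (\<lambda>l. f l * (eL (\<lambda>\<sigma>. r (l ! j) \<sigma> ^ 0) l - 1 ^ 0)) = A x k (\<lambda>l. (real k - 1) * f l)"
    by (intro A_cong) (auto simp: eL_nth RR_def)
  ultimately show ?thesis unfolding GGE_def A_cmult by (simp add: algebra_simps)
qed

lemma GGE_poly:
  assumes j: "j < k" and f: "\<And>l. l \<in> RR S k \<Longrightarrow> \<bar>f l\<bar> \<le> 1" and x: "\<And>q. q \<in> {1..D} \<Longrightarrow> x q > 0"
    and \<Delta>: "\<And>q. q \<in> {1..D} \<Longrightarrow> \<exists>m. EE (\<lambda>w. gS x w (\<lambda>\<sigma>. \<bar>fld J (V q \<sigma>) w - m\<bar>)) \<le> \<Delta> q"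
  shows "\<bar>GGE x k f j (\<lambda>y. \<Sum>q\<le>D. a q * y ^ q)\<bar> \<le> (\<Sum>q\<in>{1..D}. \<bar>a q\<bar> * (2 * \<Delta> q / (c * x q * real M)))"
proof -
  have "{..D} = insert 0 {1..D}" by auto
  then have "(\<Sum>q\<le>D. a q * GGE x k f j (\<lambda>y. y ^ q)) = (\<Sum>q\<in>{1..D}. a q * GGE x k f j (\<lambda>y. y ^ q))"
    using GGE_zero[OF j] by simp
  then have "\<bar>GGE x k f j (\<lambda>y. \<Sum>q\<le>D. a q * y ^ q)\<bar> \<le> (\<Sum>q\<in>{1..D}. \<bar>a q * GGE x k f j (\<lambda>y. y ^ q)\<bar>)"
    unfolding GGE_sum[OF finite_atMost] by (simp only: sum_abs)
  also have "\<dots> \<le> (\<Sum>q\<in>{1..D}. \<bar>a q\<bar> * (2 * \<Delta> q / (c * x q * real M)))"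
    unfolding abs_mult
  proof (intro sum_mono mult_left_mono)
    fix q assume q: "q \<in> {1..D}"
    obtain m where m: "EE (\<lambda>w. gS x w (\<lambda>\<sigma>. \<bar>fld J (V q \<sigma>) w - m\<bar>)) \<le> \<Delta> q" using \<Delta>[OF q] by blast
    show "\<bar>GGE x k f j (\<lambda>y. y ^ q)\<bar> \<le> 2 * \<Delta> q / (c * x q * real M)"
      unfolding GGE_def power_one by (rule gg_identity[OF q j f x[OF q] m])
  qed auto
  finally show ?thesis .
qed

text \<open>The three parts of the defect contribute k, 1 and k + 1 times the uniform error.\<close>

lemma GGE_approx:
  assumes j: "j < k" and f: "\<And>l. l \<in> RR S k \<Longrightarrow> \<bar>f l\<bar> \<le> 1" and P: "\<And>y. \<bar>y\<bar> \<le> 1 \<Longrightarrow> \<bar>\<phi> y - P y\<bar> \<le> \<delta>"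
  shows "\<bar>GGE x k f j \<phi> - GGE x k f j P\<bar> \<le> (2 * real k + 2) * \<delta>"
proof -
  have d0: "\<delta> \<ge> 0" using P[of 0] by simp
  have Pr: "\<bar>\<phi> (r \<sigma> \<tau>) - P (r \<sigma> \<tau>)\<bar> \<le> \<delta>" if "\<sigma> \<in> S" "\<tau> \<in> S" for \<sigma> \<tau> by (rule P[OF rb[OF that]])
  have 1: "\<bar>NEW x k f j \<phi> - NEW x k f j P\<bar> \<le> \<delta>"
  proof -
    have "\<bar>NEW x k f j \<phi> - NEW x k f j P\<bar> = \<bar>EE (\<lambda>w. gR k x w (\<lambda>l. f l * gS x w (\<lambda>\<sigma>. \<phi> (r (l ! j) \<sigma>) - P (r (l ! j) \<sigma>))))\<bar>"
      unfolding NEW_def gav_diff right_diff_distrib by (intro arg_cong[where f=abs] EE_diff[symmetric] tame_NEW)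
    also have "\<dots> \<le> EE (\<lambda>w. \<bar>gR k x w (\<lambda>l. f l * gS x w (\<lambda>\<sigma>. \<phi> (r (l ! j) \<sigma>) - P (r (l ! j) \<sigma>)))\<bar>)"
      by (rule integral_abs_bound)
    also have "\<dots> \<le> EE (\<lambda>w. \<delta>)"
    proof (intro EE_mono tame_abs tame_RR tame_cmult tame_S tame_const gav_abs_le RRf)
      fix w l assume l: "l \<in> RR S k"
      have "\<bar>gS x w (\<lambda>\<sigma>. \<phi> (r (l ! j) \<sigma>) - P (r (l ! j) \<sigma>))\<bar> \<le> \<delta>"
        by (intro gav_abs_le S Pr) (use RR_D(2)[OF l j] in auto)
      then have "\<bar>f l\<bar> * \<bar>gS x w (\<lambda>\<sigma>. \<phi> (r (l ! j) \<sigma>) - P (r (l ! j) \<sigma>))\<bar> \<le> 1 * \<delta>"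
        using f[OF l] d0 by (intro mult_mono) auto
      then show "\<bar>f l * gS x w (\<lambda>\<sigma>. \<phi> (r (l ! j) \<sigma>) - P (r (l ! j) \<sigma>))\<bar> \<le> \<delta>" by (simp add: abs_mult)
    qed
    finally show ?thesis by (simp only: EE_const)
  qed
  have 2: "\<bar>G x \<phi> - G x P\<bar> \<le> \<delta>"
  proof -
    have "\<bar>G x \<phi> - G x P\<bar> = \<bar>EE (\<lambda>w. gS x w (\<lambda>\<sigma>. gS x w (\<lambda>\<tau>. \<phi> (r \<sigma> \<tau>) - P (r \<sigma> \<tau>))))\<bar>"
      unfolding G_def gav_diff by (intro arg_cong[where f=abs] EE_diff[symmetric] tame_S tame_const)
    also have "\<dots> \<le> EE (\<lambda>w. \<bar>gS x w (\<lambda>\<sigma>. gS x w (\<lambda>\<tau>. \<phi> (r \<sigma> \<tau>) - P (r \<sigma> \<tau>)))\<bar>)"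
      by (rule integral_abs_bound)
    also have "\<dots> \<le> EE (\<lambda>w. \<delta>)"
      by (intro EE_mono tame_abs tame_S tame_const gav_abs_le S Pr)
    finally show ?thesis by (simp only: EE_const)
  qed
  have 3: "\<bar>A x k (\<lambda>l. f l * (eL (\<lambda>\<sigma>. \<phi> (r (l ! j) \<sigma>)) l - \<phi> 1)) - A x k (\<lambda>l. f l * (eL (\<lambda>\<sigma>. P (r (l ! j) \<sigma>)) l - P 1))\<bar> \<le> (real k + 1) * \<delta>"
    unfolding A_diff[symmetric]
  proof (rule A_abs)
    fix l assume l: "l \<in> RR S k"
    have "\<bar>eL (\<lambda>\<sigma>. \<phi> (r (l ! j) \<sigma>)) l - eL (\<lambda>\<sigma>. P (r (l ! j) \<sigma>)) l\<bar> \<le> (\<Sum>i<k. \<bar>\<phi> (r (l ! j) (l ! i)) - P (r (l ! j) (l ! i))\<bar>)"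
      unfolding eL_nth RR_D(1)[OF l] sum_subtractf[symmetric] by (rule sum_abs)
    also have "\<dots> \<le> (\<Sum>i<k. \<delta>)" by (intro sum_mono Pr) (use RR_D(2)[OF l] j in auto)
    finally have "\<bar>eL (\<lambda>\<sigma>. \<phi> (r (l ! j) \<sigma>)) l - eL (\<lambda>\<sigma>. P (r (l ! j) \<sigma>)) l\<bar> \<le> real k * \<delta>" by simp
    moreover have "\<bar>\<phi> 1 - P 1\<bar> \<le> \<delta>" by (rule P) simp
    ultimately have "\<bar>(eL (\<lambda>\<sigma>. \<phi> (r (l ! j) \<sigma>)) l - \<phi> 1) - (eL (\<lambda>\<sigma>. P (r (l ! j) \<sigma>)) l - P 1)\<bar> \<le> (real k + 1) * \<delta>"
      by (simp add: distrib_right)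
    then have "\<bar>f l\<bar> * \<bar>(eL (\<lambda>\<sigma>. \<phi> (r (l ! j) \<sigma>)) l - \<phi> 1) - (eL (\<lambda>\<sigma>. P (r (l ! j) \<sigma>)) l - P 1)\<bar> \<le> 1 * ((real k + 1) * \<delta>)"
      using f[OF l] d0 by (intro mult_mono) auto
    then show "\<bar>f l * (eL (\<lambda>\<sigma>. \<phi> (r (l ! j) \<sigma>)) l - \<phi> 1) - f l * (eL (\<lambda>\<sigma>. P (r (l ! j) \<sigma>)) l - P 1)\<bar> \<le> (real k + 1) * \<delta>"
      by (simp add: abs_mult[symmetric] right_diff_distrib[symmetric])
  qed
  have "\<bar>real k * (NEW x k f j \<phi> - NEW x k f j P)\<bar> \<le> real k * \<delta>"
    unfolding abs_mult using 1 by (intro mult_mono) auto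
  moreover have "\<bar>A x k f * (G x \<phi> - G x P)\<bar> \<le> 1 * \<delta>"
    unfolding abs_mult by (intro mult_mono A_abs[OF f] 2) auto
  moreover have "GGE x k f j \<phi> - GGE x k f j P = real k * (NEW x k f j \<phi> - NEW x k f j P) - A x k f * (G x \<phi> - G x P)
    - (A x k (\<lambda>l. f l * (eL (\<lambda>\<sigma>. \<phi> (r (l ! j) \<sigma>)) l - \<phi> 1)) - A x k (\<lambda>l. f l * (eL (\<lambda>\<sigma>. P (r (l ! j) \<sigma>)) l - P 1)))"
    unfolding GGE_def by (simp add: algebra_simps)
  ultimately show ?thesis using 3 by (simp add: distrib_right)
qed


subsection \<open>Talagrand's positivity principle\<close>

text \<open>Soft indicator that all pairwise overlaps are negative. The newcomer is tested with the
  ramp indexed by the current length, so on a nonzero chain the next ramp equals 1 on every pair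
  already present.\<close>

primrec gch :: "real \<Rightarrow> nat \<Rightarrow> (nat \<Rightarrow> real) list \<Rightarrow> real" where
  "gch \<epsilon> K [] = 1"
| "gch \<epsilon> K (\<sigma> # l) = gch \<epsilon> K l * (\<Prod>j<length l. ramp \<epsilon> K (length l) (r (l ! j) \<sigma>))"

lemma gch_bounds: "0 \<le> gch \<epsilon> K l" "gch \<epsilon> K l \<le> 1"
proof (induction l)
  case (Cons \<sigma> l)
  have *: "0 \<le> (\<Prod>j<length l. ramp \<epsilon> K (length l) (r (l ! j) \<sigma>))" "(\<Prod>j<length l. ramp \<epsilon> K (length l) (r (l ! j) \<sigma>)) \<le> 1"
    by (auto intro!: prod_nonneg prod_le_1 simp: ramp_bounds)
  show "0 \<le> gch \<epsilon> K (\<sigma> # l)" using * Cons.IH by simp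
  show "gch \<epsilon> K (\<sigma> # l) \<le> 1" using * Cons.IH by (simp add: mult_le_one)
qed auto

lemma gch_pairs:
  assumes "set l \<subseteq> S" "gch \<epsilon> K l \<noteq> 0" "i < length l" "j < length l" "i \<noteq> j"
  shows "\<exists>m<length l. ramp \<epsilon> K m (r (l ! i) (l ! j)) \<noteq> 0"
  using assms
proof (induction l arbitrary: i j)
  case (Cons \<sigma> l)
  have new: "ramp \<epsilon> K (length l) (r (l ! j) \<sigma>) \<noteq> 0" if "j < length l" for j
    using Cons.prems(2) that by auto
  show ?case
  proof (cases i)
    case 0
    then obtain j' where j': "j = Suc j'" using Cons.prems by (cases j) auto
    have "r \<sigma> (l ! j') = r (l ! j') \<sigma>" using Cons.prems(1,4) j' by (intro rsym) (auto simp: subset_iff)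
    then show ?thesis using new[of j'] 0 j' Cons.prems(4) by (intro exI[of _ "length l"]) auto
  next
    case i': (Suc i')
    show ?thesis
    proof (cases j)
      case 0
      then show ?thesis using new[of i'] i' Cons.prems(3) by (intro exI[of _ "length l"]) auto
    next
      case (Suc j')
      then obtain m where "m < length l" "ramp \<epsilon> K m (r (l ! i') (l ! j')) \<noteq> 0"
        using Cons.IH[of i' j'] Cons.prems i' by auto
      then show ?thesis using i' Suc by (intro exI[of _ m]) auto
    qed
  qed
qed simp

text \<open>On a nonzero chain the overlap matrix has unit diagonal and entries at most - \<epsilon>
  elsewhere; its entries sum to at most K (1 - (K - 1) \<epsilon>) < 0, which positive
  semidefiniteness forbids.\<close>

lemma chain_end:
  assumes \<epsilon>: "\<epsilon> > 0" and K: "(real K - 1) * \<epsilon> > 1" "K \<ge> 1" and l: "l \<in> RR S K"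
  shows "gch \<epsilon> K l = 0"
proof (rule ccontr)
  assume g: "gch \<epsilon> K l \<noteq> 0"
  have len: "length l = K" "set l \<subseteq> S" using RR_D[OF l] by auto
  have "(\<Sum>i<K. \<Sum>j<K. r (l ! i) (l ! j)) \<le> (\<Sum>i<K. \<Sum>j<K. if i = j then 1 else - \<epsilon>)"
  proof (intro sum_mono)
    fix i j assume ij: "i \<in> {..<K}" "j \<in> {..<K}"
    show "r (l ! i) (l ! j) \<le> (if i = j then 1 else - \<epsilon>)"
    proof (cases "i = j")
      case True then show ?thesis using r1[OF RR_D(2)[OF l, of j]] ij by simp
    next
      case False
      then obtain m where m: "m < K" "ramp \<epsilon> K m (r (l ! i) (l ! j)) \<noteq> 0"
        using gch_pairs[OF len(2) g, of i j] ij len(1) by auto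
      show ?thesis using ramp_supp[OF \<epsilon> m] False by simp
    qed
  qed
  also have "\<dots> = (\<Sum>i<K. 1 + (real K - 1) * (- \<epsilon>))"
  proof (intro sum.cong refl)
    fix i assume "i \<in> {..<K}"
    then have "(\<Sum>j<K. if i = j then 1 else - \<epsilon>) = 1 + (\<Sum>j\<in>{..<K} - {i}. if i = j then 1 else - \<epsilon>)"
      by (subst sum.remove[of _ i]) auto
    also have "(\<Sum>j\<in>{..<K} - {i}. if i = j then 1 else - \<epsilon>) = (\<Sum>j\<in>{..<K} - {i}. - \<epsilon>)" by (intro sum.cong) auto
    also have "\<dots> = (real K - 1) * (- \<epsilon>)" using \<open>i \<in> {..<K}\<close> K by (simp add: of_nat_diff)
    finally show "(\<Sum>j<K. if i = j then 1 else - \<epsilon>) = 1 + (real K - 1) * (- \<epsilon>)" .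
  qed
  also have "\<dots> = real K * (1 - (real K - 1) * \<epsilon>)" by simp
  also have "\<dots> < 0" using K by (intro mult_pos_neg) auto
  finally show False using psd[OF len(2)] len(1) by simp
qed

text \<open>Given a chain of \<open>n\<close> replicas with pairwise negative overlaps, the Ghirlanda-Guerra identities
  say that a new replica is far from replica \<open>j\<close> with probability at least \<open>1 - (1 - \<alpha>)/n\<close>; a union bound
  over the \<open>n\<close> replicas extends the chain at the price of a factor \<open>\<alpha>\<close>.\<close>

lemma chain_step:
  assumes \<epsilon>: "\<epsilon> > 0" and n: "1 \<le> n" "n < K"
    and err: "\<And>j. j < n \<Longrightarrow> \<bar>GGE x n (gch \<epsilon> K) j (ramp \<epsilon> K n)\<bar> \<le> err"
    and \<alpha>: "\<alpha> = G x (\<lambda>y. if y \<le> - 2 * \<epsilon> then 1 else 0)"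
  shows "A x (Suc n) (gch \<epsilon> K) \<ge> \<alpha> * A x n (gch \<epsilon> K) - err"
proof -
  let ?g = "gch \<epsilon> K" and ?\<phi> = "ramp \<epsilon> K n"
  let ?nw = "\<lambda>w j. gR n x w (\<lambda>l. ?g l * gS x w (\<lambda>\<sigma>. ?\<phi> (r (l ! j) \<sigma>)))"
  let ?lo = "\<lambda>w. gR n x w ?g - (\<Sum>j<n. gR n x w ?g - ?nw w j)"
  have E0: "0 \<le> A x n ?g" using A_mono[of n "\<lambda>_. 0" ?g x] gch_bounds(1) by (simp add: A_const)
  have G: "\<alpha> \<le> G x ?\<phi>"
    unfolding \<alpha> G_def using ramp_ind[OF \<epsilon>] by (intro EE_mono tame_S tame_const gav_mono)
  have NEWj: "real n * (A x n ?g - NEW x n ?g j ?\<phi>) \<le> (1 - \<alpha>) * A x n ?g + err" if j: "j < n" for j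
  proof -
    \<comment> \<open>The staggering at work: the n - 1 other old replicas contribute exactly 1
      each.\<close>
    have "A x n (\<lambda>l. ?g l * (eL (\<lambda>\<sigma>. ?\<phi> (r (l ! j) \<sigma>)) l - ?\<phi> 1)) = A x n (\<lambda>l. (real n - 1) * ?g l)"
    proof (rule A_cong)
      fix l assume l: "l \<in> RR S n"
      note len = RR_D(1)[OF l]
      have "eL (\<lambda>\<sigma>. ?\<phi> (r (l ! j) \<sigma>)) l - ?\<phi> 1 = real n - 1" if g: "?g l \<noteq> 0"
      proof -
        have 1: "?\<phi> (r (l ! j) (l ! i)) = 1" if i: "i < n" "i \<noteq> j" for i
        proof -
          obtain m where m: "m < n" "ramp \<epsilon> K m (r (l ! j) (l ! i)) \<noteq> 0"
            using gch_pairs[OF RR_D(3)[OF l] g, of j i] i j len by auto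
          show ?thesis by (rule ramp_next[OF m])
        qed
        have "eL (\<lambda>\<sigma>. ?\<phi> (r (l ! j) \<sigma>)) l = ?\<phi> (r (l ! j) (l ! j)) + (\<Sum>i\<in>{..<n} - {j}. ?\<phi> (r (l ! j) (l ! i)))"
          unfolding eL_nth len using j by (subst sum.remove[of _ j]) auto
        also have "?\<phi> (r (l ! j) (l ! j)) = ?\<phi> 1" using r1[OF RR_D(2)[OF l j]] by simp
        also have "(\<Sum>i\<in>{..<n} - {j}. ?\<phi> (r (l ! j) (l ! i))) = (\<Sum>i\<in>{..<n} - {j}. 1)" by (intro sum.cong 1) auto
        also have "\<dots> = real n - 1" using j by (simp add: of_nat_diff)
        finally show ?thesis by simp
      qed
      then show "?g l * (eL (\<lambda>\<sigma>. ?\<phi> (r (l ! j) \<sigma>)) l - ?\<phi> 1) = (real n - 1) * ?g l" by (cases "?g l = 0") auto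
    qed
    then have "GGE x n ?g j ?\<phi> = real n * NEW x n ?g j ?\<phi> - A x n ?g * G x ?\<phi> - (real n - 1) * A x n ?g"
      unfolding GGE_def A_cmult by simp
    moreover have "A x n ?g * \<alpha> \<le> A x n ?g * G x ?\<phi>" by (intro mult_left_mono G E0)
    ultimately show ?thesis using err[OF j] by (simp add: algebra_simps)
  qed
  have "A x (Suc n) ?g = EE (\<lambda>w. gR n x w (\<lambda>l. gS x w (\<lambda>\<sigma>. ?g (\<sigma> # l))))"
    unfolding A_def gav_RR_Suc ..
  also have "\<dots> \<ge> EE (\<lambda>w. ?lo w)"
  proof (rule EE_mono)
    show "tame (\<lambda>w. gR n x w (\<lambda>l. gS x w (\<lambda>\<sigma>. ?g (\<sigma> # l))))"
      by (intro tame_RR tame_S tame_const)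
    show "tame (\<lambda>w. ?lo w)"
      by (intro tame_diff tame_sum tame_NEW tame_RR tame_const)
    fix w
    have "?lo w
      = gR n x w (\<lambda>l. ?g l - (\<Sum>j<n. ?g l - ?g l * gS x w (\<lambda>\<sigma>. ?\<phi> (r (l ! j) \<sigma>))))"
      unfolding gav_diff gav_sum ..
    also have "\<dots> \<le> gR n x w (\<lambda>l. gS x w (\<lambda>\<sigma>. ?g (\<sigma> # l)))"
    proof (rule gav_mono)
      fix l assume l: "l \<in> RR S n"
      have "?g l - (\<Sum>j<n. ?g l - ?g l * gS x w (\<lambda>\<sigma>. ?\<phi> (r (l ! j) \<sigma>)))
        = gS x w (\<lambda>\<sigma>. ?g l - (\<Sum>j<n. ?g l - ?g l * ?\<phi> (r (l ! j) \<sigma>)))"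
        unfolding gav_diff gav_sum gav_cmult gav_const[OF S] ..
      also have "\<dots> \<le> gS x w (\<lambda>\<sigma>. ?g (\<sigma> # l))"
      proof (rule gav_mono)
        fix \<sigma>
        have "?g l * (1 - (\<Sum>j<n. 1 - ?\<phi> (r (l ! j) \<sigma>))) \<le> ?g l * (\<Prod>j<n. ?\<phi> (r (l ! j) \<sigma>))"
          by (intro mult_left_mono gch_bounds prod_ge_1_sum) (auto simp: ramp_bounds)
        then show "?g l - (\<Sum>j<n. ?g l - ?g l * ?\<phi> (r (l ! j) \<sigma>)) \<le> ?g (\<sigma> # l)"
          by (simp add: RR_D(1)[OF l] right_diff_distrib sum_subtractf sum_distrib_left mult.commute[of "real n"])
      qed
      finally show "?g l - (\<Sum>j<n. ?g l - ?g l * gS x w (\<lambda>\<sigma>. ?\<phi> (r (l ! j) \<sigma>))) \<le> gS x w (\<lambda>\<sigma>. ?g (\<sigma> # l))" .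
    qed
    finally show "?lo w
      \<le> gR n x w (\<lambda>l. gS x w (\<lambda>\<sigma>. ?g (\<sigma> # l)))" .
  qed
  also have "EE (\<lambda>w. ?lo w)
    = A x n ?g - (\<Sum>j<n. A x n ?g - NEW x n ?g j ?\<phi>)"
  proof -
    have s: "EE (\<lambda>w. \<Sum>j<n. gR n x w ?g - ?nw w j)
      = (\<Sum>j<n. EE (\<lambda>w. gR n x w ?g - ?nw w j))"
      by (intro Bochner_Integration.integral_sum tame_integrable tame_diff tame_NEW tame_RR tame_const)
    have d: "EE (\<lambda>w. gR n x w ?g - ?nw w j)
      = A x n ?g - NEW x n ?g j ?\<phi>" for j
      unfolding A_def NEW_def by (intro EE_diff tame_NEW tame_RR tame_const)
    show ?thesis unfolding d[symmetric] s[symmetric] unfolding A_def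
      by (intro EE_diff tame_sum tame_diff tame_NEW tame_RR tame_const)
  qed
  finally have 1: "A x (Suc n) ?g \<ge> A x n ?g - (\<Sum>j<n. A x n ?g - NEW x n ?g j ?\<phi>)" .
  have "real n * (\<Sum>j<n. A x n ?g - NEW x n ?g j ?\<phi>) \<le> (\<Sum>j<n. (1 - \<alpha>) * A x n ?g + err)"
    unfolding sum_distrib_left by (intro sum_mono NEWj) auto
  then have "real n * (\<Sum>j<n. A x n ?g - NEW x n ?g j ?\<phi>) \<le> real n * ((1 - \<alpha>) * A x n ?g + err)" by simp
  then have "(\<Sum>j<n. A x n ?g - NEW x n ?g j ?\<phi>) \<le> (1 - \<alpha>) * A x n ?g + err" using n by simp
  with 1 show ?thesis by (simp add: algebra_simps)
qed

lemma G_ind: "0 \<le> G x (\<lambda>y. if y \<le> a then 1 else 0)" "G x (\<lambda>y. if y \<le> a then 1 else 0) \<le> 1"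
proof -
  have t: "tame (\<lambda>w. gS x w (\<lambda>\<sigma>. gS x w (\<lambda>\<tau>. if r \<sigma> \<tau> \<le> a then 1 else 0)))"
    by (intro tame_S tame_const)
  have "EE (\<lambda>w. 0) \<le> G x (\<lambda>y. if y \<le> a then 1 else 0)" "G x (\<lambda>y. if y \<le> a then 1 else 0) \<le> EE (\<lambda>w. 1)"
    unfolding G_def by (rule EE_mono[OF tame_const t], intro gav_ge S, simp) (rule EE_mono[OF t tame_const], intro gav_le S, simp)
  then show "0 \<le> G x (\<lambda>y. if y \<le> a then 1 else 0)" "G x (\<lambda>y. if y \<le> a then 1 else 0) \<le> 1"
    by (simp_all only: EE_const)
qed

text \<open>Starting from mean 1 for a single replica, each extension multiplies by \<alpha> up to
  an error; since chains of length \<open>K\<close> do not exist, the (K - 1)-th power of \<alpha>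
  is bounded by the accumulated errors.\<close>

lemma chain_bound:
  assumes \<epsilon>: "\<epsilon> > 0" and K: "(real K - 1) * \<epsilon> > 1" "K \<ge> 2"
    and err: "\<And>n j. 1 \<le> n \<Longrightarrow> n < K \<Longrightarrow> j < n \<Longrightarrow> \<bar>GGE x n (gch \<epsilon> K) j (ramp \<epsilon> K n)\<bar> \<le> err"
  shows "G x (\<lambda>y. if y \<le> - 2 * \<epsilon> then 1 else 0) ^ (K - 1) \<le> real K * err"
proof -
  define \<alpha> where "\<alpha> = G x (\<lambda>y. if y \<le> - 2 * \<epsilon> then 1 else 0)"
  have \<alpha>: "0 \<le> \<alpha>" "\<alpha> \<le> 1" unfolding \<alpha>_def by (rule G_ind)+
  have e0: "err \<ge> 0" using err[of 1 0] K by auto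
  have "A x (Suc n) (gch \<epsilon> K) \<ge> \<alpha> ^ n - real n * err" if "n < K" for n
    using that
  proof (induction n)
    case 0
    have "A x 1 (gch \<epsilon> K) = A x 1 (\<lambda>_. 1)"
      by (rule A_cong) (auto simp: RR_def length_Suc_conv)
    then show ?case by (simp add: A_const)
  next
    case (Suc n)
    have "\<alpha> * (\<alpha> ^ n - real n * err) \<le> \<alpha> * A x (Suc n) (gch \<epsilon> K)" using Suc \<alpha> by (intro mult_left_mono) auto
    moreover have "\<alpha> * (real n * err) \<le> 1 * (real n * err)" using \<alpha> e0 by (intro mult_right_mono) auto
    moreover have "A x (Suc (Suc n)) (gch \<epsilon> K) \<ge> \<alpha> * A x (Suc n) (gch \<epsilon> K) - err"
      using Suc.prems by (intro chain_step[OF \<epsilon>] err \<alpha>_def) auto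
    ultimately show ?case by (simp add: algebra_simps)
  qed
  from this[of "K - 1"] K have "A x K (gch \<epsilon> K) \<ge> \<alpha> ^ (K - 1) - real (K - 1) * err" by simp
  moreover have "A x K (gch \<epsilon> K) = A x K (\<lambda>_. 0)" by (intro A_cong chain_end \<epsilon> K) (use K in auto)
  moreover have "real (K - 1) * err \<le> real K * err" using e0 by (intro mult_right_mono) auto
  ultimately show ?thesis unfolding \<alpha>_def[symmetric] by (simp add: A_const)
qed


subsection \<open>Concentration of the perturbing fields\<close>

definition \<psi> :: "(nat \<Rightarrow> real) \<Rightarrow> real" where
  "\<psi> x = EE (\<lambda>w. lZ S (en x w))"

lemma en_upd: "q \<in> {1..D} \<Longrightarrow> en (x(q := x q + y)) w \<sigma> = en x w \<sigma> + c * y * fld J (V q \<sigma>) w"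
proof -
  assume q: "q \<in> {1..D}"
  have "uu V D c (x(q := x q + y)) \<sigma> i = uu V D c x \<sigma> i + c * y * V q \<sigma> i" for i
  proof -
    have "(\<Sum>q'\<in>{1..D}. (x(q := x q + y)) q' * V q' \<sigma> i) = (\<Sum>q'\<in>{1..D}. x q' * V q' \<sigma> i + (if q' = q then y * V q \<sigma> i else 0))"
      by (intro sum.cong refl) (auto simp: algebra_simps)
    also have "\<dots> = (\<Sum>q'\<in>{1..D}. x q' * V q' \<sigma> i) + y * V q \<sigma> i"
      using q by (simp add: sum.distrib sum.delta)
    finally show ?thesis by (simp add: uu_def distrib_left)
  qed
  then show ?thesis unfolding en_def fld_def by (simp add: distrib_left sum.distrib sum_distrib_left mult_ac)
qed

lemma tame_en: "tame (\<lambda>w. en x w \<sigma>)"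
  unfolding en_def by (intro tame_intros tame_fld)

lemma tame_lZ_en: "tame (\<lambda>w. lZ S (en x w))"
  by (intro tame_lZ S tame_en)

text \<open>With strengths at most 3, Cauchy-Schwarz over the \<open>D\<close> fields gives the
  variance proxy (3 c D)^2 M, and the mean deviation is 6 times its root. Only the disorder of the
  perturbing fields fluctuates here; \<open>d\<close> is fixed.\<close>

lemma lZ_fluct:
  assumes D: "D \<ge> 1" and x: "\<And>q. q \<in> {1..D} \<Longrightarrow> 0 \<le> x q \<and> x q \<le> 3"
  shows "EE (\<lambda>w. \<bar>lZ S (en x w) - \<psi> x\<bar>) \<le> 18 * c * D * sqrt M"
proof -
  have "\<exists>b. (\<forall>q\<in>{1..D}. (\<Sum>i\<in>J. (b q i)\<^sup>2) \<le> real M) \<and> (\<forall>q\<in>{1..D}. \<forall>\<sigma>\<in>S. \<forall>i\<in>J. \<bar>V q \<sigma> i\<bar> \<le> b q i)"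
    using sys unfolding ggsys_def by (elim conjE)
  then obtain b where b: "\<And>q. q \<in> {1..D} \<Longrightarrow> (\<Sum>i\<in>J. (b q i)\<^sup>2) \<le> real M"
    "\<And>q \<sigma> i. q \<in> {1..D} \<Longrightarrow> \<sigma> \<in> S \<Longrightarrow> i \<in> J \<Longrightarrow> \<bar>V q \<sigma> i\<bar> \<le> b q i"
    by blast
  define B where "B i = c * (\<Sum>q\<in>{1..D}. 3 * \<bar>b q i\<bar>)" for i
  have B: "\<bar>uu V D c x \<sigma> i\<bar> \<le> B i" if "\<sigma> \<in> S" "i \<in> J" for \<sigma> i
  proof -
    have "\<bar>\<Sum>q\<in>{1..D}. x q * V q \<sigma> i\<bar> \<le> (\<Sum>q\<in>{1..D}. \<bar>x q * V q \<sigma> i\<bar>)" by (rule sum_abs)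
    also have "\<dots> \<le> (\<Sum>q\<in>{1..D}. 3 * \<bar>b q i\<bar>)"
    proof (rule sum_mono)
      fix q assume q: "q \<in> {1..D}"
      have "\<bar>V q \<sigma> i\<bar> \<le> \<bar>b q i\<bar>" using b(2)[OF q that] by linarith
      then show "\<bar>x q * V q \<sigma> i\<bar> \<le> 3 * \<bar>b q i\<bar>" unfolding abs_mult using x[OF q] by (intro mult_mono) auto
    qed
    finally show ?thesis unfolding uu_def B_def abs_mult using c by (intro mult_mono) auto
  qed
  have V0: "(\<Sum>i\<in>J. (B i)\<^sup>2) \<le> (3 * c * D)\<^sup>2 * real M"
  proof -
    have "(B i)\<^sup>2 \<le> 9 * c\<^sup>2 * D * (\<Sum>q\<in>{1..D}. (b q i)\<^sup>2)" for i
    proof -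
      have "(\<Sum>q\<in>{1..D}. 3 * \<bar>b q i\<bar>)\<^sup>2 \<le> (\<Sum>q\<in>{1..D}. 1\<^sup>2) * (\<Sum>q\<in>{1..D}. (3 * \<bar>b q i\<bar>)\<^sup>2)"
        using Cauchy_Schwarz_ineq_sum[of "\<lambda>_. 1" "\<lambda>q. 3 * \<bar>b q i\<bar>" "{1..D}"] by simp
      also have "\<dots> = real D * (9 * (\<Sum>q\<in>{1..D}. (b q i)\<^sup>2))"
        by (simp add: power_mult_distrib sum_distrib_left)
      finally have "c\<^sup>2 * (\<Sum>q\<in>{1..D}. 3 * \<bar>b q i\<bar>)\<^sup>2 \<le> c\<^sup>2 * (real D * (9 * (\<Sum>q\<in>{1..D}. (b q i)\<^sup>2)))"
        by (intro mult_left_mono) auto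
      then show ?thesis unfolding B_def power_mult_distrib by (simp add: mult_ac)
    qed
    then have "(\<Sum>i\<in>J. (B i)\<^sup>2) \<le> (\<Sum>i\<in>J. 9 * c\<^sup>2 * D * (\<Sum>q\<in>{1..D}. (b q i)\<^sup>2))" by (intro sum_mono)
    also have "\<dots> = 9 * c\<^sup>2 * D * (\<Sum>q\<in>{1..D}. \<Sum>i\<in>J. (b q i)\<^sup>2)"
      unfolding sum_distrib_left[symmetric] by (subst sum.swap) simp
    also have "\<dots> \<le> 9 * c\<^sup>2 * D * (\<Sum>q\<in>{1..D}. real M)" by (intro mult_left_mono sum_mono b) auto
    finally show ?thesis by (simp add: power2_eq_square mult_ac)
  qed
  have Vp: "(3 * c * D)\<^sup>2 * real M > 0" using c D n by simp
  let ?F = "\<lambda>w. lZ S (\<lambda>\<sigma>. d \<sigma> + fld J (uu V D c x \<sigma>) w)"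
  have L: "depends_on J ?F" "?F \<in> borel_measurable disorder"
    "\<And>i w x y. i \<in> J \<Longrightarrow> \<bar>?F (w(i:=x)) - ?F (w(i:=y))\<bar> \<le> B i * \<bar>x - y\<bar>"
    by (rule lZ_concentration[where b=B, OF S J]; use B in blast)+
  have "EE (\<lambda>w. \<bar>?F w - EE ?F\<bar>) \<le> 6 * sqrt ((3 * c * D)\<^sup>2 * real M)"
    by (rule concentration(3)[OF J L(1,2) _ V0 Vp]) (rule L(3))
  also have "\<dots> = 18 * c * D * sqrt M" using c by (simp add: real_sqrt_mult)
  finally show ?thesis unfolding \<psi>_def en_def[abs_def] .
qed

text \<open>Convexity in place of differentiability. Exponentiating |z - u| produces log-partition
  functions at strengths shifted by y and -y, so the total fluctuation of the field, thermal and
  from the disorder, is bounded by a second difference of \<open>\<psi>\<close> plus three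
  deviations of log-partition functions: 54 = 3 * 18.\<close>

lemma fluct:
  assumes q: "q \<in> {1..D}" and y: "y > 0" and x: "\<And>q'. q' \<in> {1..D} \<Longrightarrow> 0 \<le> x q' \<and> x q' \<le> 3" "x q - y \<ge> 0" "x q + y \<le> 3"
  shows "\<exists>m. EE (\<lambda>w. gS x w (\<lambda>\<sigma>. \<bar>fld J (V q \<sigma>) w - m\<bar>))
    \<le> (ln 2 + (\<psi> (x(q := x q + y)) + \<psi> (x(q := x q - y)) - 2 * \<psi> x) + 54 * c * D * sqrt M) / (c * y)"
proof -
  define xp where "xp = x(q := x q + y)"
  define xm where "xm = x(q := x q - y)"
  define z where "z w \<sigma> = c * y * fld J (V q \<sigma>) w" for w \<sigma>
  \<comment> \<open>A discrete derivative of \<psi> serves as the centring, which makes the shifted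
    free energies agree up to the second difference.\<close>
  define u where "u = \<psi> xp - \<psi> x"
  have cy: "c * y > 0" using c y by simp
  have ep: "en xp w = (\<lambda>\<sigma>. en x w \<sigma> + z w \<sigma>)" for w unfolding xp_def z_def using en_upd[OF q] by (intro ext) auto
  have em: "en xm w = (\<lambda>\<sigma>. en x w \<sigma> + - z w \<sigma>)" for w unfolding xm_def z_def using en_upd[OF q, of x "- y"] by (intro ext) auto
  have x': "0 \<le> xp q' \<and> xp q' \<le> 3" "0 \<le> xm q' \<and> xm q' \<le> 3" if "q' \<in> {1..D}" for q'
    using x(1)[OF that] x(2,3) y x(1)[OF q] by (auto simp: xp_def xm_def)
  have D1: "D \<ge> 1" using q by auto
  define sd where "sd w = lZ S (en xp w) + lZ S (en xm w) - 2 * lZ S (en x w)" for w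
  have sd0: "0 \<le> sd w" for w
    using lZ_tangent[OF S, of "en x w" "z w"] lZ_tangent[OF S, of "en x w" "\<lambda>\<sigma>. - z w \<sigma>"] gav_cmult[of S "en x w" "-1" "z w"]
    unfolding sd_def ep em by simp
  let ?\<Delta> = "\<lambda>x w. \<bar>lZ S (en x w) - \<psi> x\<bar>"
  have pw: "gS x w (\<lambda>\<sigma>. \<bar>z w \<sigma> - u\<bar>) \<le> ln 2 + (\<psi> xp + \<psi> xm - 2 * \<psi> x) + (?\<Delta> xp w + ?\<Delta> xm w + ?\<Delta> x w)"
    if SD: "0 \<le> \<psi> xp + \<psi> xm - 2 * \<psi> x" for w
  proof -
    let ?m = "max (lZ S (en xp w) - u) (lZ S (en xm w) + u)"
    have "lZ S (en x w) + gS x w (\<lambda>\<sigma>. \<bar>z w \<sigma> - u\<bar>) \<le> lZ S (\<lambda>\<sigma>. en x w \<sigma> + \<bar>z w \<sigma> - u\<bar>)"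
      by (rule lZ_tangent[OF S])
    also have "\<dots> \<le> ln (2 * exp ?m)"
      unfolding lZ_def[of S "\<lambda>\<sigma>. en x w \<sigma> + \<bar>z w \<sigma> - u\<bar>"]
    proof (rule ln_mono)
      have "Zs S (\<lambda>\<sigma>. en x w \<sigma> + \<bar>z w \<sigma> - u\<bar>) \<le> (\<Sum>\<sigma>\<in>S. exp (- u) * exp (en xp w \<sigma>) + exp u * exp (en xm w \<sigma>))"
        unfolding Zs_def ep em exp_add[symmetric]
      proof (rule sum_mono)
        fix \<sigma>
        show "exp (en x w \<sigma> + \<bar>z w \<sigma> - u\<bar>) \<le> exp (- u + (en x w \<sigma> + z w \<sigma>)) + exp (u + (en x w \<sigma> + - z w \<sigma>))"
          by (cases "z w \<sigma> - u \<ge> 0") (simp_all add: algebra_simps add_increasing add_increasing2)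
      qed
      also have "\<dots> = exp (lZ S (en xp w) - u) + exp (lZ S (en xm w) + u)"
        by (simp add: sum.distrib sum_distrib_left[symmetric] exp_diff exp_add exp_lZ[OF S] Zs_def[symmetric] exp_minus divide_inverse mult.commute)
      also have "\<dots> \<le> exp ?m + exp ?m" by (intro add_mono) auto
      finally show "Zs S (\<lambda>\<sigma>. en x w \<sigma> + \<bar>z w \<sigma> - u\<bar>) \<le> 2 * exp ?m" by simp
    qed (rule Zs_pos[OF S])
    also have "\<dots> = ln 2 + ?m" by (simp add: ln_mult)
    finally have "gS x w (\<lambda>\<sigma>. \<bar>z w \<sigma> - u\<bar>) \<le> ln 2 + ?m - lZ S (en x w)" by simp
    then show ?thesis using SD unfolding u_def by linarith
  qed
  have SD: "0 \<le> \<psi> xp + \<psi> xm - 2 * \<psi> x"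
  proof -
    have "EE sd = \<psi> xp + \<psi> xm - 2 * \<psi> x"
      unfolding sd_def \<psi>_def EE_cmult[symmetric]
      by (simp only: EE_diff[OF tame_add[OF tame_lZ_en tame_lZ_en] tame_cmult[OF tame_lZ_en]] EE_add[OF tame_lZ_en tame_lZ_en])
    moreover have "0 \<le> EE sd" by (intro Bochner_Integration.integral_nonneg sd0)
    ultimately show ?thesis by simp
  qed
  have tz: "tame (\<lambda>w. gS x w (\<lambda>\<sigma>. \<bar>z w \<sigma> - u\<bar>))"
    unfolding z_def by (intro tame_S tame_abs tame_diff tame_cmult tame_fld tame_const)
  have tD: "tame (?\<Delta> x)" for x by (intro tame_abs tame_diff tame_lZ_en tame_const)
  have "EE (\<lambda>w. gS x w (\<lambda>\<sigma>. \<bar>z w \<sigma> - u\<bar>)) \<le> EE (\<lambda>w. ln 2 + (\<psi> xp + \<psi> xm - 2 * \<psi> x) + (?\<Delta> xp w + ?\<Delta> xm w + ?\<Delta> x w))"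
    by (intro EE_mono tz tame_add tame_const tD pw SD)
  also have "\<dots> = ln 2 + (\<psi> xp + \<psi> xm - 2 * \<psi> x) + (EE (?\<Delta> xp) + EE (?\<Delta> xm) + EE (?\<Delta> x))"
    by (simp only: EE_add[OF tame_const tame_add[OF tame_add[OF tD tD] tD]] EE_add[OF tame_add[OF tD tD] tD] EE_add[OF tD tD] EE_const)
  also have "\<dots> \<le> ln 2 + (\<psi> xp + \<psi> xm - 2 * \<psi> x) + (18 * c * D * sqrt M + 18 * c * D * sqrt M + 18 * c * D * sqrt M)"
    by (intro add_mono order_refl lZ_fluct D1 x' x(1))
  finally have 1: "EE (\<lambda>w. gS x w (\<lambda>\<sigma>. \<bar>z w \<sigma> - u\<bar>)) \<le> ln 2 + (\<psi> xp + \<psi> xm - 2 * \<psi> x) + 54 * c * D * sqrt M" by simp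
  have 2: "gS x w (\<lambda>\<sigma>. \<bar>z w \<sigma> - u\<bar>) = (c * y) * gS x w (\<lambda>\<sigma>. \<bar>fld J (V q \<sigma>) w - u / (c * y)\<bar>)" for w
    unfolding gav_cmult[symmetric]
  proof (rule gav_cong)
    fix \<sigma>
    have "z w \<sigma> - u = c * y * (fld J (V q \<sigma>) w - u / (c * y))" using c y unfolding z_def right_diff_distrib by simp
    then show "\<bar>z w \<sigma> - u\<bar> = c * y * \<bar>fld J (V q \<sigma>) w - u / (c * y)\<bar>" using c y by (simp add: abs_mult)
  qed
  show ?thesis
    using 1 cy unfolding 2 EE_cmult xp_def xm_def
    by (intro exI[of _ "u / (c * y)"]) (simp add: pos_le_divide_eq mult.commute)
qed

text \<open>Tangents at both ends have slope c^2 x_q M (1 - E <r^q>), computed by integration by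
  parts. It lies between 0 and 6 c^2 M because x_q <= 3 and the bracket is at most 2.\<close>

lemma \<psi>_incr:
  assumes q: "q \<in> {1..D}" and y: "y > 0" and x: "0 \<le> x q" "x q + y \<le> 3"
  shows "0 \<le> \<psi> (x(q := x q + y)) - \<psi> x" "\<psi> (x(q := x q + y)) - \<psi> x \<le> 6 * c\<^sup>2 * M * y"
proof -
  define xp where "xp = x(q := x q + y)"
  have ep: "en xp w = (\<lambda>\<sigma>. en x w \<sigma> + c * y * fld J (V q \<sigma>) w)" for w unfolding xp_def using en_upd[OF q] by (intro ext) auto
  have Gb: "\<bar>G x' (\<lambda>y. y ^ q)\<bar> \<le> 1" for x'
  proof -
    have t: "tame (\<lambda>w. gS x' w (\<lambda>\<sigma>. gS x' w (\<lambda>\<tau>. r \<sigma> \<tau> ^ q)))" by (intro tame_S tame_const)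
    have b: "\<bar>gS x' w (\<lambda>\<sigma>. gS x' w (\<lambda>\<tau>. r \<sigma> \<tau> ^ q))\<bar> \<le> 1" for w
      by (intro gav_abs_le S) (simp add: power_abs power_le_one rb)
    have "G x' (\<lambda>y. y ^ q) \<le> EE (\<lambda>w. 1)" unfolding G_def by (intro EE_mono t tame_const) (use b in \<open>simp add: abs_le_iff\<close>)
    moreover have "EE (\<lambda>w. - 1) \<le> G x' (\<lambda>y. y ^ q)" unfolding G_def
      by (rule EE_mono[OF tame_const t]) (use b in \<open>simp add: abs_le_iff minus_le_iff\<close>)
    ultimately show ?thesis unfolding EE_const by simp
  qed
  have t: "tame (\<lambda>w. gS x' w (\<lambda>\<sigma>. fld J (V q \<sigma>) w))" for x' by (intro tame_S tame_fld)
  have m: "EE (\<lambda>w. gS x' w (\<lambda>\<sigma>. c * y * fld J (V q \<sigma>) w)) = c * y * ((c * x' q * real M) * (1 - G x' (\<lambda>y. y ^ q)))" for x'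
    unfolding gav_cmult EE_cmult gg_mean[OF q] ..
  have "EE (\<lambda>w. lZ S (en x w) + gS x w (\<lambda>\<sigma>. c * y * fld J (V q \<sigma>) w)) \<le> \<psi> xp"
    unfolding \<psi>_def ep by (rule EE_mono[OF _ _ lZ_tangent[OF S]]; unfold ep[symmetric] gav_cmult; intro tame_add tame_lZ_en tame_cmult t)
  then have 1: "\<psi> x + c * y * ((c * x q * real M) * (1 - G x (\<lambda>y. y ^ q))) \<le> \<psi> xp"
    unfolding m[symmetric] \<psi>_def gav_cmult by (simp only: EE_add[OF tame_lZ_en tame_cmult[OF t]])
  have "0 \<le> c * y * ((c * x q * real M) * (1 - G x (\<lambda>y. y ^ q)))"
    using c y x Gb[of x] by (intro mult_nonneg_nonneg) auto
  with 1 show "0 \<le> \<psi> (x(q := x q + y)) - \<psi> x" unfolding xp_def by simp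
  have "EE (\<lambda>w. lZ S (en xp w) - gav S (en xp w) (\<lambda>\<sigma>. c * y * fld J (V q \<sigma>) w)) \<le> \<psi> x"
    unfolding \<psi>_def
  proof (rule EE_mono)
    show "tame (\<lambda>w. lZ S (en xp w) - gav S (en xp w) (\<lambda>\<sigma>. c * y * fld J (V q \<sigma>) w))"
      unfolding gav_cmult by (intro tame_diff tame_lZ_en tame_cmult t)
    show "tame (\<lambda>w. lZ S (en x w))" by (rule tame_lZ_en)
    fix w
    show "lZ S (en xp w) - gav S (en xp w) (\<lambda>\<sigma>. c * y * fld J (V q \<sigma>) w) \<le> lZ S (en x w)"
      using lZ_tangent[OF S, of "en xp w" "\<lambda>\<sigma>. - (c * y) * fld J (V q \<sigma>) w"] unfolding gav_cmult
      by (simp add: ep)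
  qed
  then have 2: "\<psi> xp - c * y * ((c * xp q * real M) * (1 - G xp (\<lambda>y. y ^ q))) \<le> \<psi> x"
    unfolding m[symmetric] \<psi>_def gav_cmult by (simp only: EE_diff[OF tame_lZ_en tame_cmult[OF t]])
  have "(c * xp q * real M) * (1 - G xp (\<lambda>y. y ^ q)) \<le> (c * 3 * real M) * 2"
    using Gb[of xp] c x y by (intro mult_mono) (auto simp: xp_def)
  then have "c * y * ((c * xp q * real M) * (1 - G xp (\<lambda>y. y ^ q))) \<le> c * y * ((c * 3 * real M) * 2)"
    using c y by (intro mult_left_mono) auto
  with 2 show "\<psi> (x(q := x q + y)) - \<psi> x \<le> 6 * c\<^sup>2 * M * y" unfolding xp_def by (simp add: power2_eq_square mult_ac)
qed

text \<open>Second differences telescope to the last increment minus the first, so the whole line of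
  \<open>L\<close> grid points costs no more than one increment.\<close>

lemma fluct_sum:
  fixes L :: nat and x :: "nat \<Rightarrow> real"
  assumes q: "q \<in> {1..D}" and L: "L \<ge> 1" 
  defines "X \<equiv> \<lambda>k. x(q := 1 + real k / real L)"
  shows "(\<Sum>k\<in>{1..L}. \<psi> (X (Suc k)) + \<psi> (X (k - 1)) - 2 * \<psi> (X k)) \<le> 6 * c\<^sup>2 * M / L"
proof -
  have X: "X (Suc k) = (X k)(q := X k q + 1 / real L)" for k unfolding X_def using L by (auto simp: field_simps)
  have i1: "\<psi> (X (Suc L)) - \<psi> (X L) \<le> 6 * c\<^sup>2 * M * (1 / real L)"
    unfolding X[of L] using L by (intro \<psi>_incr q) (auto simp: X_def field_simps)
  have i2: "0 \<le> \<psi> (X 1) - \<psi> (X 0)"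
    using X[of 0] \<psi>_incr(1)[OF q, of "1 / real L" "X 0"] L by (auto simp: X_def field_simps)
  have "(\<Sum>k\<in>{1..L}. \<psi> (X (Suc k)) + \<psi> (X (k - 1)) - 2 * \<psi> (X k)) = (\<Sum>k\<in>{1..L}. (\<psi> (X (Suc k)) - \<psi> (X (k - 1 + 1))) - (\<psi> (X k) - \<psi> (X (k - 1))))"
    by (intro sum.cong refl) auto
  also have "\<dots> = (\<psi> (X (Suc L)) - \<psi> (X L)) - (\<psi> (X 1) - \<psi> (X 0))"
  proof -
    have "(\<Sum>k\<in>{1..n}. (h (Suc k) - h (k - 1 + 1)) - (h k - h (k - 1))) = (h (Suc n) - h n) - (h 1 - h 0)" for h :: "nat \<Rightarrow> real" and n
      by (induction n) auto
    then show ?thesis .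
  qed
  finally show ?thesis using i1 i2 by simp
qed

end

section \<open>Averaging over a grid of field strengths\<close>

text \<open>Strengths lie in (1, 2] on the grid: bounded away from 0, since the identities divide by
  them, and with neighbours at distance 1/L still inside [0, 3].\<close>

definition xk :: "nat \<Rightarrow> (nat \<Rightarrow> nat) \<Rightarrow> nat \<Rightarrow> real" where
  "xk L kk q = 1 + real (kk q) / real L"

definition grid :: "nat \<Rightarrow> nat \<Rightarrow> (nat \<Rightarrow> nat) set" where
  "grid D L = PiE {1..D} (\<lambda>_. {1..L})"

lemma finite_grid: "finite (grid D L)"
  unfolding grid_def by (rule finite_PiE) auto

lemma card_grid: "card (grid D L) = L ^ D"
  unfolding grid_def by (subst card_PiE) auto

lemma xk_bounds: "kk \<in> grid D L \<Longrightarrow> q \<in> {1..D} \<Longrightarrow> 1 + 1 / real L \<le> xk L kk q \<and> xk L kk q \<le> 2"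
proof -
  assume "kk \<in> grid D L" "q \<in> {1..D}"
  then have "kk q \<in> {1..L}" unfolding grid_def by (rule PiE_mem)
  then show ?thesis by (auto simp: xk_def divide_right_mono divide_le_eq_1)
qed

lemma sum_PiE_split:
  assumes "finite I" "q \<in> I"
  shows "(\<Sum>f\<in>PiE I (\<lambda>_. B). F f) = (\<Sum>f\<in>PiE (I - {q}) (\<lambda>_. B). \<Sum>k\<in>B. F (f(q := k)))"
proof -
  have I: "I = insert q (I - {q})" using assms by auto
  have "PiE I (\<lambda>_. B) = (\<lambda>(k, f). f(q := k)) ` (B \<times> PiE (I - {q}) (\<lambda>_. B))"
    by (subst I) (rule PiE_insert_eq)
  then have "(\<Sum>f\<in>PiE I (\<lambda>_. B). F f) = (\<Sum>(k, f)\<in>B \<times> PiE (I - {q}) (\<lambda>_. B). F (f(q := k)))"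
    using inj_combinator[of q "I - {q}" "\<lambda>_. B"] by (simp add: sum.reindex case_prod_beta' comp_def)
  also have "\<dots> = (\<Sum>k\<in>B. \<Sum>f\<in>PiE (I - {q}) (\<lambda>_. B). F (f(q := k)))"
    by (simp add: sum.cartesian_product)
  finally show ?thesis by (subst sum.swap) simp
qed

context gg
begin

definition Fl :: "nat \<Rightarrow> nat \<Rightarrow> (nat \<Rightarrow> nat) \<Rightarrow> real" where
  "Fl q L kk = (ln 2 + (\<psi> ((xk L kk)(q := xk L kk q + 1 / real L)) + \<psi> ((xk L kk)(q := xk L kk q - 1 / real L)) - 2 * \<psi> (xk L kk))
      + 54 * c * D * sqrt M) / (c * (1 / real L))"

lemma Fl_bound:
  assumes q: "q \<in> {1..D}" and L: "L \<ge> 1" and kk: "kk \<in> grid D L"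
  shows "\<exists>m. EE (\<lambda>w. gav S (en (xk L kk) w) (\<lambda>\<sigma>. \<bar>fld J (V q \<sigma>) w - m\<bar>)) \<le> Fl q L kk" "0 \<le> Fl q L kk"
proof -
  have b: "1 + 1 / real L \<le> xk L kk q' \<and> xk L kk q' \<le> 2" if "q' \<in> {1..D}" for q' by (rule xk_bounds[OF kk that])
  have L': "0 < 1 / real L" "1 / real L \<le> 1" using L by auto
  show *: "\<exists>m. EE (\<lambda>w. gav S (en (xk L kk) w) (\<lambda>\<sigma>. \<bar>fld J (V q \<sigma>) w - m\<bar>)) \<le> Fl q L kk"
    unfolding Fl_def
  proof (rule fluct[OF q L'(1)])
    show "0 \<le> xk L kk q' \<and> xk L kk q' \<le> 3" if "q' \<in> {1..D}" for q'
      using b[OF that] L' by linarith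
  qed (use b[OF q] L' in linarith)+
  have "0 \<le> EE (\<lambda>w. gav S (en (xk L kk) w) (\<lambda>\<sigma>. \<bar>fld J (V q \<sigma>) w - m\<bar>))" for m
    by (intro Bochner_Integration.integral_nonneg gav_nonneg) simp
  with * show "0 \<le> Fl q L kk" by (meson order_trans)
qed

text \<open>For each choice of the other coordinates the sum runs along a line in direction
  \<open>q\<close>, where the second differences telescope to order M / L in total.\<close>

lemma Fl_sum:
  assumes q: "q \<in> {1..D}" and L: "L \<ge> 1"
  shows "(\<Sum>kk\<in>grid D L. Fl q L kk) \<le> real L ^ D * ((L * ln 2 + 6 * c\<^sup>2 * M / L + 54 * c * D * L * sqrt M) / c)"
proof -
  define R where "R = (real L * ln 2 + 6 * c\<^sup>2 * M / L + real L * (54 * c * D * sqrt M)) * (real L / c)"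
  have D1: "D \<ge> 1" using q by auto
  have inner: "(\<Sum>k\<in>{1..L}. Fl q L (f(q := k))) \<le> R" for f
  proof -
    define X where "X k = (xk L f)(q := 1 + real k / real L)" for k
    have X: "(xk L (f(q := k))) = X k" "(X k)(q := X k q + 1 / real L) = X (Suc k)" for k
      unfolding X_def using L by (auto simp: xk_def fun_eq_iff field_simps)
    have X': "(X k)(q := X k q - 1 / real L) = X (k - 1)" if "k \<in> {1..L}" for k
      unfolding X_def using L that by (auto simp: fun_eq_iff field_simps of_nat_diff)
    have "(\<Sum>k\<in>{1..L}. Fl q L (f(q := k)))
      = (\<Sum>k\<in>{1..L}. (ln 2 + (\<psi> (X (Suc k)) + \<psi> (X (k - 1)) - 2 * \<psi> (X k)) + 54 * c * D * sqrt M) * (real L / c))"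
      unfolding Fl_def X(1) by (intro sum.cong refl) (simp add: X(2) X')
    also have "\<dots> = (\<Sum>k\<in>{1..L}. ln 2 + (\<psi> (X (Suc k)) + \<psi> (X (k - 1)) - 2 * \<psi> (X k)) + 54 * c * D * sqrt M) * (real L / c)"
      by (simp only: sum_distrib_right)
    also have "(\<Sum>k\<in>{1..L}. ln 2 + (\<psi> (X (Suc k)) + \<psi> (X (k - 1)) - 2 * \<psi> (X k)) + 54 * c * D * sqrt M)
      = real L * ln 2 + (\<Sum>k\<in>{1..L}. \<psi> (X (Suc k)) + \<psi> (X (k - 1)) - 2 * \<psi> (X k)) + real L * (54 * c * D * sqrt M)"
      unfolding sum.distrib by simp
    also have "\<dots> * (real L / c) \<le> (real L * ln 2 + 6 * c\<^sup>2 * M / L + real L * (54 * c * D * sqrt M)) * (real L / c)"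
      using fluct_sum[OF q L, of "xk L f"] c unfolding X_def by (intro mult_right_mono add_mono order_refl) auto
    finally show ?thesis unfolding R_def .
  qed
  have "(\<Sum>kk\<in>grid D L. Fl q L kk) = (\<Sum>f\<in>PiE ({1..D} - {q}) (\<lambda>_. {1..L}). \<Sum>k\<in>{1..L}. Fl q L (f(q := k)))"
    unfolding grid_def by (rule sum_PiE_split) (use q in auto)
  also have "\<dots> \<le> (\<Sum>f\<in>PiE ({1..D} - {q}) (\<lambda>_. {1..L}). R)" by (intro sum_mono inner)
  also have "\<dots> = real L ^ (D - 1) * R" using q by (simp add: card_PiE)
  also have "\<dots> = (real L ^ (D - 1) * real L) * ((L * ln 2 + 6 * c\<^sup>2 * M / L + 54 * c * D * L * sqrt M) / c)"
    unfolding R_def by (simp add: field_simps)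
  also have "real L ^ (D - 1) * real L = real L ^ D" using D1 by (cases D) auto
  finally show ?thesis .
qed

lemma GGE_ramp:
  assumes L: "L \<ge> 1" and kk: "kk \<in> grid D L" and n: "n < K" and j: "j < n" and K: "K \<ge> 1"
    and a: "\<And>y. \<bar>y\<bar> \<le> 1 \<Longrightarrow> \<bar>ramp \<epsilon> K n y - (\<Sum>q\<le>D. a q * y ^ q)\<bar> \<le> \<delta>" "\<And>q. \<bar>a q\<bar> \<le> B"
  shows "\<bar>GGE (xk L kk) n (gch \<epsilon> K) j (ramp \<epsilon> K n)\<bar> \<le> (2 * real K + 2) * \<delta> + B * (2 / (c * M)) * (\<Sum>q\<in>{1..D}. Fl q L kk)"
proof -
  let ?x = "xk L kk"
  have B: "B \<ge> 0" using a(2)[of 0] by linarith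
  have d0: "\<delta> \<ge> 0" using a(1)[of 0] by (smt (verit) abs_ge_zero)
  have x1: "?x q \<ge> 1" if "q \<in> {1..D}" for q using xk_bounds[OF kk that] L by (smt (verit) divide_nonneg_nonneg of_nat_0_le_iff)
  have g: "\<bar>gch \<epsilon> K l\<bar> \<le> 1" for l using gch_bounds[of \<epsilon> K l] by simp
  have 1: "\<bar>GGE ?x n (gch \<epsilon> K) j (ramp \<epsilon> K n) - GGE ?x n (gch \<epsilon> K) j (\<lambda>y. \<Sum>q\<le>D. a q * y ^ q)\<bar> \<le> (2 * real n + 2) * \<delta>"
    by (rule GGE_approx[OF j g a(1)])
  have "\<bar>GGE ?x n (gch \<epsilon> K) j (\<lambda>y. \<Sum>q\<le>D. a q * y ^ q)\<bar> \<le> (\<Sum>q\<in>{1..D}. \<bar>a q\<bar> * (2 * Fl q L kk / (c * ?x q * real M)))"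
    by (rule GGE_poly[OF j g _ Fl_bound(1)[OF _ L kk]]) (use x1 in force)+
  also have "\<dots> \<le> (\<Sum>q\<in>{1..D}. B * ((2 / (c * M)) * Fl q L kk))"
  proof (rule sum_mono)
    fix q assume q: "q \<in> {1..D}"
    have "2 * Fl q L kk / (c * ?x q * real M) \<le> 2 * Fl q L kk / (c * 1 * real M)"
      using c n Fl_bound(2)[OF q L kk] x1[OF q] M
      by (intro divide_left_mono mult_right_mono mult_left_mono mult_pos_pos) auto
    also have "\<dots> = (2 / (c * M)) * Fl q L kk" by simp
    finally show "\<bar>a q\<bar> * (2 * Fl q L kk / (c * ?x q * real M)) \<le> B * ((2 / (c * M)) * Fl q L kk)"
      using a(2)[of q] B c x1[OF q] Fl_bound(2)[OF q L kk] by (intro mult_mono) auto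
  qed
  also have "\<dots> = B * (2 / (c * M)) * (\<Sum>q\<in>{1..D}. Fl q L kk)" by (simp add: sum_distrib_left mult_ac)
  finally have 2: "\<bar>GGE ?x n (gch \<epsilon> K) j (\<lambda>y. \<Sum>q\<le>D. a q * y ^ q)\<bar> \<le> B * (2 / (c * M)) * (\<Sum>q\<in>{1..D}. Fl q L kk)" .
  have "(2 * real n + 2) * \<delta> \<le> (2 * real K + 2) * \<delta>" using n d0 by (intro mult_right_mono) auto
  with 1 2 show ?thesis by linarith
qed

text \<open>\<open>chain_bound\<close> holds at each grid point, but its error is small only on
  average over the grid; a linearisation of the (K - 1)-th power makes averaging possible.\<close>

lemma positivity_sys:
  assumes L: "L \<ge> 1" and D: "D \<ge> 1" and \<epsilon>: "\<epsilon> > 0" and K: "(real K - 1) * \<epsilon> > 1" "K \<ge> 2" and \<eta>: "\<eta> > 0"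
    and a: "\<And>n y. n < K \<Longrightarrow> \<bar>y\<bar> \<le> 1 \<Longrightarrow> \<bar>ramp \<epsilon> K n y - (\<Sum>q\<le>D. a n q * y ^ q)\<bar> \<le> \<delta>" "\<And>n q. n < K \<Longrightarrow> \<bar>a n q\<bar> \<le> B"
    and small: "real K * ((2 * real K + 2) * \<delta> + B * (2 / (c * M)) * (D * ((L * ln 2 + 6 * c\<^sup>2 * M / L + 54 * c * D * L * sqrt M) / c))) \<le> \<eta> ^ (K - 1)"
  shows "(\<Sum>kk\<in>grid D L. G (xk L kk) (\<lambda>y. if y \<le> - 2 * \<epsilon> then 1 else 0)) \<le> 2 * \<eta> * real L ^ D"
proof -
  define al where "al kk = G (xk L kk) (\<lambda>y. if y \<le> - 2 * \<epsilon> then 1 else 0)" for kk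
  have al: "0 \<le> al kk" "al kk \<le> 1" for kk unfolding al_def by (rule G_ind)+
  define err where "err kk = (2 * real K + 2) * \<delta> + B * (2 / (c * M)) * (\<Sum>q\<in>{1..D}. Fl q L kk)" for kk
  have B0: "B \<ge> 0" using a(2)[of 0 0] K by auto
  have ch: "al kk ^ (K - 1) \<le> real K * err kk" if kk: "kk \<in> grid D L" for kk
    unfolding al_def
  proof (rule chain_bound[OF \<epsilon> K])
    fix n j assume nj: "1 \<le> n" "n < K" "j < n"
    show "\<bar>GGE (xk L kk) n (gch \<epsilon> K) j (ramp \<epsilon> K n)\<bar> \<le> err kk"
      unfolding err_def using K nj by (intro GGE_ramp[where a="a n"] L kk a) auto
  qed
  \<comment> \<open>Either the value is below \<eta>, or it is its own (K - 1)-th power divided by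
    something larger than the (K - 2)-th power of \<eta>.\<close>
  have young: "al kk \<le> \<eta> + al kk ^ (K - 1) / \<eta> ^ (K - 2)" for kk
  proof (cases "al kk \<le> \<eta>")
    case True
    moreover have "0 \<le> al kk ^ (K - 1) / \<eta> ^ (K - 2)" using al(1) \<eta> by simp
    ultimately show ?thesis by linarith
  next
    case False
    have "al kk * \<eta> ^ (K - 2) \<le> al kk * al kk ^ (K - 2)" using False \<eta> al(1) by (intro mult_left_mono power_mono) auto
    also have "\<dots> = al kk ^ Suc (K - 2)" by simp
    also have "Suc (K - 2) = K - 1" using K by simp
    finally have "al kk \<le> al kk ^ (K - 1) / \<eta> ^ (K - 2)" using \<eta> by (simp add: pos_le_divide_eq)
    then show ?thesis using \<eta> by linarith
  qed
  have "(\<Sum>kk\<in>grid D L. al kk) \<le> (\<Sum>kk\<in>grid D L. \<eta> + (real K / \<eta> ^ (K - 2)) * err kk)"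
  proof (rule sum_mono)
    fix kk assume kk: "kk \<in> grid D L"
    have "al kk ^ (K - 1) / \<eta> ^ (K - 2) \<le> (real K * err kk) / \<eta> ^ (K - 2)" using \<eta> by (intro divide_right_mono ch kk) auto
    then show "al kk \<le> \<eta> + (real K / \<eta> ^ (K - 2)) * err kk" using young[of kk] by simp
  qed
  also have "\<dots> = real L ^ D * \<eta> + (1 / \<eta> ^ (K - 2)) * (real K * (\<Sum>kk\<in>grid D L. err kk))"
    by (simp add: sum.distrib sum_distrib_left card_grid)
  also have "(\<Sum>kk\<in>grid D L. err kk) = real L ^ D * ((2 * real K + 2) * \<delta>) + B * (2 / (c * M)) * (\<Sum>q\<in>{1..D}. \<Sum>kk\<in>grid D L. Fl q L kk)"
    unfolding err_def sum.distrib sum_distrib_left[symmetric] by (subst sum.swap) (simp add: card_grid)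
  also have "real L ^ D * \<eta> + (1 / \<eta> ^ (K - 2)) * (real K * (real L ^ D * ((2 * real K + 2) * \<delta>) + B * (2 / (c * M)) * (\<Sum>q\<in>{1..D}. \<Sum>kk\<in>grid D L. Fl q L kk)))
    \<le> real L ^ D * \<eta> + (1 / \<eta> ^ (K - 2)) * (real K * (real L ^ D * ((2 * real K + 2) * \<delta>) + B * (2 / (c * M)) * (\<Sum>q\<in>{1..D}. real L ^ D * ((L * ln 2 + 6 * c\<^sup>2 * M / L + 54 * c * D * L * sqrt M) / c))))"
    using \<eta> B0 c M by (intro add_mono order_refl mult_left_mono sum_mono Fl_sum L) auto
  also have "\<dots> = real L ^ D * \<eta> + (1 / \<eta> ^ (K - 2)) * (real L ^ D * (real K * ((2 * real K + 2) * \<delta> + B * (2 / (c * M)) * (D * ((L * ln 2 + 6 * c\<^sup>2 * M / L + 54 * c * D * L * sqrt M) / c)))))"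
    unfolding sum_constant card_atLeastAtMost by (simp only: distrib_left mult_ac diff_Suc_1)
  also have "\<dots> \<le> real L ^ D * \<eta> + (1 / \<eta> ^ (K - 2)) * (real L ^ D * \<eta> ^ (K - 1))"
    using \<eta> by (intro add_mono order_refl mult_left_mono small) auto
  also have "\<eta> ^ (K - 1) = \<eta> ^ (K - 2) * \<eta>" using K power_Suc2[of \<eta> "K - 2"] by (simp add: Suc_diff_Suc numeral_2_eq_2)
  finally show ?thesis unfolding al_def using \<eta> by simp
qed

end

abbreviation far :: "(nat \<Rightarrow> real) set \<Rightarrow> nat list set \<Rightarrow> (nat \<Rightarrow> (nat \<Rightarrow> real) \<Rightarrow> nat list \<Rightarrow> real) \<Rightarrow>
    ((nat \<Rightarrow> real) \<Rightarrow> (nat \<Rightarrow> real) \<Rightarrow> real) \<Rightarrow> ((nat \<Rightarrow> real) \<Rightarrow> real) \<Rightarrow> nat \<Rightarrow> real \<Rightarrow> real \<Rightarrow> nat \<Rightarrow> (nat \<Rightarrow> nat) \<Rightarrow> real" where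
  "far S J V r d D c \<epsilon> L kk \<equiv> EE (\<lambda>w. gav S (\<lambda>\<sigma>. d \<sigma> + fld J (uu V D c (xk L kk) \<sigma>) w) (\<lambda>\<sigma>.
        gav S (\<lambda>\<sigma>. d \<sigma> + fld J (uu V D c (xk L kk) \<sigma>) w) (\<lambda>\<tau>. if r \<sigma> \<tau> \<le> - 2 * \<epsilon> then 1 else 0)))"

text \<open>Weierstrass approximation of the finitely many ramps, padded with zero coefficients to a
  common degree with a common coefficient bound.\<close>

lemma ramp_poly:
  assumes "\<delta> > 0"
  shows "\<exists>D\<ge>1. \<exists>B::real. \<exists>a. (\<forall>n<K. \<forall>y. \<bar>y\<bar> \<le> 1 \<longrightarrow> \<bar>ramp \<epsilon> K n y - (\<Sum>q\<le>D. a n q * y ^ q)\<bar> \<le> \<delta>) \<and> (\<forall>n<K. \<forall>q. \<bar>a n q\<bar> \<le> B)"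
proof -
  have "\<exists>a m. \<forall>y. \<bar>y\<bar> \<le> 1 \<longrightarrow> \<bar>ramp \<epsilon> K n y - (\<Sum>q\<le>m. a q * y ^ q)\<bar> \<le> \<delta>" for n
  proof -
    obtain g where g: "real_polynomial_function g" "\<And>y. y \<in> {-1..1} \<Longrightarrow> \<bar>ramp \<epsilon> K n y - g y\<bar> < \<delta>"
      using Stone_Weierstrass_real_polynomial_function[OF compact_Icc continuous_ramp assms, of "-1" 1 \<epsilon> K n] by metis
    then obtain a m where "g = (\<lambda>y. \<Sum>i\<le>m. a i * y ^ i)" unfolding real_polynomial_function_iff_sum by blast
    then show ?thesis using g(2) by (intro exI[of _ a] exI[of _ m]) (fastforce simp: abs_le_iff)
  qed
  then obtain a m where am: "\<And>n y. \<bar>y\<bar> \<le> 1 \<Longrightarrow> \<bar>ramp \<epsilon> K n y - (\<Sum>q\<le>m n. a n q * y ^ q)\<bar> \<le> \<delta>" by metis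
  define D where "D = Suc (\<Sum>n<K. m n)"
  define a' where "a' n q = (if q \<le> m n then a n q else 0)" for n q
  define B where "B = (\<Sum>n<K. \<Sum>q\<le>m n. \<bar>a n q\<bar>)"
  have mD: "m n \<le> D" if "n < K" for n
    using member_le_sum[of n "{..<K}" m] that by (simp add: D_def)
  have "(\<Sum>q\<le>D. a' n q * y ^ q) = (\<Sum>q\<le>m n. a n q * y ^ q)" if "n < K" for n y
    unfolding a'_def by (rule sum.mono_neutral_cong_right) (use mD[OF that] in auto)
  then have "\<forall>n<K. \<forall>y. \<bar>y\<bar> \<le> 1 \<longrightarrow> \<bar>ramp \<epsilon> K n y - (\<Sum>q\<le>D. a' n q * y ^ q)\<bar> \<le> \<delta>" using am by simp
  moreover have "\<bar>a' n q\<bar> \<le> B" if "n < K" for n q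
  proof (cases "q \<le> m n")
    case True
    have "\<bar>a n q\<bar> \<le> (\<Sum>q\<le>m n. \<bar>a n q\<bar>)" using True by (intro member_le_sum) auto
    also have "\<dots> \<le> B" unfolding B_def using that by (intro member_le_sum[of n "{..<K}" "\<lambda>n. \<Sum>q\<le>m n. \<bar>a n q\<bar>"]) (auto intro: sum_nonneg)
    finally show ?thesis using True by (simp add: a'_def)
  qed (simp add: a'_def B_def sum_nonneg)
  moreover have "D \<ge> 1" by (simp add: D_def)
  ultimately show ?thesis by blast
qed

text \<open>The order of quantifiers matters. \<open>D\<close> comes from approximating ramps and
  depends on \<epsilon> and \<eta> only, so \<open>c\<close> may later be small compared with it;
  \<open>L\<close> then controls the second differences, and large \<open>M\<close> removes the
  terms of order 1/M and 1/sqrt M.\<close>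

theorem positivity:
  assumes \<epsilon>: "\<epsilon> > 0" and \<eta>: "\<eta> > 0"
  shows "\<exists>D\<ge>1. \<forall>c>0. \<exists>L\<ge>1. \<exists>M0. \<forall>M\<ge>M0. \<forall>S J V r d. ggsys S J V r M D \<longrightarrow>
    (\<Sum>kk\<in>grid D L. far S J V r d D c \<epsilon> L kk) \<le> \<eta> * real L ^ D"
proof -
  \<comment> \<open>Enough replicas for pairwise overlaps below - \<epsilon> to contradict positive
    semidefiniteness.\<close>
  define K :: nat where "K = nat \<lceil>1 / \<epsilon>\<rceil> + 2"
  have "real K - 1 > 1 / \<epsilon>" unfolding K_def using real_nat_ceiling_ge[of "1 / \<epsilon>"] by simp
  then have K: "(real K - 1) * \<epsilon> > 1" "K \<ge> 2" using \<epsilon> by (auto simp: K_def field_simps)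
  define \<kappa> where "\<kappa> = (\<eta> / 2) ^ (K - 1)"
  have \<kappa>: "\<kappa> > 0" using \<eta> by (simp add: \<kappa>_def)
  define \<delta> where "\<delta> = \<kappa> / (2 * (real K * (2 * real K + 2)))"
  have \<delta>: "\<delta> > 0" using \<kappa> K unfolding \<delta>_def by (intro divide_pos_pos mult_pos_pos) auto
  have K\<delta>: "real K * ((2 * real K + 2) * \<delta>) = \<kappa> / 2"
    using K by (simp add: \<delta>_def)
  obtain D B a where D: "D \<ge> 1" and a: "\<And>n y. n < K \<Longrightarrow> \<bar>y\<bar> \<le> 1 \<Longrightarrow> \<bar>ramp \<epsilon> K n y - (\<Sum>q\<le>D. a n q * y ^ q)\<bar> \<le> \<delta>"
    "\<And>n q. n < K \<Longrightarrow> \<bar>a n q\<bar> \<le> B"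
    using ramp_poly[OF \<delta>, of K \<epsilon>] by blast
  have B0: "B \<ge> 0" using a(2)[of 0 0] K by auto
  define C where "C = 2 * real K * B * real D"
  have C: "C \<ge> 0" using B0 by (simp add: C_def)
  show ?thesis
  proof (rule exI[of _ D], intro conjI D allI impI)
    fix c :: real assume c: "c > 0"
    \<comment> \<open>24 = 4 * 6: the second differences take a quarter of the budget \<kappa>, the
      approximation error a half, the terms vanishing with \<open>M\<close> the last
      quarter.\<close>
    define L :: nat where "L = nat \<lceil>24 * C / \<kappa>\<rceil> + 1"
    have "24 * C / \<kappa> \<le> real L" unfolding L_def using real_nat_ceiling_ge[of "24 * C / \<kappa>"] by simp
    then have L: "L \<ge> 1" and LC: "C * (6 / L) \<le> \<kappa> / 4" using \<kappa> by (auto simp: L_def field_simps)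
    have "(\<lambda>M. C * (L * ln 2 / c\<^sup>2) * (1 / real M) + C * (54 * D * L / c) * (1 / sqrt (real M))) \<longlonglongrightarrow> C * (L * ln 2 / c\<^sup>2) * 0 + C * (54 * D * L / c) * 0"
      by (intro tendsto_add tendsto_mult tendsto_const) real_asymp+
    then have "\<forall>\<^sub>F M in sequentially. C * (L * ln 2 / c\<^sup>2) * (1 / real M) + C * (54 * D * L / c) * (1 / sqrt (real M)) < \<kappa> / 4"
      using \<kappa> by (intro order_tendstoD(2)[where y=0]) auto
    then obtain M0 where M0: "\<And>M. M \<ge> M0 \<Longrightarrow> C * (L * ln 2 / c\<^sup>2) * (1 / real M) + C * (54 * D * L / c) * (1 / sqrt (real M)) < \<kappa> / 4"
      unfolding eventually_sequentially by blast
    show "\<exists>L\<ge>1. \<exists>M0. \<forall>M\<ge>M0. \<forall>S J V r d. ggsys S J V r M D \<longrightarrow>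
    (\<Sum>kk\<in>grid D L. far S J V r d D c \<epsilon> L kk) \<le> \<eta> * real L ^ D"
    proof (rule exI[of _ L], intro conjI L exI[of _ M0] allI impI)
      fix M S J V r and d :: "(nat \<Rightarrow> real) \<Rightarrow> real" assume MM: "M \<ge> M0" and sys: "ggsys S J V r M D"
      interpret gg S J V r M D d c by (rule gg.intro[OF sys c])
      have sq: "sqrt (real M) / real M = 1 / sqrt (real M)"
        using n by (simp add: field_simps)
      have "real K * (B * (2 / (c * M)) * (D * ((L * ln 2 + 6 * c\<^sup>2 * M / L + 54 * c * D * L * sqrt M) / c)))
        = C * ((L * ln 2 + 6 * c\<^sup>2 * M / L + 54 * c * D * L * sqrt M) / (c\<^sup>2 * M))"
        unfolding C_def using c n by (simp add: field_simps power2_eq_square)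
      also have "\<dots> = C * (L * ln 2 / c\<^sup>2) * (1 / real M) + C * (6 / L) + C * (54 * D * L / c) * (sqrt (real M) / real M)"
        using c n L by (simp add: add_divide_distrib distrib_left power2_eq_square)
      also have "\<dots> \<le> \<kappa> / 2" unfolding sq using M0[OF MM] LC by linarith
      finally have "real K * ((2 * real K + 2) * \<delta> + B * (2 / (c * M)) * (D * ((L * ln 2 + 6 * c\<^sup>2 * M / L + 54 * c * D * L * sqrt M) / c))) \<le> (\<eta> / 2) ^ (K - 1)"
        unfolding distrib_left[of "real K"] K\<delta> \<kappa>_def[symmetric] by linarith
      from positivity_sys[OF L D \<epsilon> K _ a this] \<eta>
      show "(\<Sum>kk\<in>grid D L. far S J V r d D c \<epsilon> L kk) \<le> \<eta> * real L ^ D"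
        unfolding G_def en_def[abs_def] by simp
    qed
  qed
qed

subsection \<open>Block interpolation\<close>

lemma sum_lessThan_add: "(\<Sum>i<m + n. h i) = (\<Sum>i<m. h i) + (\<Sum>i<n. h (m + i) :: real)" for m n :: nat
  by (induction n) auto

lemma sum_blocks: "(\<Sum>i<k * M. h i) = (\<Sum>j<k. \<Sum>i<M. h (j * M + i) :: real)" for k M :: nat
  by (induction k) (auto simp: sum_lessThan_add add.commute[of M])

text \<open>Tangent-line form of the convexity of a power on the nonnegative half-line; it takes the
  place of Jensen for the block overlaps.\<close>

lemma bernoulli_tangent:
  fixes a y :: real
  assumes "a \<ge> 0" "y \<ge> 0" shows "y ^ Suc n + real (Suc n) * y ^ n * (a - y) \<le> a ^ Suc n"
proof (induction n)
  case (Suc n)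
  have "a * (y ^ Suc n + real (Suc n) * y ^ n * (a - y)) \<le> a * a ^ Suc n" using Suc assms by (intro mult_left_mono) auto
  moreover have "0 \<le> real (Suc n) * y ^ n * ((a - y) * (a - y))" by (rule mult_nonneg_nonneg[OF _ zero_le_square]) (use assms in auto)
  ultimately show ?case by (simp add: algebra_simps)
qed simp

lemma ip_sum_left: "ip I (\<lambda>i. \<Sum>a\<in>A. v a i) u = (\<Sum>a\<in>A. ip I (v a) u)"
  unfolding ip_def by (simp add: sum_distrib_right sum.swap[of _ I])

lemma ip_sum_right: "ip I u (\<lambda>i. \<Sum>a\<in>A. v a i) = (\<Sum>a\<in>A. ip I u (v a))"
  unfolding ip_def by (simp add: sum_distrib_left sum.swap[of _ I])

lemma ip_scale_left: "ip I (\<lambda>i. s * u i) v = s * ip I u v"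
  unfolding ip_def by (simp add: sum_distrib_left ac_simps)

lemma ip_scale_right: "ip I u (\<lambda>i. s * v i) = s * ip I u v"
  unfolding ip_def by (simp add: sum_distrib_left ac_simps)

text \<open>Extension by zero, so that all fields share one index set and independence of
  differently tagged fields becomes orthogonality.\<close>

definition pv :: "nat list \<Rightarrow> nat \<Rightarrow> nat \<Rightarrow> nat \<Rightarrow> (nat \<Rightarrow> real) \<Rightarrow> nat list \<Rightarrow> real" where
  "pv t p M b \<sigma> i = (if i \<in> bidx t p M then bvec (length t) p M b \<sigma> i else 0)"

lemma ip_pv:
  assumes "finite I" "bidx t p M \<subseteq> I" "M \<ge> 1" "p \<ge> 1"
  shows "ip I (pv t p M b \<sigma>) (pv t p M b \<tau>) = real M * bover M b \<sigma> \<tau> ^ p"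
proof -
  have "ip I (pv t p M b \<sigma>) (pv t p M b \<tau>) = ip (bidx t p M) (bvec (length t) p M b \<sigma>) (bvec (length t) p M b \<tau>)"
    unfolding ip_def by (rule sum.mono_neutral_cong_right) (use assms in \<open>auto simp: pv_def\<close>)
  then show ?thesis using ip_bvec[OF assms(3,4)] by simp
qed

text \<open>With tags of equal length, indices are told apart by the tag or by their total length;
  the latter separates fields of different degree in one block.\<close>

lemma bidx_disj: "length t = length t' \<Longrightarrow> t \<noteq> t' \<or> p \<noteq> p' \<Longrightarrow> i \<in> bidx t p M \<Longrightarrow> i \<notin> bidx t' p' M'"
  by (auto simp: bidx_def idx_def)

lemma ip_pv_disj: "length t = length t' \<Longrightarrow> t \<noteq> t' \<or> p \<noteq> p' \<Longrightarrow> ip I (pv t p M b \<sigma>) (pv t' p' M' b' \<tau>) = 0"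
  unfolding ip_def by (intro sum.neutral) (use bidx_disj[of t t' p p'] in \<open>auto simp: pv_def\<close>)

lemma fld_pv: "finite I \<Longrightarrow> bidx t p M \<subseteq> I \<Longrightarrow> fld I (pv t p M b \<sigma>) w = fld (bidx t p M) (bvec (length t) p M b \<sigma>) w"
  unfolding fld_def by (rule sum.mono_neutral_cong_right) (auto simp: pv_def)

lemma fld_bidx: "fld (bidx t p M) (bvec (length t) p M b \<sigma>) w = hen p M 1 (\<lambda>i. w (t @ i)) (\<lambda>i. \<sigma> (b + i))"
proof -
  have inj: "inj_on (\<lambda>is. t @ is) (idx p M)" by (auto simp: inj_on_def)
  show ?thesis unfolding fld_def hen_def bidx_def sum.reindex[OF inj]
    by (simp add: bvec_def hv_def nth_append)
qed

lemma hen_cong: "(\<And>i. i < N \<Longrightarrow> \<sigma> i = \<tau> i) \<Longrightarrow> hen p N s w \<sigma> = hen p N s w \<tau>"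
  unfolding hen_hamil hamil_def
  by (intro arg_cong2[where f="(*)"] refl sum.cong prod.cong) (auto simp: idx_def subset_iff)

lemma hen_scale: "s * hen p N t w \<sigma> = hen p N (s * t) w \<sigma>"
  by (simp add: hen_hamil)

lemma PS_reindex: "EE (\<lambda>w. lZ S (\<lambda>\<sigma>. hen p N s (\<lambda>i. w (t @ i)) \<sigma>)) = PS p N S s (\<lambda>_. 0)"
  using gauss_reindex_int[of "\<lambda>i. t @ i" "\<lambda>w. lZ S (\<lambda>\<sigma>. hen p N s w \<sigma>)"]
  by (simp add: PS_def inj_def lZ_measurable hen_measurable)

lemma Zs_spins_add:
  assumes f: "\<And>\<sigma> \<tau>. (\<And>i. i < m \<Longrightarrow> \<sigma> i = \<tau> i) \<Longrightarrow> f \<sigma> = f \<tau>" and g: "\<And>\<sigma> \<tau>. (\<And>i. i < n \<Longrightarrow> \<sigma> i = \<tau> i) \<Longrightarrow> g \<sigma> = g \<tau>"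
  shows "Zs (spins (m + n)) (\<lambda>\<sigma>. f \<sigma> + g (\<lambda>i. \<sigma> (m + i))) = Zs (spins m) f * Zs (spins n) g"
proof -
  define J where "J = (\<lambda>(a, b) i. if i < m then a i else if i < m + n then b (i - m) else undefined :: real)"
  have "bij_betw J (spins m \<times> spins n) (spins (m + n))"
  proof (rule bij_betw_byWitness[where f'="\<lambda>\<sigma>. (restrict \<sigma> {..<m}, restrict (\<lambda>i. \<sigma> (m + i)) {..<n})"])
    show "\<forall>a\<in>spins m \<times> spins n. (restrict (J a) {..<m}, restrict (\<lambda>i. J a (m + i)) {..<n}) = a"
      by (auto simp: J_def spins_def fun_eq_iff PiE_def extensional_def)
    show "\<forall>\<sigma>\<in>spins (m + n). J (restrict \<sigma> {..<m}, restrict (\<lambda>i. \<sigma> (m + i)) {..<n}) = \<sigma>"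
      by (auto simp: J_def spins_def fun_eq_iff PiE_def extensional_def)
    show "J ` (spins m \<times> spins n) \<subseteq> spins (m + n)"
      by (force simp: J_def spins_def PiE_def extensional_def Pi_def)
    show "(\<lambda>\<sigma>. (restrict \<sigma> {..<m}, restrict (\<lambda>i. \<sigma> (m + i)) {..<n})) ` spins (m + n) \<subseteq> spins m \<times> spins n"
      by (force simp: spins_def PiE_def extensional_def Pi_def)
  qed
  from sum.reindex_bij_betw[OF this, of "\<lambda>\<sigma>. exp (f \<sigma> + g (\<lambda>i. \<sigma> (m + i)))"]
  have "Zs (spins (m + n)) (\<lambda>\<sigma>. f \<sigma> + g (\<lambda>i. \<sigma> (m + i))) = (\<Sum>(a, b)\<in>spins m \<times> spins n. exp (f (J (a, b)) + g (\<lambda>i. J (a, b) (m + i))))"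
    unfolding Zs_def by (simp add: case_prod_beta')
  also have "\<dots> = (\<Sum>(a, b)\<in>spins m \<times> spins n. exp (f a) * exp (g b))"
  proof (intro sum.cong refl, clarify)
    fix a b
    have "f (J (a, b)) = f a" by (rule f) (simp add: J_def)
    moreover have "g (\<lambda>i. J (a, b) (m + i)) = g b" by (rule g) (simp add: J_def)
    ultimately show "exp (f (J (a, b)) + g (\<lambda>i. J (a, b) (m + i))) = exp (f a) * exp (g b)" by (simp add: exp_add)
  qed
  finally show ?thesis by (simp add: Zs_def sum_product sum.cartesian_product)
qed

lemma lZ_spins_add:
  assumes f: "\<And>\<sigma> \<tau>. (\<And>i. i < m \<Longrightarrow> \<sigma> i = \<tau> i) \<Longrightarrow> f \<sigma> = f \<tau>" and g: "\<And>\<sigma> \<tau>. (\<And>i. i < n \<Longrightarrow> \<sigma> i = \<tau> i) \<Longrightarrow> g \<sigma> = g \<tau>"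
  shows "lZ (spins (m + n)) (\<lambda>\<sigma>. f \<sigma> + g (\<lambda>i. \<sigma> (m + i))) = lZ (spins m) f + lZ (spins n) g"
proof -
  have "Zs (spins (m + n)) (\<lambda>\<sigma>. f \<sigma> + g (\<lambda>i. \<sigma> (m + i))) = Zs (spins m) f * Zs (spins n) g"
    by (rule Zs_spins_add; (rule f | rule g); blast)
  then show ?thesis unfolding lZ_def
    using Zs_pos[OF finite_spins spins_ne, of m f] Zs_pos[OF finite_spins spins_ne, of n g] by (simp add: ln_mult)
qed

lemma lZ_blocks:
  assumes H: "\<And>j \<sigma> \<tau>. (\<And>i. i < M \<Longrightarrow> \<sigma> i = \<tau> i) \<Longrightarrow> H j \<sigma> = H j \<tau>"
  shows "lZ (spins (k * M)) (\<lambda>\<sigma>. \<Sum>j<k. H j (\<lambda>i. \<sigma> (j * M + i))) = (\<Sum>j<k. lZ (spins M) (H j))"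
proof (induction k)
  case 0
  then show ?case by (simp add: lZ_zero[OF finite_spins spins_ne] card_spins)
next
  case (Suc k)
  have dep: "(\<Sum>j<k. H j (\<lambda>i. \<sigma> (j * M + i))) = (\<Sum>j<k. H j (\<lambda>i. \<tau> (j * M + i)))" if "\<And>i. i < k * M \<Longrightarrow> \<sigma> i = \<tau> i" for \<sigma> \<tau> :: "nat \<Rightarrow> real"
  proof (intro sum.cong refl H that)
    fix j i assume "j \<in> {..<k}" "i < M"
    then have "j * M + i < Suc j * M" by simp
    also have "\<dots> \<le> k * M" using \<open>j \<in> {..<k}\<close> by (intro mult_right_mono) auto
    finally show "j * M + i < k * M" .
  qed
  have "lZ (spins (k * M + M)) (\<lambda>\<sigma>. (\<Sum>j<k. H j (\<lambda>i. \<sigma> (j * M + i))) + H k (\<lambda>i. \<sigma> (k * M + i)))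
    = lZ (spins (k * M)) (\<lambda>\<sigma>. \<Sum>j<k. H j (\<lambda>i. \<sigma> (j * M + i))) + lZ (spins M) (H k)"
    by (rule lZ_spins_add[OF dep H]; assumption)
  then show ?case using Suc by (simp add: add.commute[of M])
qed

text \<open>Turns a bound that holds for every frozen value of the coordinates outside
  \<open>J\<close> into a bound on the full mean.\<close>

lemma resample_le:
  assumes J: "finite J" and F: "tame F" "\<And>w. 0 \<le> F w"
    and t: "\<And>w. tame (\<lambda>w'. F (\<lambda>i. if i \<in> J then w' i else w i))"
    and b: "\<And>w. EE (\<lambda>w'. F (\<lambda>i. if i \<in> J then w' i else w i)) \<le> b"
  shows "EE F \<le> b"
proof -
  have b0: "0 \<le> b" using b[of undefined] F(2) by (meson Bochner_Integration.integral_nonneg order_trans)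
  have m: "F \<in> borel_measurable disorder" by (rule tame_meas[OF F(1)])
  have "ennreal (EE F) = (\<integral>\<^sup>+w. ennreal (F w) \<partial>disorder)"
    by (rule nn_integral_eq_integral[symmetric]) (use F in \<open>auto intro: tame_integrable\<close>)
  also have "\<dots> = (\<integral>\<^sup>+w. \<integral>\<^sup>+w'. ennreal (F (\<lambda>i. if i \<in> J then w' i else w i)) \<partial>disorder \<partial>disorder)"
    by (rule resample_set_nn[OF J]) (use m in measurable)
  also have "\<dots> \<le> (\<integral>\<^sup>+w. ennreal b \<partial>disorder)"
  proof (rule nn_integral_mono)
    fix w
    have "(\<integral>\<^sup>+w'. ennreal (F (\<lambda>i. if i \<in> J then w' i else w i)) \<partial>disorder) = ennreal (EE (\<lambda>w'. F (\<lambda>i. if i \<in> J then w' i else w i)))"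
      by (rule nn_integral_eq_integral) (use F t in \<open>auto intro: tame_integrable\<close>)
    also have "\<dots> \<le> ennreal b" by (rule ennreal_leI[OF b])
    finally show "(\<integral>\<^sup>+w'. ennreal (F (\<lambda>i. if i \<in> J then w' i else w i)) \<partial>disorder) \<le> ennreal b" .
  qed
  also have "\<dots> = ennreal b" by (simp add: D.emeasure_space_1[simplified])
  finally show ?thesis using b0 by simp
qed

section \<open>The interpolating system of one large system and k blocks\<close>

text \<open>\<open>k\<close> blocks of \<open>M\<close> sites are followed by \<open>r0\<close>
  leftover sites. The tags [0,0], [1,j] and [2,j] select the disorder of the large system, of block
  \<open>j\<close>, and of the perturbing fields on block \<open>j\<close>.\<close>

locale blk =
  fixes p k M r0 D :: nat and s c :: real
  assumes p: "p \<ge> 1" and k: "k \<ge> 1" and M1: "M \<ge> 1"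
begin

abbreviation "NN \<equiv> k * M + r0"
abbreviation "SS \<equiv> spins NN"
abbreviation "Va \<equiv> pv [0,0] p NN 0"
abbreviation "Vb j \<equiv> pv [1,j] p M (j * M)"
abbreviation "Vc j q \<equiv> pv [2,j] q M (j * M)"
abbreviation "Rj j \<equiv> bover M (j * M)"

definition II where "II = bidx [0,0] p NN \<union> (\<Union>j<k. bidx [1,j] p M) \<union> (\<Union>j<k. \<Union>q\<in>{1..D}. bidx [2,j] q M)"
definition JJ where "JJ j = (\<Union>q\<in>{1..D}. bidx [2,j] q M)"
definition BB where "BB \<sigma> i = (\<Sum>j<k. Vb j \<sigma> i)"
definition CC where "CC x \<sigma> i = (\<Sum>j<k. uu (Vc j) D c (x j) \<sigma> i)"
text \<open>Amplitudes of three independent fields: \<open>a\<close> for the large system,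
  \<open>b\<close> for the blocks, \<open>e\<close> to switch the perturbation.\<close>

definition UU where "UU a b e x \<sigma> i = a * Va \<sigma> i + b * BB \<sigma> i + e * CC x \<sigma> i"
definition ee where "ee a b e x w \<sigma> = 0 + fld II (UU a b e x \<sigma>) w"

lemma finII: "finite II" and finJJ: "finite (JJ j)"
  unfolding II_def JJ_def by auto

lemma N1': "NN \<ge> 1" using k M1 by (simp add: Suc_leI)

lemma blk_le: "j < k \<Longrightarrow> j * M + M \<le> NN"
proof -
  assume "j < k"
  then have "Suc j * M \<le> k * M" by (intro mult_right_mono) auto
  then show ?thesis by simp
qed

lemma sub: "bidx [0,0] p NN \<subseteq> II" "j < k \<Longrightarrow> bidx [1,j] p M \<subseteq> II" "j < k \<Longrightarrow> q \<in> {1..D} \<Longrightarrow> bidx [2,j] q M \<subseteq> II"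
  unfolding II_def by blast+

lemma ip_VaVb: "ip II (Va \<sigma>) (BB \<tau>) = 0" "ip II (BB \<tau>) (Va \<sigma>) = 0"
  unfolding BB_def[abs_def] ip_sum_right ip_sum_left by (simp_all add: ip_pv_disj)

lemma uu_def': "uu V D c x \<sigma> = (\<lambda>i. c * (\<Sum>q\<in>{1..D}. x q * V q \<sigma> i))"
  by (simp add: uu_def fun_eq_iff)

lemma ip_VaCC: "ip II (Va \<sigma>) (CC x \<tau>) = 0" "ip II (CC x \<tau>) (Va \<sigma>) = 0"
  unfolding CC_def[abs_def] ip_sum_right ip_sum_left uu_def' ip_scale_left ip_scale_right by (simp_all add: ip_pv_disj)

lemma ip_BBCC: "ip II (BB \<sigma>) (CC x \<tau>) = 0" "ip II (CC x \<tau>) (BB \<sigma>) = 0"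
  unfolding BB_def[abs_def] CC_def[abs_def] ip_sum_right ip_sum_left uu_def' ip_scale_left ip_scale_right by (simp_all add: ip_pv_disj)

lemma ip_VaVa: "ip II (Va \<sigma>) (Va \<tau>) = real NN * overlap NN \<sigma> \<tau> ^ p"
  unfolding overlap_bover by (rule ip_pv[OF finII sub(1) N1' p])

lemma ip_BBBB: "ip II (BB \<sigma>) (BB \<tau>) = real M * (\<Sum>j<k. Rj j \<sigma> \<tau> ^ p)"
proof -
  have "ip II (BB \<sigma>) (BB \<tau>) = (\<Sum>j<k. \<Sum>j'<k. ip II (Vb j \<sigma>) (Vb j' \<tau>))"
    unfolding BB_def[abs_def] ip_sum_right ip_sum_left by (rule sum.swap)
  also have "\<dots> = (\<Sum>j<k. \<Sum>j'<k. if j' = j then real M * Rj j \<sigma> \<tau> ^ p else 0)"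
  proof (intro sum.cong refl)
    fix j j' assume "j \<in> {..<k}" "j' \<in> {..<k}"
    then show "ip II (Vb j \<sigma>) (Vb j' \<tau>) = (if j' = j then real M * Rj j \<sigma> \<tau> ^ p else 0)"
      using ip_pv[OF finII sub(2)[of j] M1 p] ip_pv_disj[of "[1,j]" "[1,j']"] by auto
  qed
  also have "\<dots> = real M * (\<Sum>j<k. Rj j \<sigma> \<tau> ^ p)" by (simp add: sum_distrib_left)
  finally show ?thesis .
qed

lemma ip_CCCC_self:
  assumes \<sigma>: "\<sigma> \<in> SS" and x: "\<And>j q. j < k \<Longrightarrow> q \<in> {1..D} \<Longrightarrow> \<bar>x j q\<bar> \<le> 2"
  shows "ip II (CC x \<sigma>) (CC x \<sigma>) \<le> 4 * c\<^sup>2 * D * real (k * M)"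
proof -
  have "ip II (CC x \<sigma>) (CC x \<sigma>) = (\<Sum>j<k. \<Sum>j'<k. ip II (uu (Vc j) D c (x j) \<sigma>) (uu (Vc j') D c (x j') \<sigma>))"
    unfolding CC_def[abs_def] ip_sum_right ip_sum_left by (rule sum.swap)
  also have "\<dots> = (\<Sum>j<k. \<Sum>j'<k. if j' = j then c\<^sup>2 * (\<Sum>q\<in>{1..D}. (x j q)\<^sup>2 * real M) else 0)"
  proof (intro sum.cong refl)
    fix j j' assume j: "j \<in> {..<k}" "j' \<in> {..<k}"
    have "ip II (uu (Vc j) D c (x j) \<sigma>) (uu (Vc j') D c (x j') \<sigma>)
      = c * (c * (\<Sum>q\<in>{1..D}. x j q * (\<Sum>q'\<in>{1..D}. x j' q' * ip II (Vc j q \<sigma>) (Vc j' q' \<sigma>))))"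
      unfolding uu_def' ip_scale_left ip_scale_right ip_sum_left ip_sum_right ..
    also have "(\<Sum>q\<in>{1..D}. x j q * (\<Sum>q'\<in>{1..D}. x j' q' * ip II (Vc j q \<sigma>) (Vc j' q' \<sigma>)))
      = (\<Sum>q\<in>{1..D}. x j q * (\<Sum>q'\<in>{1..D}. if q' = q then (if j' = j then x j q * real M else 0) else 0))"
    proof (intro sum.cong refl arg_cong2[where f="(*)"])
      fix q q' assume q: "q \<in> {1..D}" "q' \<in> {1..D}"
      have "ip II (Vc j q \<sigma>) (Vc j q \<sigma>) = real M"
        using ip_pv[OF finII sub(3)[OF _ q(1)] M1, of j "j * M" \<sigma> \<sigma>] j q bover_self[OF \<sigma> blk_le M1, of j] by auto
      then show "x j' q' * ip II (Vc j q \<sigma>) (Vc j' q' \<sigma>) = (if q' = q then (if j' = j then x j q * real M else 0) else 0)"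
        using ip_pv_disj[of "[2,j]" "[2,j']" q q' II M "j * M" \<sigma> M "j' * M" \<sigma>] by auto
    qed
    also have "\<dots> = (if j' = j then \<Sum>q\<in>{1..D}. (x j q)\<^sup>2 * real M else 0)"
      by (simp add: power2_eq_square mult.assoc)
    finally show "ip II (uu (Vc j) D c (x j) \<sigma>) (uu (Vc j') D c (x j') \<sigma>) = (if j' = j then c\<^sup>2 * (\<Sum>q\<in>{1..D}. (x j q)\<^sup>2 * real M) else 0)"
      by (simp add: power2_eq_square mult.assoc)
  qed
  also have "\<dots> = (\<Sum>j<k. c\<^sup>2 * (\<Sum>q\<in>{1..D}. (x j q)\<^sup>2 * real M))" by simp
  also have "\<dots> \<le> (\<Sum>j<k. c\<^sup>2 * (\<Sum>q\<in>{1..D}. 4 * real M))"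
  proof (intro sum_mono mult_left_mono mult_right_mono)
    fix j q assume "j \<in> {..<k}" "q \<in> {1..D}"
    then have "\<bar>x j q\<bar>\<^sup>2 \<le> 2\<^sup>2" using x by (intro power_mono) auto
    then show "(x j q)\<^sup>2 \<le> 4" by simp
  qed auto
  finally show ?thesis by (simp add: mult_ac)
qed

lemma ip_UU: "ip II (UU a b 0 x \<sigma>) (UU a' b' e x \<tau>) = a * a' * (real NN * overlap NN \<sigma> \<tau> ^ p) + b * b' * (real M * (\<Sum>j<k. Rj j \<sigma> \<tau> ^ p))"
  unfolding UU_def[abs_def] ip_add_left ip_add_right ip_scale_left ip_scale_right
  by (simp add: ip_VaVa ip_BBBB ip_VaVb ip_VaCC ip_BBCC)

lemma ip_CCUU: "ip II (CC x \<sigma>) (UU a b e x \<tau>) = e * ip II (CC x \<sigma>) (CC x \<tau>)"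
  unfolding UU_def[abs_def] ip_add_right ip_scale_right by (simp add: ip_VaCC ip_BBCC)

lemma ee_add: "ee a b 1 x w \<sigma> = ee a b 0 x w \<sigma> + fld II (CC x \<sigma>) w"
  unfolding ee_def UU_def[abs_def] fld_def by (simp add: distrib_left sum.distrib)

lemma tame_ee: "tame (\<lambda>w. ee a b e x w \<sigma>)"
  unfolding ee_def by (intro tame_add_mult tame_const tame_fld)

lemma ee_meas: "(\<lambda>w. ee a b e x w \<sigma>) \<in> borel_measurable disorder"
  by (rule tame_meas[OF tame_ee])

lemma tame_lZ_ee: "tame (\<lambda>w. lZ SS (ee a b e x w))"
  by (intro tame_lZ finite_spins spins_ne tame_ee)

lemma tame_gav_ee: "(\<And>\<sigma>. tame (\<lambda>w. f w \<sigma>)) \<Longrightarrow> tame (\<lambda>w. gav SS (ee a b e x w) (f w))"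
  by (rule tame_gav[OF finite_spins ee_meas])

definition \<Phi> where "\<Phi> a b e x = EE (\<lambda>w. lZ SS (ee a b e x w))"

lemma EE_gav_CC:
  "EE (\<lambda>w. gav SS (ee a b e x w) (\<lambda>\<sigma>. fld II (CC x \<sigma>) w))
    = EE (\<lambda>w. gav SS (ee a b e x w) (\<lambda>\<sigma>. e * ip II (CC x \<sigma>) (CC x \<sigma>)) - gav SS (ee a b e x w) (\<lambda>\<sigma>. gav SS (ee a b e x w) (\<lambda>\<tau>. e * ip II (CC x \<sigma>) (CC x \<tau>))))"
  using gibbs_ibp[OF finite_spins spins_ne finII, of NN "\<lambda>_. 0" "UU a b e x" "\<lambda>_. 1" "CC x"]
  unfolding ee_def[symmetric, abs_def] ip_CCUU by simp

text \<open>An independent centred field can only raise the mean log-partition function: the tangent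
  at the unperturbed end has mean slope zero.\<close>

lemma \<Phi>_ge: "\<Phi> a b 0 x \<le> \<Phi> a b 1 x"
proof -
  have t: "tame (\<lambda>w. gav SS (ee a b 0 x w) (\<lambda>\<sigma>. fld II (CC x \<sigma>) w))" by (intro tame_gav_ee tame_fld)
  have "EE (\<lambda>w. lZ SS (ee a b 0 x w) + gav SS (ee a b 0 x w) (\<lambda>\<sigma>. fld II (CC x \<sigma>) w)) \<le> \<Phi> a b 1 x"
    unfolding \<Phi>_def
  proof (rule EE_mono[OF tame_add[OF tame_lZ_ee t] tame_lZ_ee])
    fix w
    have e1: "ee a b 1 x w = (\<lambda>\<sigma>. ee a b 0 x w \<sigma> + fld II (CC x \<sigma>) w)" by (intro ext ee_add)
    show "lZ SS (ee a b 0 x w) + gav SS (ee a b 0 x w) (\<lambda>\<sigma>. fld II (CC x \<sigma>) w) \<le> lZ SS (ee a b 1 x w)"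
      unfolding e1 by (rule lZ_tangent[OF finite_spins spins_ne])
  qed
  moreover have "EE (\<lambda>w. gav SS (ee a b 0 x w) (\<lambda>\<sigma>. fld II (CC x \<sigma>) w)) = 0"
    unfolding EE_gav_CC by (simp add: gav_const[OF finite_spins spins_ne])
  ultimately show ?thesis unfolding \<Phi>_def EE_add[OF tame_lZ_ee t] by simp
qed

text \<open>The tangent at the perturbed end; its mean slope is at most the variance of the
  perturbation, and strengths up to 2 account for the 4.\<close>

lemma \<Phi>_le:
  assumes x: "\<And>j q. j < k \<Longrightarrow> q \<in> {1..D} \<Longrightarrow> \<bar>x j q\<bar> \<le> 2"
  shows "\<Phi> a b 1 x \<le> \<Phi> a b 0 x + 4 * c\<^sup>2 * D * real (k * M)"
proof -
  have t: "tame (\<lambda>w. gav SS (ee a b 1 x w) (\<lambda>\<sigma>. fld II (CC x \<sigma>) w))" by (intro tame_gav_ee tame_fld)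
  have "EE (\<lambda>w. lZ SS (ee a b 1 x w) - gav SS (ee a b 1 x w) (\<lambda>\<sigma>. fld II (CC x \<sigma>) w)) \<le> \<Phi> a b 0 x"
    unfolding \<Phi>_def
  proof (rule EE_mono[OF tame_diff[OF tame_lZ_ee t] tame_lZ_ee])
    fix w
    have e0: "ee a b 0 x w = (\<lambda>\<sigma>. ee a b 1 x w \<sigma> + (- 1) * fld II (CC x \<sigma>) w)" using ee_add[of a b x w] by auto
    show "lZ SS (ee a b 1 x w) - gav SS (ee a b 1 x w) (\<lambda>\<sigma>. fld II (CC x \<sigma>) w) \<le> lZ SS (ee a b 0 x w)"
      using lZ_tangent[OF finite_spins spins_ne, of NN "ee a b 1 x w" "\<lambda>\<sigma>. (- 1) * fld II (CC x \<sigma>) w"]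
      unfolding e0 gav_cmult by simp
  qed
  moreover have "EE (\<lambda>w. gav SS (ee a b 1 x w) (\<lambda>\<sigma>. fld II (CC x \<sigma>) w)) \<le> EE (\<lambda>w. 4 * c\<^sup>2 * D * real (k * M))"
    unfolding EE_gav_CC
  proof (rule EE_mono)
    fix w
    have "gav SS (ee a b 1 x w) (\<lambda>\<sigma>. 1 * ip II (CC x \<sigma>) (CC x \<sigma>)) \<le> 4 * c\<^sup>2 * D * real (k * M)"
      by (intro gav_le finite_spins spins_ne) (use ip_CCCC_self[OF _ x] in simp)
    moreover have "0 \<le> gav SS (ee a b 1 x w) (\<lambda>\<sigma>. gav SS (ee a b 1 x w) (\<lambda>\<tau>. 1 * ip II (CC x \<sigma>) (CC x \<tau>)))"
      using gav_ip_nonneg[of SS "ee a b 1 x w" II "CC x"] by simp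
    ultimately show "gav SS (ee a b 1 x w) (\<lambda>\<sigma>. 1 * ip II (CC x \<sigma>) (CC x \<sigma>)) - gav SS (ee a b 1 x w) (\<lambda>\<sigma>. gav SS (ee a b 1 x w) (\<lambda>\<tau>. 1 * ip II (CC x \<sigma>) (CC x \<tau>)))
      \<le> 4 * c\<^sup>2 * D * real (k * M)" by linarith
  qed (intro tame_diff tame_gav_ee tame_const)+
  ultimately show ?thesis unfolding \<Phi>_def EE_diff[OF tame_lZ_ee t] EE_const by simp
qed

lemma \<Phi>_main: "\<Phi> s 0 0 x = PS p NN SS s (\<lambda>_. 0)"
proof -
  have "ee s 0 0 x w \<sigma> = hen p NN s (\<lambda>i. w ([0,0] @ i)) \<sigma>" for w \<sigma>
  proof -
    have "ee s 0 0 x w \<sigma> = s * fld II (Va \<sigma>) w"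
      unfolding ee_def UU_def[abs_def] fld_def by (simp add: sum_distrib_left mult_ac)
    also have "\<dots> = hen p NN s (\<lambda>i. w ([0,0] @ i)) \<sigma>"
      unfolding fld_pv[OF finII sub(1)] fld_bidx hen_scale by simp
    finally show ?thesis .
  qed
  then show ?thesis unfolding \<Phi>_def PS_reindex[of SS p NN s "[0,0]", symmetric] by (simp add: fun_eq_iff[symmetric] cong: lZ_cong)
qed

text \<open>Without the large-system field the blocks decouple and the leftover spins are free, each
  worth ln 2.\<close>

lemma \<Phi>_blocks: "\<Phi> 0 s 0 x = real k * PS p M (spins M) s (\<lambda>_. 0) + real r0 * ln 2"
proof -
  define H where "H w j \<sigma> = hen p M s (\<lambda>i. w ([1,j] @ i)) \<sigma>" for w j \<sigma>
  have e: "ee 0 s 0 x w \<sigma> = (\<Sum>j<k. H w j (\<lambda>i. \<sigma> (j * M + i))) + 0" for w \<sigma>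
  proof -
    have "ee 0 s 0 x w \<sigma> = s * (\<Sum>j<k. fld II (Vb j \<sigma>) w)"
      unfolding ee_def UU_def[abs_def] BB_def fld_def by (simp add: sum_distrib_left sum.swap[of _ II] mult_ac)
    also have "(\<Sum>j<k. fld II (Vb j \<sigma>) w) = (\<Sum>j<k. hen p M 1 (\<lambda>i. w ([1,j] @ i)) (\<lambda>i. \<sigma> (j * M + i)))"
      by (intro sum.cong refl) (simp only: fld_pv[OF finII sub(2)] fld_bidx lessThan_iff)
    finally show ?thesis unfolding H_def by (simp add: sum_distrib_left hen_scale)
  qed
  have Hc: "H w j \<sigma> = H w j \<tau>" if "\<And>i. i < M \<Longrightarrow> \<sigma> i = \<tau> i" for w j \<sigma> \<tau>
    unfolding H_def by (rule hen_cong) (rule that)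
  have "lZ SS (ee 0 s 0 x w) = (\<Sum>j<k. lZ (spins M) (H w j)) + real r0 * ln 2" for w
  proof -
    have dep: "(\<Sum>j<k. H w j (\<lambda>i. \<sigma> (j * M + i))) = (\<Sum>j<k. H w j (\<lambda>i. \<tau> (j * M + i)))" if "\<And>i. i < k * M \<Longrightarrow> \<sigma> i = \<tau> i" for \<sigma> \<tau> :: "nat \<Rightarrow> real"
    proof (intro sum.cong refl Hc that)
      fix j i assume "j \<in> {..<k}" "i < M"
      then have "j * M + i < Suc j * M" by simp
      also have "\<dots> \<le> k * M" using \<open>j \<in> {..<k}\<close> by (intro mult_right_mono) auto
      finally show "j * M + i < k * M" .
    qed
    have "lZ SS (ee 0 s 0 x w) = lZ SS (\<lambda>\<sigma>. (\<Sum>j<k. H w j (\<lambda>i. \<sigma> (j * M + i))) + (\<lambda>_. 0) (\<lambda>i. \<sigma> (k * M + i)))"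
      by (intro lZ_cong) (simp add: e)
    also have "\<dots> = lZ (spins (k * M)) (\<lambda>\<sigma>. \<Sum>j<k. H w j (\<lambda>i. \<sigma> (j * M + i))) + lZ (spins r0) (\<lambda>_. 0)"
      by (rule lZ_spins_add[OF dep]) auto
    also have "lZ (spins (k * M)) (\<lambda>\<sigma>. \<Sum>j<k. H w j (\<lambda>i. \<sigma> (j * M + i))) = (\<Sum>j<k. lZ (spins M) (H w j))"
      by (rule lZ_blocks) (rule Hc)
    finally show ?thesis by (simp add: lZ_zero[OF finite_spins spins_ne] card_spins ln_realpow)
  qed
  then have "\<Phi> 0 s 0 x = EE (\<lambda>w. (\<Sum>j<k. lZ (spins M) (H w j)) + real r0 * ln 2)" unfolding \<Phi>_def by simp
  also have tH: "tame (\<lambda>w. lZ (spins M) (H w j))" for j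
  proof -
    have "tame (\<lambda>w. H w j \<sigma>)" for \<sigma>
      unfolding H_def hen_def fld_def by (intro tame_sum tame_add_mult tame_coord tame_const)
    then show ?thesis by (intro tame_lZ finite_spins spins_ne)
  qed
  then have "EE (\<lambda>w. (\<Sum>j<k. lZ (spins M) (H w j)) + real r0 * ln 2) = (\<Sum>j<k. EE (\<lambda>w. lZ (spins M) (H w j))) + real r0 * ln 2"
    by (subst EE_add[OF tame_sum tame_const]) (simp_all only: EE_const Bochner_Integration.integral_sum tame_integrable)
  also have "(\<Sum>j<k. EE (\<lambda>w. lZ (spins M) (H w j))) = (\<Sum>j<k. PS p M (spins M) s (\<lambda>_. 0))"
    unfolding H_def[abs_def] PS_reindex ..
  finally show ?thesis by simp
qed


definition ind where "ind \<epsilon> a b x j = EE (\<lambda>w. gav SS (ee a b 1 x w) (\<lambda>\<sigma>. gav SS (ee a b 1 x w) (\<lambda>\<tau>. if Rj j \<sigma> \<tau> \<le> - 2 * \<epsilon> then 1 else 0)))"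

lemma overlap_blocks: "real NN * overlap NN \<sigma> \<tau> = (\<Sum>j<k. real M * Rj j \<sigma> \<tau>) + (\<Sum>i<r0. \<sigma> (k * M + i) * \<tau> (k * M + i))"
proof -
  have n: "real NN \<noteq> 0" "real M \<noteq> 0" using N1' M1 by linarith+
  have "real NN * overlap NN \<sigma> \<tau> = (\<Sum>i<NN. \<sigma> i * \<tau> i)"
    unfolding overlap_def times_divide_eq_right by (rule nonzero_mult_div_cancel_left[OF n(1)])
  then show ?thesis using n(2) by (simp add: bover_def sum_lessThan_add sum_blocks)
qed

text \<open>Convexity of \<open>|x|^p\<close> controls the interpolation up to blocks with negative overlap, which
  matter only for odd \<open>p\<close>.\<close>

lemma convexity:
  assumes \<sigma>: "\<sigma> \<in> SS" "\<tau> \<in> SS" and \<epsilon>: "\<epsilon> > 0"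
  shows "real r0 - real NN * overlap NN \<sigma> \<tau> ^ p + real M * (\<Sum>j<k. Rj j \<sigma> \<tau> ^ p)
    \<ge> - (2 * real M * (\<Sum>j<k. 2 * \<epsilon> + (if Rj j \<sigma> \<tau> \<le> - 2 * \<epsilon> then 1 else 0)))"
proof -
  obtain m where m: "p = Suc m" using p by (cases p) auto
  define y where "y = \<bar>overlap NN \<sigma> \<tau>\<bar>"
  have y0: "y \<ge> 0" by (simp add: y_def)
  let ?a = "\<lambda>j. \<bar>Rj j \<sigma> \<tau>\<bar>"
  have "real NN * y = \<bar>real NN * overlap NN \<sigma> \<tau>\<bar>" by (simp add: y_def abs_mult)
  also have "\<dots> \<le> (\<Sum>j<k. \<bar>real M * Rj j \<sigma> \<tau>\<bar>) + (\<Sum>i<r0. \<bar>\<sigma> (k * M + i) * \<tau> (k * M + i)\<bar>)"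
    unfolding overlap_blocks by (intro order_trans[OF abs_triangle_ineq] add_mono sum_abs)
  also have "(\<Sum>i<r0. \<bar>\<sigma> (k * M + i) * \<tau> (k * M + i)\<bar>) = (\<Sum>i<r0. 1)"
  proof (intro sum.cong refl)
    fix i assume "i \<in> {..<r0}"
    then show "\<bar>\<sigma> (k * M + i) * \<tau> (k * M + i)\<bar> = 1"
      using spinsD[OF \<sigma>(1), of "k * M + i"] spinsD[OF \<sigma>(2), of "k * M + i"] by auto
  qed
  finally have "real NN * y \<le> real M * (\<Sum>j<k. ?a j) + real r0" by (simp add: abs_mult sum_distrib_left)
  then have w: "0 \<le> real M * (\<Sum>j<k. ?a j - y) + real r0 * (1 - y)"
    by (simp add: sum_subtractf algebra_simps)
  \<comment> \<open>The added term is nonnegative since |R| is at most the weighted mean of the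
    |R_j| and of 1 for each leftover site. It distributes the tangent at |R| over the blocks and
    leftover sites.\<close>
  have "real NN * y ^ p \<le> real NN * y ^ p + (real p * y ^ m) * (real M * (\<Sum>j<k. ?a j - y) + real r0 * (1 - y))"
    using w y0 by simp
  also have "\<dots> = real M * (\<Sum>j<k. y ^ p + real p * y ^ m * (?a j - y)) + real r0 * (y ^ p + real p * y ^ m * (1 - y))"
  proof -
    have "(\<Sum>j<k. y ^ p + real p * y ^ m * (?a j - y)) = real k * y ^ p + real p * y ^ m * (\<Sum>j<k. ?a j - y)"
      unfolding sum.distrib sum_distrib_left[symmetric] by simp
    then show ?thesis by (simp add: algebra_simps)
  qed
  also have "\<dots> \<le> real M * (\<Sum>j<k. ?a j ^ p) + real r0 * 1 ^ p"
    unfolding m using bernoulli_tangent[OF abs_ge_zero y0] bernoulli_tangent[OF zero_le_one y0, of m] by (intro add_mono mult_left_mono sum_mono) auto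
  finally have 1: "real NN * y ^ p \<le> real M * (\<Sum>j<k. ?a j ^ p) + real r0" by simp
  have "overlap NN \<sigma> \<tau> ^ p \<le> y ^ p" unfolding y_def power_abs[symmetric] by simp
  then have "real NN * overlap NN \<sigma> \<tau> ^ p \<le> real NN * y ^ p" by (intro mult_left_mono) auto
  with 1 have 2: "real r0 - real NN * overlap NN \<sigma> \<tau> ^ p + real M * (\<Sum>j<k. Rj j \<sigma> \<tau> ^ p) \<ge> real M * (\<Sum>j<k. Rj j \<sigma> \<tau> ^ p - ?a j ^ p)"
    by (simp add: sum_subtractf algebra_simps)
  \<comment> \<open>A negative block overlap costs at most 2 |R_j|: no more than 4 \<epsilon> if it
    is above - 2 \<epsilon>, and no more than 2 otherwise.\<close>
  have 3: "Rj j \<sigma> \<tau> ^ p - ?a j ^ p \<ge> - 2 * (2 * \<epsilon> + (if Rj j \<sigma> \<tau> \<le> - 2 * \<epsilon> then 1 else 0))" if j: "j < k" for j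
  proof -
    have b: "?a j \<le> 1" by (rule bover_abs[OF \<sigma> blk_le[OF j]])
    have bp: "?a j ^ p \<le> ?a j" unfolding m using b by (simp add: mult_left_le power_le_one)
    have lo: "Rj j \<sigma> \<tau> ^ p \<ge> - (?a j ^ p)" using abs_ge_minus_self[of "Rj j \<sigma> \<tau> ^ p"] by (simp add: power_abs)
    show ?thesis
    proof (cases "Rj j \<sigma> \<tau> \<ge> 0")
      case True
      then show ?thesis using \<epsilon> by simp
    next
      case False
      then show ?thesis using lo bp b \<epsilon> by (auto simp: abs_if split: if_splits)
    qed
  qed
  have "real M * (\<Sum>j<k. Rj j \<sigma> \<tau> ^ p - ?a j ^ p) \<ge> real M * (\<Sum>j<k. - 2 * (2 * \<epsilon> + (if Rj j \<sigma> \<tau> \<le> - 2 * \<epsilon> then 1 else 0)))"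
    using 3 by (intro mult_left_mono sum_mono) auto
  also have "real M * (\<Sum>j<k. - 2 * (2 * \<epsilon> + (if Rj j \<sigma> \<tau> \<le> - 2 * \<epsilon> then 1 else 0))) = - (2 * real M * (\<Sum>j<k. 2 * \<epsilon> + (if Rj j \<sigma> \<tau> \<le> - 2 * \<epsilon> then 1 else 0)))"
    unfolding sum_distrib_left[symmetric] by simp
  finally show ?thesis using 2 by linarith
qed

text \<open>Amplitudes sin and cos give a path that is smooth up to both ends, unlike square roots
  of an interpolation parameter. The perturbation is constant along it and drops out of the
  derivative.\<close>

lemma \<Phi>_deriv:
  fixes \<theta> :: real
  assumes \<theta>: "\<bar>\<theta>\<bar> < 2"
  shows "((\<lambda>\<theta>. \<Phi> (s * sin \<theta>) (s * cos \<theta>) 1 x) has_real_derivative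
    EE (\<lambda>w. gav SS (ee (s * sin \<theta>) (s * cos \<theta>) 1 x w) (\<lambda>\<sigma>. gav SS (ee (s * sin \<theta>) (s * cos \<theta>) 1 x w) (\<lambda>\<tau>.
      s\<^sup>2 * sin \<theta> * cos \<theta> * (real r0 - real NN * overlap NN \<sigma> \<tau> ^ p + real M * (\<Sum>j<k. Rj j \<sigma> \<tau> ^ p)))))) (at \<theta>)"
proof -
  define Bd where "Bd = (\<Sum>\<sigma>\<in>SS. \<Sum>i\<in>II. \<bar>s\<bar> * (\<bar>Va \<sigma> i\<bar> + \<bar>BB \<sigma> i\<bar>))"
  let ?e = "\<lambda>\<theta>. ee (s * sin \<theta>) (s * cos \<theta>) 1 x"
  let ?u0 = "\<lambda>\<theta>. UU (s * sin \<theta>) (s * cos \<theta>) 1 x" and ?u1 = "\<lambda>\<theta>. UU (s * cos \<theta>) (- (s * sin \<theta>)) 0 x"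
  let ?E = "\<lambda>\<theta> w \<sigma>. 0 + fld II (?u0 \<theta> \<sigma>) w"
  let ?X = "\<lambda>\<sigma> \<tau>. s\<^sup>2 * sin \<theta> * cos \<theta> * (real r0 - real NN * overlap NN \<sigma> \<tau> ^ p + real M * (\<Sum>j<k. Rj j \<sigma> \<tau> ^ p))"
  have "((\<lambda>\<theta>. EE (\<lambda>w. lZ SS (?E \<theta> w))) has_real_derivative
     EE (\<lambda>w. gav SS (?E \<theta> w) (\<lambda>\<sigma>. 0 + ip II (?u1 \<theta> \<sigma>) (?u0 \<theta> \<sigma>))
        - gav SS (?E \<theta> w) (\<lambda>\<sigma>. gav SS (?E \<theta> w)
            (\<lambda>\<tau>. ip II (?u1 \<theta> \<sigma>) (?u0 \<theta> \<tau>))))) (at \<theta>)"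
  proof (rule lZ_path_deriv[where T=2 and B=Bd and u="?u0" and d="\<lambda>_ _. 0"
        and d'="\<lambda>_ _. 0" and u'="?u1", OF finite_spins spins_ne finII])
    show "((\<lambda>\<theta>. ?u0 \<theta> \<sigma> i) has_real_derivative ?u1 \<theta> \<sigma> i) (at \<theta>)" for \<theta> \<sigma> i
      unfolding UU_def by (auto intro!: derivative_eq_intros)
    show "\<bar>?u1 \<theta> \<sigma> i\<bar> \<le> Bd" if "\<sigma> \<in> SS" "i \<in> II" for \<theta> \<sigma> i
    proof -
      have "\<bar>?u1 \<theta> \<sigma> i\<bar> \<le> \<bar>s * cos \<theta> * Va \<sigma> i\<bar> + \<bar>s * sin \<theta> * BB \<sigma> i\<bar>"
        unfolding UU_def by simp
      also have "\<dots> \<le> \<bar>s\<bar> * \<bar>Va \<sigma> i\<bar> + \<bar>s\<bar> * \<bar>BB \<sigma> i\<bar>"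
        unfolding abs_mult by (intro add_mono mult_right_mono mult_left_le) (auto simp: abs_cos_le_one abs_sin_le_one)
      also have "\<dots> = \<bar>s\<bar> * (\<bar>Va \<sigma> i\<bar> + \<bar>BB \<sigma> i\<bar>)" by (simp add: distrib_left)
      also have "\<dots> \<le> (\<Sum>i\<in>II. \<bar>s\<bar> * (\<bar>Va \<sigma> i\<bar> + \<bar>BB \<sigma> i\<bar>))"
        by (rule member_le_sum[OF that(2) _ finII]) simp
      also have "\<dots> \<le> Bd" unfolding Bd_def
        by (rule member_le_sum[OF that(1) _ finite_spins, of "\<lambda>\<sigma>. \<Sum>i\<in>II. \<bar>s\<bar> * (\<bar>Va \<sigma> i\<bar> + \<bar>BB \<sigma> i\<bar>)"]) (simp add: sum_nonneg)
      finally show ?thesis .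
    qed
    show "\<bar>0\<bar> \<le> Bd" unfolding Bd_def by (simp add: sum_nonneg)
  qed (use \<theta> in auto)
  moreover have "EE (\<lambda>w. gav SS (?E \<theta> w) (\<lambda>\<sigma>. 0 + ip II (?u1 \<theta> \<sigma>) (?u0 \<theta> \<sigma>))
        - gav SS (?E \<theta> w) (\<lambda>\<sigma>. gav SS (?E \<theta> w)
            (\<lambda>\<tau>. ip II (?u1 \<theta> \<sigma>) (?u0 \<theta> \<tau>))))
    = EE (\<lambda>w. gav SS (?e \<theta> w) (\<lambda>\<sigma>. gav SS (?e \<theta> w) (\<lambda>\<tau>.
      ?X \<sigma> \<tau>)))"
  proof (rule arg_cong[where f=EE], rule ext)
    fix w
    have e: "(?E \<theta> w) = ?e \<theta> w" by (simp add: ee_def fun_eq_iff)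
    let ?ip = "\<lambda>\<sigma> \<tau>. s * cos \<theta> * (s * sin \<theta>) * (real NN * overlap NN \<sigma> \<tau> ^ p) + - (s * sin \<theta>) * (s * cos \<theta>) * (real M * (\<Sum>j<k. Rj j \<sigma> \<tau> ^ p))"
    have "gav SS (?e \<theta> w) (\<lambda>\<sigma>. 0 + ?ip \<sigma> \<sigma>) - gav SS (?e \<theta> w) (\<lambda>\<sigma>. gav SS (?e \<theta> w) (?ip \<sigma>))
      = gav SS (?e \<theta> w) (\<lambda>\<sigma>. gav SS (?e \<theta> w) (\<lambda>\<tau>. ?ip \<sigma> \<sigma> - ?ip \<sigma> \<tau>))"
      unfolding gav_diff gav_const[OF finite_spins spins_ne] by simp
    also have "\<dots> = gav SS (?e \<theta> w) (\<lambda>\<sigma>. gav SS (?e \<theta> w) (\<lambda>\<tau>.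
      ?X \<sigma> \<tau>))"
    proof (intro gav_cong)
      fix \<sigma> \<tau> assume \<sigma>: "\<sigma> \<in> SS"
      have "(\<Sum>j<k. Rj j \<sigma> \<sigma> ^ p) = (\<Sum>j<k. 1)"
        by (intro sum.cong refl) (simp add: bover_self[OF \<sigma> blk_le M1])
      then have "?ip \<sigma> \<sigma> = s * cos \<theta> * (s * sin \<theta>) * real NN + - (s * sin \<theta>) * (s * cos \<theta>) * (real M * real k)"
        using overlap_self[OF \<sigma> N1'] by simp
      then show "?ip \<sigma> \<sigma> - ?ip \<sigma> \<tau> = ?X \<sigma> \<tau>"
        by (simp add: algebra_simps power2_eq_square)
    qed
    finally show "gav SS (?E \<theta> w) (\<lambda>\<sigma>. 0 + ip II (?u1 \<theta> \<sigma>) (?u0 \<theta> \<sigma>))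
        - gav SS (?E \<theta> w) (\<lambda>\<sigma>. gav SS (?E \<theta> w)
            (\<lambda>\<tau>. ip II (?u1 \<theta> \<sigma>) (?u0 \<theta> \<tau>)))
      = gav SS (?e \<theta> w) (\<lambda>\<sigma>. gav SS (?e \<theta> w) (\<lambda>\<tau>.
      ?X \<sigma> \<tau>))"
      unfolding e ip_UU .
  qed
  ultimately show ?thesis unfolding \<Phi>_def ee_def by simp
qed

lemma \<Phi>_deriv_ge:
  assumes \<theta>: "0 \<le> \<theta>" "\<theta> \<le> pi / 2" and \<epsilon>: "\<epsilon> > 0"
  shows "\<exists>D'. ((\<lambda>\<theta>. \<Phi> (s * sin \<theta>) (s * cos \<theta>) 1 x) has_real_derivative D') (at \<theta>) \<and>
    D' \<ge> - (s\<^sup>2 * (2 * real M * (\<Sum>j<k. 2 * \<epsilon> + ind \<epsilon> (s * sin \<theta>) (s * cos \<theta>) x j)))"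
proof -
  let ?e = "ee (s * sin \<theta>) (s * cos \<theta>) 1 x"
  let ?i = "\<lambda>j \<sigma> \<tau>. if Rj j \<sigma> \<tau> \<le> - 2 * \<epsilon> then 1 else 0"
  let ?X = "\<lambda>\<sigma> \<tau>. real r0 - real NN * overlap NN \<sigma> \<tau> ^ p + real M * (\<Sum>j<k. Rj j \<sigma> \<tau> ^ p)"
  have sc: "0 \<le> sin \<theta> * cos \<theta>" "sin \<theta> * cos \<theta> \<le> 1"
    using \<theta> by (auto intro!: mult_nonneg_nonneg mult_le_one sin_ge_zero cos_ge_zero)
  have t: "tame (\<lambda>w. gav SS (?e w) (\<lambda>\<sigma>. gav SS (?e w) (f \<sigma>)))" for f by (intro tame_gav_ee tame_const)
  have "- (s\<^sup>2 * (2 * real M * (\<Sum>j<k. 2 * \<epsilon> + ind \<epsilon> (s * sin \<theta>) (s * cos \<theta>) x j)))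
    = EE (\<lambda>w. - (s\<^sup>2 * (2 * real M)) * (\<Sum>j<k. 2 * \<epsilon> + gav SS (?e w) (\<lambda>\<sigma>. gav SS (?e w) (?i j \<sigma>))))"
  proof -
    have "EE (\<lambda>w. \<Sum>j<k. 2 * \<epsilon> + gav SS (?e w) (\<lambda>\<sigma>. gav SS (?e w) (?i j \<sigma>))) = (\<Sum>j<k. EE (\<lambda>w. 2 * \<epsilon> + gav SS (?e w) (\<lambda>\<sigma>. gav SS (?e w) (?i j \<sigma>))))"
      by (intro Bochner_Integration.integral_sum tame_integrable tame_add tame_const t)
    then show ?thesis unfolding EE_cmult EE_add[OF tame_const t] EE_const ind_def by simp
  qed
  also have "\<dots> \<le> EE (\<lambda>w. gav SS (?e w) (\<lambda>\<sigma>. gav SS (?e w) (\<lambda>\<tau>. s\<^sup>2 * sin \<theta> * cos \<theta> * ?X \<sigma> \<tau>)))"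
  proof (rule EE_mono[OF _ t])
    show "tame (\<lambda>w. - (s\<^sup>2 * (2 * real M)) * (\<Sum>j<k. 2 * \<epsilon> + gav SS (?e w) (\<lambda>\<sigma>. gav SS (?e w) (?i j \<sigma>))))"
      by (intro tame_cmult tame_sum tame_add tame_const t)
    fix w
    have "- (s\<^sup>2 * (2 * real M)) * (\<Sum>j<k. 2 * \<epsilon> + gav SS (?e w) (\<lambda>\<sigma>. gav SS (?e w) (?i j \<sigma>)))
      = gav SS (?e w) (\<lambda>\<sigma>. gav SS (?e w) (\<lambda>\<tau>. - (s\<^sup>2 * (2 * real M)) * (\<Sum>j<k. 2 * \<epsilon> + ?i j \<sigma> \<tau>)))"
      unfolding gav_cmult gav_sum gav_add gav_const[OF finite_spins spins_ne] ..
    also have "\<dots> \<le> gav SS (?e w) (\<lambda>\<sigma>. gav SS (?e w) (\<lambda>\<tau>. s\<^sup>2 * sin \<theta> * cos \<theta> * ?X \<sigma> \<tau>))"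
    proof (intro gav_mono)
      fix \<sigma> \<tau> assume \<sigma>: "\<sigma> \<in> SS" "\<tau> \<in> SS"
      define Y where "Y = 2 * real M * (\<Sum>j<k. 2 * \<epsilon> + ?i j \<sigma> \<tau>)"
      have Y: "Y \<ge> 0" unfolding Y_def using \<epsilon> by (intro mult_nonneg_nonneg sum_nonneg) auto
      have "sin \<theta> * cos \<theta> * ?X \<sigma> \<tau> \<ge> sin \<theta> * cos \<theta> * (- Y)"
        using convexity[OF \<sigma> \<epsilon>] sc(1) unfolding Y_def by (intro mult_left_mono) auto
      moreover have "sin \<theta> * cos \<theta> * Y \<le> 1 * Y" by (intro mult_right_mono sc Y)
      ultimately have "- Y \<le> sin \<theta> * cos \<theta> * ?X \<sigma> \<tau>" by simp
      then have "s\<^sup>2 * (- Y) \<le> s\<^sup>2 * (sin \<theta> * cos \<theta> * ?X \<sigma> \<tau>)" by (intro mult_left_mono) auto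
      then show "- (s\<^sup>2 * (2 * real M)) * (\<Sum>j<k. 2 * \<epsilon> + ?i j \<sigma> \<tau>) \<le> s\<^sup>2 * sin \<theta> * cos \<theta> * ?X \<sigma> \<tau>"
        unfolding Y_def by (simp add: mult.assoc)
    qed
    finally show "- (s\<^sup>2 * (2 * real M)) * (\<Sum>j<k. 2 * \<epsilon> + gav SS (?e w) (\<lambda>\<sigma>. gav SS (?e w) (?i j \<sigma>)))
      \<le> gav SS (?e w) (\<lambda>\<sigma>. gav SS (?e w) (\<lambda>\<tau>. s\<^sup>2 * sin \<theta> * cos \<theta> * ?X \<sigma> \<tau>))" .
  qed
  finally show ?thesis using \<Phi>_deriv[of \<theta> x] \<theta> pi_half_less_two by (intro exI conjI) auto
qed

text \<open>Positive semidefiniteness holds because block overlaps form a Gram matrix: the double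
  sum is a sum over sites of squares.\<close>

lemma ggsys_block:
  assumes j: "j < k" shows "ggsys SS (JJ j) (Vc j) (Rj j) M D"
proof -
  have ip: "ip (JJ j) (Vc j q \<sigma>) (Vc j q' \<tau>) = (if q = q' then real M * Rj j \<sigma> \<tau> ^ q else 0)" if "q \<in> {1..D}" "q' \<in> {1..D}" for q q' \<sigma> \<tau>
  proof (cases "q = q'")
    case True
    have "bidx [2,j] q M \<subseteq> JJ j" unfolding JJ_def using that by blast
    then show ?thesis using ip_pv[OF finJJ _ M1, of "[2,j]" q j] that True by auto
  next
    case False
    then show ?thesis by (simp add: ip_pv_disj)
  qed
  have b: "\<exists>b. (\<forall>q\<in>{1..D}. (\<Sum>i\<in>JJ j. (b q i)\<^sup>2) \<le> real M) \<and> (\<forall>q\<in>{1..D}. \<forall>\<sigma>\<in>SS. \<forall>i\<in>JJ j. \<bar>Vc j q \<sigma> i\<bar> \<le> b q i)"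
  proof (intro exI conjI ballI)
    let ?b = "\<lambda>q i. if i \<in> bidx [2,j] q M then 1 * real M powr (- (real q - 1) / 2) else 0"
    fix q assume q: "q \<in> {1..D}"
    have "(\<Sum>i\<in>JJ j. (?b q i)\<^sup>2) = (\<Sum>i\<in>bidx [2,j] q M. (1 * real M powr (- (real q - 1) / 2))\<^sup>2)"
      by (rule sum.mono_neutral_cong_right[OF finJJ]) (use q in \<open>auto simp: JJ_def\<close>)
    also have "\<dots> = real M" using sum_sq_bidx[OF M1, of q 1 "[2,j]"] q by simp
    finally show "(\<Sum>i\<in>JJ j. (?b q i)\<^sup>2) \<le> real M" by simp
    fix \<sigma> i assume "\<sigma> \<in> SS" "i \<in> JJ j"
    then show "\<bar>Vc j q \<sigma> i\<bar> \<le> ?b q i" using abs_bvec[OF _ blk_le[OF j], of \<sigma> i "[2,j]" q] by (auto simp: pv_def)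
  qed
  have psd: "0 \<le> (\<Sum>i<length l. \<Sum>j'<length l. Rj j (l ! i) (l ! j'))" for l :: "(nat \<Rightarrow> real) list"
  proof -
    have "(\<Sum>i<length l. \<Sum>j'<length l. Rj j (l ! i) (l ! j')) = (\<Sum>a<M. (\<Sum>i<length l. (l ! i) (j * M + a))\<^sup>2) / real M"
      unfolding bover_def power2_eq_square sum_product sum_divide_distrib[symmetric]
      by (intro arg_cong2[where f="(/)"] refl) (simp add: sum.swap[of _ "{..<M}"])
    then show ?thesis by (simp add: sum_nonneg)
  qed
  show ?thesis unfolding ggsys_def
    using ip b psd M1 bover_self[OF _ blk_le[OF j] M1] bover_abs[OF _ _ blk_le[OF j]] bover_commute[of M "j * M"]
    by (intro conjI ballI finite_spins spins_ne finJJ) auto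
qed


lemma ind_sum:
  assumes j: "j < k"
    and pos: "\<And>S J V r d. ggsys S J V r M D \<Longrightarrow>
      (\<Sum>kk\<in>grid D L. far S J V r d D c \<epsilon> L kk) \<le> \<eta> * real L ^ D"
  shows "(\<Sum>kks\<in>PiE {..<k} (\<lambda>_. grid D L). ind \<epsilon> a b (\<lambda>j. xk L (kks j)) j) \<le> \<eta> * real (card (PiE {..<k} (\<lambda>_. grid D L)))"
proof -
  let ?i = "\<lambda>\<sigma> \<tau>. if Rj j \<sigma> \<tau> \<le> - 2 * \<epsilon> then 1 else (0::real)"
  have inner: "(\<Sum>kk\<in>grid D L. ind \<epsilon> a b (\<lambda>j'. xk L ((f(j := kk)) j')) j) \<le> \<eta> * real L ^ D" for f
  proof -
    define x where "x kk j' = xk L ((f(j := kk)) j')" for kk j'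
    define F where "F w = (\<Sum>kk\<in>grid D L. gav SS (ee a b 1 (x kk) w) (\<lambda>\<sigma>. gav SS (ee a b 1 (x kk) w) (?i \<sigma>)))" for w
    \<comment> \<open>Everything except the perturbation of block \<open>j\<close>; it vanishes on
      \<open>JJ j\<close> and supplies the base weights.\<close>
    define U0 where "U0 \<sigma> i = a * Va \<sigma> i + b * BB \<sigma> i + (\<Sum>j'\<in>{..<k} - {j}. uu (Vc j') D c (xk L (f j')) \<sigma> i)" for \<sigma> i
    let ?mix = "\<lambda>w w' i. if i \<in> JJ j then w' i else w i"
    have UU: "UU a b 1 (x kk) \<sigma> i = U0 \<sigma> i + uu (Vc j) D c (xk L kk) \<sigma> i" for kk \<sigma> i
    proof -
      have "CC (x kk) \<sigma> i = uu (Vc j) D c (x kk j) \<sigma> i + (\<Sum>j'\<in>{..<k} - {j}. uu (Vc j') D c (x kk j') \<sigma> i)"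
        unfolding CC_def using j by (intro sum.remove) auto
      moreover have "x kk j = xk L kk" by (simp add: x_def fun_eq_iff)
      moreover have "(\<Sum>j'\<in>{..<k} - {j}. uu (Vc j') D c (x kk j') \<sigma> i) = (\<Sum>j'\<in>{..<k} - {j}. uu (Vc j') D c (xk L (f j')) \<sigma> i)"
      proof (intro sum.cong refl)
        fix j' assume "j' \<in> {..<k} - {j}"
        then have "x kk j' = xk L (f j')" by (simp add: x_def fun_eq_iff)
        then show "uu (Vc j') D c (x kk j') \<sigma> i = uu (Vc j') D c (xk L (f j')) \<sigma> i" by simp
      qed
      ultimately show ?thesis by (simp add: UU_def U0_def)
    qed
    have U0z: "U0 \<sigma> i = 0" if "i \<in> JJ j" for \<sigma> i
    proof -
      obtain q where q: "q \<in> {1..D}" "i \<in> bidx [2,j] q M" using \<open>i \<in> JJ j\<close> unfolding JJ_def by blast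
      have "i \<notin> bidx [0,0] p NN" "i \<notin> bidx [1,j'] p M" for j' using bidx_disj[OF _ _ q(2)] by auto
      moreover have "i \<notin> bidx [2,j'] q' M" if "j' \<noteq> j" for j' q' using bidx_disj[OF _ _ q(2), of "[2,j']" q'] that by auto
      ultimately show ?thesis by (simp add: U0_def BB_def uu_def pv_def)
    qed
    have uuz: "uu (Vc j) D c y \<sigma> i = 0" if "i \<notin> JJ j" for y \<sigma> i
      unfolding uu_def using that by (auto simp: pv_def JJ_def)
    have JI: "JJ j \<subseteq> II" using sub(3)[OF j] unfolding JJ_def by blast
    have mix: "ee a b 1 (x kk) (?mix w w') = (\<lambda>\<sigma>. fld II (U0 \<sigma>) w + fld (JJ j) (uu (Vc j) D c (xk L kk) \<sigma>) w')" for kk w w'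
    proof
      fix \<sigma>
      have "ee a b 1 (x kk) (?mix w w') \<sigma> = fld II (U0 \<sigma>) (?mix w w') + fld II (uu (Vc j) D c (xk L kk) \<sigma>) (?mix w w')"
        unfolding ee_def fld_def UU distrib_left sum.distrib by simp
      also have "fld II (U0 \<sigma>) (?mix w w') = fld II (U0 \<sigma>) w"
        unfolding fld_def by (intro sum.cong refl) (simp add: U0z)
      also have "fld II (uu (Vc j) D c (xk L kk) \<sigma>) (?mix w w') = fld (JJ j) (uu (Vc j) D c (xk L kk) \<sigma>) w'"
        unfolding fld_def by (rule sum.mono_neutral_cong_right[OF finII JI]) (auto simp: uuz)
      finally show "ee a b 1 (x kk) (?mix w w') \<sigma> = fld II (U0 \<sigma>) w + fld (JJ j) (uu (Vc j) D c (xk L kk) \<sigma>) w'" .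
    qed
    have t: "tame (\<lambda>w. gav SS (ee a b 1 (x kk) w) (\<lambda>\<sigma>. gav SS (ee a b 1 (x kk) w) (?i \<sigma>)))" for kk
      by (intro tame_gav_ee tame_const)
    define e' where "e' w kk w' \<sigma> = fld II (U0 \<sigma>) w + fld (JJ j) (uu (Vc j) D c (xk L kk) \<sigma>) w'" for w kk w' \<sigma>
    have m': "(\<lambda>w'. e' w kk w' \<sigma>) \<in> borel_measurable disorder" for w kk \<sigma>
      unfolding e'_def by (intro tame_meas tame_add tame_const tame_fld)
    have t': "tame (\<lambda>w'. gav SS (e' w kk w') (\<lambda>\<sigma>. gav SS (e' w kk w') (?i \<sigma>)))" for w kk
      by (intro tame_gav finite_spins m' tame_const)
    have Fm: "F (?mix w w') = (\<Sum>kk\<in>grid D L. gav SS (e' w kk w') (\<lambda>\<sigma>. gav SS (e' w kk w') (?i \<sigma>)))" for w w'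
      unfolding F_def mix e'_def ..
    have "(\<Sum>kk\<in>grid D L. ind \<epsilon> a b (x kk) j) = EE F"
      unfolding ind_def F_def by (intro Bochner_Integration.integral_sum[symmetric] tame_integrable t)
    also have "EE F \<le> \<eta> * real L ^ D"
    proof (rule resample_le[OF finJJ[of j]])
      show "tame F" unfolding F_def by (intro tame_sum t)
      show "0 \<le> F w" for w unfolding F_def by (intro sum_nonneg gav_nonneg) auto
      fix w
      show "tame (\<lambda>w'. F (?mix w w'))" unfolding Fm by (intro tame_sum t')
      have "EE (\<lambda>w'. F (?mix w w')) = (\<Sum>kk\<in>grid D L. EE (\<lambda>w'. gav SS (e' w kk w') (\<lambda>\<sigma>. gav SS (e' w kk w') (?i \<sigma>))))"
        unfolding Fm by (intro Bochner_Integration.integral_sum tame_integrable t')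
      also have "\<dots> \<le> \<eta> * real L ^ D"
        unfolding e'_def by (rule pos[OF ggsys_block[OF j]])
      finally show "EE (\<lambda>w'. F (?mix w w')) \<le> \<eta> * real L ^ D" .
    qed
    finally show ?thesis unfolding x_def[abs_def] .
  qed
  have "(\<Sum>kks\<in>PiE {..<k} (\<lambda>_. grid D L). ind \<epsilon> a b (\<lambda>j. xk L (kks j)) j)
    = (\<Sum>f\<in>PiE ({..<k} - {j}) (\<lambda>_. grid D L). \<Sum>kk\<in>grid D L. ind \<epsilon> a b (\<lambda>j'. xk L ((f(j := kk)) j')) j)"
    by (rule sum_PiE_split) (use j in auto)
  also have "\<dots> \<le> (\<Sum>f\<in>PiE ({..<k} - {j}) (\<lambda>_. grid D L). \<eta> * real L ^ D)" by (intro sum_mono inner)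
  also have "\<dots> = \<eta> * (real L ^ D * (real L ^ D) ^ (k - 1))" using j by (simp add: card_PiE card_grid)
  also have "real L ^ D * (real L ^ D) ^ (k - 1) = (real L ^ D) ^ k" using k by (cases k) auto
  also have "(real L ^ D) ^ k = real (card (PiE {..<k} (\<lambda>_. grid D L)))" by (simp add: card_PiE card_grid)
  finally show ?thesis .
qed

text \<open>A good choice of field strengths could depend on the angle, so no single choice is
  fixed: the interpolation is summed over all grid points of all blocks, and only this sum has a
  controlled derivative. The endpoints depend on the strengths only up to the cost of the
  perturbation.\<close>

lemma PS_superadd:
  assumes \<epsilon>: "\<epsilon> > 0" and \<eta>: "\<eta> > 0" and L: "L \<ge> 1"
    and pos: "\<And>S J V r d. ggsys S J V r M D \<Longrightarrow>
      (\<Sum>kk\<in>grid D L. far S J V r d D c \<epsilon> L kk) \<le> \<eta> * real L ^ D"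
  shows "real k * PS p M (spins M) s (\<lambda>_. 0) + real r0 * ln 2
    \<le> PS p NN SS s (\<lambda>_. 0) + real (k * M) * (4 * c\<^sup>2 * D + 4 * s\<^sup>2 * (2 * \<epsilon> + \<eta>))"
proof -
  define X where "X = PiE {..<k} (\<lambda>_. grid D L)"
  define g where "g = real (card X)"
  \<comment> \<open>Bounds the possible decrease of the summed path per unit of angle; adding K
    \<theta> makes it nondecreasing.\<close>
  define K where "K = s\<^sup>2 * (2 * real M * (real k * (2 * \<epsilon> + \<eta>))) * g"
  define x where "x kks j = xk L (kks j)" for kks :: "nat \<Rightarrow> nat \<Rightarrow> nat" and j
  have g: "g > 0" unfolding g_def X_def using L by (simp add: card_PiE card_grid)
  have K: "K \<ge> 0" unfolding K_def using g \<epsilon> \<eta> by simp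
  have xb: "\<bar>x kks j q\<bar> \<le> 2" if "kks \<in> X" "j < k" "q \<in> {1..D}" for kks j q
  proof -
    have "kks j \<in> grid D L" using that unfolding X_def by (auto intro: PiE_mem)
    from xk_bounds[OF this that(3)] show ?thesis unfolding x_def by (smt (verit) divide_nonneg_nonneg of_nat_0_le_iff)
  qed
  define f where "f \<theta> = (\<Sum>kks\<in>X. \<Phi> (s * sin \<theta>) (s * cos \<theta>) 1 (x kks)) + K * \<theta>" for \<theta>
  have "f 0 \<le> f (pi / 2)"
  proof (rule DERIV_nonneg_imp_nondecreasing[where f=f and a=0 and b="pi / 2"])
    fix \<theta> :: real assume \<theta>: "0 \<le> \<theta>" "\<theta> \<le> pi / 2"
    define lo where "lo kks = - (s\<^sup>2 * (2 * real M * (\<Sum>j<k. 2 * \<epsilon> + ind \<epsilon> (s * sin \<theta>) (s * cos \<theta>) (x kks) j)))" for kks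
    have "\<forall>kks. \<exists>D'. ((\<lambda>\<theta>. \<Phi> (s * sin \<theta>) (s * cos \<theta>) 1 (x kks)) has_real_derivative D') (at \<theta>) \<and> D' \<ge> lo kks"
      unfolding lo_def by (intro allI \<Phi>_deriv_ge \<theta> \<epsilon>)
    from choice[OF this] obtain D' where D': "\<And>kks. ((\<lambda>\<theta>. \<Phi> (s * sin \<theta>) (s * cos \<theta>) 1 (x kks)) has_real_derivative D' kks) (at \<theta>)" "\<And>kks. D' kks \<ge> lo kks"
      by blast
    have "(f has_real_derivative (\<Sum>kks\<in>X. D' kks) + K) (at \<theta>)"
      unfolding f_def by (auto intro!: derivative_eq_intros DERIV_sum D')
    moreover have "(\<Sum>kks\<in>X. D' kks) + K \<ge> 0"
    proof -
      have "(\<Sum>kks\<in>X. \<Sum>j<k. 2 * \<epsilon> + ind \<epsilon> (s * sin \<theta>) (s * cos \<theta>) (x kks) j)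
        = (\<Sum>j<k. g * (2 * \<epsilon>) + (\<Sum>kks\<in>X. ind \<epsilon> (s * sin \<theta>) (s * cos \<theta>) (x kks) j))"
        by (subst sum.swap) (simp add: sum.distrib g_def)
      also have "\<dots> \<le> (\<Sum>j<k. g * (2 * \<epsilon>) + \<eta> * g)"
        unfolding X_def g_def x_def[abs_def] by (intro sum_mono add_mono order_refl ind_sum pos) auto
      also have "\<dots> = real k * (2 * \<epsilon> + \<eta>) * g" by (simp add: algebra_simps)
      finally have "s\<^sup>2 * (2 * real M * (\<Sum>kks\<in>X. \<Sum>j<k. 2 * \<epsilon> + ind \<epsilon> (s * sin \<theta>) (s * cos \<theta>) (x kks) j)) \<le> s\<^sup>2 * (2 * real M * (real k * (2 * \<epsilon> + \<eta>) * g))"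
        by (intro mult_left_mono) auto
      then have "- K \<le> (\<Sum>kks\<in>X. lo kks)" unfolding lo_def K_def sum_negf sum_distrib_left[symmetric] by (simp add: mult.assoc)
      also have "\<dots> \<le> (\<Sum>kks\<in>X. D' kks)" by (intro sum_mono D')
      finally show ?thesis by simp
    qed
    ultimately show "\<exists>y. (f has_real_derivative y) (at \<theta>) \<and> 0 \<le> y" by blast
  qed simp
  moreover have "f 0 \<ge> g * (real k * PS p M (spins M) s (\<lambda>_. 0) + real r0 * ln 2)"
  proof -
    have "(\<Sum>kks\<in>X. \<Phi> 0 s 0 (x kks)) \<le> (\<Sum>kks\<in>X. \<Phi> 0 s 1 (x kks))" by (intro sum_mono \<Phi>_ge)
    then show ?thesis unfolding f_def \<Phi>_blocks by (simp add: g_def)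
  qed
  moreover have "f (pi / 2) \<le> g * (PS p NN SS s (\<lambda>_. 0) + 4 * c\<^sup>2 * D * real (k * M)) + K * 2"
  proof -
    have "(\<Sum>kks\<in>X. \<Phi> s 0 1 (x kks)) \<le> (\<Sum>kks\<in>X. \<Phi> s 0 0 (x kks) + 4 * c\<^sup>2 * D * real (k * M))" by (intro sum_mono \<Phi>_le xb)
    also have "\<dots> = g * (PS p NN SS s (\<lambda>_. 0) + 4 * c\<^sup>2 * D * real (k * M))" unfolding \<Phi>_main by (simp add: g_def)
    finally have "(\<Sum>kks\<in>X. \<Phi> s 0 1 (x kks)) \<le> g * (PS p NN SS s (\<lambda>_. 0) + 4 * c\<^sup>2 * D * real (k * M))" .
    \<comment> \<open>The path has length pi/2 < 2, which turns the 2 in \<open>K\<close> into the 4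
      of the claim.\<close>
    moreover have "K * (pi / 2) \<le> K * 2" using K pi_half_less_two by (intro mult_left_mono) auto
    ultimately show ?thesis unfolding f_def by simp
  qed
  ultimately have "g * (real k * PS p M (spins M) s (\<lambda>_. 0) + real r0 * ln 2) \<le> g * (PS p NN SS s (\<lambda>_. 0) + 4 * c\<^sup>2 * D * real (k * M)) + K * 2" by linarith
  also have "\<dots> = g * (PS p NN SS s (\<lambda>_. 0) + real (k * M) * (4 * c\<^sup>2 * D + 4 * s\<^sup>2 * (2 * \<epsilon> + \<eta>)))"
    unfolding K_def by (simp add: algebra_simps)
  finally show ?thesis using g by simp
qed

end

section \<open>Approximate superadditivity and convergence\<close>

lemma fN_superadd:
  assumes p: "p \<ge> 1" and \<delta>: "\<delta> > 0"
  shows "\<exists>M0\<ge>1. \<forall>M\<ge>M0. \<forall>k\<ge>1. \<forall>r0. fN p (k * M + r0) s \<ge> real (k * M) / real (k * M + r0) * fN p M s - \<delta>"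
proof -
  \<comment> \<open>With \<eta> = \<epsilon> the interpolation error is 12 s^2 \<epsilon>, at most
    half of \<delta>.\<close>
  define \<epsilon> where "\<epsilon> = \<delta> / (24 * (s\<^sup>2 + 1))"
  have s1: "s\<^sup>2 + 1 > 0" by (simp add: add_nonneg_pos)
  have \<epsilon>: "\<epsilon> > 0" unfolding \<epsilon>_def using \<delta> s1 by simp
  have "24 * (s\<^sup>2 + 1) * \<epsilon> = \<delta>" unfolding \<epsilon>_def using s1 by simp
  then have s\<epsilon>: "4 * s\<^sup>2 * (2 * \<epsilon> + \<epsilon>) \<le> \<delta> / 2" using \<epsilon> by (simp add: algebra_simps)
  from positivity[OF \<epsilon> \<epsilon>] obtain D :: nat where D: "D \<ge> 1" and pos: "\<And>c. c > 0 \<Longrightarrow> \<exists>L\<ge>1. \<exists>M0. \<forall>M\<ge>M0. \<forall>S J V r d. ggsys S J V r M D \<longrightarrow>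
    (\<Sum>kk\<in>grid D L. far S J V r d D c \<epsilon> L kk) \<le> \<epsilon> * real L ^ D"
    by blast
  \<comment> \<open>Makes the cost of the perturbation the other half of \<delta>; possible because
    \<open>D\<close> is already fixed.\<close>
  define c where "c = sqrt (\<delta> / (8 * D))"
  have c: "c > 0" "4 * c\<^sup>2 * D = \<delta> / 2" unfolding c_def using \<delta> D by auto
  from pos[OF c(1)] obtain L M0 where L: "L \<ge> 1" and M0: "\<And>M S J V r d. M \<ge> M0 \<Longrightarrow> ggsys S J V r M D \<Longrightarrow>
    (\<Sum>kk\<in>grid D L. far S J V r d D c \<epsilon> L kk) \<le> \<epsilon> * real L ^ D"
    by blast
  show ?thesis
  proof (intro exI[of _ "max 1 M0"] conjI allI impI)
    fix M k r0 :: nat assume M: "max 1 M0 \<le> M" and k: "1 \<le> k"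
    interpret blk p k M r0 D s c using p k M by unfold_locales auto
    have "real k * PS p M (spins M) s (\<lambda>_. 0) + real r0 * ln 2
      \<le> PS p NN SS s (\<lambda>_. 0) + real (k * M) * (4 * c\<^sup>2 * D + 4 * s\<^sup>2 * (2 * \<epsilon> + \<epsilon>))"
      by (rule PS_superadd[OF \<epsilon> \<epsilon> L]) (rule M0, use M in auto)
    also have "real (k * M) * (4 * c\<^sup>2 * D + 4 * s\<^sup>2 * (2 * \<epsilon> + \<epsilon>)) \<le> real NN * \<delta>"
      using c(2) s\<epsilon> \<delta> \<epsilon> by (intro mult_mono) auto
    finally have 1: "real k * PS p M (spins M) s (\<lambda>_. 0) + real r0 * ln 2 \<le> PS p NN SS s (\<lambda>_. 0) + real NN * \<delta>" by simp
    have N: "real NN > 0" using N1' by linarith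
    have "PS p M (spins M) s (\<lambda>_. 0) = real M * (fN p M s + ln 2)" unfolding fN_def using M1 by (simp add: field_simps)
    moreover have "PS p NN SS s (\<lambda>_. 0) = real NN * (fN p NN s + ln 2)" unfolding fN_def using N by (simp add: field_simps)
    ultimately have "real (k * M) * fN p M s \<le> real NN * (fN p NN s + \<delta>)"
      using 1 by (simp add: algebra_simps)
    then have "real (k * M) * fN p M s / real NN \<le> fN p NN s + \<delta>" using N by (simp add: pos_divide_le_eq mult.commute)
    then show "fN p NN s \<ge> real (k * M) / real NN * fN p M s - \<delta>" by simp
  qed simp
qed

text \<open>Fekete's argument with errors: once \<open>M\<close> is large, all much larger systems
  have values above that at \<open>M\<close> minus \<delta>. For a bounded sequence, any cluster
  point is then the limit.\<close>

lemma fN_convergent: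
  assumes p: "p \<ge> 1" and s: "s \<ge> 0"
  shows "\<exists>l. (\<lambda>N. fN p N s) \<longlonglongrightarrow> l"
proof -
  define f where "f N = fN p N s" for N
  have b: "0 \<le> f N" "f N \<le> s\<^sup>2/2" if "N \<ge> 1" for N unfolding f_def using fN_le[OF that p s] by auto
  have sup: "\<exists>M0\<ge>1. \<forall>M\<ge>M0. \<exists>N0. \<forall>N\<ge>N0. f N \<ge> f M - \<delta>" if \<delta>: "\<delta> > 0" for \<delta>
  proof -
    obtain M0 where M0: "M0 \<ge> 1" "\<And>M k r0. M \<ge> M0 \<Longrightarrow> k \<ge> 1 \<Longrightarrow> f (k * M + r0) \<ge> real (k * M) / real (k * M + r0) * f M - \<delta> / 2"
      using fN_superadd[OF p, of "\<delta> / 2" s] \<delta> unfolding f_def by auto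
    show ?thesis
    proof (rule exI[of _ M0], intro conjI M0(1) allI impI)
      fix M assume M: "M \<ge> M0"
      \<comment> \<open>Beyond this size the leftover sites, fewer than \<open>M\<close>, carry at
        most \<delta>/2 of the free energy density.\<close>
      obtain N1 :: nat where N1: "real N1 > 2 * (real M * f M) / \<delta>" using reals_Archimedean2 by blast
      show "\<exists>N0. \<forall>N\<ge>N0. f N \<ge> f M - \<delta>"
      proof (intro exI[of _ "max M N1"] allI impI)
        fix N assume N: "max M N1 \<le> N"
        have M1: "M \<ge> 1" using M M0(1) by simp
        define k where "k = N div M"
        define r0 where "r0 = N mod M"
        have Nk: "k * M + r0 = N" unfolding k_def r0_def by simp
        have k: "k \<ge> 1" unfolding k_def using N M1 by (simp add: Suc_le_eq div_greater_zero_iff)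
        have n: "real N > 0" using N M1 by simp
        have "r0 < M" unfolding r0_def using M1 by simp
        then have "real (k * M) \<ge> real N - real M" using Nk by linarith
        then have "real (k * M) / real N * f M \<ge> (real N - real M) / real N * f M"
          using b(1)[OF M1] n by (intro mult_right_mono divide_right_mono) auto
        also have "(real N - real M) / real N * f M = f M - real M * f M / real N"
          using n by (simp add: field_simps)
        finally have 1: "real (k * M) / real N * f M \<ge> f M - real M * f M / real N" .
        have "2 * (real M * f M) / \<delta> < real N" using N1 N by (smt (verit) max.cobounded2 of_nat_le_iff order_trans)
        then have "real M * f M / real N \<le> \<delta> / 2" using n \<delta> by (simp add: field_simps)
        with 1 M0(2)[OF M k, of r0] show "f N \<ge> f M - \<delta>" unfolding Nk by linarith
      qed
    qed
  qed
  have "seq_compact {0..s\<^sup>2/2}" by (simp add: compact_imp_seq_compact)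
  then have "\<exists>l\<in>{0..s\<^sup>2/2}. \<exists>r. strict_mono r \<and> ((\<lambda>n. f (Suc n)) \<circ> r) \<longlonglongrightarrow> l"
    unfolding seq_compact_def by (elim allE[of _ "\<lambda>n. f (Suc n)"] impE) (use b in simp)
  then obtain l r where r: "strict_mono r" "((\<lambda>n. f (Suc n)) \<circ> r) \<longlonglongrightarrow> l"
    by blast
  have "f \<longlonglongrightarrow> l"
  proof (rule LIMSEQ_I)
    fix e :: real assume e: "e > 0"
    obtain M0 where M0: "M0 \<ge> 1" "\<And>M. M \<ge> M0 \<Longrightarrow> \<exists>N0. \<forall>N\<ge>N0. f N \<ge> f M - e/4" using sup[of "e/4"] e by auto
    obtain n0 where n0: "\<And>n. n \<ge> n0 \<Longrightarrow> \<bar>f (Suc (r n)) - l\<bar> < e/4"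
      using LIMSEQ_D[OF r(2), of "e/4"] e by auto
    have rge: "n \<le> r n" for n by (rule strict_mono_imp_increasing[OF r(1)])
    have up: "f M < l + e" if M: "M \<ge> M0" for M
    proof -
      obtain N0 where N0: "\<And>N. N \<ge> N0 \<Longrightarrow> f N \<ge> f M - e/4" using M0(2)[OF M] by blast
      define n where "n = max n0 N0"
      have "f (Suc (r n)) \<ge> f M - e/4" using rge[of n] by (intro N0) (simp add: n_def)
      moreover have "\<bar>f (Suc (r n)) - l\<bar> < e/4" by (rule n0) (simp add: n_def)
      ultimately show ?thesis using e by linarith
    qed
    define n where "n = max n0 M0"
    obtain N0 where N0: "\<And>N. N \<ge> N0 \<Longrightarrow> f N \<ge> f (Suc (r n)) - e/4" using M0(2)[of "Suc (r n)"] rge[of n] by (auto simp: n_def)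
    have "\<bar>f (Suc (r n)) - l\<bar> < e/4" by (rule n0) (simp add: n_def)
    then have lo: "f N > l - e" if "N \<ge> N0" for N using N0[OF that] e by linarith
    show "\<exists>no. \<forall>N\<ge>no. norm (f N - l) < e"
    proof (intro exI[of _ "max M0 N0"] allI impI)
      fix N assume "max M0 N0 \<le> N"
      then have "f N < l + e" "f N > l - e" using up lo by auto
      then show "norm (f N - l) < e" by (simp add: abs_less_iff)
    qed
  qed
  then show ?thesis unfolding f_def[abs_def] by blast
qed

subsection \<open>The critical temperature\<close>

definition F :: "nat \<Rightarrow> real \<Rightarrow> real" where
  "F p s = lim (\<lambda>N. fN p N s)"

lemma fN_tendsto_F: "p \<ge> 1 \<Longrightarrow> s \<ge> 0 \<Longrightarrow> (\<lambda>N. fN p N s) \<longlonglongrightarrow> F p s"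
  unfolding F_def using fN_convergent convergent_LIMSEQ_iff convergent_def by blast

lemma free_energy_F: "p \<ge> 1 \<Longrightarrow> \<beta> \<ge> 0 \<Longrightarrow> free_energy p \<beta> = F p (\<beta> / sqrt 2)"
  by (intro free_energy_eq_lim fN_tendsto_F) auto

lemma F_mono:
  assumes p: "p \<ge> 1" and st: "0 \<le> s" "s \<le> t"
  shows "F p s \<le> F p t" "s\<^sup>2/2 - F p s \<le> t\<^sup>2/2 - F p t" "F p s \<le> s\<^sup>2/2" "F p s \<le> s\<^sup>2/4 + ln 2"
proof -
  have t: "t \<ge> 0" using st by simp
  note ls = fN_tendsto_F[OF p st(1)] and lt = fN_tendsto_F[OF p t]
  show "F p s \<le> F p t"
    by (rule LIMSEQ_le[OF ls lt]) (use fN_mono(1)[OF _ p st] in blast)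
  show "s\<^sup>2/2 - F p s \<le> t\<^sup>2/2 - F p t"
    by (rule LIMSEQ_le[OF tendsto_diff[OF tendsto_const ls] tendsto_diff[OF tendsto_const lt]]) (use fN_mono(2)[OF _ p st] in blast)
  show "F p s \<le> s\<^sup>2/2"
    by (rule LIMSEQ_le_const2[OF ls]) (use fN_le(1)[OF _ p st(1)] in blast)
  show "F p s \<le> s\<^sup>2/4 + ln 2"
    by (rule LIMSEQ_le_const2[OF ls]) (use fN_quarter[OF _ p st(1)] in blast)
qed

text \<open>In terms of s the replica symmetric set contains 1/2, is bounded because s^2/2 <= s^2/4
  + ln 2 fails beyond 2, and contains its supremum. So the greatest element exists and is itself
  replica symmetric.\<close>

lemma beta_crit_replica_symmetric:
  assumes p: "p \<ge> 2"
  shows "beta_crit p > 0" "F p (beta_crit p / sqrt 2) = (beta_crit p / sqrt 2)\<^sup>2 / 2"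
proof -
  have p1: "p \<ge> 1" using p by simp
  define A where "A = {s. s > 0 \<and> F p s = s\<^sup>2/2}"
  have RS: "\<beta> \<in> replica_symmetric_set p \<longleftrightarrow> \<beta> / sqrt 2 \<in> A" for \<beta>
  proof (cases "\<beta> > 0")
    case True
    then show ?thesis using free_energy_F[OF p1, of \<beta>] by (auto simp: replica_symmetric_set_def A_def power_divide)
  next
    case False
    then show ?thesis by (simp add: replica_symmetric_set_def A_def zero_less_divide_iff)
  qed
  have half: "1/2 \<in> A"
    using LIMSEQ_unique[OF fN_tendsto_F[OF p1, of "1/2"] RS_small[OF p]] by (simp add: A_def power_divide)
  have bdd: "s \<le> 2" if "s \<in> A" for s
  proof (rule ccontr)
    assume "\<not> s \<le> 2"
    then have s: "s > 2" by simp
    have "s\<^sup>2/2 \<le> s\<^sup>2/4 + ln 2" using that F_mono(4)[OF p1, of s s] by (simp add: A_def)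
    moreover have "s\<^sup>2 > 2\<^sup>2" using s by (intro power_strict_mono) auto
    moreover have "ln 2 \<le> (1::real)" using ln_le_minus_one[of "2::real"] by simp
    ultimately show False by simp
  qed
  define t where "t = Sup A"
  have bA: "bdd_above A" using bdd by (auto simp: bdd_above_def)
  have tup: "s \<le> t" if "s \<in> A" for s unfolding t_def by (rule cSup_upper[OF that bA])
  have t0: "t > 0" using tup[OF half] by simp
  have "F p t = t\<^sup>2/2"
  proof (rule antisym)
    show "F p t \<le> t\<^sup>2/2" by (rule F_mono(3)[OF p1, of t t]) (use t0 in auto)
    show "t\<^sup>2/2 \<le> F p t"
    proof (rule field_le_epsilon)
      fix e :: real assume e: "e > 0"
      \<comment> \<open>Attainment of the supremum uses only that F is nondecreasing: F(t) >= F(s) =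
        s^2/2 for members s close to t, and t^2/2 - s^2/2 <= d (t + 1) = e.\<close>
      define d where "d = e / (t + 1)"
      have d: "d > 0" unfolding d_def using e t0 by simp
      obtain s where s: "s \<in> A" "t - d < s"
        using less_cSupD[of A "t - d"] half d unfolding t_def by auto
      have st: "0 \<le> s" "s \<le> t" "F p s = s\<^sup>2/2" using s(1) tup by (auto simp: A_def)
      have "t\<^sup>2/2 - s\<^sup>2/2 = (t - s) * ((t + s) / 2)" by (simp add: power2_eq_square field_simps)
      also have "\<dots> \<le> d * (t + 1)" using s(2) st d by (intro mult_mono) auto
      also have "\<dots> = e" unfolding d_def using t0 by simp
      finally show "t\<^sup>2/2 \<le> F p t + e" using F_mono(1)[OF p1 st(1,2)] st(3) by linarith
    qed
  qed
  then have tA: "t \<in> A" using t0 by (simp add: A_def)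
  have "beta_crit p = t * sqrt 2"
    unfolding beta_crit_def
  proof (rule Greatest_equality)
    show "t * sqrt 2 \<in> replica_symmetric_set p" using tA by (simp add: RS)
    show "\<beta> \<le> t * sqrt 2" if "\<beta> \<in> replica_symmetric_set p" for \<beta>
      using tup[of "\<beta> / sqrt 2"] that by (simp add: RS pos_divide_le_eq)
  qed
  then show "beta_crit p > 0" "F p (beta_crit p / sqrt 2) = (beta_crit p / sqrt 2)\<^sup>2 / 2"
    using tA by (auto simp: A_def)
qed

lemma gibbs_avg2_gav:
  "gibbs_avg2 p N \<beta> w f = gav (spins N) (hen p N (\<beta> / sqrt 2) w) (\<lambda>\<sigma>. gav (spins N) (hen p N (\<beta> / sqrt 2) w) (\<lambda>\<tau>. f \<sigma> \<tau>))"
proof -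
  have W: "gibbs_weight p N \<beta> w \<sigma> = exp (hen p N (\<beta> / sqrt 2) w \<sigma>)" for \<sigma>
    by (simp add: gibbs_weight_def hen_hamil)
  show ?thesis
    unfolding gibbs_avg2_def gav_def W Zs_def[symmetric] power2_eq_square
    by (simp add: sum_distrib_left sum_distrib_right sum_divide_distrib mult_ac)
qed

theorem mainTheorem9:
  fixes p :: nat and b :: real
  assumes "p \<ge> 3" and "0 < b" and "b < beta_crit p"
  shows "\<forall>k::nat. k \<ge> 1 \<longrightarrow> (\<exists>K>0. \<forall>\<beta>\<in>{0..b}. \<forall>N::nat. N \<ge> 1 \<longrightarrow>
           (\<integral>g. gibbs_avg2 p N \<beta> g (\<lambda>\<sigma>1 \<sigma>2. (overlap N \<sigma>1 \<sigma>2) ^ (2 * k)) \<partial>disorder)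
             \<le> K / real N ^ k)"
proof (intro allI impI)
  fix k :: nat assume k: "k \<ge> 1"
  define t where "t = beta_crit p / sqrt 2"
  have p1: "p \<ge> 1" "p \<ge> 2" using assms(1) by auto
  have t: "t > 0" "F p t = t\<^sup>2/2" using beta_crit_replica_symmetric[OF p1(2)] by (auto simp: t_def)
  have L: "(\<lambda>N. fN p N t) \<longlonglongrightarrow> t\<^sup>2/2" using fN_tendsto_F[OF p1(1), of t] t by simp
  have T: "0 \<le> b / sqrt 2" "b / sqrt 2 < t" using assms by (auto simp: t_def divide_strict_right_mono)
  from null_moments[OF assms(1) L T k] obtain C where C: "C > 0" "\<And>N s. N \<ge> 1 \<Longrightarrow> s \<in> {0..b / sqrt 2} \<Longrightarrow>
    EE (\<lambda>w. gav (spins N) (hen p N s w) (\<lambda>\<sigma>. gav (spins N) (hen p N s w) (\<lambda>\<tau>. overlap N \<sigma> \<tau> ^ (2 * k)))) \<le> C / real N ^ k"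
    by blast
  show "\<exists>K>0. \<forall>\<beta>\<in>{0..b}. \<forall>N::nat. N \<ge> 1 \<longrightarrow>
           (\<integral>g. gibbs_avg2 p N \<beta> g (\<lambda>\<sigma>1 \<sigma>2. (overlap N \<sigma>1 \<sigma>2) ^ (2 * k)) \<partial>disorder)
             \<le> K / real N ^ k"
  proof (intro exI[of _ C] conjI C(1) ballI allI impI)
    fix \<beta> N assume "\<beta> \<in> {0..b}" and N: "N \<ge> (1::nat)"
    then have "\<beta> / sqrt 2 \<in> {0..b / sqrt 2}" by (auto intro: divide_right_mono)
    from C(2)[OF N this] show "(\<integral>g. gibbs_avg2 p N \<beta> g (\<lambda>\<sigma>1 \<sigma>2. (overlap N \<sigma>1 \<sigma>2) ^ (2 * k)) \<partial>disorder) \<le> C / real N ^ k"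
      unfolding gibbs_avg2_gav .
  qed
qed

end
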